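(* Let $K$ be a field of prime characteristic $p$ with $[K:K^p]<\infty$, let $S=K[\![x_1,\dots,x_n]\!]$, and let $f=x_1^{d_1}\cdots x_n^{d_n}\in S$ be a monomial where $d_j$ is a positive integer for each $1\le j\le n$. Let $d=\max\{d_1,\dots,d_n\}$ and $R^{\bigstar}=S[\![u,v]\!]/(f+uv)$, where $u,v$ are new variables. Then the $F$-signature of $R^{\bigstar}$ is $$\mathbb S(R^{\bigstar})=\frac{2}{d^{n+1}}\left[\frac{d_1d_2\cdots d_n}{n+1}+\frac{W^{(n)}_1}{n}+\dots+\frac{W^{(n)}_s}{n-s+1}+\dots+\frac{W^{(n)}_{n-1}}{2}\right],$$ that is, $\mathbb S(R^{\bigstar})=\frac{2}{d^{n+1}}\sum_{s=0}^{n-1}\frac{W_s^{(n)}}{n-s+1}$. Therefore $\mathbb S(R^{\bigstar})$ is positive.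
   Context: For $0\le s\le n-1$, with $d=\max\{d_1,\dots,d_n\}$, $$W^{(n)}_s=\sum_{\{j_1<\dots<j_s\}\subseteq\{1,\dots,n\}}(d-d_{j_1})\cdots(d-d_{j_s})\prod_{j\in\{1,\dots,n\}\setminus\{j_1,\dots,j_s\}}d_j,$$ so $W^{(n)}_0=d_1\cdots d_n$. For a commutative ring $A$ of prime characteristic $p$ and $e\ge0$, $F_*^e(A)$ is the $A$-module with elements $\{F_*^ea : a\in A\}$, addition inherited from $A$ and action $r\,F_*^ea=F_*^e(r^{p^e}a)$. If $(A,\mathfrak m_A,k)$ is an $F$-finite Noetherian local ring of prime characteristic $p$ and dimension $\delta$, with $[k:k^p]<\infty$ and $\alpha(A)=\log_p[k:k^p]$, its $F$-signature is $\mathbb S(A)=\lim_{e\to\infty}\frac{\sharp(F_*^e(A),A)}{p^{e(\delta+\alpha(A))}}$, where $\sharp(M,A)$ denotes the maximal rank of a free direct summand of $M$. *)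

theory Defs
  imports
    Complex_Main
    "HOL-Computational_Algebra.Primes"
    "HOL-Algebra.Multiplicative_Group"
    "HOL-Algebra.Embedded_Algebras"
    "HOL-Algebra.Indexed_Polynomials"
    "HOL-Algebra.QuotRing"
begin

text \<open>The characteristic is the additive order of 1; \<^const>\<open>group.ord\<close> is 0 for infinite order.\<close>

definition ring_char :: "('a, 'm) ring_scheme \<Rightarrow> nat"
  where "ring_char R = group.ord (add_monoid R) \<one>\<^bsub>R\<^esub>"

definition pth_powers :: "nat \<Rightarrow> ('a, 'm) ring_scheme \<Rightarrow> 'a set"
  where "pth_powers p R = (\<lambda>x. x [^]\<^bsub>R\<^esub> p) ` carrier R"


text \<open>
  As for the indexed polynomials of HOL-Algebra, a monomial is a multiset of indices and a series
  is the function sending a monomial to its coefficient, here without any finiteness condition.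
  The index set \<open>I\<close> is assumed finite. The constant series and the variables are
  \<^const>\<open>ring.indexed_const\<close> and \<^const>\<open>ring.indexed_var\<close>.
\<close>

definition power_series_ring :: "('a, 'm) ring_scheme \<Rightarrow> 'i set \<Rightarrow> ('i multiset \<Rightarrow> 'a) ring"
  where "power_series_ring R I =
    \<lparr> carrier = {P. (\<forall>m. P m \<in> carrier R) \<and> (\<forall>m. \<not> set_mset m \<subseteq> I \<longrightarrow> P m = \<zero>\<^bsub>R\<^esub>)},
      monoid.mult = (\<lambda>P Q m. \<Oplus>\<^bsub>R\<^esub>k\<in>{k. k \<subseteq># m}. P k \<otimes>\<^bsub>R\<^esub> Q (m - k)),
      one = ring.indexed_const R \<one>\<^bsub>R\<^esub>,
      zero = ring.indexed_const R \<zero>\<^bsub>R\<^esub>,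
      add = (\<lambda>P Q m. P m \<oplus>\<^bsub>R\<^esub> Q m) \<rparr>"

datatype uv_var = U | V

definition monomial_of :: "('a, 'm) ring_scheme \<Rightarrow> nat \<Rightarrow> (nat \<Rightarrow> nat) \<Rightarrow> nat multiset \<Rightarrow> 'a"
  where "monomial_of K n d =
    (\<Otimes>\<^bsub>power_series_ring K {1..n}\<^esub>j\<in>{1..n}. ring.indexed_var K j [^]\<^bsub>power_series_ring K {1..n}\<^esub> d j)"

definition R_star ::
    "('a, 'm) ring_scheme \<Rightarrow> nat \<Rightarrow> (nat \<Rightarrow> nat) \<Rightarrow> (uv_var multiset \<Rightarrow> nat multiset \<Rightarrow> 'a) set ring"
  where "R_star K n d =
    (let S = power_series_ring K {1..n};
         T = power_series_ring S {U, V};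
         f = monomial_of K n d
     in T Quot (PIdl\<^bsub>T\<^esub> (ring.indexed_const S f
                       \<oplus>\<^bsub>T\<^esub> ring.indexed_var S U \<otimes>\<^bsub>T\<^esub> ring.indexed_var S V)))"


text \<open>
  The underlying additive group is that of \<open>A\<close>. The fields \<open>mult\<close> and \<open>one\<close> only fill
  the module record and play no role.
\<close>

definition frobenius_pushforward :: "nat \<Rightarrow> nat \<Rightarrow> ('a, 'm) ring_scheme \<Rightarrow> ('a, 'a) module"
  where "frobenius_pushforward p e A =
    \<lparr> carrier = carrier A, monoid.mult = monoid.mult A, one = \<one>\<^bsub>A\<^esub>, zero = \<zero>\<^bsub>A\<^esub>, add = add A,
      smult = (\<lambda>r a. r [^]\<^bsub>A\<^esub> (p ^ e) \<otimes>\<^bsub>A\<^esub> a) \<rparr>"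

definition module_basis ::
    "('a, 'm) ring_scheme \<Rightarrow> ('a, 'b, 'k) module_scheme \<Rightarrow> 'b set \<Rightarrow> 'b set \<Rightarrow> bool"
  where "module_basis A M F B \<longleftrightarrow> finite B \<and> B \<subseteq> F \<and>
    (\<forall>x\<in>F. \<exists>!c. c \<in> B \<rightarrow>\<^sub>E carrier A \<and> x = (\<Oplus>\<^bsub>M\<^esub>b\<in>B. c b \<odot>\<^bsub>M\<^esub> b))"

definition has_free_summand_of_rank ::
    "('a, 'm) ring_scheme \<Rightarrow> ('a, 'b, 'k) module_scheme \<Rightarrow> nat \<Rightarrow> bool"
  where "has_free_summand_of_rank A M r \<longleftrightarrow>
    (\<exists>F N. submodule F A M \<and> submodule N A M \<and>
           F <+>\<^bsub>M\<^esub> N = carrier M \<and> F \<inter> N = {\<zero>\<^bsub>M\<^esub>} \<and>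
           (\<exists>B. module_basis A M F B \<and> card B = r))"

text \<open>Meaningful when the ranks are bounded, e.g. for finitely generated \<open>M\<close> and nonzero \<open>A\<close>.\<close>

definition max_free_rank :: "('a, 'm) ring_scheme \<Rightarrow> ('a, 'b, 'k) module_scheme \<Rightarrow> nat"
  where "max_free_rank A M = Max {r. has_free_summand_of_rank A M r}"

text \<open>
  Maximal length \<open>l\<close> of a strict chain of primes \<open>P 0 \<subset> \<dots> \<subset> P l\<close>; meaningful for rings of finite
  dimension, in particular for Noetherian local rings.
\<close>

definition krull_dim :: "('a, 'm) ring_scheme \<Rightarrow> nat"
  where "krull_dim A =
    Max {l. \<exists>P :: nat \<Rightarrow> 'a set. (\<forall>i\<le>l. primeideal (P i) A) \<and> (\<forall>i<l. P i \<subset> P (Suc i))}"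

definition residue_field :: "('a, 'm) ring_scheme \<Rightarrow> 'a set ring"
  where "residue_field A = A Quot (THE \<mm>. maximalideal \<mm> A)"

definition alpha :: "nat \<Rightarrow> ('a, 'm) ring_scheme \<Rightarrow> real"
  where "alpha p A =
    (let k = residue_field A in log (real p) (real (ring.dim k (pth_powers p k) (carrier k))))"

text \<open>Here \<open>A\<close> is an F-finite Noetherian local ring of prime characteristic \<open>p\<close>.\<close>

definition F_signature_seq :: "nat \<Rightarrow> ('a, 'm) ring_scheme \<Rightarrow> nat \<Rightarrow> real"
  where "F_signature_seq p A e =
    real (max_free_rank A (frobenius_pushforward p e A))
      / real p powr (real e * (real (krull_dim A) + alpha p A))"

definition F_signature :: "nat \<Rightarrow> ('a, 'm) ring_scheme \<Rightarrow> real"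
  where "F_signature p A = lim (F_signature_seq p A)"


definition max_exponent :: "nat \<Rightarrow> (nat \<Rightarrow> nat) \<Rightarrow> nat"
  where "max_exponent n d = Max (d ` {1..n})"

definition W :: "nat \<Rightarrow> (nat \<Rightarrow> nat) \<Rightarrow> nat \<Rightarrow> real"
  where "W n d s =
    (\<Sum>J\<in>{J. J \<subseteq> {1..n} \<and> card J = s}.
       (\<Prod>j\<in>J. real (max_exponent n d) - real (d j)) * (\<Prod>j\<in>{1..n} - J. real (d j)))"

end

theory Submission
  imports Defs "HOL-Library.Multiset_Order" "HOL-Library.Product_Lexorder"
begin

text \<open>
  A monomial of \<open>S[[u,v]]/(f + uv)\<close>, written \<open>x\<^sup>a u\<^sup>t\<close> with negative \<open>t\<close> standing for powers
  of \<open>v\<close>, is determined by its values on the \<open>2n\<close> facets of the cone generated by all of them. This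
  identifies the hypersurface with the ring \<open>A\<close> of series supported on a full submonoid of
  \<open>\<nat>\<^sup>2\<^sup>n\<close>. Put \<open>q = p\<^sup>e\<close>. As a module over the \<open>q\<close>-th powers, \<open>A\<close> is topologically spanned by the
  products of a \<open>K\<^sup>q\<close>-basis of \<open>K\<close> with monomials. Those monomials all of whose facet values are
  less than \<open>q\<close> span a free summand, and every \<open>A\<close>-linear form on the pushforward maps a monomial
  with some facet value at least \<open>q\<close> into the maximal ideal, so there is no larger free summand.
  Hence the free rank is \<open>[K : K\<^sup>p]\<^sup>e\<close> times the sum over \<open>t\<close> of the products over \<open>j\<close> of
  \<open>max (q - \<bar>t\<bar> d\<^sub>j) 0\<close>. Divided by \<open>q\<^sup>n\<^sup>+\<^sup>1\<close> this is a Riemann sum of twice the integral of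
  \<open>\<Prod>\<^sub>j (1 - x d\<^sub>j)\<close> over \<open>[0, 1/d]\<close>, and expanding \<open>1 - x d\<^sub>j\<close> as
  \<open>((d - d\<^sub>j) + d\<^sub>j (1 - x d)) / d\<close> produces the numbers \<open>W\<^sub>s\<close>. The Krull dimension is at least
  \<open>n + 1\<close> by the chain of face primes, and at most \<open>n + 1\<close> because there are only \<open>O(N\<^sup>n\<^sup>+\<^sup>1)\<close>
  monomials of degree less than \<open>N\<close>, while each step of a chain of primes raises the growth
  exponent of the quotient by one.
\<close>

section \<open>Finite sums\<close>

text \<open>The facet coordinates serve two purposes. Fullness turns divisibility of monomials in
  the model into containment of multisets, so leading-term arguments for ideals work as in a power
  series ring. And reducing facet values modulo \<open>q\<close> determines the bounded part of a
  monomial, if it has a decomposition into a bounded part and \<open>q\<close> times a member of the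
  monoid; the monomials with no such decomposition span the complement of the free summand. The
  obstacle to the upper bound for the rank is that a linear form on the pushforward is only additive
  and cannot be evaluated on an infinite series term by term. The series is therefore cut into
  finitely many pieces, one for each facet. For the dimension, growth is measured by counting
  standard monomials. A step along a chain of primes requires that multiplication by an element
  outside the smaller prime raise orders modulo that prime by a bounded amount only. This is an
  Artin-Rees statement, obtained by division with a standard basis while keeping track of the orders
  of the quotients. The sum stops at \<open>s = n - 1\<close> because some \<open>d j\<close> equals
  the maximum, which makes the term for \<open>s = n\<close> zero.\<close>

context abelian_monoid
begin

lemma finsum_Sigma:
  assumes "finite A" "\<And>a. a \<in> A \<Longrightarrow> finite (B a)"
    and "\<And>a b. a \<in> A \<Longrightarrow> b \<in> B a \<Longrightarrow> f a b \<in> carrier G"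
  shows "(\<Oplus>a\<in>A. \<Oplus>b\<in>B a. f a b) = (\<Oplus>z\<in>Sigma A B. case z of (a, b) \<Rightarrow> f a b)"
  using assms
proof (induction A rule: finite_induct)
  case empty
  then show ?case by simp
next
  case (insert x F)
  have S: "Sigma (insert x F) B = Pair x ` B x \<union> Sigma F B" by auto
  have "(\<Oplus>z\<in>Sigma (insert x F) B. case z of (a, b) \<Rightarrow> f a b)
      = (\<Oplus>z\<in>Pair x ` B x. case z of (a, b) \<Rightarrow> f a b) \<oplus> (\<Oplus>z\<in>Sigma F B. case z of (a, b) \<Rightarrow> f a b)"
    unfolding S using insert by (intro finsum_Un_disjoint) auto
  also have "(\<Oplus>z\<in>Pair x ` B x. case z of (a, b) \<Rightarrow> f a b) = (\<Oplus>b\<in>B x. f x b)"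
    using insert by (subst finsum_reindex) (auto simp: inj_on_def)
  also have "(\<Oplus>z\<in>Sigma F B. case z of (a, b) \<Rightarrow> f a b) = (\<Oplus>a\<in>F. \<Oplus>b\<in>B a. f a b)"
    using insert by (intro insert.IH[symmetric]) auto
  finally show ?case
    using insert by (subst finsum_insert) auto
qed

lemma finsum_bij:
  assumes "bij_betw h A B" "\<And>b. b \<in> B \<Longrightarrow> g b \<in> carrier G"
    and "\<And>a. a \<in> A \<Longrightarrow> f a = g (h a)"
  shows "finsum G f A = finsum G g B"
proof -
  have "finsum G g (h ` A) = finsum G (\<lambda>x. g (h x)) A"
    using assms by (intro finsum_reindex) (auto simp: bij_betw_def)
  moreover have "finsum G f A = finsum G (\<lambda>x. g (h x)) A"
    using assms by (intro finsum_cong') (auto simp: bij_betw_def)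
  ultimately show ?thesis
    using assms(1) by (simp add: bij_betw_def)
qed

lemma finsum_bij_witness:
  assumes "\<And>a. a \<in> A \<Longrightarrow> h a \<in> B" "\<And>a. a \<in> A \<Longrightarrow> h' (h a) = a"
    and "\<And>b. b \<in> B \<Longrightarrow> h' b \<in> A" "\<And>b. b \<in> B \<Longrightarrow> h (h' b) = b"
    and "\<And>b. b \<in> B \<Longrightarrow> g b \<in> carrier G" "\<And>a. a \<in> A \<Longrightarrow> f a = g (h a)"
  shows "finsum G f A = finsum G g B"
  by (rule finsum_bij[OF bij_betw_byWitness[where f' = h']]) (use assms in auto)

lemma finsum_only:
  assumes "finite A" "a \<in> A" "f a \<in> carrier G" "\<And>b. b \<in> A \<Longrightarrow> b \<noteq> a \<Longrightarrow> f b = \<zero>"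
  shows "finsum G f A = f a"
proof -
  have "finsum G f A = finsum G f {a}"
    by (rule add.finprod_mono_neutral_cong_right) (use assms in \<open>auto simp: Pi_def, metis zero_closed\<close>)
  then show ?thesis using assms by simp
qed

lemma finsum_all_zero: "(\<And>a. a \<in> A \<Longrightarrow> f a = \<zero>) \<Longrightarrow> finsum G f A = \<zero>"
  using add.finprod_one_eqI .

end

section \<open>Power series supported on a monoid of monomials\<close>

lemma finite_submultisets [simp]: "finite {k. k \<subseteq># m}"
proof (rule finite_subset)
  show "{k. k \<subseteq># m} \<subseteq> (\<Union>i\<le>size m. multisets_of_size (set_mset m) i)"
    by (auto simp: multisets_of_size_def set_mset_mono size_mset_mono dest: mset_subset_eqD)
  show "finite (\<Union>i\<le>size m. multisets_of_size (set_mset m) i)"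
    by auto
qed

text \<open>Indexing a product coefficient by all ordered pairs with sum \<open>m\<close>, rather
  than by submultisets \<open>k\<close> with cofactor \<open>m - k\<close>, makes the index set
  symmetric. Commutativity and associativity of the convolution become bijections of index sets,
  free of multiset subtraction.\<close>

definition splits :: "'i multiset \<Rightarrow> ('i multiset \<times> 'i multiset) set"
  where "splits m = {(k, l). k + l = m}"

lemma splits_image: "splits m = (\<lambda>k. (k, m - k)) ` {k. k \<subseteq># m}"
  by (auto simp: splits_def image_iff)

lemma finite_splits [simp]: "finite (splits m)"
  by (simp add: splits_image)

lemma mem_splits [simp]: "(k, l) \<in> splits m \<longleftrightarrow> k + l = m"
  by (simp add: splits_def)

text \<open>The set \<open>Q\<close> constrains supports only: the product still runs over every
  submultiset of \<open>m\<close>, inside \<open>Q\<close> or not, because pairs leaving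
  \<open>Q\<close> contribute zero. Keeping the shape of \<open>power_series_ring\<close> lets one
  construction serve for \<open>S\<close>, for \<open>S[[u,v]]\<close> and for the toric
  model.\<close>

definition series_ring :: "('a, 'm) ring_scheme \<Rightarrow> 'i multiset set \<Rightarrow> ('i multiset \<Rightarrow> 'a) ring"
  where "series_ring R Q =
    \<lparr> carrier = {P. (\<forall>m. P m \<in> carrier R) \<and> (\<forall>m. m \<notin> Q \<longrightarrow> P m = \<zero>\<^bsub>R\<^esub>)},
      monoid.mult = (\<lambda>P Q m. \<Oplus>\<^bsub>R\<^esub>k\<in>{k. k \<subseteq># m}. P k \<otimes>\<^bsub>R\<^esub> Q (m - k)),
      one = (\<lambda>m. if m = {#} then \<one>\<^bsub>R\<^esub> else \<zero>\<^bsub>R\<^esub>),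
      zero = (\<lambda>m. \<zero>\<^bsub>R\<^esub>),
      add = (\<lambda>P Q m. P m \<oplus>\<^bsub>R\<^esub> Q m) \<rparr>"

definition mono_series :: "('a, 'm) ring_scheme \<Rightarrow> 'a \<Rightarrow> 'i multiset \<Rightarrow> 'i multiset \<Rightarrow> 'a"
  where "mono_series R c k = (\<lambda>m. if m = k then c else \<zero>\<^bsub>R\<^esub>)"

lemma power_series_ring_eq:
  "ring R \<Longrightarrow> power_series_ring R I = series_ring R {m. set_mset m \<subseteq> I}"
  by (simp add: power_series_ring_def series_ring_def ring.indexed_const_def)

lemma series_ring_mult:
  "(P \<otimes>\<^bsub>series_ring R Q\<^esub> P') m = (\<Oplus>\<^bsub>R\<^esub>k\<in>{k. k \<subseteq># m}. P k \<otimes>\<^bsub>R\<^esub> P' (m - k))"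
  by (simp add: series_ring_def)

text \<open>The coefficients form a commutative ring and not a field, since the construction is
  iterated: \<open>S\<close> is the coefficient ring when \<open>u\<close> and \<open>v\<close> are
  adjoined.\<close>

locale monoid_series = cring R for R (structure) +
  fixes Q :: "'i multiset set"
  assumes empty_Q: "{#} \<in> Q" and add_Q: "\<And>k l. k \<in> Q \<Longrightarrow> l \<in> Q \<Longrightarrow> k + l \<in> Q"
begin

abbreviation "A \<equiv> series_ring R Q"

lemma carrier_A: "P \<in> carrier A \<longleftrightarrow> (\<forall>m. P m \<in> carrier R) \<and> (\<forall>m. m \<notin> Q \<longrightarrow> P m = \<zero>)"
  by (simp add: series_ring_def)

lemma coeff_closed: "P \<in> carrier A \<Longrightarrow> P m \<in> carrier R"
  by (simp add: carrier_A)

lemma coeff_outside: "P \<in> carrier A \<Longrightarrow> m \<notin> Q \<Longrightarrow> P m = \<zero>"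
  by (simp add: carrier_A)

lemma coeff_add: "(P \<oplus>\<^bsub>A\<^esub> P') m = P m \<oplus> P' m"
  by (simp add: series_ring_def)

lemma coeff_zero: "\<zero>\<^bsub>A\<^esub> m = \<zero>"
  by (simp add: series_ring_def)

lemma coeff_one: "\<one>\<^bsub>A\<^esub> m = (if m = {#} then \<one> else \<zero>)"
  by (simp add: series_ring_def)

lemma one_eq: "\<one>\<^bsub>A\<^esub> = mono_series R \<one> {#}"
  by (simp add: series_ring_def mono_series_def)

lemma coeff_mult:
  assumes "P \<in> carrier A" "P' \<in> carrier A"
  shows "(P \<otimes>\<^bsub>A\<^esub> P') m = (\<Oplus>z\<in>splits m. case z of (k, l) \<Rightarrow> P k \<otimes> P' l)"
proof -
  note [simp] = assms[THEN coeff_closed]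
  have "(P \<otimes>\<^bsub>A\<^esub> P') m = (\<Oplus>k\<in>{k. k \<subseteq># m}. P k \<otimes> P' (m - k))"
    by (rule series_ring_mult)
  also have "\<dots> = (\<Oplus>z\<in>splits m. case z of (k, l) \<Rightarrow> P k \<otimes> P' l)"
    by (rule finsum_bij[of "\<lambda>k. (k, m - k)"])
       (use assms in \<open>auto simp: bij_betw_def inj_on_def splits_image\<close>)
  finally show ?thesis .
qed

lemma mult_closed_A:
  assumes "P \<in> carrier A" "P' \<in> carrier A"
  shows "P \<otimes>\<^bsub>A\<^esub> P' \<in> carrier A"
  unfolding carrier_A
proof (intro conjI allI impI)
  note [simp] = assms[THEN coeff_closed]
  fix m
  show "(P \<otimes>\<^bsub>A\<^esub> P') m \<in> carrier R"
    using assms by (auto simp: coeff_mult intro!: finsum_closed)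
  assume m: "m \<notin> Q"
  have "P k \<otimes> P' l = \<zero>" if "k + l = m" for k l
  proof -
    have "k \<notin> Q \<or> l \<notin> Q" using add_Q m that by blast
    then show ?thesis using assms by (auto simp: coeff_outside)
  qed
  then show "(P \<otimes>\<^bsub>A\<^esub> P') m = \<zero>"
    using assms by (auto simp: coeff_mult intro!: finsum_all_zero)
qed

lemma comm_monoid_A: "comm_monoid A"
proof (rule comm_monoidI)
  fix P P' P'' assume c: "P \<in> carrier A" "P' \<in> carrier A" "P'' \<in> carrier A"
  note [simp] = c[THEN coeff_closed]
  show "(P \<otimes>\<^bsub>A\<^esub> P') \<otimes>\<^bsub>A\<^esub> P'' = P \<otimes>\<^bsub>A\<^esub> (P' \<otimes>\<^bsub>A\<^esub> P'')"
  proof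
    fix m
    have "((P \<otimes>\<^bsub>A\<^esub> P') \<otimes>\<^bsub>A\<^esub> P'') m
        = (\<Oplus>x\<in>splits m. \<Oplus>y\<in>splits (fst x). P (fst y) \<otimes> P' (snd y) \<otimes> P'' (snd x))"
      using c by (simp add: coeff_mult mult_closed_A split_def)
        (intro finsum_cong' finsum_ldistr; force simp: Pi_def intro!: finsum_closed)
    also have "\<dots> = (\<Oplus>z\<in>(SIGMA x:splits m. splits (fst x)). case z of (x, y) \<Rightarrow> P (fst y) \<otimes> P' (snd y) \<otimes> P'' (snd x))"
      using c by (intro finsum_Sigma) auto
    \<comment> \<open>Both sums run over triples with total \<open>m\<close>: in
      \<open>((a, b), (c, d))\<close> one has \<open>a = c + d\<close>, and the triple is regrouped
      as \<open>c\<close> against \<open>d + b\<close>.\<close>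
    also have "\<dots> = (\<Oplus>z\<in>(SIGMA x:splits m. splits (snd x)). case z of (x, y) \<Rightarrow> P (fst x) \<otimes> (P' (fst y) \<otimes> P'' (snd y)))"
      by (rule finsum_bij_witness[where h = "\<lambda>((a, b), (c, d)). ((c, d + b), (d, b))"
            and h' = "\<lambda>((c, e), (d, b)). ((c + d, b), (c, d))"])
         (use c in \<open>auto simp: m_assoc add.assoc\<close>)
    also have "\<dots> = (\<Oplus>x\<in>splits m. \<Oplus>y\<in>splits (snd x). P (fst x) \<otimes> (P' (fst y) \<otimes> P'' (snd y)))"
      using c by (intro finsum_Sigma[symmetric]) auto
    also have "\<dots> = (P \<otimes>\<^bsub>A\<^esub> (P' \<otimes>\<^bsub>A\<^esub> P'')) m"
      using c by (simp add: coeff_mult mult_closed_A split_def)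
        (intro finsum_cong' finsum_rdistr[symmetric]; force simp: Pi_def intro!: finsum_closed)
    finally show "((P \<otimes>\<^bsub>A\<^esub> P') \<otimes>\<^bsub>A\<^esub> P'') m = (P \<otimes>\<^bsub>A\<^esub> (P' \<otimes>\<^bsub>A\<^esub> P'')) m" .
  qed
next
  fix P P' assume c: "P \<in> carrier A" "P' \<in> carrier A"
  note [simp] = c[THEN coeff_closed]
  show "P \<otimes>\<^bsub>A\<^esub> P' \<in> carrier A" using mult_closed_A c .
  show "P \<otimes>\<^bsub>A\<^esub> P' = P' \<otimes>\<^bsub>A\<^esub> P"
  proof
    fix m
    show "(P \<otimes>\<^bsub>A\<^esub> P') m = (P' \<otimes>\<^bsub>A\<^esub> P) m"
      unfolding coeff_mult[OF c] coeff_mult[OF c(2,1)]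
      by (rule finsum_bij_witness[where h = "\<lambda>(a, b). (b, a)" and h' = "\<lambda>(a, b). (b, a)"])
         (use c in \<open>auto simp: add.commute m_comm\<close>)
  qed
next
  show "\<one>\<^bsub>A\<^esub> \<in> carrier A"
    by (auto simp: carrier_A coeff_one empty_Q)
next
  fix P assume c: "P \<in> carrier A"
  note [simp] = c[THEN coeff_closed]
  have o: "\<one>\<^bsub>A\<^esub> \<in> carrier A"
    by (auto simp: carrier_A coeff_one empty_Q)
  show "\<one>\<^bsub>A\<^esub> \<otimes>\<^bsub>A\<^esub> P = P"
  proof
    fix m
    have "(\<one>\<^bsub>A\<^esub> \<otimes>\<^bsub>A\<^esub> P) m = (case ({#}, m) of (k, l) \<Rightarrow> \<one>\<^bsub>A\<^esub> k \<otimes> P l)"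
      unfolding coeff_mult[OF o c]
      by (rule finsum_only) (use c in \<open>auto simp: coeff_one split: if_splits\<close>)
    then show "(\<one>\<^bsub>A\<^esub> \<otimes>\<^bsub>A\<^esub> P) m = P m" using c by (simp add: coeff_one)
  qed
qed

lemma abelian_group_A: "abelian_group A"
proof (rule abelian_groupI)
  fix P assume c: "P \<in> carrier A"
  note [simp] = c[THEN coeff_closed]
  have "(\<lambda>m. \<ominus> P m) \<in> carrier A" using c by (auto simp: carrier_A)
  moreover have "(\<lambda>m. \<ominus> P m) \<oplus>\<^bsub>A\<^esub> P = \<zero>\<^bsub>A\<^esub>"
    using c by (auto simp: coeff_add coeff_zero fun_eq_iff l_neg)
  ultimately show "\<exists>y\<in>carrier A. y \<oplus>\<^bsub>A\<^esub> P = \<zero>\<^bsub>A\<^esub>" by blast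
qed (auto simp: carrier_A coeff_add coeff_zero fun_eq_iff a_ac)

lemma cring_A: "cring A"
proof (rule cringI[OF abelian_group_A comm_monoid_A])
  fix P P' P'' assume c: "P \<in> carrier A" "P' \<in> carrier A" "P'' \<in> carrier A"
  note [simp] = c[THEN coeff_closed]
  interpret A: abelian_group A by (rule abelian_group_A)
  show "(P \<oplus>\<^bsub>A\<^esub> P') \<otimes>\<^bsub>A\<^esub> P'' = P \<otimes>\<^bsub>A\<^esub> P'' \<oplus>\<^bsub>A\<^esub> P' \<otimes>\<^bsub>A\<^esub> P''"
  proof
    fix m
    have AP: "P \<oplus>\<^bsub>A\<^esub> P' \<in> carrier A" using c by (intro A.a_closed)
    have "((P \<oplus>\<^bsub>A\<^esub> P') \<otimes>\<^bsub>A\<^esub> P'') m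
        = (\<Oplus>x\<in>splits m. P (fst x) \<otimes> P'' (snd x) \<oplus> P' (fst x) \<otimes> P'' (snd x))"
      unfolding coeff_mult[OF AP c(3)] split_def
      by (intro finsum_cong') (auto simp: coeff_add l_distr)
    also have "\<dots> = (\<Oplus>x\<in>splits m. P (fst x) \<otimes> P'' (snd x)) \<oplus> (\<Oplus>x\<in>splits m. P' (fst x) \<otimes> P'' (snd x))"
      by (intro finsum_addf) auto
    also have "\<dots> = (P \<otimes>\<^bsub>A\<^esub> P'' \<oplus>\<^bsub>A\<^esub> P' \<otimes>\<^bsub>A\<^esub> P'') m"
      unfolding coeff_mult[OF c(1,3)] coeff_mult[OF c(2,3)] coeff_add split_def ..
    finally show "((P \<oplus>\<^bsub>A\<^esub> P') \<otimes>\<^bsub>A\<^esub> P'') m = (P \<otimes>\<^bsub>A\<^esub> P'' \<oplus>\<^bsub>A\<^esub> P' \<otimes>\<^bsub>A\<^esub> P'') m" .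
  qed
qed

sublocale A: cring A by (rule cring_A)

lemma mono_series_closed: "c \<in> carrier R \<Longrightarrow> k \<in> Q \<Longrightarrow> mono_series R c k \<in> carrier A"
  by (auto simp: carrier_A mono_series_def)

lemma coeff_mono_mult:
  assumes "c \<in> carrier R" "k \<in> Q" "P \<in> carrier A"
  shows "(mono_series R c k \<otimes>\<^bsub>A\<^esub> P) m = (if k \<subseteq># m then c \<otimes> P (m - k) else \<zero>)"
proof -
  note [simp] = coeff_closed[OF assms(3)] assms(1)
  have e: "(mono_series R c k \<otimes>\<^bsub>A\<^esub> P) m
      = (\<Oplus>z\<in>splits m. case z of (a, b) \<Rightarrow> mono_series R c k a \<otimes> P b)"
    by (rule coeff_mult[OF mono_series_closed[OF assms(1,2)] assms(3)])
  show ?thesis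
  proof (cases "k \<subseteq># m")
    case True
    have "(\<Oplus>z\<in>splits m. case z of (a, b) \<Rightarrow> mono_series R c k a \<otimes> P b)
        = (case (k, m - k) of (a, b) \<Rightarrow> mono_series R c k a \<otimes> P b)"
      by (rule finsum_only) (use True in \<open>auto simp: mono_series_def split: if_splits\<close>)
    then show ?thesis using True e by (simp add: mono_series_def)
  next
    case False
    have "(\<Oplus>z\<in>splits m. case z of (a, b) \<Rightarrow> mono_series R c k a \<otimes> P b) = \<zero>"
      by (rule finsum_all_zero) (use False in \<open>auto simp: mono_series_def\<close>)
    then show ?thesis using False e by simp
  qed
qed

lemma mono_mult_mono:
  assumes "c \<in> carrier R" "c' \<in> carrier R" "k \<in> Q" "k' \<in> Q"
  shows "mono_series R c k \<otimes>\<^bsub>A\<^esub> mono_series R c' k' = mono_series R (c \<otimes> c') (k + k')"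
proof
  fix m
  have "m - k = k' \<longleftrightarrow> m = k + k'" if "k \<subseteq># m" using that by auto
  then show "(mono_series R c k \<otimes>\<^bsub>A\<^esub> mono_series R c' k') m = mono_series R (c \<otimes> c') (k + k') m"
    unfolding coeff_mono_mult[OF assms(1,3) mono_series_closed[OF assms(2,4)]]
    using assms(1,2) by (auto simp: mono_series_def)
qed

lemma mono_pow:
  assumes "c \<in> carrier R" "k \<in> Q"
  shows "mono_series R c k [^]\<^bsub>A\<^esub> (s::nat) = mono_series R (c [^] s) (repeat_mset s k) \<and> repeat_mset s k \<in> Q"
proof (induction s)
  case 0
  then show ?case by (simp add: one_eq empty_Q)
next
  case (Suc s)
  then show ?case
    using assms by (simp add: mono_mult_mono add.commute add_Q)
qed

lemma coeff_finsum:
  assumes "finite Y" "\<And>x. x \<in> Y \<Longrightarrow> F x \<in> carrier A"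
  shows "(\<Oplus>\<^bsub>A\<^esub>x\<in>Y. F x) m = (\<Oplus>x\<in>Y. F x m)"
  using assms
proof (induction Y rule: finite_induct)
  case empty
  then show ?case by (simp add: coeff_zero)
next
  case (insert x Y)
  then have "\<And>y. y \<in> insert x Y \<Longrightarrow> F y m \<in> carrier R"
    using coeff_closed by blast
  then show ?case
    using insert by (simp add: Pi_def coeff_add)
qed

lemma coeff_a_inv: "P \<in> carrier A \<Longrightarrow> (\<ominus>\<^bsub>A\<^esub> P) m = \<ominus> P m"
proof -
  assume c: "P \<in> carrier A"
  have "(\<ominus>\<^bsub>A\<^esub> P \<oplus>\<^bsub>A\<^esub> P) m = \<zero>" using c by (simp add: A.l_neg coeff_zero)
  then have "(\<ominus>\<^bsub>A\<^esub> P) m \<oplus> P m = \<zero>" by (simp add: coeff_add)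
  then show ?thesis using c by (simp add: coeff_closed minus_equality)
qed

lemma coeff_minus:
  "P \<in> carrier A \<Longrightarrow> P' \<in> carrier A \<Longrightarrow> (P \<ominus>\<^bsub>A\<^esub> P') m = P m \<ominus> P' m"
  by (simp add: a_minus_def coeff_add coeff_a_inv)

text \<open>The filtration by total degree plays the part of an adic topology:
  \<open>ord_ge_mult\<close> makes it multiplicative, \<open>ord_ge_all_zero\<close> separated and
  \<open>series_complete\<close> complete.\<close>

definition ord_ge :: "nat \<Rightarrow> ('i multiset \<Rightarrow> 'a) set"
  where "ord_ge N = {P \<in> carrier A. \<forall>m. size m < N \<longrightarrow> P m = \<zero>}"

lemma ord_ge_carrier: "P \<in> ord_ge N \<Longrightarrow> P \<in> carrier A"
  by (simp add: ord_ge_def)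

lemma ord_ge_0: "ord_ge 0 = carrier A"
  by (auto simp: ord_ge_def)

lemma ord_ge_mono: "N \<le> N' \<Longrightarrow> ord_ge N' \<subseteq> ord_ge N"
  by (auto simp: ord_ge_def)

lemma ord_ge_add: "P \<in> ord_ge N \<Longrightarrow> P' \<in> ord_ge N \<Longrightarrow> P \<oplus>\<^bsub>A\<^esub> P' \<in> ord_ge N"
  by (auto simp: ord_ge_def coeff_add)

lemma ord_ge_a_inv: "P \<in> ord_ge N \<Longrightarrow> \<ominus>\<^bsub>A\<^esub> P \<in> ord_ge N"
  by (auto simp: ord_ge_def coeff_a_inv)

lemma ord_ge_minus: "P \<in> ord_ge N \<Longrightarrow> P' \<in> ord_ge N \<Longrightarrow> P \<ominus>\<^bsub>A\<^esub> P' \<in> ord_ge N"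
  by (simp add: a_minus_def ord_ge_add ord_ge_a_inv)

lemma ord_ge_zero: "\<zero>\<^bsub>A\<^esub> \<in> ord_ge N"
  by (simp add: ord_ge_def coeff_zero)

lemma ord_ge_finsum:
  "finite Y \<Longrightarrow> (\<And>x. x \<in> Y \<Longrightarrow> F x \<in> ord_ge N) \<Longrightarrow> (\<Oplus>\<^bsub>A\<^esub>x\<in>Y. F x) \<in> ord_ge N"
proof (induction Y rule: finite_induct)
  case empty
  then show ?case by (simp add: ord_ge_zero)
next
  case (insert x Y)
  then have "F \<in> Y \<rightarrow> carrier A" "F x \<in> carrier A" using ord_ge_carrier by auto
  then show ?case using insert by (simp add: ord_ge_add)
qed

lemma ord_ge_mult:
  assumes "P \<in> ord_ge N" "P' \<in> ord_ge N'"
  shows "P \<otimes>\<^bsub>A\<^esub> P' \<in> ord_ge (N + N')"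
proof -
  have c: "P \<in> carrier A" "P' \<in> carrier A" using assms by (auto intro: ord_ge_carrier)
  note [simp] = c[THEN coeff_closed]
  have "(P \<otimes>\<^bsub>A\<^esub> P') m = \<zero>" if m: "size m < N + N'" for m
    unfolding coeff_mult[OF c]
  proof (rule finsum_all_zero)
    fix z assume "z \<in> splits m"
    then obtain k l where z: "z = (k, l)" "k + l = m" by (cases z) auto
    then have "size k < N \<or> size l < N'" using m by auto
    then show "(case z of (k, l) \<Rightarrow> P k \<otimes> P' l) = \<zero>"
      using assms z by (auto simp: ord_ge_def)
  qed
  then show ?thesis using c by (simp add: ord_ge_def)
qed

lemma ord_ge_mult_left:
  assumes "P \<in> carrier A" "P' \<in> ord_ge N"
  shows "P \<otimes>\<^bsub>A\<^esub> P' \<in> ord_ge N"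
  using ord_ge_mult[of P 0 P' N] assms by (simp add: ord_ge_0)

lemma ord_ge_all_zero:
  assumes "\<And>N. P \<in> ord_ge N"
  shows "P = \<zero>\<^bsub>A\<^esub>"
proof
  fix m :: "'i multiset"
  have "P \<in> ord_ge (Suc (size m))" by fact
  then show "P m = \<zero>\<^bsub>A\<^esub> m" by (simp add: ord_ge_def coeff_zero)
qed

lemma mono_series_ord: "c \<in> carrier R \<Longrightarrow> k \<in> Q \<Longrightarrow> N \<le> size k \<Longrightarrow> mono_series R c k \<in> ord_ge N"
  by (auto simp: ord_ge_def mono_series_closed) (auto simp: mono_series_def)

text \<open>A term \<open>a s\<close> of order at least \<open>N + s\<close> cannot reach a monomial
  \<open>m\<close> with \<open>s > size m\<close>, so every coefficient of the infinite sum is a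
  finite sum. The error is recorded for each partial sum, the form in which limits are used
  later.\<close>

lemma series_complete:
  assumes "\<And>s. a s \<in> ord_ge (N + s)"
  shows "\<exists>S \<in> ord_ge N. \<forall>k. S \<ominus>\<^bsub>A\<^esub> (\<Oplus>\<^bsub>A\<^esub>s\<in>{..<k}. a s) \<in> ord_ge (N + k)"
proof -
  have a: "a s \<in> carrier A" for s using assms ord_ge_carrier by blast
  note [simp] = a[THEN coeff_closed]
  define S where "S = (\<lambda>m. \<Oplus>s\<in>{..size m}. a s m)"
  have S: "S \<in> carrier A"
    by (auto simp: carrier_A S_def coeff_outside[OF a] intro!: finsum_all_zero)
  have diff: "S m = (\<Oplus>s\<in>{..<k}. a s m)" if "size m < N + k" for m k
    unfolding S_def
  proof (rule add.finprod_mono_neutral_cong)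
    show "a i m = \<zero>" if "i \<in> {..<k} - {..size m}" for i
      using that assms[of i] by (auto simp: ord_ge_def)
    show "a i m = \<zero>" if "i \<in> {..size m} - {..<k}" for i
      using that assms[of i] \<open>size m < N + k\<close> by (auto simp: ord_ge_def)
  qed auto
  have 1: "S \<ominus>\<^bsub>A\<^esub> (\<Oplus>\<^bsub>A\<^esub>s\<in>{..<k}. a s) \<in> ord_ge (N + k)" for k
  proof -
    have "(S \<ominus>\<^bsub>A\<^esub> (\<Oplus>\<^bsub>A\<^esub>s\<in>{..<k}. a s)) m = \<zero>" if "size m < N + k" for m
      using S a diff[OF that]
      by (subst coeff_minus) (auto simp: coeff_finsum Pi_def r_neg a_minus_def)
    then show ?thesis using S a by (auto simp: ord_ge_def)
  qed
  have 2: "S \<in> ord_ge N"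
    using S diff[of _ 0] by (auto simp: ord_ge_def)
  from 1 2 show ?thesis by blast
qed

end

section \<open>Homogeneous systems and Dickson's lemma\<close>

text \<open>Gaussian elimination, one equation at a time: if equation \<open>e\<close> has a nonzero
  coefficient at \<open>x0\<close>, it is solved for \<open>x0\<close> and substituted into the
  others, which removes one equation and one unknown. This supplies the linear algebra both for the
  growth estimate along primes and for the bound on free ranks.\<close>

lemma (in field) homogeneous_system:
  assumes "finite E" "finite Y" "card E < card Y"
    and "\<And>e x. e \<in> E \<Longrightarrow> x \<in> Y \<Longrightarrow> M e x \<in> carrier R"
  shows "\<exists>t. (\<forall>x\<in>Y. t x \<in> carrier R) \<and> (\<exists>x\<in>Y. t x \<noteq> \<zero>) \<and> (\<forall>e\<in>E. (\<Oplus>x\<in>Y. M e x \<otimes> t x) = \<zero>)"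
  using assms
proof (induction E arbitrary: Y M rule: finite_induct)
  case empty
  then have "Y \<noteq> {}" by auto
  then show ?case by (intro exI[of _ "\<lambda>_. \<one>"]) auto
next
  case (insert e E)
  show ?case
  proof (cases "\<forall>x\<in>Y. M e x = \<zero>")
    case True
    have "\<exists>t. (\<forall>x\<in>Y. t x \<in> carrier R) \<and> (\<exists>x\<in>Y. t x \<noteq> \<zero>) \<and> (\<forall>e\<in>E. (\<Oplus>x\<in>Y. M e x \<otimes> t x) = \<zero>)"
      using insert by (intro insert.IH) auto
    then obtain t where t: "\<forall>x\<in>Y. t x \<in> carrier R" "\<exists>x\<in>Y. t x \<noteq> \<zero>"
      "\<forall>e\<in>E. (\<Oplus>x\<in>Y. M e x \<otimes> t x) = \<zero>" by blast
    have "(\<Oplus>x\<in>Y. M e x \<otimes> t x) = \<zero>"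
      using True t by (intro finsum_all_zero) auto
    then show ?thesis using t by auto
  next
    case False
    then obtain x0 where x0: "x0 \<in> Y" "M e x0 \<noteq> \<zero>" by blast
    define i where "i = inv (M e x0)"
    have M: "\<And>e' x. e' \<in> insert e E \<Longrightarrow> x \<in> Y \<Longrightarrow> M e' x \<in> carrier R" using insert.prems by blast
    have i: "i \<in> carrier R" "M e x0 \<otimes> i = \<one>"
      using M[of e x0] x0 by (auto simp: i_def field_Units)
    define Z where "Z = Y - {x0}"
    have Z: "finite Z" "x0 \<notin> Z" "Y = insert x0 Z" "card E < card Z"
      using insert x0 by (auto simp: Z_def card_Diff_singleton)
    define M' where "M' = (\<lambda>e' x. M e' x \<ominus> M e' x0 \<otimes> i \<otimes> M e x)"
    have "\<exists>t. (\<forall>x\<in>Z. t x \<in> carrier R) \<and> (\<exists>x\<in>Z. t x \<noteq> \<zero>) \<and> (\<forall>e'\<in>E. (\<Oplus>x\<in>Z. M' e' x \<otimes> t x) = \<zero>)"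
      using Z M i x0 by (intro insert.IH) (auto simp: M'_def)
    then obtain t where t: "\<And>x. x \<in> Z \<Longrightarrow> t x \<in> carrier R" "\<exists>x\<in>Z. t x \<noteq> \<zero>"
      "\<And>e'. e' \<in> E \<Longrightarrow> (\<Oplus>x\<in>Z. M' e' x \<otimes> t x) = \<zero>" by blast
    define S where "S = (\<lambda>e'. \<Oplus>x\<in>Z. M e' x \<otimes> t x)"
    have S: "S e' \<in> carrier R" if "e' \<in> insert e E" for e'
      unfolding S_def using M that t(1) Z by (intro finsum_closed) auto
    \<comment> \<open>The value at \<open>x0\<close> is the one forced by equation \<open>e\<close>
      once the reduced system \<open>M'\<close> is solved on the other unknowns.\<close>
    define t' where "t' = (\<lambda>x. if x = x0 then \<ominus> (i \<otimes> S e) else t x)"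
    have sum: "(\<Oplus>x\<in>Y. M e' x \<otimes> t' x) = M e' x0 \<otimes> \<ominus> (i \<otimes> S e) \<oplus> S e'" if e': "e' \<in> insert e E" for e'
    proof -
      have "(\<Oplus>x\<in>Y. M e' x \<otimes> t' x) = M e' x0 \<otimes> t' x0 \<oplus> (\<Oplus>x\<in>Z. M e' x \<otimes> t' x)"
        unfolding Z(3) using Z M e' t(1) i S
        by (subst finsum_insert) (auto simp: t'_def Pi_def)
      also have "(\<Oplus>x\<in>Z. M e' x \<otimes> t' x) = S e'"
        unfolding S_def using Z M e' t(1) by (intro finsum_cong') (auto simp: t'_def)
      finally show ?thesis by (simp add: t'_def)
    qed
    have "(\<Oplus>x\<in>Y. M e' x \<otimes> t' x) = \<zero>" if e': "e' \<in> insert e E" for e'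
    proof (cases "e' = e")
      case True
      have "M e x0 \<otimes> \<ominus> (i \<otimes> S e) = \<ominus> (M e x0 \<otimes> i \<otimes> S e)"
        using M[of e x0] i(1) S[of e] x0 by (simp add: r_minus m_assoc)
      then show ?thesis using sum[OF e'] True i S[of e] by (simp add: l_neg)
    next
      case False
      then have e: "e' \<in> E" using e' by simp
      have "(\<Oplus>x\<in>Z. M' e' x \<otimes> t x) = (\<Oplus>x\<in>Z. M e' x \<otimes> t x \<oplus> (\<ominus> (M e' x0 \<otimes> i)) \<otimes> (M e x \<otimes> t x))"
        using M t(1) Z e i
        by (intro finsum_cong') (auto simp: M'_def a_minus_def l_distr l_minus m_assoc)
      also have "\<dots> = (\<Oplus>x\<in>Z. M e' x \<otimes> t x) \<oplus> (\<Oplus>x\<in>Z. (\<ominus> (M e' x0 \<otimes> i)) \<otimes> (M e x \<otimes> t x))"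
        using M t(1) Z e i by (intro finsum_addf) auto
      also have "(\<Oplus>x\<in>Z. (\<ominus> (M e' x0 \<otimes> i)) \<otimes> (M e x \<otimes> t x)) = (\<ominus> (M e' x0 \<otimes> i)) \<otimes> S e"
        unfolding S_def using M t(1) Z e i by (intro finsum_rdistr[symmetric]) auto
      finally have "S e' \<oplus> (\<ominus> (M e' x0 \<otimes> i)) \<otimes> S e = \<zero>"
        using t(3)[OF e] by (simp add: S_def)
      then show ?thesis using sum[OF e'] M[of e' x0] e' x0 i S[of e] S[of e']
        by (simp add: r_minus l_minus m_assoc a_comm)
    qed
    moreover have "\<forall>x\<in>Y. t' x \<in> carrier R"
      using t(1) Z i S by (auto simp: t'_def)
    moreover have "\<exists>x\<in>Y. t' x \<noteq> \<zero>"
      using t(2) Z by (auto simp: t'_def)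
    ultimately show ?thesis by blast
  qed
qed

text \<open>Forgetting the exponent of \<open>i\<close> reduces the number of variables and yields a
  finite set \<open>T0\<close>. If \<open>B\<close> bounds the exponents of \<open>i\<close> in
  \<open>T0\<close>, then \<open>T0\<close> covers every monomial whose exponent of \<open>i\<close>
  is at least \<open>B\<close>; each of the finitely many smaller exponents gets a cover of its
  own.\<close>

lemma dickson:
  assumes "finite I" "\<And>m. m \<in> S \<Longrightarrow> set_mset m \<subseteq> I"
  shows "\<exists>T\<subseteq>S. finite T \<and> (\<forall>m\<in>S. \<exists>t\<in>T. t \<subseteq># m)"
  using assms
proof (induction I arbitrary: S rule: finite_induct)
  case empty
  then have "S \<subseteq> {{#}}" by auto
  then show ?case by (intro exI[of _ S]) (auto intro: finite_subset)
next
  case (insert i I)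
  define drop_i where "drop_i = filter_mset (\<lambda>x. x \<noteq> i)"
  have drop_i: "t \<subseteq># m" if "drop_i t \<subseteq># drop_i m" "count t i \<le> count m i" for t m
  proof (rule mset_subset_eqI)
    fix x show "count t x \<le> count m x"
      using mset_subset_eq_count[OF that(1), of x] that(2) by (cases "x = i") (auto simp: drop_i_def)
  qed
  have cover: "\<exists>T\<subseteq>S'. finite T \<and> (\<forall>m\<in>S'. \<exists>t\<in>T. drop_i t \<subseteq># drop_i m)" if S': "S' \<subseteq> S" for S'
  proof -
    have "\<exists>T\<subseteq>drop_i ` S'. finite T \<and> (\<forall>m\<in>drop_i ` S'. \<exists>t\<in>T. t \<subseteq># m)"
    proof (rule insert.IH)
      show "set_mset m \<subseteq> I" if "m \<in> drop_i ` S'" for m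
      proof -
        from that obtain k where k: "m = drop_i k" "k \<in> S'" by (rule imageE)
        then have "set_mset k \<subseteq> insert i I" using insert.prems S' by blast
        then show ?thesis by (auto simp: k(1) drop_i_def)
      qed
    qed
    then obtain T where "T \<subseteq> drop_i ` S' \<and> finite T \<and> (\<forall>m\<in>drop_i ` S'. \<exists>t\<in>T. t \<subseteq># m)" ..
    then have T: "T \<subseteq> drop_i ` S'" "finite T" "\<forall>m\<in>drop_i ` S'. \<exists>t\<in>T. t \<subseteq># m" by simp_all
    from finite_subset_image[OF T(2,1)] obtain T' where "T' \<subseteq> S'" "finite T'" "T = drop_i ` T'" by auto
    then show ?thesis using T(3) by (intro exI[of _ T']) simp
  qed
  from cover[OF subset_refl] obtain T0
    where "T0 \<subseteq> S \<and> finite T0 \<and> (\<forall>m\<in>S. \<exists>t\<in>T0. drop_i t \<subseteq># drop_i m)" ..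
  then have T0: "T0 \<subseteq> S" "finite T0" "\<And>m. m \<in> S \<Longrightarrow> \<exists>t\<in>T0. drop_i t \<subseteq># drop_i m" by simp_all
  obtain B where B: "\<And>t. t \<in> T0 \<Longrightarrow> count t i \<le> B"
    using finite_nat_set_iff_bounded_le[of "(\<lambda>t. count t i) ` T0"] T0(2) by auto
  have "\<forall>c. \<exists>T. T \<subseteq> {m \<in> S. count m i = c} \<and> finite T
      \<and> (\<forall>m\<in>{m \<in> S. count m i = c}. \<exists>t\<in>T. drop_i t \<subseteq># drop_i m)"
    by (intro allI cover) auto
  from choice[OF this] obtain T where "\<forall>c. T c \<subseteq> {m \<in> S. count m i = c} \<and> finite (T c)
      \<and> (\<forall>m\<in>{m \<in> S. count m i = c}. \<exists>t\<in>T c. drop_i t \<subseteq># drop_i m)" ..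
  then have T: "\<And>c. T c \<subseteq> {m \<in> S. count m i = c}" "\<And>c. finite (T c)"
    "\<And>c m. m \<in> {m \<in> S. count m i = c} \<Longrightarrow> \<exists>t\<in>T c. drop_i t \<subseteq># drop_i m"
    by simp_all
  have "\<exists>t\<in>T0 \<union> (\<Union>c<B. T c). t \<subseteq># m" if m: "m \<in> S" for m
  proof (cases "count m i < B")
    case True
    obtain t where t: "t \<in> T (count m i)" "drop_i t \<subseteq># drop_i m" using T(3)[of m] m by auto
    then have "count t i = count m i" using T(1) by blast
    then have "t \<subseteq># m" using drop_i[OF t(2)] by simp
    then show ?thesis using t True by blast
  next
    case False
    obtain t where t: "t \<in> T0" "drop_i t \<subseteq># drop_i m" using T0(3)[OF m] by blast
    then have "t \<subseteq># m" using drop_i[OF t(2)] B[OF t(1)] False by simp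
    then show ?thesis using t by blast
  qed
  moreover have "T0 \<union> (\<Union>c<B. T c) \<subseteq> S" "finite (T0 \<union> (\<Union>c<B. T c))"
    using T0 T by auto
  ultimately show ?case by blast
qed

section \<open>Series over a field\<close>

lemma (in cring) geometric_sum:
  assumes "r \<in> carrier R"
  shows "(\<one> \<ominus> r) \<otimes> (\<Oplus>s\<in>{..<k}. r [^] s) = \<one> \<ominus> r [^] (k::nat)"
proof (induction k)
  case 0
  then show ?case using assms by (simp add: a_minus_def r_neg)
next
  case (Suc k)
  have "(\<Oplus>s\<in>{..<Suc k}. r [^] s) = (\<Oplus>s\<in>{..<k}. r [^] s) \<oplus> r [^] k"
    using assms by (simp add: lessThan_Suc a_comm Pi_def)
  then have "(\<one> \<ominus> r) \<otimes> (\<Oplus>s\<in>{..<Suc k}. r [^] s)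
    = (\<one> \<ominus> r) \<otimes> (\<Oplus>s\<in>{..<k}. r [^] s) \<oplus> (\<one> \<ominus> r) \<otimes> r [^] k"
    using assms by (simp add: r_distr Pi_def)
  also have "\<dots> = \<one> \<ominus> r [^] k \<oplus> (\<one> \<ominus> r) \<otimes> r [^] k" by (simp only: Suc.IH)
  also have "\<dots> = \<one> \<ominus> r [^] k \<otimes> r"
  proof -
    have "\<one> \<ominus> z \<oplus> (\<one> \<ominus> r) \<otimes> z = \<one> \<ominus> z \<otimes> r" if "z \<in> carrier R" for z
      using assms that by algebra
    then show ?thesis using assms by simp
  qed
  finally show ?case by simp
qed

text \<open>\<open>Q_full\<close> makes the monoid full in the free monoid: a quotient of members of
  \<open>Q\<close> that is a multiset at all lies in \<open>Q\<close>. Hence divisibility of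
  monomials is containment of multisets, and Dickson's lemma applies to leading monomials of ideals.
  The linear order on the variables serves to break ties between monomials of equal degree.\<close>

locale affine_series = monoid_series R Q + field R
  for R (structure) and Q :: "'i :: linorder multiset set" +
  fixes I :: "'i set"
  assumes finite_I: "finite I"
    and Q_supported: "k \<in> Q \<Longrightarrow> set_mset k \<subseteq> I"
    and Q_full: "k \<in> Q \<Longrightarrow> l \<in> Q \<Longrightarrow> k \<subseteq># l \<Longrightarrow> l - k \<in> Q"
begin

lemma const_coeff_mult:
  assumes "P \<in> carrier A" "P' \<in> carrier A"
  shows "(P \<otimes>\<^bsub>A\<^esub> P') {#} = P {#} \<otimes> P' {#}"
proof -
  have "splits ({#} :: 'i multiset) = {({#}, {#})}" by (auto simp: splits_def)
  then show ?thesis using assms by (simp add: coeff_mult coeff_closed)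
qed

lemma const_coeff_hom: "(\<lambda>P. P {#}) \<in> ring_hom A R"
  by (rule ring_hom_memI) (auto simp: coeff_closed coeff_add coeff_one const_coeff_mult)

text \<open>Divided by its constant coefficient the series is \<open>1 - r\<close> with
  \<open>r\<close> of positive order, and the geometric series in \<open>r\<close> converges to an
  inverse. So the ring is local, with the constant coefficient as residue map.\<close>

lemma unit_if_const_coeff:
  assumes P: "P \<in> carrier A" and P0: "P {#} \<noteq> \<zero>"
  shows "P \<in> Units A"
proof -
  define c where "c = mono_series R (inv (P {#})) ({#} :: 'i multiset)"
  have u: "P {#} \<in> Units R" using P P0 by (simp add: field_Units coeff_closed)
  have c: "c \<in> carrier A" "c {#} = inv (P {#})"
    using u by (auto simp: c_def mono_series_closed empty_Q) (simp add: mono_series_def)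
  define r where "r = \<one>\<^bsub>A\<^esub> \<ominus>\<^bsub>A\<^esub> c \<otimes>\<^bsub>A\<^esub> P"
  have r: "r \<in> ord_ge 1"
  proof -
    have "r {#} = \<zero>"
    proof -
      have "r {#} = \<one> \<ominus> \<one>"
        using c P u by (simp add: r_def coeff_minus const_coeff_mult coeff_one)
      then show ?thesis by simp
    qed
    moreover have "r \<in> carrier A" using c P by (simp add: r_def)
    ultimately show ?thesis by (simp add: ord_ge_def less_Suc_eq)
  qed
  then have rc: "r \<in> carrier A" by (rule ord_ge_carrier)
  have rp: "r [^]\<^bsub>A\<^esub> s \<in> ord_ge (0 + s)" for s :: nat
  proof (induction s)
    case 0
    then show ?case using rc by (simp add: ord_ge_0)
  next
    case (Suc s)
    then show ?case using ord_ge_mult[OF Suc.IH r] by simp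
  qed
  obtain S where S: "S \<in> ord_ge 0" "\<And>k. S \<ominus>\<^bsub>A\<^esub> (\<Oplus>\<^bsub>A\<^esub>s\<in>{..<k}. r [^]\<^bsub>A\<^esub> s) \<in> ord_ge (0 + k)"
    using series_complete[of "\<lambda>s. r [^]\<^bsub>A\<^esub> s", OF rp] by blast
  have Sc: "S \<in> carrier A" using S ord_ge_carrier by blast
  have "(\<one>\<^bsub>A\<^esub> \<ominus>\<^bsub>A\<^esub> r) \<otimes>\<^bsub>A\<^esub> S \<ominus>\<^bsub>A\<^esub> \<one>\<^bsub>A\<^esub> \<in> ord_ge k" for k
  proof -
    define T where "T = (\<Oplus>\<^bsub>A\<^esub>s\<in>{..<k}. r [^]\<^bsub>A\<^esub> s)"
    have T: "T \<in> carrier A" unfolding T_def using rc by (intro A.finsum_closed) auto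
    have "(\<one>\<^bsub>A\<^esub> \<ominus>\<^bsub>A\<^esub> r) \<otimes>\<^bsub>A\<^esub> T = \<one>\<^bsub>A\<^esub> \<ominus>\<^bsub>A\<^esub> r [^]\<^bsub>A\<^esub> k"
      unfolding T_def using rc by (rule A.geometric_sum)
    moreover have "(\<one>\<^bsub>A\<^esub> \<ominus>\<^bsub>A\<^esub> r) \<otimes>\<^bsub>A\<^esub> S \<ominus>\<^bsub>A\<^esub> \<one>\<^bsub>A\<^esub>
        = (\<one>\<^bsub>A\<^esub> \<ominus>\<^bsub>A\<^esub> r) \<otimes>\<^bsub>A\<^esub> (S \<ominus>\<^bsub>A\<^esub> T) \<oplus>\<^bsub>A\<^esub> ((\<one>\<^bsub>A\<^esub> \<ominus>\<^bsub>A\<^esub> r) \<otimes>\<^bsub>A\<^esub> T \<ominus>\<^bsub>A\<^esub> \<one>\<^bsub>A\<^esub>)"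
      using rc Sc T by algebra
    moreover have "(\<one>\<^bsub>A\<^esub> \<ominus>\<^bsub>A\<^esub> r [^]\<^bsub>A\<^esub> k) \<ominus>\<^bsub>A\<^esub> \<one>\<^bsub>A\<^esub> = \<ominus>\<^bsub>A\<^esub> (r [^]\<^bsub>A\<^esub> k)"
      using A.nat_pow_closed[OF rc, of k] by algebra
    moreover have "(\<one>\<^bsub>A\<^esub> \<ominus>\<^bsub>A\<^esub> r) \<otimes>\<^bsub>A\<^esub> (S \<ominus>\<^bsub>A\<^esub> T) \<in> ord_ge k"
      using S(2)[of k] rc by (intro ord_ge_mult_left) (auto simp: T_def)
    ultimately show ?thesis
      using ord_ge_add ord_ge_a_inv rp[of k] by simp
  qed
  then have "(\<one>\<^bsub>A\<^esub> \<ominus>\<^bsub>A\<^esub> r) \<otimes>\<^bsub>A\<^esub> S \<ominus>\<^bsub>A\<^esub> \<one>\<^bsub>A\<^esub> = \<zero>\<^bsub>A\<^esub>" by (rule ord_ge_all_zero)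
  then have "(\<one>\<^bsub>A\<^esub> \<ominus>\<^bsub>A\<^esub> r) \<otimes>\<^bsub>A\<^esub> S = \<one>\<^bsub>A\<^esub>"
    using rc Sc by simp
  moreover have "\<one>\<^bsub>A\<^esub> \<ominus>\<^bsub>A\<^esub> r = c \<otimes>\<^bsub>A\<^esub> P" using c P unfolding r_def by algebra
  ultimately have "P \<otimes>\<^bsub>A\<^esub> (c \<otimes>\<^bsub>A\<^esub> S) = \<one>\<^bsub>A\<^esub>"
    using c P Sc by (simp add: A.m_ac)
  then show ?thesis using c P Sc by (metis A.Units_one_closed A.m_closed A.prod_unit_l A.unit_factor)
qed

end

text \<open>For series the leading monomial has to be the smallest one, so degree comes first and
  counts upwards. Within one degree the multiset order decides, being total and compatible with
  sums.\<close>

definition mono_less :: "'i :: linorder multiset \<Rightarrow> 'i multiset \<Rightarrow> bool"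
  where "mono_less m m' \<longleftrightarrow> size m < size m' \<or> size m = size m' \<and> m < m'"

lemma mono_less_add: "mono_less m m' \<Longrightarrow> mono_less (k + m) (k + m')"
  by (auto simp: mono_less_def)

lemma mono_less_trans: "mono_less a b \<Longrightarrow> mono_less b c \<Longrightarrow> mono_less a c"
  by (auto simp: mono_less_def)

lemma mono_less_irrefl: "\<not> mono_less a a"
  by (auto simp: mono_less_def)

text \<open>The order is compatible with addition, so two domination relations with equal sums are
  both equalities. Consequently no other pair of terms can cancel the product of two leading
  terms.\<close>

lemma mono_less_add_both:
  assumes "a = b \<or> mono_less a b" "c = d \<or> mono_less c d" "a + c = b + d"
  shows "a = b \<and> c = d"
proof -
  have "mono_less a b \<Longrightarrow> mono_less (a + c) (b + c)" "mono_less c d \<Longrightarrow> mono_less (b + c) (b + d)"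
    using mono_less_add[of a b c] mono_less_add[of c d b] by (auto simp: add.commute)
  then show ?thesis using assms mono_less_irrefl mono_less_trans by (metis)
qed

lemma finite_supported_size: "finite I \<Longrightarrow> finite {m. set_mset m \<subseteq> I \<and> size m = N}"
  using finite_multisets_of_size[of I N] by (simp add: multisets_of_size_def)

lemma finite_supported_size_less: "finite I \<Longrightarrow> finite {m. set_mset m \<subseteq> I \<and> size m < N}"
proof -
  assume I: "finite I"
  have "{m. set_mset m \<subseteq> I \<and> size m < N} = (\<Union>i<N. {m. set_mset m \<subseteq> I \<and> size m = i})" by auto
  then show ?thesis using finite_supported_size[OF I] by simp
qed

text \<open>Even an infinite set of monomials has only finitely many members of its least degree,
  since there are finitely many variables. Among these the tie-breaking order has a minimum.\<close>

lemma mono_least: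
  assumes "finite I" "S \<noteq> {}" "\<And>m. m \<in> S \<Longrightarrow> set_mset m \<subseteq> I"
  shows "\<exists>m\<in>S. \<forall>m'\<in>S. m' = m \<or> mono_less m m'"
proof -
  define N where "N = (LEAST N. N \<in> size ` S)"
  have N: "N \<in> size ` S" unfolding N_def by (rule LeastI_ex) (use assms in auto)
  have N_le: "N \<le> size m" if "m \<in> S" for m unfolding N_def by (rule Least_le) (use that in auto)
  define S' where "S' = {m \<in> S. size m = N}"
  have "finite S'" by (rule finite_subset[OF _ finite_supported_size[OF assms(1), of N]])
      (use assms in \<open>auto simp: S'_def\<close>)
  moreover have "S' \<noteq> {}" using N by (auto simp: S'_def)
  ultimately have M: "Min S' \<in> S'" "\<And>m. m \<in> S' \<Longrightarrow> Min S' \<le> m" by auto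
  have "m' = Min S' \<or> mono_less (Min S') m'" if m': "m' \<in> S" for m'
  proof (cases "size m' = N")
    case True
    then have "Min S' \<le> m'" using m' M(2)[of m'] by (simp add: S'_def)
    moreover have "size (Min S') = N" using M(1) by (simp add: S'_def)
    ultimately show ?thesis using True by (auto simp: mono_less_def le_less)
  next
    case False
    then show ?thesis using N_le[OF m'] M(1) by (auto simp: mono_less_def S'_def)
  qed
  then show ?thesis using M(1) by (auto simp: S'_def)
qed

section \<open>Leading monomials, standard bases and division with control of orders\<close>

context affine_series
begin

definition is_lm :: "('i multiset \<Rightarrow> 'a) \<Rightarrow> 'i multiset \<Rightarrow> bool"
  where "is_lm P m \<longleftrightarrow> P m \<noteq> \<zero> \<and> (\<forall>m'. P m' \<noteq> \<zero> \<longrightarrow> m' = m \<or> mono_less m m')"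

definition lms :: "('i multiset \<Rightarrow> 'a) set \<Rightarrow> 'i multiset set"
  where "lms J = {m. \<exists>g\<in>J. is_lm g m}"

lemma support_Q: "P \<in> carrier A \<Longrightarrow> P m \<noteq> \<zero> \<Longrightarrow> m \<in> Q"
  using coeff_outside by blast

lemma is_lm_Q: "P \<in> carrier A \<Longrightarrow> is_lm P m \<Longrightarrow> m \<in> Q"
  using support_Q by (auto simp: is_lm_def)

lemma lm_exists:
  assumes "P \<in> carrier A" "P m \<noteq> \<zero>"
  shows "\<exists>k. is_lm P k"
proof -
  have "\<exists>k\<in>{m. P m \<noteq> \<zero>}. \<forall>m'\<in>{m. P m \<noteq> \<zero>}. m' = k \<or> mono_less k m'"
    using assms support_Q Q_supported by (intro mono_least[OF finite_I]) auto
  then show ?thesis by (auto simp: is_lm_def)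
qed

lemma is_lm_size: "is_lm P k \<Longrightarrow> P m \<noteq> \<zero> \<Longrightarrow> size k \<le> size m"
  by (auto simp: is_lm_def mono_less_def)

lemma is_lm_ord_ge: "P \<in> ord_ge N \<Longrightarrow> is_lm P k \<Longrightarrow> N \<le> size k"
  by (auto simp: ord_ge_def is_lm_def not_less[symmetric])

text \<open>The division algorithm within a single degree. Fullness turns
  \<open>l g \<subseteq># m0\<close> into a cofactor \<open>k\<close> in \<open>Q\<close>, and
  subtracting a monomial multiple of \<open>g\<close> cancels the leading term. The cofactor has
  degree at least \<open>N - c\<close> because \<open>size (l g) \<le> c\<close>; this bound is the
  source of Artin-Rees.\<close>

lemma reduce_degree:
  assumes J: "ideal J A" and G: "finite G" "G \<subseteq> J" "\<And>g. g \<in> G \<Longrightarrow> is_lm g (l g)"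
    "\<And>g. g \<in> G \<Longrightarrow> size (l g) \<le> c" "\<And>m. m \<in> lms J \<Longrightarrow> \<exists>g\<in>G. l g \<subseteq># m"
    and r: "r \<in> J" "r \<in> ord_ge N"
  shows "\<exists>a. (\<forall>g\<in>G. a g \<in> ord_ge (N - c)) \<and> r \<ominus>\<^bsub>A\<^esub> (\<Oplus>\<^bsub>A\<^esub>g\<in>G. a g \<otimes>\<^bsub>A\<^esub> g) \<in> J \<inter> ord_ge (Suc N)"
  using r
\<comment> \<open>The measure counts the monomials of degree \<open>N\<close> at or above some
  support monomial of degree \<open>N\<close>. It drops because the leading monomial
  \<open>m0\<close> leaves this set once its term is cancelled.\<close>
proof (induction "card {m. set_mset m \<subseteq> I \<and> size m = N \<and> (\<exists>m'. r m' \<noteq> \<zero> \<and> size m' = N \<and> (m = m' \<or> mono_less m' m))}"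
    arbitrary: r rule: less_induct)
  case (less r)
  interpret J: ideal J A by fact
  have Gc: "\<And>g. g \<in> G \<Longrightarrow> g \<in> carrier A" using G(2) J.a_subset by blast
  have rc: "r \<in> carrier A" using less.prems ord_ge_carrier by blast
  show ?case
  proof (cases "r \<in> ord_ge (Suc N)")
    case True
    have "(\<Oplus>\<^bsub>A\<^esub>g\<in>G. \<zero>\<^bsub>A\<^esub> \<otimes>\<^bsub>A\<^esub> g) = \<zero>\<^bsub>A\<^esub>"
      using Gc by (intro A.finsum_all_zero) auto
    then show ?thesis
      using True less.prems rc by (intro exI[of _ "\<lambda>_. \<zero>\<^bsub>A\<^esub>"]) (simp add: ord_ge_zero a_minus_def)
  next
    case False
    then obtain m1 where m1: "r m1 \<noteq> \<zero>" "size m1 < Suc N" using rc by (auto simp: ord_ge_def)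
    obtain m0 where m0: "is_lm r m0" using lm_exists[OF rc m1(1)] by blast
    have sz: "size m0 = N"
      using is_lm_ord_ge[OF less.prems(2) m0] is_lm_size[OF m0 m1(1)] m1(2) by simp
    have "m0 \<in> lms J" using less.prems m0 by (auto simp: lms_def)
    then obtain g where g: "g \<in> G" "l g \<subseteq># m0" using G(5) by blast
    have m0Q: "m0 \<in> Q" "l g \<in> Q" using is_lm_Q rc m0 Gc[OF g(1)] G(3)[OF g(1)] by blast+
    define k where "k = m0 - l g"
    have k: "k \<in> Q" "m0 = k + l g" using Q_full m0Q g(2) by (auto simp: k_def)
    have gl: "g (l g) \<in> Units R"
      using G(3)[OF g(1)] Gc[OF g(1)] by (auto simp: is_lm_def field_Units coeff_closed)
    define u where "u = r m0 \<otimes> inv (g (l g))"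
    have u: "u \<in> carrier R" "u \<otimes> g (l g) = r m0"
      using gl rc Gc[OF g(1)] by (auto simp: u_def coeff_closed m_assoc)
    define b where "b = mono_series R u k"
    have b: "b \<in> carrier A" "b \<in> ord_ge (N - c)"
    proof -
      have "N - c \<le> size k" using sz k(2) G(4)[OF g(1)] by simp
      then show "b \<in> carrier A" "b \<in> ord_ge (N - c)"
        using u k by (auto simp: b_def mono_series_closed mono_series_ord)
    qed
    have bg: "(b \<otimes>\<^bsub>A\<^esub> g) m = (if k \<subseteq># m then u \<otimes> g (m - k) else \<zero>)" for m
      unfolding b_def by (rule coeff_mono_mult[OF u(1) k(1) Gc[OF g(1)]])
    define r' where "r' = r \<ominus>\<^bsub>A\<^esub> b \<otimes>\<^bsub>A\<^esub> g"
    have r'c: "r' \<in> carrier A" using rc b Gc[OF g(1)] by (simp add: r'_def)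
    have r': "mono_less m0 m" if "r' m \<noteq> \<zero>" for m
    proof -
      have e: "r' m = r m \<ominus> (b \<otimes>\<^bsub>A\<^esub> g) m"
        using rc b Gc[OF g(1)] by (simp add: r'_def coeff_minus)
      have ne: "m \<noteq> m0"
      proof
        assume "m = m0"
        then have "r' m = r m0 \<ominus> r m0" using e bg[of m0] u(2) k(2) by simp
        then show False using that rc by (simp add: coeff_closed)
      qed
      have "r m \<noteq> \<zero> \<or> (b \<otimes>\<^bsub>A\<^esub> g) m \<noteq> \<zero>" using that e by (auto simp: a_minus_def)
      then show ?thesis
      proof
        assume "r m \<noteq> \<zero>"
        then show ?thesis using m0 ne by (auto simp: is_lm_def)
      next
        assume "(b \<otimes>\<^bsub>A\<^esub> g) m \<noteq> \<zero>"
        then have *: "k \<subseteq># m" "g (m - k) \<noteq> \<zero>" using bg[of m] u(1) by (auto split: if_splits)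
        then have "m - k = l g \<or> mono_less (l g) (m - k)" using G(3)[OF g(1)] by (auto simp: is_lm_def)
        then have "m = m0 \<or> mono_less m0 m"
          using mono_less_add[of "l g" "m - k" k] k(2) subset_mset.add_diff_inverse[OF *(1)] by metis
        then show ?thesis using ne by simp
      qed
    qed
    have r'N: "r' \<in> ord_ge N"
    proof -
      have "r' m = \<zero>" if "size m < N" for m
        using r'[of m] that sz by (auto simp: mono_less_def)
      then show ?thesis using r'c by (simp add: ord_ge_def)
    qed
    have r'J: "r' \<in> J"
    proof -
      have "b \<otimes>\<^bsub>A\<^esub> g \<in> J" using b(1) g(1) G(2) J.I_l_closed by blast
      then show ?thesis
        unfolding r'_def a_minus_def using less.prems(1) J.a_closed J.a_inv_closed by simp
    qed
    let ?U = "\<lambda>r. {m. set_mset m \<subseteq> I \<and> size m = N \<and> (\<exists>m'. r m' \<noteq> \<zero> \<and> size m' = N \<and> (m = m' \<or> mono_less m' m))}"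
    have "?U r' \<subset> ?U r"
    proof
      show "?U r' \<subseteq> ?U r"
      proof
        fix m assume "m \<in> ?U r'"
        then obtain m' where m: "set_mset m \<subseteq> I" "size m = N" "r' m' \<noteq> \<zero>" "m = m' \<or> mono_less m' m" by blast
        have "mono_less m0 m" using r'[OF m(3)] m(4) mono_less_trans by blast
        then show "m \<in> ?U r" using m m0 sz by (auto simp: is_lm_def)
      qed
      have "m0 \<in> ?U r" using m0 sz Q_supported[OF m0Q(1)] by (auto simp: is_lm_def)
      moreover have "m0 \<notin> ?U r'" using r' mono_less_irrefl mono_less_trans by blast
      ultimately show "?U r' \<noteq> ?U r" by blast
    qed
    moreover have "finite (?U r)"
      by (rule finite_subset[OF _ finite_supported_size[OF finite_I, of N]]) auto
    ultimately have "card (?U r') < card (?U r)" by (rule psubset_card_mono[rotated])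
    from less.hyps[OF this r'J r'N] obtain a
      where a: "\<forall>g\<in>G. a g \<in> ord_ge (N - c)"
        "r' \<ominus>\<^bsub>A\<^esub> (\<Oplus>\<^bsub>A\<^esub>g\<in>G. a g \<otimes>\<^bsub>A\<^esub> g) \<in> J \<inter> ord_ge (Suc N)" by blast
    have ac: "\<And>g. g \<in> G \<Longrightarrow> a g \<in> carrier A" using a(1) ord_ge_carrier by blast
    define a' where "a' = a(g := a g \<oplus>\<^bsub>A\<^esub> b)"
    have "(\<Oplus>\<^bsub>A\<^esub>h\<in>G. a' h \<otimes>\<^bsub>A\<^esub> h) = a' g \<otimes>\<^bsub>A\<^esub> g \<oplus>\<^bsub>A\<^esub> (\<Oplus>\<^bsub>A\<^esub>h\<in>G - {g}. a' h \<otimes>\<^bsub>A\<^esub> h)"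
      using A.finsum_insert[of "G - {g}" g "\<lambda>h. a' h \<otimes>\<^bsub>A\<^esub> h"] G(1) g(1) ac Gc b
      by (auto simp: insert_absorb a'_def)
    also have "(\<Oplus>\<^bsub>A\<^esub>h\<in>G - {g}. a' h \<otimes>\<^bsub>A\<^esub> h) = (\<Oplus>\<^bsub>A\<^esub>h\<in>G - {g}. a h \<otimes>\<^bsub>A\<^esub> h)"
      using ac Gc by (intro A.finsum_cong') (auto simp: a'_def)
    finally have s1: "(\<Oplus>\<^bsub>A\<^esub>h\<in>G. a' h \<otimes>\<^bsub>A\<^esub> h)
      = (a g \<oplus>\<^bsub>A\<^esub> b) \<otimes>\<^bsub>A\<^esub> g \<oplus>\<^bsub>A\<^esub> (\<Oplus>\<^bsub>A\<^esub>h\<in>G - {g}. a h \<otimes>\<^bsub>A\<^esub> h)" by (simp add: a'_def)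
    have s2: "(\<Oplus>\<^bsub>A\<^esub>h\<in>G. a h \<otimes>\<^bsub>A\<^esub> h) = a g \<otimes>\<^bsub>A\<^esub> g \<oplus>\<^bsub>A\<^esub> (\<Oplus>\<^bsub>A\<^esub>h\<in>G - {g}. a h \<otimes>\<^bsub>A\<^esub> h)"
      using A.finsum_insert[of "G - {g}" g "\<lambda>h. a h \<otimes>\<^bsub>A\<^esub> h"] G(1) g(1) ac Gc
      by (auto simp: insert_absorb)
    have "r \<ominus>\<^bsub>A\<^esub> ((x \<oplus>\<^bsub>A\<^esub> b) \<otimes>\<^bsub>A\<^esub> g \<oplus>\<^bsub>A\<^esub> s) = (r \<ominus>\<^bsub>A\<^esub> b \<otimes>\<^bsub>A\<^esub> g) \<ominus>\<^bsub>A\<^esub> (x \<otimes>\<^bsub>A\<^esub> g \<oplus>\<^bsub>A\<^esub> s)"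
      if "x \<in> carrier A" "s \<in> carrier A" for x s
      using that rc b(1) Gc[OF g(1)] by algebra
    moreover have "(\<Oplus>\<^bsub>A\<^esub>h\<in>G - {g}. a h \<otimes>\<^bsub>A\<^esub> h) \<in> carrier A" using ac Gc by (intro A.finsum_closed) auto
    ultimately have "r \<ominus>\<^bsub>A\<^esub> (\<Oplus>\<^bsub>A\<^esub>h\<in>G. a' h \<otimes>\<^bsub>A\<^esub> h) = r' \<ominus>\<^bsub>A\<^esub> (\<Oplus>\<^bsub>A\<^esub>h\<in>G. a h \<otimes>\<^bsub>A\<^esub> h)"
      unfolding s1 s2 r'_def using ac[OF g(1)] by blast
    moreover have "\<forall>g\<in>G. a' g \<in> ord_ge (N - c)"
      using a(1) b(2) g(1) by (auto simp: a'_def ord_ge_add)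
    ultimately show ?thesis using a(2) by (intro exI[of _ a']) simp
  qed
qed

text \<open>Dickson's lemma leaves finitely many leading monomials to be realised by elements of
  \<open>J\<close>. The bound \<open>c\<close> on their degrees is returned as well, being the loss
  of order in every division.\<close>

lemma standard_basis:
  assumes J: "ideal J A"
  obtains G l c where "finite G" "G \<subseteq> J" "\<And>g. g \<in> G \<Longrightarrow> is_lm g (l g)"
    "\<And>g. g \<in> G \<Longrightarrow> size (l g) \<le> c" "\<And>m. m \<in> lms J \<Longrightarrow> \<exists>g\<in>G. l g \<subseteq># m"
proof -
  interpret J: ideal J A by fact
  have "set_mset m \<subseteq> I" if m: "m \<in> lms J" for m
  proof -
    obtain g where "g \<in> J" "is_lm g m" using m by (auto simp: lms_def)
    then show ?thesis using is_lm_Q Q_supported J.Icarr by blast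
  qed
  from dickson[OF finite_I this] obtain T
    where "T \<subseteq> lms J \<and> finite T \<and> (\<forall>m\<in>lms J. \<exists>t\<in>T. t \<subseteq># m)" ..
  then have T: "T \<subseteq> lms J" "finite T" "\<And>m. m \<in> lms J \<Longrightarrow> \<exists>t\<in>T. t \<subseteq># m" by simp_all
  have "\<forall>t\<in>T. \<exists>g. g \<in> J \<and> is_lm g t" using T(1) by (auto simp: lms_def)
  from bchoice[OF this] obtain g where "\<forall>t\<in>T. g t \<in> J \<and> is_lm (g t) t" ..
  then have g: "\<And>t. t \<in> T \<Longrightarrow> g t \<in> J \<and> is_lm (g t) t" by blast
  \<comment> \<open>\<open>l\<close> recovers the index \<open>t\<close> from the chosen element;
    this is consistent because a series has only one leading monomial.\<close>
  define l where "l = (\<lambda>x. SOME t. t \<in> T \<and> g t = x)"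
  have l: "l (g t) = t" if "t \<in> T" for t
  proof -
    have "l (g t) \<in> T \<and> g (l (g t)) = g t" unfolding l_def by (rule someI) (use that in auto)
    then have 1: "is_lm (g t) (l (g t))" using g[of "l (g t)"] by simp
    have 2: "is_lm (g t) t" using g that by blast
    have "l (g t) = t \<or> mono_less t (l (g t))" "t = l (g t) \<or> mono_less (l (g t)) t"
      using 1 2 by (auto simp: is_lm_def)
    then show ?thesis by (metis mono_less_irrefl mono_less_trans)
  qed
  have "finite (size ` T)" using T(2) by simp
  then obtain c where "\<forall>n\<in>size ` T. n \<le> c" unfolding finite_nat_set_iff_bounded_le ..
  then have c: "\<And>t. t \<in> T \<Longrightarrow> size t \<le> c" by blast
  show thesis
  proof (rule that)
    show "finite (g ` T)" "g ` T \<subseteq> J" using T(2) g by auto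
    show "is_lm x (l x)" "size (l x) \<le> c" if "x \<in> g ` T" for x
      using that g l c by auto
    show "\<exists>x\<in>g ` T. l x \<subseteq># m" if m: "m \<in> lms J" for m
    proof -
      from T(3)[OF m] obtain t where t: "t \<in> T" "t \<subseteq># m" ..
      then show ?thesis using l[OF t(1)] by (intro bexI[of _ "g t"]) simp_all
    qed
  qed
qed

text \<open>\<open>reduce_degree\<close> is repeated in the degrees \<open>N\<close>,
  \<open>N + 1\<close> and so on. The corrections to the coefficient of each \<open>g\<close> have
  growing order, hence they sum to a series, and the final remainder lies in every
  \<open>ord_ge k\<close>. The hypothesis \<open>c \<le> N\<close> makes \<open>N + s - c\<close>
  equal to \<open>N - c + s\<close> for subtraction of natural numbers.\<close>

lemma standard_division:
  assumes J: "ideal J A" and G: "finite G" "G \<subseteq> J" "\<And>g. g \<in> G \<Longrightarrow> is_lm g (l g)"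
    "\<And>g. g \<in> G \<Longrightarrow> size (l g) \<le> c" "\<And>m. m \<in> lms J \<Longrightarrow> \<exists>g\<in>G. l g \<subseteq># m"
    and r: "r \<in> J" "r \<in> ord_ge N" and N: "c \<le> N"
  shows "\<exists>a. (\<forall>g\<in>G. a g \<in> ord_ge (N - c)) \<and> r = (\<Oplus>\<^bsub>A\<^esub>g\<in>G. a g \<otimes>\<^bsub>A\<^esub> g)"
proof -
  interpret J: ideal J A by fact
  have Gc: "\<And>g. g \<in> G \<Longrightarrow> g \<in> carrier A" using G(2) J.a_subset by blast
  define ok where "ok = (\<lambda>M r a. (\<forall>g\<in>G. a g \<in> ord_ge (M - c))
    \<and> r \<ominus>\<^bsub>A\<^esub> (\<Oplus>\<^bsub>A\<^esub>g\<in>G. a g \<otimes>\<^bsub>A\<^esub> g) \<in> J \<inter> ord_ge (Suc M))"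
  define st where "st = (\<lambda>M r. SOME a. ok M r a)"
  have st: "ok M r (st M r)" if "r \<in> J \<inter> ord_ge M" for M r
  proof -
    have "\<exists>a. ok M r a" unfolding ok_def using that by (intro reduce_degree[OF J G]) simp_all
    then show ?thesis unfolding st_def by (rule someI_ex)
  qed
  define rs where "rs = rec_nat r (\<lambda>s x. x \<ominus>\<^bsub>A\<^esub> (\<Oplus>\<^bsub>A\<^esub>g\<in>G. st (N + s) x g \<otimes>\<^bsub>A\<^esub> g))"
  define as where "as = (\<lambda>g s. st (N + s) (rs s) g)"
  have rs0: "rs 0 = r" and rsS: "\<And>s. rs (Suc s) = rs s \<ominus>\<^bsub>A\<^esub> (\<Oplus>\<^bsub>A\<^esub>g\<in>G. as g s \<otimes>\<^bsub>A\<^esub> g)"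
    by (simp_all add: rs_def as_def)
  have rs: "rs s \<in> J \<inter> ord_ge (N + s)" for s
  proof (induction s)
    case 0
    then show ?case using r by (simp add: rs0)
  next
    case (Suc s)
    from st[OF Suc.IH] show ?case unfolding rsS ok_def as_def by simp
  qed
  have as: "as g s \<in> ord_ge (N - c + s)" if "g \<in> G" for g s
  proof -
    have "N + s - c = N - c + s" using N by simp
    then show ?thesis using st[OF rs[of s]] that unfolding ok_def as_def by metis
  qed
  have asc: "\<And>g s. g \<in> G \<Longrightarrow> as g s \<in> carrier A" using as ord_ge_carrier by blast
  have "\<forall>g\<in>G. \<exists>S. S \<in> ord_ge (N - c) \<and> (\<forall>k. S \<ominus>\<^bsub>A\<^esub> (\<Oplus>\<^bsub>A\<^esub>s\<in>{..<k}. as g s) \<in> ord_ge (N - c + k))"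
  proof
    fix g assume g: "g \<in> G"
    have "\<exists>S \<in> ord_ge (N - c). \<forall>k. S \<ominus>\<^bsub>A\<^esub> (\<Oplus>\<^bsub>A\<^esub>s\<in>{..<k}. as g s) \<in> ord_ge (N - c + k)"
      by (rule series_complete[of "as g", OF as[OF g]])
    then show "\<exists>S. S \<in> ord_ge (N - c) \<and> (\<forall>k. S \<ominus>\<^bsub>A\<^esub> (\<Oplus>\<^bsub>A\<^esub>s\<in>{..<k}. as g s) \<in> ord_ge (N - c + k))"
      by (simp only: Bex_def)
  qed
  from bchoice[OF this] obtain S where
    "\<forall>g\<in>G. S g \<in> ord_ge (N - c) \<and> (\<forall>k. S g \<ominus>\<^bsub>A\<^esub> (\<Oplus>\<^bsub>A\<^esub>s\<in>{..<k}. as g s) \<in> ord_ge (N - c + k))" ..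
  then have S: "\<And>g. g \<in> G \<Longrightarrow> S g \<in> ord_ge (N - c)"
    "\<And>g k. g \<in> G \<Longrightarrow> S g \<ominus>\<^bsub>A\<^esub> (\<Oplus>\<^bsub>A\<^esub>s\<in>{..<k}. as g s) \<in> ord_ge (N - c + k)" by simp_all
  have Sc: "\<And>g. g \<in> G \<Longrightarrow> S g \<in> carrier A" using S(1) ord_ge_carrier by blast
  define T where "T = (\<lambda>g k. \<Oplus>\<^bsub>A\<^esub>s\<in>{..<k}. as g s)"
  have Tc: "\<And>g k. g \<in> G \<Longrightarrow> T g k \<in> carrier A"
    unfolding T_def using asc by (intro A.finsum_closed) auto
  have TS: "T g (Suc k) = T g k \<oplus>\<^bsub>A\<^esub> as g k" if "g \<in> G" for g k
    unfolding T_def using asc[OF that] by (simp add: lessThan_Suc A.a_comm Pi_def)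
  have sumc: "(\<Oplus>\<^bsub>A\<^esub>g\<in>G. F g \<otimes>\<^bsub>A\<^esub> g) \<in> carrier A" if "\<And>g. g \<in> G \<Longrightarrow> F g \<in> carrier A" for F
    using that Gc by (intro A.finsum_closed) auto
  have suma: "(\<Oplus>\<^bsub>A\<^esub>g\<in>G. F g \<otimes>\<^bsub>A\<^esub> g) = (\<Oplus>\<^bsub>A\<^esub>g\<in>G. F1 g \<otimes>\<^bsub>A\<^esub> g) \<oplus>\<^bsub>A\<^esub> (\<Oplus>\<^bsub>A\<^esub>g\<in>G. F2 g \<otimes>\<^bsub>A\<^esub> g)"
    if F: "\<And>g. g \<in> G \<Longrightarrow> F1 g \<in> carrier A" "\<And>g. g \<in> G \<Longrightarrow> F2 g \<in> carrier A"
      "\<And>g. g \<in> G \<Longrightarrow> F g = F1 g \<oplus>\<^bsub>A\<^esub> F2 g" for F F1 F2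
  proof -
    have "(\<Oplus>\<^bsub>A\<^esub>g\<in>G. F g \<otimes>\<^bsub>A\<^esub> g) = (\<Oplus>\<^bsub>A\<^esub>g\<in>G. F1 g \<otimes>\<^bsub>A\<^esub> g \<oplus>\<^bsub>A\<^esub> F2 g \<otimes>\<^bsub>A\<^esub> g)"
      using F Gc by (intro A.finsum_cong') (auto simp: A.l_distr)
    also have "\<dots> = (\<Oplus>\<^bsub>A\<^esub>g\<in>G. F1 g \<otimes>\<^bsub>A\<^esub> g) \<oplus>\<^bsub>A\<^esub> (\<Oplus>\<^bsub>A\<^esub>g\<in>G. F2 g \<otimes>\<^bsub>A\<^esub> g)"
      using F Gc by (intro A.finsum_addf) auto
    finally show ?thesis .
  qed
  have rc: "r \<in> carrier A" using r ord_ge_carrier by blast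
  have alg: "r \<ominus>\<^bsub>A\<^esub> (x \<oplus>\<^bsub>A\<^esub> y) = (r \<ominus>\<^bsub>A\<^esub> x) \<ominus>\<^bsub>A\<^esub> y" if "x \<in> carrier A" "y \<in> carrier A" for x y
    using that rc by algebra
  have rsk: "rs k = r \<ominus>\<^bsub>A\<^esub> (\<Oplus>\<^bsub>A\<^esub>g\<in>G. T g k \<otimes>\<^bsub>A\<^esub> g)" for k
  proof (induction k)
    case 0
    have "(\<Oplus>\<^bsub>A\<^esub>g\<in>G. T g 0 \<otimes>\<^bsub>A\<^esub> g) = \<zero>\<^bsub>A\<^esub>"
      using Gc by (intro A.finsum_all_zero) (auto simp: T_def)
    then show ?case using rc by (simp add: rs0 a_minus_def)
  next
    case (Suc k)
    have "(\<Oplus>\<^bsub>A\<^esub>g\<in>G. T g (Suc k) \<otimes>\<^bsub>A\<^esub> g) = (\<Oplus>\<^bsub>A\<^esub>g\<in>G. T g k \<otimes>\<^bsub>A\<^esub> g) \<oplus>\<^bsub>A\<^esub> (\<Oplus>\<^bsub>A\<^esub>g\<in>G. as g k \<otimes>\<^bsub>A\<^esub> g)"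
      using Tc asc TS by (intro suma)
    then show ?case
      unfolding rsS Suc.IH using alg[OF sumc sumc] Tc asc by simp
  qed
  have "r \<ominus>\<^bsub>A\<^esub> (\<Oplus>\<^bsub>A\<^esub>g\<in>G. S g \<otimes>\<^bsub>A\<^esub> g) \<in> ord_ge k" for k
  proof -
    have "(\<Oplus>\<^bsub>A\<^esub>g\<in>G. S g \<otimes>\<^bsub>A\<^esub> g) = (\<Oplus>\<^bsub>A\<^esub>g\<in>G. T g k \<otimes>\<^bsub>A\<^esub> g) \<oplus>\<^bsub>A\<^esub> (\<Oplus>\<^bsub>A\<^esub>g\<in>G. (S g \<ominus>\<^bsub>A\<^esub> T g k) \<otimes>\<^bsub>A\<^esub> g)"
    proof (rule suma)
      show "S g = T g k \<oplus>\<^bsub>A\<^esub> (S g \<ominus>\<^bsub>A\<^esub> T g k)" if "g \<in> G" for g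
        using Sc[OF that] Tc[OF that, of k] by algebra
    qed (use Sc Tc in auto)
    then have "r \<ominus>\<^bsub>A\<^esub> (\<Oplus>\<^bsub>A\<^esub>g\<in>G. S g \<otimes>\<^bsub>A\<^esub> g) = rs k \<ominus>\<^bsub>A\<^esub> (\<Oplus>\<^bsub>A\<^esub>g\<in>G. (S g \<ominus>\<^bsub>A\<^esub> T g k) \<otimes>\<^bsub>A\<^esub> g)"
      unfolding rsk using alg[OF sumc sumc] Tc Sc by simp
    moreover have "rs k \<in> ord_ge k" using rs[of k] ord_ge_mono[of k "N + k"] by auto
    moreover have "(\<Oplus>\<^bsub>A\<^esub>g\<in>G. (S g \<ominus>\<^bsub>A\<^esub> T g k) \<otimes>\<^bsub>A\<^esub> g) \<in> ord_ge k"
    proof (rule ord_ge_finsum[OF G(1)])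
      fix g assume g: "g \<in> G"
      have "S g \<ominus>\<^bsub>A\<^esub> T g k \<in> ord_ge k"
        using S(2)[OF g, of k] ord_ge_mono[of k "N - c + k"] unfolding T_def by auto
      then have "g \<otimes>\<^bsub>A\<^esub> (S g \<ominus>\<^bsub>A\<^esub> T g k) \<in> ord_ge k" using Gc[OF g] by (intro ord_ge_mult_left)
      then show "(S g \<ominus>\<^bsub>A\<^esub> T g k) \<otimes>\<^bsub>A\<^esub> g \<in> ord_ge k"
        using Gc[OF g] Sc[OF g] Tc[OF g] by (simp add: A.m_comm)
    qed
    ultimately show ?thesis by (simp add: ord_ge_minus)
  qed
  then have "r \<ominus>\<^bsub>A\<^esub> (\<Oplus>\<^bsub>A\<^esub>g\<in>G. S g \<otimes>\<^bsub>A\<^esub> g) = \<zero>\<^bsub>A\<^esub>" by (rule ord_ge_all_zero)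
  then have "r = (\<Oplus>\<^bsub>A\<^esub>g\<in>G. S g \<otimes>\<^bsub>A\<^esub> g)" using rc sumc[OF Sc] by simp
  then show ?thesis using S(1) by blast
qed

text \<open>Artin-Rees for multiplication by \<open>f\<close> modulo \<open>P\<close>. Dividing by a
  standard basis of \<open>P + (f)\<close> gives \<open>f x - p = q + H f\<close> with
  \<open>q\<close> in \<open>P\<close> and \<open>H\<close> of order at least \<open>N - c\<close>.
  Then \<open>f (x - H)\<close> lies in \<open>P\<close>, so \<open>x - H\<close> does, and it
  approximates \<open>x\<close> up to \<open>H\<close>.\<close>

lemma artin_rees:
  assumes P: "ideal P A" and f: "f \<in> carrier A"
    and nzd: "\<And>x. x \<in> carrier A \<Longrightarrow> f \<otimes>\<^bsub>A\<^esub> x \<in> P \<Longrightarrow> x \<in> P"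
  shows "\<exists>c. \<forall>N\<ge>c. \<forall>x\<in>carrier A. \<forall>p\<in>P. f \<otimes>\<^bsub>A\<^esub> x \<ominus>\<^bsub>A\<^esub> p \<in> ord_ge N \<longrightarrow> (\<exists>p'\<in>P. x \<ominus>\<^bsub>A\<^esub> p' \<in> ord_ge (N - c))"
proof -
  interpret P: ideal P A by fact
  define J where "J = P <+>\<^bsub>A\<^esub> PIdl\<^bsub>A\<^esub> f"
  have J: "ideal J A" unfolding J_def by (rule A.add_ideals[OF P A.cgenideal_ideal[OF f]])
  have mem_J: "g \<in> J \<longleftrightarrow> (\<exists>p\<in>P. \<exists>h\<in>carrier A. g = p \<oplus>\<^bsub>A\<^esub> h \<otimes>\<^bsub>A\<^esub> f)" for g
    by (auto simp: J_def set_add_def' cgenideal_def)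
  obtain G l c where G: "finite G" "G \<subseteq> J"
    "\<And>g. g \<in> G \<Longrightarrow> is_lm g (l g)" "\<And>g. g \<in> G \<Longrightarrow> size (l g) \<le> c"
    "\<And>m. m \<in> lms J \<Longrightarrow> \<exists>g\<in>G. l g \<subseteq># m"
    using standard_basis[OF J] by metis
  have "\<forall>g\<in>G. \<exists>ph. fst ph \<in> P \<and> snd ph \<in> carrier A \<and> g = fst ph \<oplus>\<^bsub>A\<^esub> snd ph \<otimes>\<^bsub>A\<^esub> f"
  proof
    fix g assume "g \<in> G"
    then have "g \<in> J" using G(2) by blast
    then obtain p h where "p \<in> P" "h \<in> carrier A" "g = p \<oplus>\<^bsub>A\<^esub> h \<otimes>\<^bsub>A\<^esub> f" unfolding mem_J by auto
    then show "\<exists>ph. fst ph \<in> P \<and> snd ph \<in> carrier A \<and> g = fst ph \<oplus>\<^bsub>A\<^esub> snd ph \<otimes>\<^bsub>A\<^esub> f"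
      by (intro exI[of _ "(p, h)"]) simp
  qed
  from bchoice[OF this] obtain ph where "\<forall>g\<in>G. fst (ph g) \<in> P \<and> snd (ph g) \<in> carrier A \<and> g = fst (ph g) \<oplus>\<^bsub>A\<^esub> snd (ph g) \<otimes>\<^bsub>A\<^esub> f" ..
  then have ph: "\<And>g. g \<in> G \<Longrightarrow> fst (ph g) \<in> P" "\<And>g. g \<in> G \<Longrightarrow> snd (ph g) \<in> carrier A"
    "\<And>g. g \<in> G \<Longrightarrow> g = fst (ph g) \<oplus>\<^bsub>A\<^esub> snd (ph g) \<otimes>\<^bsub>A\<^esub> f" by simp_all
  have phc: "\<And>g. g \<in> G \<Longrightarrow> fst (ph g) \<in> carrier A" using ph(1) P.Icarr by blast
  have "\<exists>p'\<in>P. x \<ominus>\<^bsub>A\<^esub> p' \<in> ord_ge (N - c)"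
    if N: "c \<le> N" and x: "x \<in> carrier A" and p: "p \<in> P" and o: "f \<otimes>\<^bsub>A\<^esub> x \<ominus>\<^bsub>A\<^esub> p \<in> ord_ge N" for N x p
  proof -
    have pc: "p \<in> carrier A" using p P.Icarr by blast
    have "f \<otimes>\<^bsub>A\<^esub> x \<ominus>\<^bsub>A\<^esub> p = \<ominus>\<^bsub>A\<^esub> p \<oplus>\<^bsub>A\<^esub> x \<otimes>\<^bsub>A\<^esub> f" using f x pc by algebra
    then have "f \<otimes>\<^bsub>A\<^esub> x \<ominus>\<^bsub>A\<^esub> p \<in> J" using mem_J P.a_inv_closed[OF p] x by blast
    from standard_division[OF J G this o N] obtain a where a: "\<And>g. g \<in> G \<Longrightarrow> a g \<in> ord_ge (N - c)"
      "f \<otimes>\<^bsub>A\<^esub> x \<ominus>\<^bsub>A\<^esub> p = (\<Oplus>\<^bsub>A\<^esub>g\<in>G. a g \<otimes>\<^bsub>A\<^esub> g)" by auto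
    have ac: "\<And>g. g \<in> G \<Longrightarrow> a g \<in> carrier A" using a(1) ord_ge_carrier by blast
    define H where "H = (\<Oplus>\<^bsub>A\<^esub>g\<in>G. a g \<otimes>\<^bsub>A\<^esub> snd (ph g))"
    define q where "q = (\<Oplus>\<^bsub>A\<^esub>g\<in>G. a g \<otimes>\<^bsub>A\<^esub> fst (ph g))"
    have Hc: "H \<in> carrier A" unfolding H_def using ac ph(2) by (intro A.finsum_closed) auto
    have Ho: "H \<in> ord_ge (N - c)"
      unfolding H_def
    proof (rule ord_ge_finsum[OF G(1)])
      fix g assume g: "g \<in> G"
      then have "snd (ph g) \<otimes>\<^bsub>A\<^esub> a g \<in> ord_ge (N - c)" using a(1) ph(2) by (intro ord_ge_mult_left)
      then show "a g \<otimes>\<^bsub>A\<^esub> snd (ph g) \<in> ord_ge (N - c)" using g ac ph(2) by (simp add: A.m_comm)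
    qed
    have qP: "q \<in> P"
    proof -
      have "(\<Oplus>\<^bsub>A\<^esub>g\<in>G'. a g \<otimes>\<^bsub>A\<^esub> fst (ph g)) \<in> P" if "G' \<subseteq> G" for G'
        using finite_subset[OF that G(1)] that
      proof (induction G' rule: finite_induct)
        case empty
        then show ?case by simp
      next
        case (insert g G')
        then show ?case using ac ph(1) phc P.I_l_closed
          by (subst A.finsum_insert) (auto intro!: P.a_closed)
      qed
      then show ?thesis by (simp add: q_def)
    qed
    then have qc: "q \<in> carrier A" by (rule P.Icarr)
    have "(\<Oplus>\<^bsub>A\<^esub>g\<in>G. a g \<otimes>\<^bsub>A\<^esub> g) = (\<Oplus>\<^bsub>A\<^esub>g\<in>G. a g \<otimes>\<^bsub>A\<^esub> fst (ph g) \<oplus>\<^bsub>A\<^esub> (a g \<otimes>\<^bsub>A\<^esub> snd (ph g)) \<otimes>\<^bsub>A\<^esub> f)"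
    proof (rule A.finsum_cong'[OF refl])
      show "a g \<otimes>\<^bsub>A\<^esub> g = a g \<otimes>\<^bsub>A\<^esub> fst (ph g) \<oplus>\<^bsub>A\<^esub> (a g \<otimes>\<^bsub>A\<^esub> snd (ph g)) \<otimes>\<^bsub>A\<^esub> f" if "g \<in> G" for g
        by (subst ph(3)[OF that]) (use ac phc ph(2) f that in \<open>simp add: A.r_distr A.m_assoc\<close>)
    qed (use ac phc ph(2) f in auto)
    also have "\<dots> = q \<oplus>\<^bsub>A\<^esub> (\<Oplus>\<^bsub>A\<^esub>g\<in>G. (a g \<otimes>\<^bsub>A\<^esub> snd (ph g)) \<otimes>\<^bsub>A\<^esub> f)"
      unfolding q_def using ac phc ph(2) f by (intro A.finsum_addf) auto
    also have "(\<Oplus>\<^bsub>A\<^esub>g\<in>G. (a g \<otimes>\<^bsub>A\<^esub> snd (ph g)) \<otimes>\<^bsub>A\<^esub> f) = H \<otimes>\<^bsub>A\<^esub> f"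
      unfolding H_def using ac ph(2) f G(1) by (intro A.finsum_ldistr[symmetric]) auto
    finally have e: "f \<otimes>\<^bsub>A\<^esub> x \<ominus>\<^bsub>A\<^esub> p = q \<oplus>\<^bsub>A\<^esub> H \<otimes>\<^bsub>A\<^esub> f" using a(2) by simp
    have "f \<otimes>\<^bsub>A\<^esub> (x \<ominus>\<^bsub>A\<^esub> H) = (f \<otimes>\<^bsub>A\<^esub> x \<ominus>\<^bsub>A\<^esub> p) \<ominus>\<^bsub>A\<^esub> H \<otimes>\<^bsub>A\<^esub> f \<oplus>\<^bsub>A\<^esub> p"
      using f x Hc pc by algebra
    also have "\<dots> = q \<oplus>\<^bsub>A\<^esub> p" unfolding e using f Hc pc qc by algebra
    finally have "f \<otimes>\<^bsub>A\<^esub> (x \<ominus>\<^bsub>A\<^esub> H) \<in> P" using P.a_closed[OF qP p] by simp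
    then have "x \<ominus>\<^bsub>A\<^esub> H \<in> P" using nzd x Hc by simp
    moreover have "x \<ominus>\<^bsub>A\<^esub> (x \<ominus>\<^bsub>A\<^esub> H) = H" using x Hc by algebra
    ultimately show ?thesis using Ho by (intro bexI[of _ "x \<ominus>\<^bsub>A\<^esub> H"]) simp_all
  qed
  then show ?thesis by (intro exI[of _ c]) simp
qed

end

section \<open>Hilbert functions of quotients and the length of chains of primes\<close>

context affine_series
begin

text \<open>Standard monomials of degree less than \<open>N\<close> represent a basis of the
  quotient by \<open>P + ord_ge N\<close>, so this is the Hilbert function of \<open>A / P\<close>
  for the order filtration.\<close>

definition std_count :: "('i multiset \<Rightarrow> 'a) set \<Rightarrow> nat \<Rightarrow> nat"
  where "std_count P N = card {m \<in> Q. size m < N \<and> m \<notin> lms P}"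

lemma finite_Q_less: "finite {m \<in> Q. size m < N}"
  by (rule finite_subset[OF _ finite_supported_size_less[OF finite_I, of N]]) (use Q_supported in auto)

lemma std_count_mono: "N \<le> N' \<Longrightarrow> std_count P N \<le> std_count P N'"
  unfolding std_count_def
  by (rule card_mono, rule finite_subset[OF _ finite_Q_less[of N']]) auto

lemma lms_Q:
  assumes "ideal P A"
  shows "lms P \<subseteq> Q"
proof
  fix m assume "m \<in> lms P"
  then obtain g where g: "g \<in> P" "is_lm g m" by (auto simp: lms_def)
  have "g \<in> carrier A" by (rule ideal.Icarr[OF assms g(1)])
  then show "m \<in> Q" using g(2) by (rule is_lm_Q)
qed

text \<open>Multiplication by an element \<open>f\<close> of \<open>P'\<close> outside
  \<open>P\<close> embeds \<open>A / P\<close> into \<open>P' / P\<close> and, by Artin-Rees, raises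
  orders modulo \<open>P\<close> by at most \<open>c\<close>. So below degree \<open>N\<close> the
  ideal \<open>P'\<close> has at least one leading monomial more than \<open>P\<close> for every
  standard monomial of \<open>P\<close> of degree below \<open>N - c\<close>.\<close>

lemma std_count_drop:
  assumes P: "primeideal P A" and P': "ideal P' A" and sub: "P \<subset> P'"
  shows "\<exists>c. \<forall>N\<ge>c. std_count P' N + std_count P (N - c) \<le> std_count P N"
proof -
  interpret P: primeideal P A by fact
  interpret P': ideal P' A by fact
  obtain f where f: "f \<in> P'" "f \<notin> P" using sub by blast
  have fc: "f \<in> carrier A" using f P'.Icarr by blast
  have "\<exists>c. \<forall>N\<ge>c. \<forall>x\<in>carrier A. \<forall>p\<in>P. f \<otimes>\<^bsub>A\<^esub> x \<ominus>\<^bsub>A\<^esub> p \<in> ord_ge N \<longrightarrow> (\<exists>p'\<in>P. x \<ominus>\<^bsub>A\<^esub> p' \<in> ord_ge (N - c))"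
    using P.I_prime fc f by (intro artin_rees[OF P.is_ideal fc]) blast
  then obtain c where c: "\<And>N x p. c \<le> N \<Longrightarrow> x \<in> carrier A \<Longrightarrow> p \<in> P \<Longrightarrow> f \<otimes>\<^bsub>A\<^esub> x \<ominus>\<^bsub>A\<^esub> p \<in> ord_ge N
    \<Longrightarrow> \<exists>p'\<in>P. x \<ominus>\<^bsub>A\<^esub> p' \<in> ord_ge (N - c)" by metis
  have "std_count P' N + std_count P (N - c) \<le> std_count P N" if N: "c \<le> N" for N
  proof -
    define T where "T = {m \<in> Q. size m < N}"
    define X1 where "X1 = {m \<in> Q. size m < N - c \<and> m \<notin> lms P}"
    define Y1 where "Y1 = lms P \<inter> T"
    define Z1 where "Z1 = lms P' \<inter> T"
    have fin: "finite T" "finite X1" "finite Y1" "finite Z1"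
    proof -
      show T: "finite T" using finite_Q_less[of N] by (simp add: T_def)
      show "finite Y1" "finite Z1" using T by (simp_all add: Y1_def Z1_def)
      show "finite X1" by (rule finite_subset[OF _ finite_Q_less[of "N - c"]]) (auto simp: X1_def)
    qed
    \<comment> \<open>The unknowns are attached to the multiples of \<open>f\<close> by monomials in
      \<open>X1\<close> and to elements \<open>g v\<close> of \<open>P\<close> with leading
      monomials \<open>v\<close> in \<open>Y1\<close>; the equations ask for vanishing at
      \<open>Z1\<close>. Were the inequality false, a nontrivial solution would exist, and it is
      shown to be impossible.\<close>
    have "card X1 + card Y1 \<le> card Z1"
    proof (rule ccontr)
      assume "\<not> ?thesis"
      then have lt: "card Z1 < card (X1 <+> Y1)" using fin by (simp add: card_Plus)
      have "\<forall>y\<in>Y1. \<exists>g. g \<in> P \<and> is_lm g y" by (auto simp: Y1_def lms_def)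
      from bchoice[OF this] obtain g where "\<forall>y\<in>Y1. g y \<in> P \<and> is_lm (g y) y" ..
      then have g: "\<And>y. y \<in> Y1 \<Longrightarrow> g y \<in> P" "\<And>y. y \<in> Y1 \<Longrightarrow> is_lm (g y) y" by simp_all
      define w where "w = case_sum (\<lambda>m. f \<otimes>\<^bsub>A\<^esub> mono_series R \<one> m) g"
      have monoc: "mono_series R \<one> m \<in> carrier A" if "m \<in> X1" for m
        using that by (auto simp: X1_def mono_series_closed)
      have w: "w i \<in> P'" if "i \<in> X1 <+> Y1" for i
        using that
      proof (cases i)
        case (Inl m)
        then show ?thesis using that f(1) monoc P'.I_r_closed by (auto simp: w_def)
      next
        case (Inr v)
        then have "g v \<in> P'" using that g(1) sub by blast
        then show ?thesis using Inr by (simp add: w_def)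
      qed
      then have wc: "\<And>i. i \<in> X1 <+> Y1 \<Longrightarrow> w i \<in> carrier A" using P'.Icarr by blast
      have "\<exists>t. (\<forall>i\<in>X1 <+> Y1. t i \<in> carrier R) \<and> (\<exists>i\<in>X1 <+> Y1. t i \<noteq> \<zero>)
          \<and> (\<forall>z\<in>Z1. (\<Oplus>i\<in>X1 <+> Y1. w i z \<otimes> t i) = \<zero>)"
      proof (rule homogeneous_system[of Z1 "X1 <+> Y1" "\<lambda>z i. w i z"])
        show "w i z \<in> carrier R" if "i \<in> X1 <+> Y1" for z i by (rule coeff_closed[OF wc[OF that]])
      qed (use fin lt in simp_all)
      then obtain t where "(\<forall>i\<in>X1 <+> Y1. t i \<in> carrier R) \<and> (\<exists>i\<in>X1 <+> Y1. t i \<noteq> \<zero>)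
          \<and> (\<forall>z\<in>Z1. (\<Oplus>i\<in>X1 <+> Y1. w i z \<otimes> t i) = \<zero>)" ..
      then have t: "\<forall>i\<in>X1 <+> Y1. t i \<in> carrier R" "\<exists>i\<in>X1 <+> Y1. t i \<noteq> \<zero>"
        "\<forall>z\<in>Z1. (\<Oplus>i\<in>X1 <+> Y1. w i z \<otimes> t i) = \<zero>" by simp_all
      have tc: "\<And>i. i \<in> X1 <+> Y1 \<Longrightarrow> t i \<in> carrier R"
        "\<And>v. v \<in> X1 \<Longrightarrow> t (Inl v) \<in> carrier R" "\<And>v. v \<in> Y1 \<Longrightarrow> t (Inr v) \<in> carrier R"
        using t(1) by auto
      define k where "k = (\<lambda>i. mono_series R (t i) ({#} :: 'i multiset))"
      have kc: "k i \<in> carrier A" if "i \<in> X1 <+> Y1" for i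
        using tc that by (auto simp: k_def mono_series_closed empty_Q)
      have k: "(k i \<otimes>\<^bsub>A\<^esub> p) m = t i \<otimes> p m" if "i \<in> X1 <+> Y1" "p \<in> carrier A" for i p m
        using tc that by (auto simp: k_def coeff_mono_mult empty_Q)
      have kX: "(k (Inl v) \<otimes>\<^bsub>A\<^esub> p) m = t (Inl v) \<otimes> p m" if "v \<in> X1" "p \<in> carrier A" for v p m
        using that by (intro k) auto
      have kY: "(k (Inr v) \<otimes>\<^bsub>A\<^esub> p) m = t (Inr v) \<otimes> p m" if "v \<in> Y1" "p \<in> carrier A" for v p m
        using that by (intro k) auto
      have kcX: "k (Inl v) \<in> carrier A" "w (Inl v) \<in> carrier A" if "v \<in> X1" for v
        using that kc wc by auto
      have kcY: "k (Inr v) \<in> carrier A" "w (Inr v) \<in> carrier A" if "v \<in> Y1" for v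
        using that kc wc by auto
      have wcc: "\<And>i z. i \<in> X1 <+> Y1 \<Longrightarrow> w i z \<in> carrier R"
        "\<And>v z. v \<in> X1 \<Longrightarrow> w (Inl v) z \<in> carrier R" "\<And>v z. v \<in> Y1 \<Longrightarrow> w (Inr v) z \<in> carrier R"
        by (rule coeff_closed, erule wc kcX(2) kcY(2))+
      define x where "x = (\<Oplus>\<^bsub>A\<^esub>m\<in>X1. k (Inl m) \<otimes>\<^bsub>A\<^esub> mono_series R \<one> m)"
      define y where "y = (\<Oplus>\<^bsub>A\<^esub>v\<in>Y1. k (Inr v) \<otimes>\<^bsub>A\<^esub> g v)"
      have gc: "\<And>v. v \<in> Y1 \<Longrightarrow> g v \<in> carrier A" using g(1) P.Icarr by blast
      have gcc: "\<And>v z. v \<in> Y1 \<Longrightarrow> g v z \<in> carrier R" by (rule coeff_closed[OF gc])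
      have xc: "x \<in> carrier A" unfolding x_def using kcX monoc by (intro A.finsum_closed) auto
      have yP: "y \<in> P"
      proof -
        have "(\<Oplus>\<^bsub>A\<^esub>v\<in>V. k (Inr v) \<otimes>\<^bsub>A\<^esub> g v) \<in> P" if "V \<subseteq> Y1" for V
          using finite_subset[OF that fin(3)] that
        proof (induction V rule: finite_induct)
          case empty
          then show ?case by simp
        next
          case (insert v V)
          then have "k (Inr v) \<otimes>\<^bsub>A\<^esub> g v \<in> P" using g(1) kc by (intro P.I_l_closed) auto
          moreover have "k (Inr u) \<otimes>\<^bsub>A\<^esub> g u \<in> carrier A" if "u \<in> insert v V" for u
            using insert.prems that kc[of "Inr u"] gc[of u] by auto
          ultimately show ?case using insert
            by (subst A.finsum_insert) (auto intro!: P.a_closed)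
        qed
        then show ?thesis by (simp add: y_def)
      qed
      then have yc: "y \<in> carrier A" by (rule P.Icarr)
      have coeff_x: "x m = (if m \<in> X1 then t (Inl m) else \<zero>)" for m
      proof -
        have "x m = (\<Oplus>v\<in>X1. (k (Inl v) \<otimes>\<^bsub>A\<^esub> mono_series R \<one> v) m)"
          unfolding x_def using kcX monoc fin by (intro coeff_finsum) auto
        also have "\<dots> = (\<Oplus>v\<in>X1. if v = m then t (Inl v) else \<zero>)"
        proof (rule finsum_cong'[OF refl])
          fix v assume v: "v \<in> X1"
          have "(k (Inl v) \<otimes>\<^bsub>A\<^esub> mono_series R \<one> v) m = t (Inl v) \<otimes> mono_series R \<one> v m"
            using v monoc by (intro k) auto
          then show "(k (Inl v) \<otimes>\<^bsub>A\<^esub> mono_series R \<one> v) m = (if v = m then t (Inl v) else \<zero>)"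
            using tc v by (auto simp: mono_series_def)
        qed (use tc in auto)
        also have "\<dots> = (if m \<in> X1 then t (Inl m) else \<zero>)"
        proof (cases "m \<in> X1")
          case True
          then show ?thesis
            using finsum_only[OF fin(2) True, of "\<lambda>v. if v = m then t (Inl v) else \<zero>"] tc by simp
        next
          case False
          then show ?thesis by (auto intro!: finsum_all_zero)
        qed
        finally show ?thesis .
      qed
      have coeff_y: "y m = (\<Oplus>v\<in>Y1. t (Inr v) \<otimes> g v m)" for m
      proof -
        have "y m = (\<Oplus>v\<in>Y1. (k (Inr v) \<otimes>\<^bsub>A\<^esub> g v) m)"
          unfolding y_def using kcY gc fin by (intro coeff_finsum) auto
        also have "\<dots> = (\<Oplus>v\<in>Y1. t (Inr v) \<otimes> g v m)"
          using tc gc by (intro finsum_cong') (auto simp: kX kY coeff_closed)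
        finally show ?thesis .
      qed
      define W where "W = f \<otimes>\<^bsub>A\<^esub> x \<oplus>\<^bsub>A\<^esub> y"
      have WP': "W \<in> P'" unfolding W_def
        by (rule P'.a_closed[OF P'.I_r_closed[OF f(1) xc]]) (use yP sub in blast)
      have Wc: "W \<in> carrier A" using WP' P'.Icarr by blast
      have fx: "f \<otimes>\<^bsub>A\<^esub> x = (\<Oplus>\<^bsub>A\<^esub>m\<in>X1. k (Inl m) \<otimes>\<^bsub>A\<^esub> w (Inl m))"
      proof -
        have "f \<otimes>\<^bsub>A\<^esub> x = (\<Oplus>\<^bsub>A\<^esub>m\<in>X1. f \<otimes>\<^bsub>A\<^esub> (k (Inl m) \<otimes>\<^bsub>A\<^esub> mono_series R \<one> m))"
          unfolding x_def using kcX monoc fin fc by (intro A.finsum_rdistr) auto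
        also have "\<dots> = (\<Oplus>\<^bsub>A\<^esub>m\<in>X1. k (Inl m) \<otimes>\<^bsub>A\<^esub> w (Inl m))"
          using kcX monoc fc by (intro A.finsum_cong') (auto simp: w_def A.m_lcomm)
        finally show ?thesis .
      qed
      have "W z = (\<Oplus>i\<in>X1 <+> Y1. w i z \<otimes> t i)" for z
      proof -
        have "(\<Oplus>i\<in>X1 <+> Y1. w i z \<otimes> t i) = (\<Oplus>i\<in>Inl ` X1. w i z \<otimes> t i) \<oplus> (\<Oplus>i\<in>Inr ` Y1. w i z \<otimes> t i)"
          unfolding Plus_def using fin tc wcc by (intro finsum_Un_disjoint) (auto simp: Plus_def Pi_def)
        also have "(\<Oplus>i\<in>Inl ` X1. w i z \<otimes> t i) = (\<Oplus>m\<in>X1. w (Inl m) z \<otimes> t (Inl m))"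
          using tc wcc by (intro finsum_reindex) auto
        also have "\<dots> = (\<Oplus>m\<in>X1. (k (Inl m) \<otimes>\<^bsub>A\<^esub> w (Inl m)) z)"
          using tc wcc kcX by (intro finsum_cong') (auto simp: kX kY m_comm)
        also have "\<dots> = (f \<otimes>\<^bsub>A\<^esub> x) z"
          unfolding fx using kcX fin by (intro coeff_finsum[symmetric]) auto
        also have "(\<Oplus>i\<in>Inr ` Y1. w i z \<otimes> t i) = (\<Oplus>v\<in>Y1. w (Inr v) z \<otimes> t (Inr v))"
          using tc wcc by (intro finsum_reindex) auto
        also have "\<dots> = y z"
          unfolding coeff_y using tc gcc by (intro finsum_cong') (auto simp: w_def m_comm)
        finally show ?thesis by (simp add: W_def coeff_add)
      qed
      then have Wz: "W z = \<zero>" if "z \<in> Z1" for z using t(3) that by simp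
      \<comment> \<open>\<open>W\<close> lies in \<open>P'\<close>, so a leading monomial of degree
        below \<open>N\<close> would belong to \<open>Z1\<close>, where all its coefficients
        vanish.\<close>
      have W_ord: "W \<in> ord_ge N"
      proof -
        have "W m = \<zero>" if m: "size m < N" for m
        proof (rule ccontr)
          assume n: "W m \<noteq> \<zero>"
          obtain l where l: "is_lm W l" using lm_exists[OF Wc n] by blast
          have "size l < N" using is_lm_size[OF l n] m by simp
          then have "l \<in> Z1" using l WP' is_lm_Q[OF Wc l] by (auto simp: Z1_def T_def lms_def)
          then show False using Wz l by (auto simp: is_lm_def)
        qed
        then show ?thesis using Wc by (simp add: ord_ge_def)
      qed
      have "f \<otimes>\<^bsub>A\<^esub> x \<ominus>\<^bsub>A\<^esub> (\<ominus>\<^bsub>A\<^esub> y) = W" unfolding W_def using fc xc yc by algebra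
      then have "f \<otimes>\<^bsub>A\<^esub> x \<ominus>\<^bsub>A\<^esub> (\<ominus>\<^bsub>A\<^esub> y) \<in> ord_ge N" using W_ord by simp
      from c[OF N xc P.a_inv_closed[OF yP] this] obtain p' where p': "p' \<in> P" "x \<ominus>\<^bsub>A\<^esub> p' \<in> ord_ge (N - c)" ..
      have p'c: "p' \<in> carrier A" using p'(1) by (rule P.Icarr)
      have same: "p' m = x m" if "size m < N - c" for m
      proof -
        have "x m \<ominus> p' m = \<zero>" using p'(2) that xc p'c by (auto simp: ord_ge_def coeff_minus)
        then show ?thesis using xc p'c by (simp add: coeff_closed)
      qed
      \<comment> \<open>Below degree \<open>N - c\<close> the series \<open>x\<close> agrees with an
        element \<open>p'\<close> of \<open>P\<close>. The leading monomial of \<open>x\<close> lies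
        in \<open>X1\<close>, so it would also lead \<open>p'\<close>, although it is standard for
        \<open>P\<close>.\<close>
      have x0: "x m = \<zero>" for m
      proof (rule ccontr)
        assume n: "x m \<noteq> \<zero>"
        obtain l where l: "is_lm x l" using lm_exists[OF xc n] by blast
        then have lX: "l \<in> X1" using coeff_x[of l] by (auto simp: is_lm_def split: if_splits)
        then have sl: "size l < N - c" by (simp add: X1_def)
        have "is_lm p' l"
          unfolding is_lm_def
        proof (intro conjI allI impI)
          show "p' l \<noteq> \<zero>" using l same[OF sl] by (auto simp: is_lm_def)
          fix m' assume m': "p' m' \<noteq> \<zero>"
          show "m' = l \<or> mono_less l m'"
          proof (cases "size m' < N - c")
            case True
            then show ?thesis using m' same l by (auto simp: is_lm_def)
          next
            case False
            then show ?thesis using sl by (auto simp: mono_less_def)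
          qed
        qed
        then have "l \<in> lms P" using p'(1) by (auto simp: lms_def)
        then show False using lX by (simp add: X1_def)
      qed
      then have tX: "t (Inl m) = \<zero>" if "m \<in> X1" for m using coeff_x[of m] that by simp
      have "x = \<zero>\<^bsub>A\<^esub>" using x0 by (auto simp: fun_eq_iff coeff_zero)
      then have "W = y" using fc yc by (simp add: W_def)
      then have y_ord: "y \<in> ord_ge N" using W_ord by simp
      \<comment> \<open>What remains is a combination of the series \<open>g v\<close>, which have
        distinct leading monomials. At the smallest \<open>v\<close> with nonzero coefficient
        nothing cancels, against the order being at least \<open>N\<close>.\<close>
      define V where "V = {v \<in> Y1. t (Inr v) \<noteq> \<zero>}"
      have "V \<noteq> {}" using t(2) tX by (auto simp: V_def)
      moreover have "set_mset m \<subseteq> I" if "m \<in> V" for m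
        using that Q_supported by (auto simp: V_def Y1_def T_def)
      ultimately obtain v0 where v0: "v0 \<in> V" "\<And>v. v \<in> V \<Longrightarrow> v = v0 \<or> mono_less v0 v"
        using mono_least[OF finite_I, of V] by blast
      have v0Y: "v0 \<in> Y1" using v0(1) by (simp add: V_def)
      have "y v0 = t (Inr v0) \<otimes> g v0 v0"
        unfolding coeff_y
      proof (rule finsum_only[OF fin(3) v0Y])
        show "t (Inr v0) \<otimes> g v0 v0 \<in> carrier R" using tc v0Y gcc by auto
        fix v assume v: "v \<in> Y1" "v \<noteq> v0"
        show "t (Inr v) \<otimes> g v v0 = \<zero>"
        proof (cases "v \<in> V")
          case False
          then show ?thesis using v gcc by (simp add: V_def)
        next
          case True
          then have "mono_less v0 v" using v0(2) v by blast
          then have "g v v0 = \<zero>" using g(2)[OF v(1)] v(2) mono_less_trans mono_less_irrefl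
            unfolding is_lm_def by metis
          then show ?thesis using tc v by auto
        qed
      qed
      moreover have "y v0 = \<zero>" using y_ord v0Y by (auto simp: ord_ge_def Y1_def T_def)
      moreover have "g v0 v0 \<noteq> \<zero>" "t (Inr v0) \<noteq> \<zero>" using g(2)[OF v0Y] v0(1) by (auto simp: is_lm_def V_def)
      ultimately show False using integral[of "t (Inr v0)" "g v0 v0"] tc v0Y gcc by auto
    qed
    moreover have "std_count P' N + card Z1 = card T"
    proof -
      have "{m \<in> Q. size m < N \<and> m \<notin> lms P'} \<union> Z1 = T" using lms_Q[OF P'] by (auto simp: T_def Z1_def)
      then show ?thesis unfolding std_count_def using fin(4) finite_subset[OF _ fin(1), of "{m \<in> Q. size m < N \<and> m \<notin> lms P'}"]
        by (subst card_Un_disjoint[symmetric]) (auto simp: T_def Z1_def)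
    qed
    moreover have "std_count P N + card Y1 = card T"
    proof -
      have "{m \<in> Q. size m < N \<and> m \<notin> lms P} \<union> Y1 = T" using lms_Q[OF P.is_ideal] by (auto simp: T_def Y1_def)
      then show ?thesis unfolding std_count_def using fin(3) finite_subset[OF _ fin(1), of "{m \<in> Q. size m < N \<and> m \<notin> lms P}"]
        by (subst card_Un_disjoint[symmetric]) (auto simp: T_def Y1_def)
    qed
    ultimately show ?thesis by (simp add: std_count_def X1_def)
  qed
  then show ?thesis by blast
qed

text \<open>An element led by the empty monomial has nonzero constant coefficient, so it is a unit
  and lies in no proper ideal.\<close>

lemma std_count_pos:
  assumes P: "primeideal P A" and N: "N > 0"
  shows "std_count P N \<ge> 1"
proof -
  interpret P: primeideal P A by fact
  have "{#} \<notin> lms P"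
  proof
    assume "{#} \<in> lms P"
    then obtain g where g: "g \<in> P" "g {#} \<noteq> \<zero>" by (auto simp: lms_def is_lm_def)
    then have "g \<in> Units A" using unit_if_const_coeff P.Icarr by blast
    then have "inv\<^bsub>A\<^esub> g \<otimes>\<^bsub>A\<^esub> g \<in> P"
      using P.I_l_closed[OF g(1)] A.Units_inv_closed by blast
    then have "\<one>\<^bsub>A\<^esub> \<in> P" using \<open>g \<in> Units A\<close> by simp
    then have "P = carrier A" by (rule P.one_imp_carrier)
    then show False using P.I_notcarr by simp
  qed
  then have "{#} \<in> {m \<in> Q. size m < N \<and> m \<notin> lms P}" using N empty_Q by simp
  moreover have "finite {m \<in> Q. size m < N \<and> m \<notin> lms P}"
    by (rule finite_subset[OF _ finite_Q_less[of N]]) auto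
  ultimately show ?thesis unfolding std_count_def
    by (metis One_nat_def Suc_leI card_gt_0_iff empty_iff)
qed

text \<open>Going down the chain, each inclusion raises the degree of growth by one: the inequality
  of \<open>std_count_drop\<close> has the form of Pascal's rule, so binomial coefficients bound the
  counts from below along an arithmetic progression.\<close>

lemma std_count_growth:
  assumes P: "\<And>i. i \<le> l \<Longrightarrow> primeideal (P i) A" and sub: "\<And>i. i < l \<Longrightarrow> P i \<subset> P (Suc i)"
    and j: "j \<le> l"
  shows "\<exists>a b. \<forall>k. (k choose j) \<le> std_count (P (l - j)) (a * k + b)"
  using j
proof (induction j)
  case 0
  show ?case
    using std_count_pos[OF P[of l]] by (intro exI[of _ 0] exI[of _ 1]) simp
next
  case (Suc j)
  then obtain a b where ab: "\<And>k. (k choose j) \<le> std_count (P (l - j)) (a * k + b)" by auto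
  have l: "l - Suc j < l" "Suc (l - Suc j) = l - j" using Suc.prems by auto
  have pr: "primeideal (P (l - Suc j)) A" "ideal (P (l - j)) A"
    using P[of "l - Suc j"] P[of "l - j"] primeideal.axioms(1) by auto
  have "P (l - Suc j) \<subset> P (l - j)" using sub[OF l(1)] l(2) by simp
  from std_count_drop[OF pr this] obtain c where
    "\<forall>N\<ge>c. std_count (P (l - j)) N + std_count (P (l - Suc j)) (N - c) \<le> std_count (P (l - Suc j)) N" ..
  then have c: "\<And>N. c \<le> N \<Longrightarrow> std_count (P (l - j)) N + std_count (P (l - Suc j)) (N - c) \<le> std_count (P (l - Suc j)) N"
    by simp
  \<comment> \<open>The step \<open>a + c\<close> leaves room for the loss \<open>c\<close> in
    passing from \<open>k\<close> to \<open>Suc k\<close>, and the progression still dominates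
    \<open>a * k + b\<close>, the one belonging to the larger prime.\<close>
  have "(k choose Suc j) \<le> std_count (P (l - Suc j)) ((a + c) * k + (b + c))" for k
  proof (induction k)
    case 0
    then show ?case by simp
  next
    case (Suc k)
    define N where "N = (a + c) * Suc k + (b + c)"
    have "(k choose Suc j) \<le> std_count (P (l - Suc j)) (N - c)"
      by (rule order_trans[OF Suc.IH std_count_mono]) (simp add: N_def algebra_simps)
    moreover have "(k choose j) \<le> std_count (P (l - j)) N"
      by (rule order_trans[OF ab std_count_mono]) (simp add: N_def algebra_simps)
    moreover have "c \<le> N" by (simp add: N_def)
    ultimately have "(k choose Suc j) + (k choose j) \<le> std_count (P (l - Suc j)) N" using c[of N] by linarith
    then show ?case by (simp add: N_def)
  qed
  then show ?case by blast
qed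

text \<open>The count for \<open>P 0\<close> grows at least like \<open>k choose l\<close>, of
  degree \<open>l\<close> in \<open>k\<close>, and at most like the number of all monomials, of
  degree \<open>D\<close>.\<close>

lemma prime_chain_length:
  assumes P: "\<And>i. i \<le> l \<Longrightarrow> primeideal (P i) A" and sub: "\<And>i. i < l \<Longrightarrow> P i \<subset> P (Suc i)"
    and C: "\<And>N. card {m \<in> Q. size m < N} \<le> C * N ^ D"
  shows "l \<le> D"
proof (rule ccontr)
  assume "\<not> l \<le> D"
  then have l: "l > D" "l > 0" by simp_all
  obtain a b where ab: "\<And>k. (k choose l) \<le> std_count (P 0) (a * k + b)"
    using std_count_growth[of l P l, OF P sub] by auto
  have le: "(k choose l) \<le> C * (a * k + b) ^ D" for k
  proof -
    have "std_count (P 0) (a * k + b) \<le> card {m \<in> Q. size m < a * k + b}"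
      unfolding std_count_def by (rule card_mono[OF finite_Q_less]) auto
    then show ?thesis using ab[of k] C[of "a * k + b"] by linarith
  qed
  have key: "k ^ l \<le> l ^ l * (C * ((a + b) * k) ^ D)" if k: "k \<ge> l" for k
  proof -
    have "(real k / real l) ^ l \<le> real (k choose l)"
      using binomial_ge_n_over_k_pow_k[of l k, where 'a = real] k by simp
    also have "\<dots> \<le> real (C * (a * k + b) ^ D)" using le[of k] by (simp only: of_nat_le_iff)
    also have "\<dots> \<le> real (C * ((a + b) * k) ^ D)"
    proof -
      have "a * k + b \<le> (a + b) * k" using k l by (cases k) (auto simp: algebra_simps)
      then show ?thesis by (intro of_nat_mono mult_left_mono power_mono) auto
    qed
    finally have "real k ^ l \<le> real l ^ l * real (C * ((a + b) * k) ^ D)"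
      using l by (simp add: power_divide field_simps)
    then have "real (k ^ l) \<le> real (l ^ l * (C * ((a + b) * k) ^ D))" by simp
    then show ?thesis by (simp only: of_nat_le_iff)
  qed
  \<comment> \<open>\<open>B\<close> collects the constants in \<open>key\<close>. A value of
    \<open>k\<close> beyond both \<open>l\<close> and \<open>B\<close> contradicts the resulting
    bound \<open>k ^ (l - D) \<le> B\<close>.\<close>
  define B where "B = l ^ l * C * (a + b) ^ D"
  define k where "k = l + B + 1"
  have "k ^ l = k ^ D * k ^ (l - D)" using l by (simp add: power_add[symmetric])
  moreover have "l ^ l * (C * ((a + b) * k) ^ D) = k ^ D * B"
    by (simp only: B_def power_mult_distrib ac_simps)
  ultimately have "k ^ D * k ^ (l - D) \<le> k ^ D * B"
    using key[of k] by (simp add: k_def)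
  then have "k ^ (l - D) \<le> B" by (simp add: k_def)
  moreover have "k \<le> k ^ (l - D)" using l by (intro self_le_power) (auto simp: k_def)
  ultimately show False by (simp add: k_def)
qed

end

section \<open>The Frobenius endomorphism\<close>

context cring
begin

lemma binomial_expansion:
  assumes a: "a \<in> carrier R" and b: "b \<in> carrier R"
  shows "(a \<oplus> b) [^] n = (\<Oplus>k\<in>{..n}. [(n choose k)] \<cdot> (a [^] k \<otimes> b [^] (n - k)))"
proof (induction n)
  case 0
  then show ?case using a b by simp
next
  case (Suc n)
  define t where "t = (\<lambda>c k. [(c::nat)] \<cdot> (a [^] (k::nat) \<otimes> b [^] (Suc n - k)))"
  have tc: "t c k \<in> carrier R" for c k using a b by (simp add: t_def)
  have tadd: "t (c + c') k = t c k \<oplus> t c' k" for c c' k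
    using a b by (simp add: t_def add.nat_pow_mult)
  have A: "(\<Oplus>k\<in>{..n}. [(n choose k)] \<cdot> (a [^] k \<otimes> b [^] (n - k))) \<otimes> a = (\<Oplus>k\<in>{..n}. t (n choose k) (Suc k))"
    unfolding t_def using a b
    by (subst finsum_ldistr) (auto simp: add_pow_ldistr add_pow_rdistr m_ac intro!: finsum_cong')
  have "(\<Oplus>k\<in>{..n}. [(n choose k)] \<cdot> (a [^] k \<otimes> b [^] (n - k))) \<otimes> b = (\<Oplus>k\<in>{..n}. t (n choose k) k)"
    unfolding t_def using a b
    by (subst finsum_ldistr) (auto simp: add_pow_ldistr m_assoc Suc_diff_le intro!: finsum_cong')
  also have "\<dots> = (\<Oplus>k\<in>{..Suc n}. t (n choose k) k)"
  proof -
    have "t (n choose Suc n) (Suc n) = \<zero>" by (simp add: t_def binomial_eq_0)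
    then show ?thesis using tc by (subst finsum_Suc) (auto simp: Pi_def)
  qed
  also have "\<dots> = (\<Oplus>k\<in>{..n}. t (n choose Suc k) (Suc k)) \<oplus> t (n choose 0) 0"
    using tc by (intro finsum_Suc2) auto
  finally have B: "(\<Oplus>k\<in>{..n}. [(n choose k)] \<cdot> (a [^] k \<otimes> b [^] (n - k))) \<otimes> b
    = (\<Oplus>k\<in>{..n}. t (n choose Suc k) (Suc k)) \<oplus> t (n choose 0) 0" .
  have s: "(\<Oplus>k\<in>{..n}. t (Suc n choose Suc k) (Suc k))
      = (\<Oplus>k\<in>{..n}. t (n choose k) (Suc k)) \<oplus> (\<Oplus>k\<in>{..n}. t (n choose Suc k) (Suc k))"
    using tc by (subst finsum_addf[symmetric]) (auto simp: tadd Pi_def)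
  have "(\<Oplus>k\<in>{..Suc n}. t (Suc n choose k) k) = (\<Oplus>k\<in>{..n}. t (Suc n choose Suc k) (Suc k)) \<oplus> t (Suc n choose 0) 0"
    using tc by (intro finsum_Suc2) auto
  also have "\<dots> = (\<Oplus>k\<in>{..n}. t (n choose k) (Suc k)) \<oplus> ((\<Oplus>k\<in>{..n}. t (n choose Suc k) (Suc k)) \<oplus> t (n choose 0) 0)"
    unfolding s using tc by (simp add: a_assoc Pi_def)
  also have "\<dots> = (a \<oplus> b) [^] n \<otimes> a \<oplus> (a \<oplus> b) [^] n \<otimes> b"
    unfolding A[symmetric] B[symmetric] Suc.IH ..
  also have "\<dots> = (a \<oplus> b) [^] Suc n" using a b by (simp add: r_distr)
  finally show ?case by (simp add: t_def)
qed

lemma freshmans_dream: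
  assumes p: "Factorial_Ring.prime p" and char: "[(p::nat)] \<cdot> \<one> = \<zero>"
    and a: "a \<in> carrier R" and b: "b \<in> carrier R"
  shows "(a \<oplus> b) [^] p = a [^] p \<oplus> b [^] p"
proof -
  have pz: "[(p * j)] \<cdot> x = \<zero>" if x: "x \<in> carrier R" for j x
  proof -
    have "[(p * j)] \<cdot> (\<one> \<otimes> x) = [j] \<cdot> (([p] \<cdot> \<one>) \<otimes> x)"
      using x by (simp only: add.nat_pow_pow[symmetric] add_pow_ldistr one_closed m_closed add.nat_pow_closed)
    then show ?thesis using x char by simp
  qed
  define t where "t = (\<lambda>k. [(p choose k)] \<cdot> (a [^] k \<otimes> b [^] (p - k)))"
  have tc: "t k \<in> carrier R" for k using a b by (simp add: t_def)
  have p2: "p \<ge> 2" using p prime_ge_2_nat by blast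
  have "(a \<oplus> b) [^] p = (\<Oplus>k\<in>{..p}. t k)"
    unfolding t_def by (rule binomial_expansion[OF a b])
  also have "\<dots> = (\<Oplus>k\<in>{0, p}. t k)"
  proof (rule add.finprod_mono_neutral_cong_right)
    fix k assume "k \<in> {..p} - {0, p}"
    then have "0 < k" "k < p" by auto
    then have "p dvd (p choose k)" using p by (intro dvd_choose_prime) auto
    then obtain j where "(p choose k) = p * j" by blast
    then show "t k = \<zero>" using a b pz by (simp add: t_def)
  qed (use tc in auto)
  also have "\<dots> = t 0 \<oplus> t p" using tc p2 by (subst finsum_insert) auto
  also have "\<dots> = a [^] p \<oplus> b [^] p" using a b by (simp add: t_def a_comm)
  finally show ?thesis .
qed

lemma freshmans_dream_pow:
  assumes p: "Factorial_Ring.prime p" and char: "[(p::nat)] \<cdot> \<one> = \<zero>"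
    and a: "a \<in> carrier R" and b: "b \<in> carrier R"
  shows "(a \<oplus> b) [^] (p ^ e) = a [^] (p ^ e) \<oplus> b [^] (p ^ e)"
proof (induction e)
  case 0
  then show ?case using a b by simp
next
  case (Suc e)
  have e: "x [^] (p ^ Suc e) = (x [^] (p ^ e)) [^] p" if "x \<in> carrier R" for x
    using that by (simp add: nat_pow_pow mult.commute)
  show ?case
    using freshmans_dream[OF p char, of "a [^] (p ^ e)" "b [^] (p ^ e)"] a b
    by (simp only: e[OF a] e[OF b] e[OF a_closed[OF a b]] Suc.IH nat_pow_closed)
qed

lemma frobenius_hom:
  assumes "Factorial_Ring.prime p" "[(p::nat)] \<cdot> \<one> = \<zero>"
  shows "(\<lambda>x. x [^] (p ^ e)) \<in> ring_hom R R"
  by (rule ring_hom_memI) (auto simp: freshmans_dream_pow[OF assms] nat_pow_distrib)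

end

lemma char_eq_zero:
  assumes "field K" "ring_char K = p"
  shows "[p] \<cdot>\<^bsub>K\<^esub> \<one>\<^bsub>K\<^esub> = \<zero>\<^bsub>K\<^esub>"
proof -
  interpret field K by fact
  have "\<one>\<^bsub>K\<^esub> [^]\<^bsub>add_monoid K\<^esub> (group.ord (add_monoid K) \<one>\<^bsub>K\<^esub>) = \<one>\<^bsub>add_monoid K\<^esub>"
    by (rule group.pow_ord_eq_1[OF add.is_group]) simp
  then show ?thesis using assms(2) by (simp add: ring_char_def add_pow_def)
qed

context field
begin

lemma frobenius_inj:
  assumes "Factorial_Ring.prime p" "[(p::nat)] \<cdot> \<one> = \<zero>"
  shows "inj_on (\<lambda>x. x [^] (p ^ e)) (carrier R)"
proof -
  interpret h: ring_hom_ring R R "\<lambda>x. x [^] (p ^ e)"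
    by (rule ring_hom_ringI2[OF ring_axioms ring_axioms frobenius_hom[OF assms]])
  have z: "x = \<zero>" if "x [^] (k::nat) = \<zero>" "x \<in> carrier R" for x k
    using that
  proof (induction k)
    case (Suc k)
    then show ?case using integral[of "x [^] k" x] by auto
  qed simp
  show ?thesis
  proof (rule inj_onI)
    fix x y assume xy: "x \<in> carrier R" "y \<in> carrier R" "x [^] (p ^ e) = y [^] (p ^ e)"
    then have "(x \<ominus> y) [^] (p ^ e) = \<zero>" by (simp add: a_minus_def)
        (metis a_inv_closed h.hom_a_inv r_neg nat_pow_closed frobenius_hom[OF assms, THEN ring_hom_add])
    then have "x \<ominus> y = \<zero>" using z xy by simp
    then show "x = y" using xy by simp
  qed
qed

lemma pth_powers_subfield:
  assumes "Factorial_Ring.prime p" "[(p::nat)] \<cdot> \<one> = \<zero>"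
  shows "subfield (pth_powers (p ^ e) R) R"
proof -
  interpret h: ring_hom_ring R R "\<lambda>x. x [^] (p ^ e)"
    by (rule ring_hom_ringI2[OF ring_axioms ring_axioms frobenius_hom[OF assms]])
  show ?thesis unfolding pth_powers_def
    by (rule h.img_is_subfield(2)[OF carrier_is_subfield one_not_zero])
qed

text \<open>Degrees multiply along the tower of Frobenius images: the Frobenius map carries the
  field over its \<open>p ^ e\<close>-th powers isomorphically to the \<open>p\<close>-th powers
  over the \<open>p ^ Suc e\<close>-th powers.\<close>

lemma dimension_pth_powers:
  assumes p: "Factorial_Ring.prime p" "[(p::nat)] \<cdot> \<one> = \<zero>"
    and D: "dimension D (pth_powers p R) (carrier R)"
  shows "dimension (D ^ e) (pth_powers (p ^ e) R) (carrier R)"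
proof (induction e)
  case 0
  have "pth_powers 1 R = carrier R" by (auto simp: pth_powers_def image_iff)
  then show ?case using dimension_one[OF carrier_is_subfield] by simp
next
  case (Suc e)
  interpret h: ring_hom_ring R R "\<lambda>x. x [^] (p ^ 1)"
    by (rule ring_hom_ringI2[OF ring_axioms ring_axioms frobenius_hom[OF p]])
  have "dimension (D ^ e) ((\<lambda>x. x [^] (p ^ 1)) ` pth_powers (p ^ e) R) ((\<lambda>x. x [^] (p ^ 1)) ` carrier R)"
    by (rule h.inj_hom_dimension[OF pth_powers_subfield[OF p] one_not_zero frobenius_inj[OF p] Suc.IH])
  moreover have "(\<lambda>x. x [^] (p ^ 1)) ` pth_powers (p ^ e) R = pth_powers (p ^ Suc e) R"
    by (auto simp: pth_powers_def image_image nat_pow_pow mult.commute)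
  moreover have "(\<lambda>x. x [^] (p ^ 1)) ` carrier R = pth_powers (p ^ 1) R"
    by (simp add: pth_powers_def)
  ultimately have "dimension (D ^ e) (pth_powers (p ^ Suc e) R) (pth_powers (p ^ 1) R)" by simp
  from telescopic_base[OF pth_powers_subfield[OF p] pth_powers_subfield[OF p] this, of D "carrier R"]
  show ?case using D by (simp add: mult.commute)
qed

text \<open>Coordinates are recorded by their roots, as \<open>c b [^] (p ^ e)\<close> in place of
  an element of the subfield, because scalars act on the pushforward through their powers.
  Uniqueness of the roots is injectivity of Frobenius.\<close>

lemma basis_over_pth_powers:
  assumes p: "Factorial_Ring.prime p" "[(p::nat)] \<cdot> \<one> = \<zero>"
    and D: "dimension D (pth_powers (p ^ e) R) (carrier R)"
  shows "\<exists>L. L \<subseteq> carrier R \<and> finite L \<and> card L = D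
    \<and> (\<forall>x\<in>carrier R. \<exists>!c. c \<in> L \<rightarrow>\<^sub>E carrier R \<and> x = (\<Oplus>b\<in>L. c b [^] (p ^ e) \<otimes> b))"
proof -
  let ?F = "pth_powers (p ^ e) R"
  have sf: "subfield ?F R" by (rule pth_powers_subfield[OF p])
  have Fc: "?F \<subseteq> carrier R" by (rule subfieldE(3)[OF sf])
  obtain Us where Us: "set Us \<subseteq> carrier R" "independent ?F Us" "length Us = D" "Span ?F Us = carrier R"
    using exists_base[OF sf D] by blast
  have dist: "distinct Us" using independent_distinct[OF sf Us(2)] .
  have comb: "combine (map f Vs) Vs = (\<Oplus>u\<in>set Vs. f u \<otimes> u)"
    if "distinct Vs" "set Vs \<subseteq> carrier R" "\<And>u. u \<in> set Vs \<Longrightarrow> f u \<in> carrier R" for f Vs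
    using that by (induction Vs) (auto simp: subset_iff Pi_def)
  define L where "L = set Us"
  have Lc: "\<And>u. u \<in> L \<Longrightarrow> u \<in> carrier R" using Us(1) by (auto simp: L_def)
  have fL: "finite L" by (simp add: L_def)
  have ex: "\<exists>c. c \<in> L \<rightarrow>\<^sub>E carrier R \<and> x = (\<Oplus>b\<in>L. c b [^] (p ^ e) \<otimes> b)" if x: "x \<in> carrier R" for x
  proof -
    obtain Ks where Ks: "length Ks = length Us" "set Ks \<subseteq> ?F" "x = combine Ks Us"
      using x Us(4) Span_eq_combine_set_length_version[OF sf Us(1)] by auto
    define f where "f = (\<lambda>u. the (map_of (zip Us Ks) u))"
    have mf: "map f Us = Ks"
      using Ks(1) dist by (intro nth_equalityI) (auto simp: f_def map_of_zip_nth)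
    then have fF: "f u \<in> ?F" if "u \<in> L" for u using Ks(2) that by (auto simp: L_def)
    have "\<forall>u\<in>L. \<exists>c. c \<in> carrier R \<and> f u = c [^] (p ^ e)" using fF by (auto simp: pth_powers_def)
    from bchoice[OF this] obtain c where "\<forall>u\<in>L. c u \<in> carrier R \<and> f u = c u [^] (p ^ e)" ..
    then have c: "\<And>u. u \<in> L \<Longrightarrow> c u \<in> carrier R" "\<And>u. u \<in> L \<Longrightarrow> f u = c u [^] (p ^ e)" by simp_all
    have "x = (\<Oplus>u\<in>L. f u \<otimes> u)"
      using comb[OF dist Us(1), of f] fF Fc mf Ks(3) by (auto simp: L_def)
    also have "\<dots> = (\<Oplus>u\<in>L. restrict c L u [^] (p ^ e) \<otimes> u)"
      using c Lc by (intro finsum_cong') auto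
    finally show ?thesis using c by (intro exI[of _ "restrict c L"]) auto
  qed
  have uniq: "c = c'" if c: "c \<in> L \<rightarrow>\<^sub>E carrier R" "c' \<in> L \<rightarrow>\<^sub>E carrier R"
    and eq: "(\<Oplus>b\<in>L. c b [^] (p ^ e) \<otimes> b) = (\<Oplus>b\<in>L. c' b [^] (p ^ e) \<otimes> b)" for c c'
  proof -
    define f where "f = (\<lambda>u. c u [^] (p ^ e) \<ominus> c' u [^] (p ^ e))"
    have cc: "\<And>u. u \<in> L \<Longrightarrow> c u \<in> carrier R" "\<And>u. u \<in> L \<Longrightarrow> c' u \<in> carrier R" using c by auto
    have fc: "f u \<in> carrier R" if "u \<in> L" for u using cc that by (simp add: f_def)
    have inF: "\<And>u. u \<in> L \<Longrightarrow> c u [^] (p ^ e) \<in> ?F" "\<And>u. u \<in> L \<Longrightarrow> c' u [^] (p ^ e) \<in> ?F"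
      using cc by (auto simp: pth_powers_def)
    have fF: "f u \<in> ?F" if "u \<in> L" for u
      unfolding f_def a_minus_def using subringE(5,7)[OF subfieldE(1)[OF sf]] inF that by blast
    have "(\<Oplus>u\<in>L. c u [^] (p ^ e) \<otimes> u) = (\<Oplus>u\<in>L. f u \<otimes> u \<oplus> c' u [^] (p ^ e) \<otimes> u)"
    proof (rule finsum_cong'[OF refl])
      fix u assume u: "u \<in> L"
      have "x = (x \<ominus> y) \<oplus> y" if "x \<in> carrier R" "y \<in> carrier R" for x y
        using that by algebra
      then have "c u [^] (p ^ e) = f u \<oplus> c' u [^] (p ^ e)" unfolding f_def using cc u by simp
      then show "c u [^] (p ^ e) \<otimes> u = f u \<otimes> u \<oplus> c' u [^] (p ^ e) \<otimes> u"
        using cc u fc Lc by (simp add: l_distr)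
    qed (use cc fc Lc in auto)
    also have "\<dots> = (\<Oplus>u\<in>L. f u \<otimes> u) \<oplus> (\<Oplus>u\<in>L. c' u [^] (p ^ e) \<otimes> u)"
      using cc fc Lc by (intro finsum_addf) auto
    finally have "(\<Oplus>u\<in>L. f u \<otimes> u) \<oplus> (\<Oplus>u\<in>L. c' u [^] (p ^ e) \<otimes> u) = \<zero> \<oplus> (\<Oplus>u\<in>L. c' u [^] (p ^ e) \<otimes> u)"
      using eq cc Lc by (simp add: Pi_def)
    moreover have "(\<Oplus>u\<in>L. f u \<otimes> u) \<in> carrier R" "(\<Oplus>u\<in>L. c' u [^] (p ^ e) \<otimes> u) \<in> carrier R"
      using cc fc Lc by (auto intro!: finsum_closed)
    ultimately have s0: "(\<Oplus>u\<in>L. f u \<otimes> u) = \<zero>"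
      using add.r_cancel[of "\<Oplus>u\<in>L. f u \<otimes> u" _ \<zero>] by simp
    have "combine (map f Us) Us = (\<Oplus>u\<in>set Us. f u \<otimes> u)"
      by (rule comb[OF dist Us(1)]) (rule fc, simp only: L_def)
    then have cz: "combine (map f Us) Us = \<zero>" using s0 unfolding L_def by (rule trans)
    have "set (map f Us) \<subseteq> ?F"
    proof
      fix y assume "y \<in> set (map f Us)"
      then have "y \<in> f ` L" by (simp only: L_def set_map)
      then show "y \<in> ?F" by (rule imageE) (simp only: fF)
    qed
    from independent_imp_trivial_combine[OF sf Us(2) this cz]
    have "set (take (length Us) (map f Us)) \<subseteq> {\<zero>}" .
    then have "f ` L \<subseteq> {\<zero>}" by (simp add: L_def)
    then have f0: "f u = \<zero>" if "u \<in> L" for u using that by blast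
    have "c u = c' u" if "u \<in> L" for u
    proof -
      have "c u [^] (p ^ e) = c' u [^] (p ^ e)" using f0[OF that] cc[OF that] by (simp add: f_def)
      then show ?thesis using frobenius_inj[OF p, of e] cc[OF that] by (auto simp: inj_on_def)
    qed
    then show ?thesis using c by (intro PiE_ext[of c L _ c']) auto
  qed
  have "card L = D" using distinct_card[OF dist] Us(3) by (simp add: L_def)
  moreover have "\<exists>!c. c \<in> L \<rightarrow>\<^sub>E carrier R \<and> x = (\<Oplus>b\<in>L. c b [^] (p ^ e) \<otimes> b)" if x: "x \<in> carrier R" for x
    by (rule ex_ex1I[OF ex[OF x]]) (elim conjE, rule uniq, assumption, assumption, simp)
  ultimately show ?thesis using Lc fL by (intro exI[of _ L]) auto
qed

end

section \<open>Local rings with a section of units\<close>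

text \<open>If everything outside the kernel of a surjection onto a field is a unit, every proper
  ideal lies in the kernel, so the kernel is the only maximal ideal. This resolves the definite
  description inside \<open>residue_field\<close>.\<close>

lemma local_residue:
  assumes "cring B" "field K" and hom: "eps \<in> ring_hom B K" and surj: "eps ` carrier B = carrier K"
    and unit: "\<And>x. x \<in> carrier B \<Longrightarrow> eps x \<noteq> \<zero>\<^bsub>K\<^esub> \<Longrightarrow> x \<in> Units B"
  shows "(\<lambda>Y. the_elem (eps ` Y)) \<in> ring_iso (residue_field B) K" "field (residue_field B)"
proof -
  interpret B: cring B by fact
  interpret K: field K by fact
  interpret h: ring_hom_ring B K eps
    by (rule ring_hom_ringI2[OF B.ring_axioms K.ring_axioms hom])
  have ker: "ideal (a_kernel B K eps) B" by (rule h.kernel_is_ideal)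
  have notunit: "J \<subseteq> a_kernel B K eps" if J: "ideal J B" "J \<noteq> carrier B" for J
  proof
    fix x assume x: "x \<in> J"
    interpret J: ideal J B by (rule J(1))
    have xc: "x \<in> carrier B" using x by (rule J.Icarr)
    show "x \<in> a_kernel B K eps"
    proof (rule ccontr)
      assume "x \<notin> a_kernel B K eps"
      then have "eps x \<noteq> \<zero>\<^bsub>K\<^esub>" using xc unfolding a_kernel_def' by blast
      then have u: "x \<in> Units B" by (rule unit[OF xc])
      have "inv\<^bsub>B\<^esub> x \<otimes>\<^bsub>B\<^esub> x \<in> J" using J.I_l_closed[OF x B.Units_inv_closed[OF u]] .
      then have "\<one>\<^bsub>B\<^esub> \<in> J" by (simp only: B.Units_l_inv[OF u])
      then show False using J.one_imp_carrier J(2) by blast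
    qed
  qed
  have nc: "carrier B \<noteq> a_kernel B K eps"
  proof
    assume "carrier B = a_kernel B K eps"
    then have "\<one>\<^bsub>B\<^esub> \<in> a_kernel B K eps" using B.one_closed by blast
    then have "eps \<one>\<^bsub>B\<^esub> = \<zero>\<^bsub>K\<^esub>" unfolding a_kernel_def' by blast
    then show False using ring_hom_one[OF hom] K.one_not_zero by metis
  qed
  have max: "maximalideal (a_kernel B K eps) B"
    by (rule maximalidealI[OF ker nc]) (use notunit in blast)
  have "(THE \<mm>. maximalideal \<mm> B) = a_kernel B K eps"
  proof (rule the_equality)
    show "maximalideal (a_kernel B K eps) B" by (rule max)
    fix J assume "maximalideal J B"
    then interpret J: maximalideal J B .
    have "J \<subseteq> a_kernel B K eps" using notunit[OF J.is_ideal] J.I_notcarr by blast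
    moreover have "a_kernel B K eps \<subseteq> carrier B" unfolding a_kernel_def' by blast
    ultimately show "J = a_kernel B K eps"
      using J.I_maximal[OF ker] nc by metis
  qed
  then have "residue_field B = B Quot (a_kernel B K eps)" by (simp add: residue_field_def)
  then show "(\<lambda>Y. the_elem (eps ` Y)) \<in> ring_iso (residue_field B) K" "field (residue_field B)"
    using h.FactRing_iso_set[OF surj] maximalideal.quotient_is_field[OF max B.is_cring] by simp_all
qed

text \<open>The residue field is an abstract quotient; its isomorphism with \<open>K\<close> carries
  \<open>p\<close>-th powers to \<open>p\<close>-th powers, and an injective homomorphism preserves
  dimension over the image of the subfield.\<close>

lemma alpha_eq:
  assumes "cring B" "field K" and hom: "eps \<in> ring_hom B K" and surj: "eps ` carrier B = carrier K"
    and unit: "\<And>x. x \<in> carrier B \<Longrightarrow> eps x \<noteq> \<zero>\<^bsub>K\<^esub> \<Longrightarrow> x \<in> Units B"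
    and p: "Factorial_Ring.prime p" "[p] \<cdot>\<^bsub>K\<^esub> \<one>\<^bsub>K\<^esub> = \<zero>\<^bsub>K\<^esub>"
    and D: "ring.dimension K D (pth_powers p K) (carrier K)"
  shows "alpha p B = log (real p) (real D)"
proof -
  interpret K: field K by fact
  let ?k = "residue_field B"
  have iso: "(\<lambda>Y. the_elem (eps ` Y)) \<in> ring_iso ?k K"
    by (rule local_residue) fact+
  interpret B: cring B by fact
  have fk: "field ?k" by (rule local_residue) fact+
  interpret k: field ?k by (rule fk)
  define g where "g = inv_into (carrier ?k) (\<lambda>Y. the_elem (eps ` Y))"
  have g: "g \<in> ring_iso K ?k" unfolding g_def by (rule ring_iso_set_sym[OF k.ring_axioms iso])
  interpret g: ring_hom_ring K ?k g
    by (rule ring_hom_ringI2[OF K.ring_axioms k.ring_axioms]) (use g in \<open>simp add: ring_iso_def\<close>)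
  have bij: "bij_betw g (carrier K) (carrier ?k)" using g by (simp add: ring_iso_def)
  have sf: "subfield (pth_powers p K) K" using K.pth_powers_subfield[OF p, of 1] by simp
  have "k.dimension D (g ` pth_powers p K) (g ` carrier K)"
    by (rule g.inj_hom_dimension[OF sf k.one_not_zero bij_betw_imp_inj_on[OF bij] D])
  moreover have "g ` carrier K = carrier ?k" using bij by (simp add: bij_betw_def)
  moreover have "g ` pth_powers p K = pth_powers p ?k"
  proof -
    have "g ` pth_powers p K = (\<lambda>x. (g x) [^]\<^bsub>?k\<^esub> p) ` carrier K"
      unfolding pth_powers_def image_image by (intro image_cong refl g.hom_nat_pow)
    also have "\<dots> = pth_powers p ?k"
      unfolding pth_powers_def bij_betw_imp_surj_on[OF bij, symmetric] image_image ..
    finally show ?thesis .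
  qed
  moreover have "subfield (g ` pth_powers p K) ?k"
    by (rule g.img_is_subfield(2)[OF sf k.one_not_zero])
  ultimately have "k.dim (pth_powers p ?k) (carrier ?k) = D"
    using k.dimI unfolding over_def by simp
  then show ?thesis by (simp add: alpha_def Let_def)
qed

section \<open>Free summands of the Frobenius pushforward\<close>

lemma repeat_mset_inj: "n > 0 \<Longrightarrow> repeat_mset n k = repeat_mset n l \<longleftrightarrow> k = l"
  by (auto simp: multiset_eq_iff)

lemma finsum_pushforward:
  "finsum (frobenius_pushforward p e B) f Y = finsum B f Y"
  by (simp add: finsum_def finprod_def frobenius_pushforward_def)

text \<open>This removes the module record from the later arguments: a submodule becomes an additive
  subgroup of the ring that absorbs \<open>p ^ e\<close>-th powers.\<close>

lemma (in ring) submodule_pushforward: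
  "submodule F R (frobenius_pushforward p e R) \<longleftrightarrow> F \<subseteq> carrier R \<and> \<zero> \<in> F
    \<and> (\<forall>x\<in>F. \<forall>y\<in>F. x \<oplus> y \<in> F) \<and> (\<forall>x\<in>F. \<ominus> x \<in> F)
    \<and> (\<forall>r\<in>carrier R. \<forall>x\<in>F. r [^] (p ^ e) \<otimes> x \<in> F)"
proof -
  have "inv\<^bsub>add_monoid (frobenius_pushforward p e R)\<^esub> x = \<ominus> x" for x
    by (simp add: a_inv_def m_inv_def frobenius_pushforward_def)
  then show ?thesis
    unfolding submodule_def submodule_axioms_def subgroup_def
    by (auto simp: frobenius_pushforward_def)
qed

text \<open>In \<open>facet\<close>, the element \<open>g - h\<close> of the group completion has
  value -1 at \<open>i\<close> and nonnegative values elsewhere. So nonnegativity at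
  \<open>i\<close> does not follow from the other indices, which is what makes each coordinate a
  genuine facet of the cone, and the height over it attains the value 1.\<close>

locale frobenius_series = affine_series R Q I
  for R (structure) and Q :: "'i :: linorder multiset set" and I +
  fixes p e :: nat
  assumes prime_p: "Factorial_Ring.prime p" and char_p: "[p] \<cdot> \<one> = \<zero>"
    and facet: "i \<in> I \<Longrightarrow> \<exists>g\<in>Q. \<exists>h\<in>Q. count g i = 0 \<and> count h i = 1 \<and> (\<forall>j. j \<noteq> i \<longrightarrow> count h j \<le> count g j)"
begin

abbreviation "q \<equiv> p ^ e"
abbreviation "M \<equiv> frobenius_pushforward p e A"

lemma q_pos: "q > 0"
  using prime_p prime_gt_0_nat by simp

section \<open>Coefficients of \<open>q\<close>-th powers of series\<close>

lemma char_A: "[p] \<cdot>\<^bsub>A\<^esub> \<one>\<^bsub>A\<^esub> = \<zero>\<^bsub>A\<^esub>"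
proof
  fix m :: "'i multiset"
  have "([k] \<cdot>\<^bsub>A\<^esub> \<one>\<^bsub>A\<^esub>) m = [k] \<cdot> (\<one>\<^bsub>A\<^esub> m)" for k :: nat
    by (induction k) (simp_all add: coeff_zero coeff_add)
  then have "([p] \<cdot>\<^bsub>A\<^esub> \<one>\<^bsub>A\<^esub>) m = [p] \<cdot> (\<one>\<^bsub>A\<^esub> m)" .
  also have "\<dots> = \<zero>" using char_p by (simp add: coeff_one)
  finally show "([p] \<cdot>\<^bsub>A\<^esub> \<one>\<^bsub>A\<^esub>) m = \<zero>\<^bsub>A\<^esub> m" by (simp add: coeff_zero)
qed

lemmas frob_add = A.freshmans_dream_pow[OF prime_p char_A, of _ _ e]

lemma frob_finsum:
  assumes "finite Y" "\<And>x. x \<in> Y \<Longrightarrow> F x \<in> carrier A"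
  shows "(\<Oplus>\<^bsub>A\<^esub>x\<in>Y. F x) [^]\<^bsub>A\<^esub> q = (\<Oplus>\<^bsub>A\<^esub>x\<in>Y. F x [^]\<^bsub>A\<^esub> q)"
  using assms
proof (induction Y rule: finite_induct)
  case empty
  show ?case using A.nat_pow_zero[of q] q_pos by simp
next
  case (insert x Y)
  then have "(\<Oplus>\<^bsub>A\<^esub>x\<in>Y. F x) \<in> carrier A" by (intro A.finsum_closed) auto
  then show ?case using insert by (subst (1 2) A.finsum_insert) (auto simp: frob_add)
qed

lemma repeat_Q: "k \<in> Q \<Longrightarrow> repeat_mset s k \<in> Q"
  using mono_pow[of \<one> k s] by simp

lemma mono_one_pow: "k \<in> Q \<Longrightarrow> mono_series R \<one> k [^]\<^bsub>A\<^esub> (s::nat) = mono_series R \<one> (repeat_mset s k)"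
  using mono_pow[of \<one> k s] by simp

text \<open>Additivity of Frobenius reaches finite sums, so \<open>P\<close> is truncated at degree
  \<open>size m\<close>. The rest \<open>S\<close> has order above \<open>size m\<close>, and so has
  its \<open>q\<close>-th power, being a multiple of \<open>S\<close>; hence it does not contribute
  at \<open>m\<close>.\<close>

lemma coeff_frob:
  assumes P: "P \<in> carrier A"
  shows "(P [^]\<^bsub>A\<^esub> q) m = (\<Oplus>k\<in>{k \<in> Q. size k \<le> size m}. if m = repeat_mset q k then P k [^] q else \<zero>)"
proof -
  define T where "T = {k \<in> Q. size k \<le> size m}"
  have fT: "finite T"
    by (rule finite_subset[OF _ finite_Q_less[of "Suc (size m)"]]) (auto simp: T_def)
  define H where "H = (\<Oplus>\<^bsub>A\<^esub>k\<in>T. mono_series R (P k) k)"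
  have mc: "mono_series R (P k) k \<in> carrier A" if "k \<in> T" for k
    using that P by (intro mono_series_closed coeff_closed) (auto simp: T_def)
  have H: "H \<in> carrier A" unfolding H_def using mc by (intro A.finsum_closed) auto
  have Hk: "H k = P k" if k: "size k < Suc (size m)" for k
  proof -
    have "H k = (\<Oplus>l\<in>T. mono_series R (P l) l k)"
      unfolding H_def using mc fT by (intro coeff_finsum) auto
    also have "\<dots> = P k"
    proof (cases "k \<in> Q")
      case True
      then have "k \<in> T" using k by (simp add: T_def)
      then have "(\<Oplus>l\<in>T. mono_series R (P l) l k) = mono_series R (P k) k k"
        using fT P by (intro finsum_only) (auto simp: mono_series_def coeff_closed)
      then show ?thesis by (simp add: mono_series_def)
    next
      case False
      then have "(\<Oplus>l\<in>T. mono_series R (P l) l k) = \<zero>"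
        by (intro finsum_all_zero) (auto simp: mono_series_def T_def)
      then show ?thesis using False coeff_outside[OF P] by simp
    qed
    finally show ?thesis .
  qed
  define S where "S = P \<ominus>\<^bsub>A\<^esub> H"
  have S: "S \<in> ord_ge (Suc (size m))"
    unfolding ord_ge_def S_def using P H Hk by (auto simp: coeff_minus coeff_closed)
  have Sc: "S \<in> carrier A" using S ord_ge_carrier by blast
  have "H \<oplus>\<^bsub>A\<^esub> S = P"
    unfolding S_def a_minus_def using P H A.a_lcomm[of H P "\<ominus>\<^bsub>A\<^esub> H"] by (simp add: A.r_neg)
  then have "(P [^]\<^bsub>A\<^esub> q) m = (H [^]\<^bsub>A\<^esub> q) m \<oplus> (S [^]\<^bsub>A\<^esub> q) m"
    using frob_add[OF H Sc] by (simp add: coeff_add)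
  moreover have "(S [^]\<^bsub>A\<^esub> q) m = \<zero>"
  proof -
    obtain s where s: "q = Suc s" using q_pos gr0_implies_Suc by blast
    have "S [^]\<^bsub>A\<^esub> s \<otimes>\<^bsub>A\<^esub> S \<in> ord_ge (Suc (size m))"
      using S Sc by (intro ord_ge_mult_left) simp_all
    then have "S [^]\<^bsub>A\<^esub> q \<in> ord_ge (Suc (size m))" unfolding s by simp
    then show ?thesis by (simp add: ord_ge_def)
  qed
  moreover have "(H [^]\<^bsub>A\<^esub> q) m = (\<Oplus>k\<in>T. if m = repeat_mset q k then P k [^] q else \<zero>)"
  proof -
    have "H [^]\<^bsub>A\<^esub> q = (\<Oplus>\<^bsub>A\<^esub>k\<in>T. mono_series R (P k) k [^]\<^bsub>A\<^esub> q)"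
      unfolding H_def by (rule frob_finsum[OF fT mc])
    then have "(H [^]\<^bsub>A\<^esub> q) m = (\<Oplus>k\<in>T. (mono_series R (P k) k [^]\<^bsub>A\<^esub> q) m)"
      using mc fT by (simp add: coeff_finsum)
    also have "\<dots> = (\<Oplus>k\<in>T. if m = repeat_mset q k then P k [^] q else \<zero>)"
    proof (rule finsum_cong'[OF refl])
      fix k assume k: "k \<in> T"
      then have "mono_series R (P k) k [^]\<^bsub>A\<^esub> q = mono_series R (P k [^] q) (repeat_mset q k)"
        using mono_pow[of "P k" k q] P by (simp add: T_def coeff_closed)
      then show "(mono_series R (P k) k [^]\<^bsub>A\<^esub> q) m = (if m = repeat_mset q k then P k [^] q else \<zero>)"
        by (simp add: mono_series_def)
    qed (use P in \<open>auto simp: coeff_closed\<close>)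
    finally show ?thesis .
  qed
  moreover have "(\<Oplus>k\<in>T. if m = repeat_mset q k then P k [^] q else \<zero>) \<in> carrier R"
    using P by (intro finsum_closed) (auto simp: coeff_closed)
  ultimately show ?thesis by (simp add: T_def)
qed

lemma coeff_frob_repeat:
  assumes P: "P \<in> carrier A"
  shows "(P [^]\<^bsub>A\<^esub> q) (repeat_mset q k) = P k [^] q"
proof -
  define T where "T = {l \<in> Q. size l \<le> size (repeat_mset q k)}"
  have fT: "finite T"
    by (rule finite_subset[OF _ finite_Q_less[of "Suc (size (repeat_mset q k))"]]) (auto simp: T_def)
  have e: "(P [^]\<^bsub>A\<^esub> q) (repeat_mset q k)
      = (\<Oplus>l\<in>T. if repeat_mset q k = repeat_mset q l then P l [^] q else \<zero>)"
    unfolding T_def by (rule coeff_frob[OF P])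
  show ?thesis
  proof (cases "k \<in> Q")
    case True
    moreover have "size k \<le> q * size k" using mult_le_mono1[OF Suc_leI[OF q_pos], of "size k"] by simp
    ultimately have "k \<in> T" by (simp add: T_def)
    then have "(\<Oplus>l\<in>T. if repeat_mset q k = repeat_mset q l then P l [^] q else \<zero>)
        = (if repeat_mset q k = repeat_mset q k then P k [^] q else \<zero>)"
      using fT P q_pos by (intro finsum_only) (auto simp: repeat_mset_inj coeff_closed)
    then show ?thesis using e by simp
  next
    case False
    then have "(\<Oplus>l\<in>T. if repeat_mset q k = repeat_mset q l then P l [^] q else \<zero>) = \<zero>"
      using q_pos by (intro finsum_all_zero) (auto simp: repeat_mset_inj T_def)
    then show ?thesis using e coeff_outside[OF P False] q_pos nat_pow_zero[of q] by simp
  qed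
qed

lemma coeff_frob_other:
  assumes P: "P \<in> carrier A" and m: "\<And>k. m \<noteq> repeat_mset q k"
  shows "(P [^]\<^bsub>A\<^esub> q) m = \<zero>"
  unfolding coeff_frob[OF P] using m by (intro finsum_all_zero) simp

lemma coeff_frob_nonzero:
  assumes P: "P \<in> carrier A" and m: "(P [^]\<^bsub>A\<^esub> q) m \<noteq> \<zero>"
  shows "\<exists>k\<in>Q. m = repeat_mset q k \<and> P k \<noteq> \<zero>"
proof -
  obtain k where k: "m = repeat_mset q k" using coeff_frob_other[OF P] m by blast
  then have "P k [^] q \<noteq> \<zero>" using coeff_frob_repeat[OF P] m by simp
  then have "P k \<noteq> \<zero>" using nat_pow_zero[of q] q_pos by auto
  then show ?thesis using k support_Q[OF P] by blast
qed

text \<open>These are the \<open>A\<close>-linear forms from the pushforward to \<open>A\<close>,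
  read as maps of the underlying series; they are also called \<open>p^(-e)\<close>-linear
  maps.\<close>

definition inv_linear :: "(('i multiset \<Rightarrow> 'a) \<Rightarrow> ('i multiset \<Rightarrow> 'a)) \<Rightarrow> bool"
  where "inv_linear \<phi> \<longleftrightarrow> (\<forall>x\<in>carrier A. \<phi> x \<in> carrier A)
    \<and> (\<forall>x\<in>carrier A. \<forall>y\<in>carrier A. \<phi> (x \<oplus>\<^bsub>A\<^esub> y) = \<phi> x \<oplus>\<^bsub>A\<^esub> \<phi> y)
    \<and> (\<forall>r\<in>carrier A. \<forall>x\<in>carrier A. \<phi> (r [^]\<^bsub>A\<^esub> q \<otimes>\<^bsub>A\<^esub> x) = r \<otimes>\<^bsub>A\<^esub> \<phi> x)"

lemma inv_linear_zero: "inv_linear \<phi> \<Longrightarrow> \<phi> \<zero>\<^bsub>A\<^esub> = \<zero>\<^bsub>A\<^esub>"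
proof -
  assume \<phi>: "inv_linear \<phi>"
  have "\<phi> (\<zero>\<^bsub>A\<^esub> [^]\<^bsub>A\<^esub> q \<otimes>\<^bsub>A\<^esub> \<zero>\<^bsub>A\<^esub>) = \<zero>\<^bsub>A\<^esub> \<otimes>\<^bsub>A\<^esub> \<phi> \<zero>\<^bsub>A\<^esub>"
    using \<phi> unfolding inv_linear_def by blast
  moreover have "\<phi> \<zero>\<^bsub>A\<^esub> \<in> carrier A" using \<phi> unfolding inv_linear_def by blast
  ultimately show ?thesis by simp
qed

lemma inv_linear_finsum:
  assumes \<phi>: "inv_linear \<phi>" and Y: "finite Y" "\<And>x. x \<in> Y \<Longrightarrow> F x \<in> carrier A"
  shows "\<phi> (\<Oplus>\<^bsub>A\<^esub>x\<in>Y. F x) = (\<Oplus>\<^bsub>A\<^esub>x\<in>Y. \<phi> (F x))"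
  using Y
proof (induction Y rule: finite_induct)
  case empty
  show ?case using inv_linear_zero[OF \<phi>] by simp
next
  case (insert x Y)
  have c: "\<And>y. y \<in> carrier A \<Longrightarrow> \<phi> y \<in> carrier A"
    and a: "\<And>y z. y \<in> carrier A \<Longrightarrow> z \<in> carrier A \<Longrightarrow> \<phi> (y \<oplus>\<^bsub>A\<^esub> z) = \<phi> y \<oplus>\<^bsub>A\<^esub> \<phi> z"
    using \<phi> by (simp_all add: inv_linear_def)
  have "(\<Oplus>\<^bsub>A\<^esub>x\<in>Y. F x) \<in> carrier A" using insert by (intro A.finsum_closed) auto
  then show ?case using insert c a by (subst (1 2) A.finsum_insert) auto
qed

text \<open>Multiplying by the \<open>q\<close>-th power of a monomial \<open>g\<close> on the facet \<open>i\<close> makes room for a factor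
  \<open>h ^ q\<close>, where \<open>h\<close> has height 1 over that facet. Hence \<open>g * \<phi> a\<close> is divisible by \<open>h\<close>.\<close>
lemma inv_linear_kills:
  assumes \<phi>: "inv_linear \<phi>" and a: "a \<in> carrier A" and i: "i \<in> I"
    and supp: "\<And>m. a m \<noteq> \<zero> \<Longrightarrow> q \<le> count m i"
  shows "(\<phi> a) {#} = \<zero>"
proof -
  obtain g h where gh: "g \<in> Q" "h \<in> Q" "count g i = 0" "count h i = 1" "\<And>j. j \<noteq> i \<Longrightarrow> count h j \<le> count g j"
    using facet[OF i] by blast
  define qg where "qg = repeat_mset q g"
  define qh where "qh = repeat_mset q h"
  have Qq: "qg \<in> Q" "qh \<in> Q" using repeat_Q gh by (simp_all add: qg_def qh_def)
  have sub: "qh \<subseteq># k + qg" if k: "q \<le> count k i" for k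
  proof (rule mset_subset_eqI)
    fix j show "count qh j \<le> count (k + qg) j"
      using gh(3,4) gh(5)[of j] k by (cases "j = i") (auto simp: qg_def qh_def intro: trans_le_add2)
  qed
  \<comment> \<open>\<open>b\<close> is the product of \<open>a\<close> with the monomial
    \<open>qg\<close>, divided by the monomial \<open>qh\<close>. Fullness keeps its support inside
    \<open>Q\<close>.\<close>
  define b where "b = (\<lambda>m. if qg \<subseteq># m + qh then a (m + qh - qg) else \<zero>)"
  have b: "b \<in> carrier A"
    unfolding carrier_A
  proof (intro conjI allI impI)
    fix m show "b m \<in> carrier R" using a by (simp add: b_def coeff_closed)
    assume m: "m \<notin> Q"
    show "b m = \<zero>"
    proof (rule ccontr)
      assume "b m \<noteq> \<zero>"
      then have *: "qg \<subseteq># m + qh" "a (m + qh - qg) \<noteq> \<zero>" by (auto simp: b_def split: if_splits)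
      define k where "k = m + qh - qg"
      have k: "m + qh = k + qg" using *(1) by (simp add: k_def)
      have ak: "a k \<noteq> \<zero>" using *(2) by (simp add: k_def)
      have "k \<in> Q" "q \<le> count k i" using support_Q[OF a ak] supp[OF ak] by blast+
      then have "k + qg - qh \<in> Q" using Q_full[OF Qq(2) add_Q[OF _ Qq(1)] sub] by blast
      then show False using m k[symmetric] by simp
    qed
  qed
  have oc: "\<And>k. k \<in> Q \<Longrightarrow> mono_series R \<one> k \<in> carrier A" by (simp add: mono_series_closed)
  have "mono_series R \<one> qg \<otimes>\<^bsub>A\<^esub> a = mono_series R \<one> qh \<otimes>\<^bsub>A\<^esub> b"
  proof
    fix m
    have "(if qg \<subseteq># m then \<one> \<otimes> a (m - qg) else \<zero>) = (if qh \<subseteq># m then \<one> \<otimes> b (m - qh) else \<zero>)"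
    proof (cases "qh \<subseteq># m")
      case True
      then show ?thesis using a by (simp add: b_def coeff_closed)
    next
      case False
      have "a (m - qg) = \<zero>" if "qg \<subseteq># m"
      proof (rule ccontr)
        assume "a (m - qg) \<noteq> \<zero>"
        then have "qh \<subseteq># (m - qg) + qg" using sub supp by blast
        then show False using False that by simp
      qed
      then show ?thesis using False by simp
    qed
    then show "(mono_series R \<one> qg \<otimes>\<^bsub>A\<^esub> a) m = (mono_series R \<one> qh \<otimes>\<^bsub>A\<^esub> b) m"
      by (simp only: coeff_mono_mult[OF one_closed Qq(1) a] coeff_mono_mult[OF one_closed Qq(2) b])
  qed
  then have "\<phi> (mono_series R \<one> g [^]\<^bsub>A\<^esub> q \<otimes>\<^bsub>A\<^esub> a) = \<phi> (mono_series R \<one> h [^]\<^bsub>A\<^esub> q \<otimes>\<^bsub>A\<^esub> b)"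
    using gh by (simp add: mono_one_pow qg_def qh_def)
  then have eq: "mono_series R \<one> g \<otimes>\<^bsub>A\<^esub> \<phi> a = mono_series R \<one> h \<otimes>\<^bsub>A\<^esub> \<phi> b"
    using \<phi> a b oc gh(1,2) by (simp add: inv_linear_def)
  have \<phi>c: "\<phi> a \<in> carrier A" "\<phi> b \<in> carrier A" using \<phi> a b by (simp_all add: inv_linear_def)
  \<comment> \<open>Coefficients are compared at \<open>g\<close>: the left side yields the constant
    coefficient of \<open>\<phi> a\<close>, while the right side has none there because
    \<open>h\<close> does not divide \<open>g\<close>.\<close>
  have "(mono_series R \<one> g \<otimes>\<^bsub>A\<^esub> \<phi> a) g = \<phi> a {#}"
    unfolding coeff_mono_mult[OF one_closed gh(1) \<phi>c(1)] using coeff_closed[OF \<phi>c(1)] by simp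
  moreover have "(mono_series R \<one> h \<otimes>\<^bsub>A\<^esub> \<phi> b) g = \<zero>"
  proof -
    have "\<not> h \<subseteq># g" using gh(3,4) mset_subset_eq_count[of h g i] by auto
    then show ?thesis unfolding coeff_mono_mult[OF one_closed gh(2) \<phi>c(2)] by simp
  qed
  ultimately show ?thesis using eq by simp
qed

definition small :: "'i multiset set"
  where "small = {m \<in> Q. \<forall>i\<in>I. count m i < q}"

lemma finite_small: "finite small"
proof (rule finite_subset[OF _ finite_Q_less[of "card I * q + 1"]])
  show "small \<subseteq> {m \<in> Q. size m < card I * q + 1}"
  proof
    fix m assume m: "m \<in> small"
    then have "set_mset m \<subseteq> I" using Q_supported by (simp add: small_def)
    then have "size m = (\<Sum>i\<in>I. count m i)"
      unfolding size_multiset_overloaded_eq using finite_I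
      by (intro sum.mono_neutral_left) (auto simp: not_in_iff)
    also have "\<dots> \<le> (\<Sum>i\<in>I. q)" using m by (intro sum_mono) (auto simp: small_def intro: less_imp_le)
    finally show "m \<in> {m \<in> Q. size m < card I * q + 1}" using m by (simp add: small_def)
  qed
qed

text \<open>The form can be computed on finite sums, so \<open>a\<close> is cut into its finitely
  many small terms and, for each \<open>i\<close>, one possibly infinite series whose monomials all
  have value at least \<open>q\<close> at \<open>i\<close>. Each such series is treated as a whole
  by \<open>inv_linear_kills\<close>.\<close>

lemma inv_linear_vanish:
  assumes \<phi>: "inv_linear \<phi>" and a: "a \<in> carrier A"
    and L: "finite L" "L \<subseteq> carrier R"
      "\<And>x. x \<in> carrier R \<Longrightarrow> \<exists>c. c \<in> L \<rightarrow>\<^sub>E carrier R \<and> x = (\<Oplus>b\<in>L. c b [^] q \<otimes> b)"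
    and zero: "\<And>l \<gamma>. l \<in> L \<Longrightarrow> \<gamma> \<in> small \<Longrightarrow> \<phi> (mono_series R l \<gamma>) {#} = \<zero>"
  shows "\<phi> a {#} = \<zero>"
proof -
  have \<phi>c: "\<And>x. x \<in> carrier A \<Longrightarrow> \<phi> x \<in> carrier A" using \<phi> by (simp add: inv_linear_def)
  have sQ: "\<And>\<gamma>. \<gamma> \<in> small \<Longrightarrow> \<gamma> \<in> Q" by (simp add: small_def)
  \<comment> \<open>The coefficient \<open>x\<close> is expanded in \<open>L\<close> over the
    \<open>q\<close>-th powers; the roots of its coordinates then leave the form as scalars.\<close>
  have single: "\<phi> (mono_series R x \<gamma>) {#} = \<zero>" if x: "x \<in> carrier R" and \<gamma>: "\<gamma> \<in> small" for x \<gamma>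
  proof -
    obtain c where c: "c \<in> L \<rightarrow>\<^sub>E carrier R" "x = (\<Oplus>b\<in>L. c b [^] q \<otimes> b)" using L(3)[OF x] by blast
    have cc: "\<And>b. b \<in> L \<Longrightarrow> c b \<in> carrier R" using c(1) by auto
    have Lc: "\<And>b. b \<in> L \<Longrightarrow> b \<in> carrier R" using L(2) by auto
    define k where "k = (\<lambda>b. mono_series R (c b) ({#} :: 'i multiset))"
    have kc: "\<And>b. b \<in> L \<Longrightarrow> k b \<in> carrier A" using cc empty_Q by (simp add: k_def mono_series_closed)
    have mc: "\<And>b. b \<in> L \<Longrightarrow> mono_series R b \<gamma> \<in> carrier A" using Lc sQ[OF \<gamma>] by (simp add: mono_series_closed)
    have kq: "k b [^]\<^bsub>A\<^esub> q \<otimes>\<^bsub>A\<^esub> mono_series R b \<gamma> = mono_series R (c b [^] q \<otimes> b) \<gamma>" if b: "b \<in> L" for b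
    proof -
      have "k b [^]\<^bsub>A\<^esub> q = mono_series R (c b [^] q) {#}"
        unfolding k_def using mono_pow[OF cc[OF b] empty_Q, of q] by simp
      then show ?thesis using mono_mult_mono[of "c b [^] q" b "{#}" \<gamma>] cc[OF b] Lc[OF b] empty_Q sQ[OF \<gamma>] by simp
    qed
    have "mono_series R x \<gamma> = (\<Oplus>\<^bsub>A\<^esub>b\<in>L. k b [^]\<^bsub>A\<^esub> q \<otimes>\<^bsub>A\<^esub> mono_series R b \<gamma>)"
    proof
      fix m
      have "(\<Oplus>\<^bsub>A\<^esub>b\<in>L. k b [^]\<^bsub>A\<^esub> q \<otimes>\<^bsub>A\<^esub> mono_series R b \<gamma>) m = (\<Oplus>b\<in>L. (k b [^]\<^bsub>A\<^esub> q \<otimes>\<^bsub>A\<^esub> mono_series R b \<gamma>) m)"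
        using kc mc L(1) by (intro coeff_finsum) auto
      also have "\<dots> = (\<Oplus>b\<in>L. if m = \<gamma> then c b [^] q \<otimes> b else \<zero>)"
      proof (rule finsum_cong'[OF refl])
        fix b assume "b \<in> L"
        then show "(k b [^]\<^bsub>A\<^esub> q \<otimes>\<^bsub>A\<^esub> mono_series R b \<gamma>) m = (if m = \<gamma> then c b [^] q \<otimes> b else \<zero>)"
          by (subst kq) (simp_all add: mono_series_def)
      qed (use cc Lc in auto)
      also have "\<dots> = mono_series R x \<gamma> m"
        using c(2) by (cases "m = \<gamma>") (auto simp: mono_series_def intro!: finsum_all_zero)
      finally show "mono_series R x \<gamma> m = (\<Oplus>\<^bsub>A\<^esub>b\<in>L. k b [^]\<^bsub>A\<^esub> q \<otimes>\<^bsub>A\<^esub> mono_series R b \<gamma>) m" ..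
    qed
    then have "\<phi> (mono_series R x \<gamma>) = (\<Oplus>\<^bsub>A\<^esub>b\<in>L. \<phi> (k b [^]\<^bsub>A\<^esub> q \<otimes>\<^bsub>A\<^esub> mono_series R b \<gamma>))"
      using inv_linear_finsum[OF \<phi> L(1), of "\<lambda>b. k b [^]\<^bsub>A\<^esub> q \<otimes>\<^bsub>A\<^esub> mono_series R b \<gamma>"] kc mc by simp
    also have "\<dots> = (\<Oplus>\<^bsub>A\<^esub>b\<in>L. k b \<otimes>\<^bsub>A\<^esub> \<phi> (mono_series R b \<gamma>))"
      using \<phi> kc mc by (intro A.finsum_cong') (auto simp: inv_linear_def)
    finally have "\<phi> (mono_series R x \<gamma>) {#} = (\<Oplus>b\<in>L. (k b \<otimes>\<^bsub>A\<^esub> \<phi> (mono_series R b \<gamma>)) {#})"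
      using kc mc \<phi>c L(1) by (simp add: coeff_finsum)
    also have "\<dots> = \<zero>"
    proof (rule finsum_all_zero)
      fix b assume b: "b \<in> L"
      show "(k b \<otimes>\<^bsub>A\<^esub> \<phi> (mono_series R b \<gamma>)) {#} = \<zero>"
        using const_coeff_mult[OF kc[OF b] \<phi>c[OF mc[OF b]]] zero[OF b \<gamma>] coeff_closed[OF kc[OF b]] by simp
    qed
    finally show ?thesis .
  qed
  \<comment> \<open>A monomial may reach \<open>q\<close> at several indices. Fixing one of them
    makes the pieces \<open>r i\<close> a partition of the terms outside
    \<open>small\<close>.\<close>
  define pick where "pick = (\<lambda>m. Min {i \<in> I. q \<le> count m i})"
  have pick: "pick m \<in> I \<and> q \<le> count m (pick m)" if "m \<in> Q" "m \<notin> small" for m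
  proof -
    have "{i \<in> I. q \<le> count m i} \<noteq> {}" using that by (auto simp: small_def not_less)
    then have "pick m \<in> {i \<in> I. q \<le> count m i}" unfolding pick_def using finite_I by (intro Min_in) auto
    then show ?thesis by simp
  qed
  define s where "s = (\<Oplus>\<^bsub>A\<^esub>\<gamma>\<in>small. mono_series R (a \<gamma>) \<gamma>)"
  define r where "r = (\<lambda>i m. if m \<notin> small \<and> pick m = i then a m else \<zero>)"
  have rc: "r i \<in> carrier A" for i using a by (auto simp: carrier_A r_def)
  have mc: "mono_series R (a \<gamma>) \<gamma> \<in> carrier A" if "\<gamma> \<in> small" for \<gamma>
    using coeff_closed[OF a] sQ[OF that] by (simp add: mono_series_closed)
  have sc: "s \<in> carrier A" unfolding s_def using mc by (intro A.finsum_closed) auto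
  have Rc: "(\<Oplus>\<^bsub>A\<^esub>i\<in>I. r i) \<in> carrier A" using rc by (intro A.finsum_closed) auto
  have "a = s \<oplus>\<^bsub>A\<^esub> (\<Oplus>\<^bsub>A\<^esub>i\<in>I. r i)"
  proof
    fix m
    have sm: "s m = (if m \<in> small then a m else \<zero>)"
    proof -
      have "s m = (\<Oplus>\<gamma>\<in>small. mono_series R (a \<gamma>) \<gamma> m)"
        unfolding s_def using mc finite_small by (intro coeff_finsum) auto
      also have "\<dots> = (if m \<in> small then a m else \<zero>)"
      proof (cases "m \<in> small")
        case True
        then have "(\<Oplus>\<gamma>\<in>small. mono_series R (a \<gamma>) \<gamma> m) = mono_series R (a m) m m"
          using coeff_closed[OF a] finite_small by (intro finsum_only) (auto simp: mono_series_def)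
        then show ?thesis using True by (simp add: mono_series_def)
      next
        case False
        then have "(\<Oplus>\<gamma>\<in>small. mono_series R (a \<gamma>) \<gamma> m) = \<zero>"
          by (intro finsum_all_zero) (auto simp: mono_series_def)
        then show ?thesis using False by simp
      qed
      finally show ?thesis .
    qed
    have "(\<Oplus>\<^bsub>A\<^esub>i\<in>I. r i) m = (\<Oplus>i\<in>I. r i m)" using rc finite_I by (intro coeff_finsum) auto
    also have "\<dots> = (if m \<in> small then \<zero> else a m)"
    proof (cases "m \<in> small \<or> m \<notin> Q")
      case True
      then have "(\<Oplus>i\<in>I. r i m) = \<zero>" using coeff_outside[OF a]
        by (intro finsum_all_zero) (auto simp: r_def)
      then show ?thesis using True coeff_outside[OF a] by auto
    next
      case False
      then have "(\<Oplus>i\<in>I. r i m) = r (pick m) m"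
        using pick[of m] finite_I coeff_closed[OF a] by (intro finsum_only) (auto simp: r_def)
      then show ?thesis using False by (simp add: r_def)
    qed
    finally show "a m = (s \<oplus>\<^bsub>A\<^esub> (\<Oplus>\<^bsub>A\<^esub>i\<in>I. r i)) m"
      using sm coeff_closed[OF a] by (simp add: coeff_add)
  qed
  then have "\<phi> a = \<phi> s \<oplus>\<^bsub>A\<^esub> \<phi> (\<Oplus>\<^bsub>A\<^esub>i\<in>I. r i)" using \<phi> sc Rc by (simp add: inv_linear_def)
  also have "\<phi> s = (\<Oplus>\<^bsub>A\<^esub>\<gamma>\<in>small. \<phi> (mono_series R (a \<gamma>) \<gamma>))"
    unfolding s_def by (rule inv_linear_finsum[OF \<phi> finite_small mc])
  also have "\<phi> (\<Oplus>\<^bsub>A\<^esub>i\<in>I. r i) = (\<Oplus>\<^bsub>A\<^esub>i\<in>I. \<phi> (r i))"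
    by (rule inv_linear_finsum[OF \<phi> finite_I rc])
  finally have "\<phi> a {#} = (\<Oplus>\<gamma>\<in>small. \<phi> (mono_series R (a \<gamma>) \<gamma>) {#}) \<oplus> (\<Oplus>i\<in>I. \<phi> (r i) {#})"
    using mc rc \<phi>c finite_small finite_I by (simp add: coeff_add coeff_finsum)
  also have "(\<Oplus>\<gamma>\<in>small. \<phi> (mono_series R (a \<gamma>) \<gamma>) {#}) = \<zero>"
    using single coeff_closed[OF a] by (intro finsum_all_zero) simp
  also have "(\<Oplus>i\<in>I. \<phi> (r i) {#}) = \<zero>"
  proof (rule finsum_all_zero)
    fix i assume i: "i \<in> I"
    show "\<phi> (r i) {#} = \<zero>"
    proof (rule inv_linear_kills[OF \<phi> rc i])
      fix m assume "r i m \<noteq> \<zero>"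
      then have "m \<notin> small" "pick m = i" "a m \<noteq> \<zero>" by (auto simp: r_def split: if_splits)
      then show "q \<le> count m i" using pick[of m] support_Q[OF a] by blast
    qed
  qed
  finally show ?thesis by simp
qed

section \<open>Free summands as families of dual forms, and the upper bound for the rank\<close>

lemmas submodule_pushforward = A.submodule_pushforward[of _ p e]

lemma frob_mult: "r \<in> carrier A \<Longrightarrow> x \<in> carrier A \<Longrightarrow> (r \<otimes>\<^bsub>A\<^esub> x) [^]\<^bsub>A\<^esub> q = r [^]\<^bsub>A\<^esub> q \<otimes>\<^bsub>A\<^esub> x [^]\<^bsub>A\<^esub> q"
  by (rule A.nat_pow_distrib)

lemma zero_frob: "\<zero>\<^bsub>A\<^esub> [^]\<^bsub>A\<^esub> q = \<zero>\<^bsub>A\<^esub>"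
  using A.nat_pow_zero[of q] q_pos by simp

text \<open>Projecting onto \<open>F\<close> along \<open>N\<close> and taking coordinates in
  \<open>B\<close> gives the dual forms. A free summand enters the upper bound through these forms
  and their duality with ring elements.\<close>

lemma free_summand_projections:
  assumes "has_free_summand_of_rank A M r"
  obtains B \<phi> where "finite B" "card B = r" "B \<subseteq> carrier A" "\<And>b. b \<in> B \<Longrightarrow> inv_linear (\<phi> b)"
    "\<And>b c. b \<in> B \<Longrightarrow> c \<in> B \<Longrightarrow> \<phi> b c = (if b = c then \<one>\<^bsub>A\<^esub> else \<zero>\<^bsub>A\<^esub>)"
proof -
  from assms obtain F N B where FN: "submodule F A M" "submodule N A M" "F <+>\<^bsub>M\<^esub> N = carrier M"
    "F \<inter> N = {\<zero>\<^bsub>M\<^esub>}" and B: "module_basis A M F B" "card B = r"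
    unfolding has_free_summand_of_rank_def by auto
  have Mc: "carrier M = carrier A" "\<zero>\<^bsub>M\<^esub> = \<zero>\<^bsub>A\<^esub>" by (simp_all add: frobenius_pushforward_def)
  note F = FN(1)[unfolded submodule_pushforward] and N = FN(2)[unfolded submodule_pushforward]
  have FNsum: "F <+>\<^bsub>M\<^esub> N = {x. \<exists>f\<in>F. \<exists>n\<in>N. x = f \<oplus>\<^bsub>A\<^esub> n}"
    by (auto simp: set_add_def set_mult_def frobenius_pushforward_def)
  define S where "S = (\<lambda>c. \<Oplus>\<^bsub>A\<^esub>b\<in>B. c b [^]\<^bsub>A\<^esub> q \<otimes>\<^bsub>A\<^esub> b)"
  have basis: "finite B" "B \<subseteq> F" "\<And>x. x \<in> F \<Longrightarrow> \<exists>!c. c \<in> B \<rightarrow>\<^sub>E carrier A \<and> x = S c"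
    using B(1) unfolding module_basis_def S_def finsum_pushforward
    by (simp_all add: frobenius_pushforward_def)
  have Bc: "\<And>b. b \<in> B \<Longrightarrow> b \<in> carrier A" using basis(2) F by blast
  have S_F: "S c \<in> F" if c: "\<And>b. b \<in> B \<Longrightarrow> c b \<in> carrier A" for c
  proof -
    have "(\<Oplus>\<^bsub>A\<^esub>b\<in>B'. c b [^]\<^bsub>A\<^esub> q \<otimes>\<^bsub>A\<^esub> b) \<in> F" if "B' \<subseteq> B" for B'
      using finite_subset[OF that basis(1)] that
    proof (induction B' rule: finite_induct)
      case empty
      then show ?case using F by simp
    next
      case (insert b B')
      have "c b [^]\<^bsub>A\<^esub> q \<otimes>\<^bsub>A\<^esub> b \<in> F" using insert.prems basis(2) c F by blast
      moreover have "\<And>y. y \<in> insert b B' \<Longrightarrow> c y [^]\<^bsub>A\<^esub> q \<otimes>\<^bsub>A\<^esub> y \<in> carrier A"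
        using insert.prems c Bc by auto
      ultimately show ?case using insert F by (subst A.finsum_insert) auto
    qed
    then show ?thesis by (simp add: S_def)
  qed
  define rep where "rep = (\<lambda>x c. c \<in> B \<rightarrow>\<^sub>E carrier A \<and> (\<exists>n\<in>N. x = S c \<oplus>\<^bsub>A\<^esub> n))"
  have rep_ex: "\<exists>c. rep x c" if "x \<in> carrier A" for x
  proof -
    have "x \<in> F <+>\<^bsub>M\<^esub> N" using that FN(3) Mc by simp
    then obtain f n where fn: "f \<in> F" "n \<in> N" "x = f \<oplus>\<^bsub>A\<^esub> n" unfolding FNsum by blast
    obtain c where "c \<in> B \<rightarrow>\<^sub>E carrier A" "f = S c" using basis(3)[OF fn(1)] by blast
    then show ?thesis using fn by (auto simp: rep_def)
  qed
  have rep_uniq: "c = c'" if r1: "rep x c" and r2: "rep x c'" for x c c'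
  proof -
    obtain n n' where n: "n \<in> N" "x = S c \<oplus>\<^bsub>A\<^esub> n" and n': "n' \<in> N" "x = S c' \<oplus>\<^bsub>A\<^esub> n'"
      using r1 r2 by (auto simp: rep_def)
    have cc: "c \<in> B \<rightarrow>\<^sub>E carrier A" "c' \<in> B \<rightarrow>\<^sub>E carrier A" using r1 r2 by (auto simp: rep_def)
    have SF: "S c \<in> F" "S c' \<in> F" using S_F cc by (auto simp: PiE_mem)
    have cl: "S c \<in> carrier A" "S c' \<in> carrier A" "n \<in> carrier A" "n' \<in> carrier A"
      using SF n(1) n'(1) F N by blast+
    have "S c \<ominus>\<^bsub>A\<^esub> S c' = n' \<ominus>\<^bsub>A\<^esub> n"
    proof -
      have "S c \<ominus>\<^bsub>A\<^esub> S c' = (S c \<oplus>\<^bsub>A\<^esub> n) \<ominus>\<^bsub>A\<^esub> S c' \<ominus>\<^bsub>A\<^esub> n" using cl by algebra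
      also have "\<dots> = (S c' \<oplus>\<^bsub>A\<^esub> n') \<ominus>\<^bsub>A\<^esub> S c' \<ominus>\<^bsub>A\<^esub> n" using n(2) n'(2) by simp
      also have "\<dots> = n' \<ominus>\<^bsub>A\<^esub> n" using cl by algebra
      finally show ?thesis .
    qed
    moreover have "S c \<ominus>\<^bsub>A\<^esub> S c' \<in> F" "n' \<ominus>\<^bsub>A\<^esub> n \<in> N"
      using SF n(1) n'(1) F N by (simp_all add: a_minus_def)
    ultimately have "S c \<ominus>\<^bsub>A\<^esub> S c' = \<zero>\<^bsub>A\<^esub>" using FN(4) Mc by auto
    then have "S c = S c'" using cl by simp
    then show ?thesis using basis(3)[OF SF(1)] cc by auto
  qed
  define \<phi> where "\<phi> = (\<lambda>b x. (THE c. rep x c) b)"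
  have \<phi>: "\<phi> b x = c b" if "rep x c" for b x c
    using the_equality[of "rep x" c] that rep_uniq unfolding \<phi>_def by metis
  have add: "rep (x \<oplus>\<^bsub>A\<^esub> y) (\<lambda>b\<in>B. c b \<oplus>\<^bsub>A\<^esub> c' b)" if r1: "rep x c" and r2: "rep y c'" for x y c c'
  proof -
    obtain n n' where n: "n \<in> N" "x = S c \<oplus>\<^bsub>A\<^esub> n" and n': "n' \<in> N" "y = S c' \<oplus>\<^bsub>A\<^esub> n'"
      using r1 r2 by (auto simp: rep_def)
    have cc: "\<And>b. b \<in> B \<Longrightarrow> c b \<in> carrier A" "\<And>b. b \<in> B \<Longrightarrow> c' b \<in> carrier A"
      using r1 r2 by (auto simp: rep_def)
    have cl: "S c \<in> carrier A" "S c' \<in> carrier A" "n \<in> carrier A" "n' \<in> carrier A"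
      using S_F cc n(1) n'(1) F N by blast+
    have "S (\<lambda>b\<in>B. c b \<oplus>\<^bsub>A\<^esub> c' b) = (\<Oplus>\<^bsub>A\<^esub>b\<in>B. c b [^]\<^bsub>A\<^esub> q \<otimes>\<^bsub>A\<^esub> b \<oplus>\<^bsub>A\<^esub> c' b [^]\<^bsub>A\<^esub> q \<otimes>\<^bsub>A\<^esub> b)"
      unfolding S_def using cc Bc by (intro A.finsum_cong') (auto simp: frob_add A.l_distr)
    also have "\<dots> = S c \<oplus>\<^bsub>A\<^esub> S c'"
      unfolding S_def using cc Bc by (intro A.finsum_addf) auto
    finally have "x \<oplus>\<^bsub>A\<^esub> y = S (\<lambda>b\<in>B. c b \<oplus>\<^bsub>A\<^esub> c' b) \<oplus>\<^bsub>A\<^esub> (n \<oplus>\<^bsub>A\<^esub> n')"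
      using n(2) n'(2) cl by (simp add: A.a_ac)
    moreover have "n \<oplus>\<^bsub>A\<^esub> n' \<in> N" using n(1) n'(1) N by blast
    ultimately show ?thesis using cc by (auto simp: rep_def)
  qed
  have scale: "rep (s [^]\<^bsub>A\<^esub> q \<otimes>\<^bsub>A\<^esub> x) (\<lambda>b\<in>B. s \<otimes>\<^bsub>A\<^esub> c b)" if r1: "rep x c" and s: "s \<in> carrier A" for x s c
  proof -
    obtain n where n: "n \<in> N" "x = S c \<oplus>\<^bsub>A\<^esub> n" using r1 by (auto simp: rep_def)
    have cc: "\<And>b. b \<in> B \<Longrightarrow> c b \<in> carrier A" using r1 by (auto simp: rep_def)
    have cl: "S c \<in> carrier A" "n \<in> carrier A" using S_F cc n(1) F N by blast+
    have "S (\<lambda>b\<in>B. s \<otimes>\<^bsub>A\<^esub> c b) = (\<Oplus>\<^bsub>A\<^esub>b\<in>B. s [^]\<^bsub>A\<^esub> q \<otimes>\<^bsub>A\<^esub> (c b [^]\<^bsub>A\<^esub> q \<otimes>\<^bsub>A\<^esub> b))"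
      unfolding S_def using cc Bc s by (intro A.finsum_cong') (auto simp: frob_mult A.m_assoc)
    also have "\<dots> = s [^]\<^bsub>A\<^esub> q \<otimes>\<^bsub>A\<^esub> S c"
      unfolding S_def using cc Bc s basis(1) by (intro A.finsum_rdistr[symmetric]) auto
    finally have "s [^]\<^bsub>A\<^esub> q \<otimes>\<^bsub>A\<^esub> x = S (\<lambda>b\<in>B. s \<otimes>\<^bsub>A\<^esub> c b) \<oplus>\<^bsub>A\<^esub> s [^]\<^bsub>A\<^esub> q \<otimes>\<^bsub>A\<^esub> n"
      using n(2) cl s by (simp add: A.r_distr)
    moreover have "s [^]\<^bsub>A\<^esub> q \<otimes>\<^bsub>A\<^esub> n \<in> N" using n(1) s N by blast
    ultimately show ?thesis using cc s by (auto simp: rep_def)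
  qed
  have delta: "rep d (\<lambda>b\<in>B. if b = d then \<one>\<^bsub>A\<^esub> else \<zero>\<^bsub>A\<^esub>)" if d: "d \<in> B" for d
  proof -
    have "S (\<lambda>b\<in>B. if b = d then \<one>\<^bsub>A\<^esub> else \<zero>\<^bsub>A\<^esub>)
        = (\<lambda>b\<in>B. if b = d then \<one>\<^bsub>A\<^esub> else \<zero>\<^bsub>A\<^esub>) d [^]\<^bsub>A\<^esub> q \<otimes>\<^bsub>A\<^esub> d"
      unfolding S_def using d Bc basis(1) by (intro A.finsum_only) (auto simp: zero_frob)
    then have "S (\<lambda>b\<in>B. if b = d then \<one>\<^bsub>A\<^esub> else \<zero>\<^bsub>A\<^esub>) = d" using d Bc by simp
    moreover have "\<zero>\<^bsub>A\<^esub> \<in> N" using N by blast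
    ultimately show ?thesis using Bc[OF d] unfolding rep_def by (intro conjI bexI[of _ "\<zero>\<^bsub>A\<^esub>"]) auto
  qed
  show thesis
  proof (rule that[of B \<phi>])
    show "finite B" "card B = r" "B \<subseteq> carrier A" using basis B(2) Bc by auto
    show "inv_linear (\<phi> b)" if b: "b \<in> B" for b
      unfolding inv_linear_def
    proof (intro conjI ballI)
      fix x assume x: "x \<in> carrier A"
      obtain c where c: "rep x c" using rep_ex[OF x] by blast
      then have "c b \<in> carrier A" using b by (auto simp: rep_def)
      then show "\<phi> b x \<in> carrier A" using \<phi>[OF c] by simp
      fix y assume y: "y \<in> carrier A"
      obtain c' where c': "rep y c'" using rep_ex[OF y] by blast
      show "\<phi> b (x \<oplus>\<^bsub>A\<^esub> y) = \<phi> b x \<oplus>\<^bsub>A\<^esub> \<phi> b y"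
        using \<phi>[OF add[OF c c']] \<phi>[OF c] \<phi>[OF c'] b by simp
    next
      fix s x assume s: "s \<in> carrier A" and x: "x \<in> carrier A"
      obtain c where c: "rep x c" using rep_ex[OF x] by blast
      show "\<phi> b (s [^]\<^bsub>A\<^esub> q \<otimes>\<^bsub>A\<^esub> x) = s \<otimes>\<^bsub>A\<^esub> \<phi> b x"
        using \<phi>[OF scale[OF c s]] \<phi>[OF c] b by simp
    qed
    show "\<phi> b c = (if b = c then \<one>\<^bsub>A\<^esub> else \<zero>\<^bsub>A\<^esub>)" if "b \<in> B" "c \<in> B" for b c
      using \<phi>[OF delta[OF that(2)]] that(1) by simp
  qed
qed

text \<open>With more forms than pairs \<open>(l, \<gamma>)\<close>, a nontrivial combination over
  the field has constant coefficient zero on every \<open>mono_series R l \<gamma>\<close>, so it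
  maps the whole ring into the maximal ideal by \<open>inv_linear_vanish\<close>. At a basis element
  \<open>d\<close> with \<open>t d\<close> nonzero, duality gives the constant coefficient
  \<open>t d\<close> instead.\<close>

lemma free_rank_upper:
  assumes L: "finite L" "L \<subseteq> carrier R"
      "\<And>x. x \<in> carrier R \<Longrightarrow> \<exists>c. c \<in> L \<rightarrow>\<^sub>E carrier R \<and> x = (\<Oplus>b\<in>L. c b [^] q \<otimes> b)"
    and free: "has_free_summand_of_rank A M r"
  shows "r \<le> card L * card small"
proof (rule ccontr)
  assume neg: "\<not> r \<le> card L * card small"
  obtain B \<phi> where B: "finite B" "card B = r" "B \<subseteq> carrier A" "\<And>b. b \<in> B \<Longrightarrow> inv_linear (\<phi> b)"
    "\<And>b c. b \<in> B \<Longrightarrow> c \<in> B \<Longrightarrow> \<phi> b c = (if b = c then \<one>\<^bsub>A\<^esub> else \<zero>\<^bsub>A\<^esub>)"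
    using free_summand_projections[OF free] by metis
  have \<phi>c: "\<And>b x. b \<in> B \<Longrightarrow> x \<in> carrier A \<Longrightarrow> \<phi> b x \<in> carrier A"
    using B(4) by (simp add: inv_linear_def)
  have mc: "\<And>l \<gamma>. l \<in> L \<Longrightarrow> \<gamma> \<in> small \<Longrightarrow> mono_series R l \<gamma> \<in> carrier A"
    using L(2) by (auto simp: small_def mono_series_closed)
  have "\<exists>t. (\<forall>b\<in>B. t b \<in> carrier R) \<and> (\<exists>b\<in>B. t b \<noteq> \<zero>)
    \<and> (\<forall>z\<in>L \<times> small. (\<Oplus>b\<in>B. \<phi> b (mono_series R (fst z) (snd z)) {#} \<otimes> t b) = \<zero>)"
  proof (rule homogeneous_system)
    show "finite (L \<times> small)" "finite B" "card (L \<times> small) < card B"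
      using L(1) finite_small B(1,2) neg by (auto simp: card_cartesian_product)
    show "\<phi> b (mono_series R (fst z) (snd z)) {#} \<in> carrier R" if "z \<in> L \<times> small" "b \<in> B" for z b
      using that by (intro coeff_closed \<phi>c mc) auto
  qed
  then obtain t where h: "(\<forall>b\<in>B. t b \<in> carrier R) \<and> (\<exists>b\<in>B. t b \<noteq> \<zero>)
    \<and> (\<forall>z\<in>L \<times> small. (\<Oplus>b\<in>B. \<phi> b (mono_series R (fst z) (snd z)) {#} \<otimes> t b) = \<zero>)" ..
  note t = bspec[OF conjunct1[OF h]] conjunct1[OF conjunct2[OF h]] bspec[OF conjunct2[OF conjunct2[OF h]]]
  define k where "k = (\<lambda>b. mono_series R (t b) ({#} :: 'i multiset))"
  have kc: "\<And>b. b \<in> B \<Longrightarrow> k b \<in> carrier A" using t(1) empty_Q by (simp add: k_def mono_series_closed)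
  have k0: "\<And>b. k b {#} = t b" by (simp add: k_def mono_series_def)
  define \<Phi> where "\<Phi> = (\<lambda>x. \<Oplus>\<^bsub>A\<^esub>b\<in>B. k b \<otimes>\<^bsub>A\<^esub> \<phi> b x)"
  have \<Phi>0: "\<Phi> x {#} = (\<Oplus>b\<in>B. \<phi> b x {#} \<otimes> t b)" if x: "x \<in> carrier A" for x
  proof -
    have "\<Phi> x {#} = (\<Oplus>b\<in>B. (k b \<otimes>\<^bsub>A\<^esub> \<phi> b x) {#})"
      unfolding \<Phi>_def using kc \<phi>c[OF _ x] B(1) by (intro coeff_finsum) auto
    also have "\<dots> = (\<Oplus>b\<in>B. \<phi> b x {#} \<otimes> t b)"
    proof (rule finsum_cong'[OF refl])
      fix b assume b: "b \<in> B"
      show "(k b \<otimes>\<^bsub>A\<^esub> \<phi> b x) {#} = \<phi> b x {#} \<otimes> t b"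
        using const_coeff_mult[OF kc[OF b] \<phi>c[OF b x]] t(1)[OF b] coeff_closed[OF \<phi>c[OF b x]]
        by (simp add: k0 m_comm)
    qed (use t(1) coeff_closed[OF \<phi>c[OF _ x]] in auto)
    finally show ?thesis .
  qed
  have "inv_linear \<Phi>"
    unfolding inv_linear_def
  proof (intro conjI ballI)
    fix x assume x: "x \<in> carrier A"
    show "\<Phi> x \<in> carrier A" unfolding \<Phi>_def using kc \<phi>c[OF _ x] by (intro A.finsum_closed) auto
    fix y assume y: "y \<in> carrier A"
    have "\<Phi> (x \<oplus>\<^bsub>A\<^esub> y) = (\<Oplus>\<^bsub>A\<^esub>b\<in>B. k b \<otimes>\<^bsub>A\<^esub> \<phi> b x \<oplus>\<^bsub>A\<^esub> k b \<otimes>\<^bsub>A\<^esub> \<phi> b y)"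
      unfolding \<Phi>_def using kc \<phi>c x y B(4)
      by (intro A.finsum_cong') (auto simp: inv_linear_def A.r_distr)
    also have "\<dots> = \<Phi> x \<oplus>\<^bsub>A\<^esub> \<Phi> y"
      unfolding \<Phi>_def using kc \<phi>c x y by (intro A.finsum_addf) auto
    finally show "\<Phi> (x \<oplus>\<^bsub>A\<^esub> y) = \<Phi> x \<oplus>\<^bsub>A\<^esub> \<Phi> y" .
  next
    fix s x assume s: "s \<in> carrier A" and x: "x \<in> carrier A"
    have "\<Phi> (s [^]\<^bsub>A\<^esub> q \<otimes>\<^bsub>A\<^esub> x) = (\<Oplus>\<^bsub>A\<^esub>b\<in>B. s \<otimes>\<^bsub>A\<^esub> (k b \<otimes>\<^bsub>A\<^esub> \<phi> b x))"
      unfolding \<Phi>_def using kc \<phi>c x s B(4)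
      by (intro A.finsum_cong') (auto simp: inv_linear_def A.m_lcomm)
    also have "\<dots> = s \<otimes>\<^bsub>A\<^esub> \<Phi> x"
      unfolding \<Phi>_def using kc \<phi>c x s B(1) by (intro A.finsum_rdistr[symmetric]) auto
    finally show "\<Phi> (s [^]\<^bsub>A\<^esub> q \<otimes>\<^bsub>A\<^esub> x) = s \<otimes>\<^bsub>A\<^esub> \<Phi> x" .
  qed
  then have vanish: "\<Phi> a {#} = \<zero>" if "a \<in> carrier A" for a
  proof (rule inv_linear_vanish[OF _ that L])
    fix l \<gamma> assume z: "l \<in> L" "\<gamma> \<in> small"
    show "\<Phi> (mono_series R l \<gamma>) {#} = \<zero>"
      unfolding \<Phi>0[OF mc[OF z]] using t(3)[of "(l, \<gamma>)"] z by simp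
  qed
  obtain d where d: "d \<in> B" "t d \<noteq> \<zero>" using t(2) by blast
  have dc: "d \<in> carrier A" using d(1) B(3) by blast
  have "\<Phi> d {#} = \<phi> d d {#} \<otimes> t d"
    unfolding \<Phi>0[OF dc]
  proof (rule finsum_only[OF B(1) d(1)])
    show "\<phi> d d {#} \<otimes> t d \<in> carrier R" using coeff_closed[OF \<phi>c[OF d(1) dc]] t(1)[OF d(1)] by simp
    show "\<phi> b d {#} \<otimes> t b = \<zero>" if "b \<in> B" "b \<noteq> d" for b
      using B(5)[OF that(1) d(1)] that t(1) by (simp add: coeff_zero)
  qed
  also have "\<dots> = t d" using B(5)[OF d(1) d(1)] t(1)[OF d(1)] by (simp add: coeff_one)
  finally show False using vanish[OF dc] d(2) by simp
qed

section \<open>The free summand spanned by the small monomials\<close>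

definition good :: "'i multiset set"
  where "good = {m. \<exists>\<gamma>\<in>small. \<exists>k\<in>Q. m = \<gamma> + repeat_mset q k}"

text \<open>The part \<open>\<gamma>\<close> is recovered by reducing every facet value modulo
  \<open>q\<close>.\<close>

lemma small_unique:
  assumes "\<gamma> \<in> small" "\<gamma>' \<in> small" "k \<in> Q" "k' \<in> Q" "\<gamma> + repeat_mset q k = \<gamma>' + repeat_mset q k'"
  shows "\<gamma> = \<gamma>' \<and> k = k'"
proof -
  have "count \<gamma> j = count \<gamma>' j" for j
  proof (cases "j \<in> I")
    case True
    then have "count \<gamma> j < q" "count \<gamma>' j < q" using assms(1,2) by (auto simp: small_def)
    moreover have "count \<gamma> j + q * count k j = count \<gamma>' j + q * count k' j"
      using arg_cong[OF assms(5), of "\<lambda>m. count m j"] by simp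
    then have "(count \<gamma> j + q * count k j) mod q = (count \<gamma>' j + q * count k' j) mod q" by simp
    ultimately show ?thesis by simp
  next
    case False
    then have "j \<notin># \<gamma>" "j \<notin># \<gamma>'" using assms(1,2) Q_supported by (auto simp: small_def)
    then show ?thesis by (simp add: not_in_iff)
  qed
  then have "\<gamma> = \<gamma>'" by (simp add: multiset_eq_iff)
  then show ?thesis using assms(5) by (metis repeat_mset_inj[OF q_pos] add_left_cancel)
qed

text \<open>The equivalence makes \<open>good\<close> and its complement both stable under
  \<open>q\<close>-th powers of monomials, so that the two sets of series supported on them are
  submodules. In the implication from left to right the bounds on \<open>\<gamma>\<close> force
  \<open>k \<subseteq># l\<close>, and fullness puts \<open>l - k\<close> into
  \<open>Q\<close>.\<close>

lemma good_add:
  assumes m: "m \<in> Q" and k: "k \<in> Q"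
  shows "repeat_mset q k + m \<in> good \<longleftrightarrow> m \<in> good"
proof
  assume "m \<in> good"
  then obtain \<gamma> l where "\<gamma> \<in> small" "l \<in> Q" "m = \<gamma> + repeat_mset q l" by (auto simp: good_def)
  then show "repeat_mset q k + m \<in> good"
    using add_Q[OF k, of l] unfolding good_def
    by (intro CollectI bexI[of _ \<gamma>] bexI[of _ "k + l"]) (auto simp: multiset_eq_iff algebra_simps)
next
  assume "repeat_mset q k + m \<in> good"
  then obtain \<gamma> l where l: "\<gamma> \<in> small" "l \<in> Q" "repeat_mset q k + m = \<gamma> + repeat_mset q l"
    by (auto simp: good_def)
  have c: "q * count k j + count m j = count \<gamma> j + q * count l j" for j
    using arg_cong[OF l(3), of "\<lambda>m. count m j"] by simp
  have "k \<subseteq># l"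
  proof (rule mset_subset_eqI)
    fix j
    show "count k j \<le> count l j"
    proof (cases "j \<in> I")
      case True
      then have "count \<gamma> j < q" using l(1) by (simp add: small_def)
      then have "q * count k j < q * Suc (count l j)" using c[of j] by simp
      then show ?thesis using q_pos by (simp only: nat_mult_less_cancel1 less_Suc_eq_le)
    next
      case False
      then have "j \<notin># k" using k Q_supported by blast
      then show ?thesis by (simp add: not_in_iff)
    qed
  qed
  then have kl: "l - k \<in> Q" "l = k + (l - k)" using Q_full[OF k l(2)] by simp_all
  then have "repeat_mset q l = repeat_mset q k + repeat_mset q (l - k)"
    by (metis repeat_mset_distrib2)
  then have "m = \<gamma> + repeat_mset q (l - k)" using l(3) by (simp add: multiset_eq_iff)
  then show "m \<in> good" using l(1) kl(1) by (auto simp: good_def)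
qed

text \<open>The support of a \<open>q\<close>-th power consists of multiples of \<open>q\<close>, so
  stability under the monomials \<open>repeat_mset q k\<close> carries over to arbitrary
  series.\<close>

lemma supported_submodule:
  assumes Y: "\<And>m k. m \<in> Q \<Longrightarrow> k \<in> Q \<Longrightarrow> m \<in> Y \<Longrightarrow> repeat_mset q k + m \<in> Y"
  shows "submodule {P \<in> carrier A. \<forall>m. P m \<noteq> \<zero> \<longrightarrow> m \<in> Y} A M"
  unfolding submodule_pushforward
proof (intro conjI ballI)
  show "{P \<in> carrier A. \<forall>m. P m \<noteq> \<zero> \<longrightarrow> m \<in> Y} \<subseteq> carrier A" by blast
  show "\<zero>\<^bsub>A\<^esub> \<in> {P \<in> carrier A. \<forall>m. P m \<noteq> \<zero> \<longrightarrow> m \<in> Y}" by (simp add: coeff_zero)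
next
  fix x y assume "x \<in> {P \<in> carrier A. \<forall>m. P m \<noteq> \<zero> \<longrightarrow> m \<in> Y}" "y \<in> {P \<in> carrier A. \<forall>m. P m \<noteq> \<zero> \<longrightarrow> m \<in> Y}"
  then have x: "x \<in> carrier A" "\<And>m. m \<notin> Y \<Longrightarrow> x m = \<zero>" and y: "y \<in> carrier A" "\<And>m. m \<notin> Y \<Longrightarrow> y m = \<zero>"
    by blast+
  show "x \<oplus>\<^bsub>A\<^esub> y \<in> {P \<in> carrier A. \<forall>m. P m \<noteq> \<zero> \<longrightarrow> m \<in> Y}"
  proof (intro CollectI conjI allI impI)
    show "x \<oplus>\<^bsub>A\<^esub> y \<in> carrier A" using x y by simp
    show "m \<in> Y" if "(x \<oplus>\<^bsub>A\<^esub> y) m \<noteq> \<zero>" for m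
      using that x(2)[of m] y(2)[of m] by (cases "m \<in> Y") (auto simp: coeff_add)
  qed
next
  fix x assume "x \<in> {P \<in> carrier A. \<forall>m. P m \<noteq> \<zero> \<longrightarrow> m \<in> Y}"
  then have x: "x \<in> carrier A" "\<And>m. m \<notin> Y \<Longrightarrow> x m = \<zero>" by blast+
  show "\<ominus>\<^bsub>A\<^esub> x \<in> {P \<in> carrier A. \<forall>m. P m \<noteq> \<zero> \<longrightarrow> m \<in> Y}"
  proof (intro CollectI conjI allI impI)
    show "\<ominus>\<^bsub>A\<^esub> x \<in> carrier A" using x by simp
    show "m \<in> Y" if "(\<ominus>\<^bsub>A\<^esub> x) m \<noteq> \<zero>" for m
      using that x(2)[of m] by (cases "m \<in> Y") (auto simp: coeff_a_inv[OF x(1)])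
  qed
  fix r assume r: "r \<in> carrier A"
  have rq: "r [^]\<^bsub>A\<^esub> q \<in> carrier A" using r by simp
  show "r [^]\<^bsub>A\<^esub> q \<otimes>\<^bsub>A\<^esub> x \<in> {P \<in> carrier A. \<forall>m. P m \<noteq> \<zero> \<longrightarrow> m \<in> Y}"
  proof (intro CollectI conjI allI impI)
    show "r [^]\<^bsub>A\<^esub> q \<otimes>\<^bsub>A\<^esub> x \<in> carrier A" using rq x by simp
    show "m \<in> Y" if nz: "(r [^]\<^bsub>A\<^esub> q \<otimes>\<^bsub>A\<^esub> x) m \<noteq> \<zero>" for m
    proof (rule ccontr)
      assume m: "m \<notin> Y"
      have "(r [^]\<^bsub>A\<^esub> q \<otimes>\<^bsub>A\<^esub> x) m = \<zero>"
        unfolding coeff_mult[OF rq x(1)]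
      proof (rule finsum_all_zero)
        fix z assume "z \<in> splits m"
        then obtain a b where z: "z = (a, b)" "a + b = m" by (cases z) auto
        have "(r [^]\<^bsub>A\<^esub> q) a \<otimes> x b = \<zero>"
        proof (cases "(r [^]\<^bsub>A\<^esub> q) a = \<zero> \<or> x b = \<zero>")
          case True
          then show ?thesis using coeff_closed[OF rq] coeff_closed[OF x(1)] by auto
        next
          case False
          then obtain k where "k \<in> Q" "a = repeat_mset q k" using coeff_frob_nonzero[OF r] by blast
          moreover have "b \<in> Y" "b \<in> Q" using False x(2) support_Q[OF x(1)] by blast+
          ultimately have "m \<in> Y" using Y z(2) by blast
          then show ?thesis using m by simp
        qed
        then show "(case z of (k, l) \<Rightarrow> (r [^]\<^bsub>A\<^esub> q) k \<otimes> x l) = \<zero>" using z(1) by simp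
      qed
      then show False using nz by simp
    qed
  qed
qed

lemma coeff_frob_mono:
  assumes P: "P \<in> carrier A" and l: "l \<in> carrier R" and \<gamma>: "\<gamma> \<in> small" "\<gamma>0 \<in> small" and k: "k \<in> Q"
  shows "(P [^]\<^bsub>A\<^esub> q \<otimes>\<^bsub>A\<^esub> mono_series R l \<gamma>) (\<gamma>0 + repeat_mset q k)
    = (if \<gamma> = \<gamma>0 then P k [^] q \<otimes> l else \<zero>)"
proof -
  have Pq: "P [^]\<^bsub>A\<^esub> q \<in> carrier A" using P by simp
  have \<gamma>Q: "\<gamma> \<in> Q" using \<gamma>(1) by (simp add: small_def)
  have e: "(P [^]\<^bsub>A\<^esub> q \<otimes>\<^bsub>A\<^esub> mono_series R l \<gamma>) m
      = (if \<gamma> \<subseteq># m then l \<otimes> (P [^]\<^bsub>A\<^esub> q) (m - \<gamma>) else \<zero>)" for m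
    using coeff_mono_mult[OF l \<gamma>Q Pq] A.m_comm[OF Pq mono_series_closed[OF l \<gamma>Q]] by simp
  show ?thesis
  proof (cases "\<gamma> = \<gamma>0")
    case True
    then show ?thesis using e l coeff_closed[OF P] by (simp add: coeff_frob_repeat[OF P] m_comm)
  next
    case False
    have "(P [^]\<^bsub>A\<^esub> q) (\<gamma>0 + repeat_mset q k - \<gamma>) = \<zero>" if s: "\<gamma> \<subseteq># \<gamma>0 + repeat_mset q k"
    proof (rule ccontr)
      assume "(P [^]\<^bsub>A\<^esub> q) (\<gamma>0 + repeat_mset q k - \<gamma>) \<noteq> \<zero>"
      then obtain k' where k': "k' \<in> Q" "\<gamma>0 + repeat_mset q k - \<gamma> = repeat_mset q k'"
        using coeff_frob_nonzero[OF P] by blast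
      have "\<gamma>0 + repeat_mset q k = \<gamma> + repeat_mset q k'"
        using subset_mset.add_diff_inverse[OF s] k'(2) by simp
      then show False using small_unique[OF \<gamma>(2,1) k k'(1)] False by blast
    qed
    then show ?thesis using e False l by simp
  qed
qed

text \<open>The direct sum is a partition of supports into \<open>good\<close> and its complement.
  On \<open>good\<close>, the coefficients at \<open>\<gamma> + repeat_mset q k\<close> for fixed
  \<open>\<gamma>\<close> are functions of \<open>k\<close>; expanding each in \<open>L\<close> and
  collecting the coordinates at \<open>l\<close> gives the series whose \<open>q\<close>-th power
  multiplies \<open>mono_series R l \<gamma>\<close>.\<close>

lemma free_rank_lower:
  assumes L: "finite L" "L \<subseteq> carrier R"
      "\<And>x. x \<in> carrier R \<Longrightarrow> \<exists>!c. c \<in> L \<rightarrow>\<^sub>E carrier R \<and> x = (\<Oplus>b\<in>L. c b [^] q \<otimes> b)"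
  shows "has_free_summand_of_rank A M (card L * card small)"
proof -
  have Lc: "\<And>l. l \<in> L \<Longrightarrow> l \<in> carrier R" using L(2) by blast
  have zq: "\<zero> [^] q = \<zero>" using nat_pow_zero[of q] q_pos by simp
  \<comment> \<open>A zero in \<open>L\<close> could receive any coordinate, against uniqueness.
    Only for nonzero \<open>l\<close> can the pair \<open>(l, \<gamma>)\<close> be recovered from
    its series, which gives the cardinality of the basis.\<close>
  have L0: "l \<noteq> \<zero>" if l: "l \<in> L" for l
  proof
    assume l0: "l = \<zero>"
    define c where "c = (\<lambda>x. \<lambda>b\<in>L. if b = l then x else \<zero>)"
    have c0: "(\<Oplus>b\<in>L. c x b [^] q \<otimes> b) = \<zero>" if "x \<in> carrier R" for x
      using that l0 Lc zq by (intro finsum_all_zero) (auto simp: c_def)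
    have "c x \<in> L \<rightarrow>\<^sub>E carrier R \<and> \<zero> = (\<Oplus>b\<in>L. c x b [^] q \<otimes> b)" if "x \<in> carrier R" for x
      using c0[OF that] that by (auto simp: c_def)
    then have "c \<zero> = c \<one>" using L(3)[OF zero_closed] by blast
    then have "c \<zero> l = c \<one> l" by simp
    then show False using l by (simp add: c_def)
  qed
  define F where "F = {P \<in> carrier A. \<forall>m. P m \<noteq> \<zero> \<longrightarrow> m \<in> good}"
  define N where "N = {P \<in> carrier A. \<forall>m. P m \<noteq> \<zero> \<longrightarrow> m \<in> - good}"
  have Fsub: "submodule F A M" unfolding F_def by (rule supported_submodule) (simp add: good_add)
  have Nsub: "submodule N A M" unfolding N_def by (rule supported_submodule) (simp add: good_add)
  have sum: "F <+>\<^bsub>M\<^esub> N = carrier M"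
  proof
    show "F <+>\<^bsub>M\<^esub> N \<subseteq> carrier M"
      by (auto simp: set_add_def set_mult_def frobenius_pushforward_def F_def N_def)
    show "carrier M \<subseteq> F <+>\<^bsub>M\<^esub> N"
    proof
      fix P assume "P \<in> carrier M"
      then have P: "P \<in> carrier A" by (simp add: frobenius_pushforward_def)
      define f where "f = (\<lambda>m. if m \<in> good then P m else \<zero>)"
      define n where "n = (\<lambda>m. if m \<in> good then \<zero> else P m)"
      have "f \<in> F" "n \<in> N" using P by (auto simp: F_def N_def f_def n_def carrier_A)
      moreover have "P = f \<oplus>\<^bsub>A\<^esub> n" using coeff_closed[OF P] by (auto simp: fun_eq_iff coeff_add f_def n_def)
      ultimately show "P \<in> F <+>\<^bsub>M\<^esub> N"
        by (auto simp: set_add_def set_mult_def frobenius_pushforward_def)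
    qed
  qed
  have int: "F \<inter> N = {\<zero>\<^bsub>M\<^esub>}"
  proof
    show "{\<zero>\<^bsub>M\<^esub>} \<subseteq> F \<inter> N" by (auto simp: F_def N_def frobenius_pushforward_def coeff_zero)
    show "F \<inter> N \<subseteq> {\<zero>\<^bsub>M\<^esub>}"
    proof
      fix P assume "P \<in> F \<inter> N"
      then have "P m = \<zero>" for m by (auto simp: F_def N_def)
      then have "P = \<zero>\<^bsub>A\<^esub>" by (simp add: fun_eq_iff coeff_zero)
      then show "P \<in> {\<zero>\<^bsub>M\<^esub>}" by (simp add: frobenius_pushforward_def)
    qed
  qed
  define mo where "mo = (\<lambda>z. mono_series R (fst z) (snd z) :: 'i multiset \<Rightarrow> 'a)"
  define Z where "Z = L \<times> small"
  define B where "B = mo ` Z"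
  have fZ: "finite Z" using L(1) finite_small by (simp add: Z_def)
  have moc: "\<And>z. z \<in> Z \<Longrightarrow> mo z \<in> carrier A"
    using Lc by (auto simp: Z_def mo_def small_def intro!: mono_series_closed)
  have inj: "inj_on mo Z"
  proof (rule inj_onI)
    fix z z' assume z: "z \<in> Z" "z' \<in> Z" "mo z = mo z'"
    have 1: "mo z (snd z) = fst z" by (simp add: mo_def mono_series_def)
    have "fst z \<noteq> \<zero>" using z(1) L0 by (auto simp: Z_def)
    then have "mo z' (snd z) \<noteq> \<zero>" using 1 z(3) by simp
    then have "snd z = snd z'" by (auto simp: mo_def mono_series_def split: if_splits)
    moreover have "mo z' (snd z') = fst z'" by (simp add: mo_def mono_series_def)
    ultimately show "z = z'" using 1 z(3) by (simp add: prod_eq_iff)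
  qed
  have cardB: "card B = card L * card small"
    unfolding B_def by (simp add: card_image[OF inj]) (simp add: Z_def card_cartesian_product)
  have moF: "mo z \<in> F" if z: "z \<in> Z" for z
  proof -
    have "snd z \<in> good"
      using z empty_Q unfolding good_def Z_def by (intro CollectI bexI[of _ "snd z"] bexI[of _ "{#}"]) auto
    then show ?thesis using moc[OF z] by (auto simp: F_def mo_def mono_series_def split: if_splits)
  qed
  \<comment> \<open>Evaluation at \<open>\<gamma> + repeat_mset q k\<close> isolates the basis
    elements with this \<open>\<gamma>\<close> and the coefficient at the single \<open>k\<close>.
    Existence and uniqueness of coordinates are both read off from this formula.\<close>
  have S: "(\<Oplus>\<^bsub>A\<^esub>b\<in>B. c b [^]\<^bsub>A\<^esub> q \<otimes>\<^bsub>A\<^esub> b) (\<gamma> + repeat_mset q k) = (\<Oplus>l\<in>L. c (mo (l, \<gamma>)) k [^] q \<otimes> l)"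
    if c: "\<And>b. b \<in> B \<Longrightarrow> c b \<in> carrier A" and \<gamma>: "\<gamma> \<in> small" and k: "k \<in> Q" for c \<gamma> k
  proof -
    have cz: "\<And>z. z \<in> Z \<Longrightarrow> c (mo z) \<in> carrier A" using c by (simp add: B_def)
    have cl: "\<And>l. l \<in> L \<Longrightarrow> c (mo (l, \<gamma>)) k \<in> carrier R"
      using coeff_closed[OF cz] \<gamma> by (simp add: Z_def)
    have "(\<Oplus>\<^bsub>A\<^esub>b\<in>B. c b [^]\<^bsub>A\<^esub> q \<otimes>\<^bsub>A\<^esub> b) = (\<Oplus>\<^bsub>A\<^esub>z\<in>Z. c (mo z) [^]\<^bsub>A\<^esub> q \<otimes>\<^bsub>A\<^esub> mo z)"
      unfolding B_def using cz moc inj by (intro A.finsum_reindex) auto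
    then have "(\<Oplus>\<^bsub>A\<^esub>b\<in>B. c b [^]\<^bsub>A\<^esub> q \<otimes>\<^bsub>A\<^esub> b) (\<gamma> + repeat_mset q k)
        = (\<Oplus>z\<in>Z. (c (mo z) [^]\<^bsub>A\<^esub> q \<otimes>\<^bsub>A\<^esub> mo z) (\<gamma> + repeat_mset q k))"
      using cz moc fZ by (simp add: coeff_finsum)
    also have "\<dots> = (\<Oplus>z\<in>Z. if snd z = \<gamma> then c (mo z) k [^] q \<otimes> fst z else \<zero>)"
    proof (rule finsum_cong'[OF refl])
      fix z assume z: "z \<in> Z"
      then have zz: "fst z \<in> carrier R" "snd z \<in> small" using Lc by (auto simp: Z_def)
      show "(c (mo z) [^]\<^bsub>A\<^esub> q \<otimes>\<^bsub>A\<^esub> mo z) (\<gamma> + repeat_mset q k) = (if snd z = \<gamma> then c (mo z) k [^] q \<otimes> fst z else \<zero>)"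
        using coeff_frob_mono[OF cz[OF z] zz(1,2) \<gamma> k] by (simp add: mo_def)
    next
      show "(\<lambda>z. if snd z = \<gamma> then c (mo z) k [^] q \<otimes> fst z else \<zero>) \<in> Z \<rightarrow> carrier R"
        using coeff_closed[OF cz] Lc by (auto simp: Z_def)
    qed
    also have "\<dots> = (\<Oplus>z\<in>(\<lambda>l. (l, \<gamma>)) ` L. c (mo z) k [^] q \<otimes> fst z)"
    proof (rule add.finprod_mono_neutral_cong_right[OF fZ])
      show "(\<lambda>l. (l, \<gamma>)) ` L \<subseteq> Z" using \<gamma> by (auto simp: Z_def)
      show "(if snd z = \<gamma> then c (mo z) k [^] q \<otimes> fst z else \<zero>) = \<zero>" if "z \<in> Z - (\<lambda>l. (l, \<gamma>)) ` L" for z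
        using that by (cases z) (auto simp: Z_def)
      show "(if snd z = \<gamma> then c (mo z) k [^] q \<otimes> fst z else \<zero>) = c (mo z) k [^] q \<otimes> fst z"
        if "z \<in> (\<lambda>l. (l, \<gamma>)) ` L" for z using that by auto
      show "(\<lambda>z. if snd z = \<gamma> then c (mo z) k [^] q \<otimes> fst z else \<zero>) \<in> Z \<rightarrow> carrier R"
        using coeff_closed[OF cz] Lc by (auto simp: Z_def)
    qed
    also have "\<dots> = (\<Oplus>l\<in>L. c (mo (l, \<gamma>)) k [^] q \<otimes> l)"
      using cl Lc by (subst finsum_reindex) (auto simp: inj_on_def)
    finally show ?thesis .
  qed
  have S_F: "(\<Oplus>\<^bsub>A\<^esub>b\<in>B. c b [^]\<^bsub>A\<^esub> q \<otimes>\<^bsub>A\<^esub> b) \<in> F" if c: "\<And>b. b \<in> B \<Longrightarrow> c b \<in> carrier A" for c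
  proof -
    note Fs = Fsub[unfolded submodule_pushforward]
    have "(\<Oplus>\<^bsub>A\<^esub>b\<in>B'. c b [^]\<^bsub>A\<^esub> q \<otimes>\<^bsub>A\<^esub> b) \<in> F" if "finite B'" "B' \<subseteq> B" for B'
      using that
    proof (induction B' rule: finite_induct)
      case empty
      then show ?case using Fs by simp
    next
      case (insert b B')
      have "b \<in> F" using insert.prems moF by (auto simp: B_def)
      then have "c b [^]\<^bsub>A\<^esub> q \<otimes>\<^bsub>A\<^esub> b \<in> F" using insert.prems c Fs by blast
      moreover have "\<And>y. y \<in> insert b B' \<Longrightarrow> c y [^]\<^bsub>A\<^esub> q \<otimes>\<^bsub>A\<^esub> y \<in> carrier A"
        using insert.prems c moc by (auto simp: B_def)
      ultimately show ?case using insert Fs by (subst A.finsum_insert) auto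
    qed
    then show ?thesis using fZ by (simp add: B_def)
  qed
  have F_eq: "P = P'" if "P \<in> F" "P' \<in> F" "\<And>\<gamma> k. \<gamma> \<in> small \<Longrightarrow> k \<in> Q \<Longrightarrow> P (\<gamma> + repeat_mset q k) = P' (\<gamma> + repeat_mset q k)" for P P'
  proof
    fix m show "P m = P' m"
    proof (cases "m \<in> good")
      case True
      then show ?thesis using that(3) by (auto simp: good_def)
    next
      case False
      then have "P m = \<zero>" "P' m = \<zero>" using that(1,2) by (auto simp: F_def)
      then show ?thesis by simp
    qed
  qed
  have "module_basis A M F B"
    unfolding module_basis_def finsum_pushforward
  proof (intro conjI ballI)
    show "finite B" using fZ by (simp add: B_def)
    show "B \<subseteq> F" using moF by (auto simp: B_def)
    fix P assume P: "P \<in> F"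
    then have Pc: "P \<in> carrier A" by (simp add: F_def)
    define co where "co = (\<lambda>y. THE c. c \<in> L \<rightarrow>\<^sub>E carrier R \<and> y = (\<Oplus>b\<in>L. c b [^] q \<otimes> b))"
    have co: "co y \<in> L \<rightarrow>\<^sub>E carrier R" "y = (\<Oplus>b\<in>L. co y b [^] q \<otimes> b)" if "y \<in> carrier R" for y
      using theI'[OF L(3)[OF that]] by (auto simp: co_def)
    define cf where "cf = (\<lambda>z k. if k \<in> Q then co (P (snd z + repeat_mset q k)) (fst z) else \<zero>)"
    define c where "c = (\<lambda>b\<in>B. cf (inv_into Z mo b))"
    have cm: "c (mo z) = cf z" if "z \<in> Z" for z
      using that inj by (simp add: c_def B_def)
    have cfc: "cf z \<in> carrier A" if z: "z \<in> Z" for z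
      unfolding carrier_A
    proof (intro conjI allI impI)
      fix k
      have "co (P (snd z + repeat_mset q k)) \<in> L \<rightarrow>\<^sub>E carrier R" by (rule co(1)[OF coeff_closed[OF Pc]])
      then have "co (P (snd z + repeat_mset q k)) (fst z) \<in> carrier R" using z by (auto simp: Z_def)
      then show "cf z k \<in> carrier R" by (simp add: cf_def)
      show "k \<notin> Q \<Longrightarrow> cf z k = \<zero>" by (simp add: cf_def)
    qed
    have cc: "c b \<in> carrier A" if "b \<in> B" for b using that cm cfc by (auto simp: B_def)
    have "P = (\<Oplus>\<^bsub>A\<^esub>b\<in>B. c b [^]\<^bsub>A\<^esub> q \<otimes>\<^bsub>A\<^esub> b)"
    proof (rule F_eq[OF P S_F[OF cc]])
      fix \<gamma> k assume g: "\<gamma> \<in> small" "k \<in> Q"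
      have "(\<Oplus>\<^bsub>A\<^esub>b\<in>B. c b [^]\<^bsub>A\<^esub> q \<otimes>\<^bsub>A\<^esub> b) (\<gamma> + repeat_mset q k) = (\<Oplus>l\<in>L. c (mo (l, \<gamma>)) k [^] q \<otimes> l)"
        by (rule S[OF cc g])
      also have "\<dots> = (\<Oplus>l\<in>L. co (P (\<gamma> + repeat_mset q k)) l [^] q \<otimes> l)"
      proof (rule finsum_cong'[OF refl])
        show "(\<lambda>l. co (P (\<gamma> + repeat_mset q k)) l [^] q \<otimes> l) \<in> L \<rightarrow> carrier R"
          using co(1)[OF coeff_closed[OF Pc], of "\<gamma> + repeat_mset q k"] Lc by (auto simp: PiE_mem)
        show "c (mo (l, \<gamma>)) k [^] q \<otimes> l = co (P (\<gamma> + repeat_mset q k)) l [^] q \<otimes> l" if "l \<in> L" for l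
          using cm[of "(l, \<gamma>)"] that g by (simp add: Z_def cf_def)
      qed
      also have "\<dots> = P (\<gamma> + repeat_mset q k)" using co(2)[OF coeff_closed[OF Pc]] by simp
      finally show "P (\<gamma> + repeat_mset q k) = (\<Oplus>\<^bsub>A\<^esub>b\<in>B. c b [^]\<^bsub>A\<^esub> q \<otimes>\<^bsub>A\<^esub> b) (\<gamma> + repeat_mset q k)" ..
    qed
    moreover have "c \<in> B \<rightarrow>\<^sub>E carrier A" using cc by (auto simp: c_def)
    moreover have "c' = c''" if c': "c' \<in> B \<rightarrow>\<^sub>E carrier A" "P = (\<Oplus>\<^bsub>A\<^esub>b\<in>B. c' b [^]\<^bsub>A\<^esub> q \<otimes>\<^bsub>A\<^esub> b)"
      and c'': "c'' \<in> B \<rightarrow>\<^sub>E carrier A" "P = (\<Oplus>\<^bsub>A\<^esub>b\<in>B. c'' b [^]\<^bsub>A\<^esub> q \<otimes>\<^bsub>A\<^esub> b)" for c' c''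
    proof (rule PiE_ext[OF c'(1) c''(1)])
      have m: "\<And>b. b \<in> B \<Longrightarrow> c' b \<in> carrier A" "\<And>b. b \<in> B \<Longrightarrow> c'' b \<in> carrier A"
        using c'(1) c''(1) by auto
      fix b assume "b \<in> B"
      then obtain l \<gamma> where z: "l \<in> L" "\<gamma> \<in> small" "b = mo (l, \<gamma>)" by (auto simp: B_def Z_def)
      have inB: "\<And>l. l \<in> L \<Longrightarrow> mo (l, \<gamma>) \<in> B" using z(2) by (auto simp: B_def Z_def)
      have bB: "b \<in> B" by fact
      show "c' b = c'' b"
      proof
        fix k
        show "c' b k = c'' b k"
        proof (cases "k \<in> Q")
          case False
          then show ?thesis using coeff_outside m bB by metis
        next
          case True
          define u where "u = (\<lambda>c :: ('i multiset \<Rightarrow> 'a) \<Rightarrow> ('i multiset \<Rightarrow> 'a). \<lambda>l\<in>L. c (mo (l, \<gamma>)) k)"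
          have ue: "(\<Oplus>l\<in>L. u c l [^] q \<otimes> l) = (\<Oplus>l\<in>L. c (mo (l, \<gamma>)) k [^] q \<otimes> l)"
            if "\<And>b. b \<in> B \<Longrightarrow> c b \<in> carrier A" for c
            using coeff_closed[OF that] inB Lc by (intro finsum_cong') (auto simp: u_def)
          have "u c' \<in> L \<rightarrow>\<^sub>E carrier R" "u c'' \<in> L \<rightarrow>\<^sub>E carrier R"
            using coeff_closed[OF m(1)] coeff_closed[OF m(2)] inB by (auto simp: u_def)
          moreover have "P (\<gamma> + repeat_mset q k) = (\<Oplus>l\<in>L. u c' l [^] q \<otimes> l)"
            by (rule trans[OF trans[OF fun_cong[OF c'(2)] S[OF m(1) z(2) True]] ue[OF m(1), symmetric]])
          moreover have "P (\<gamma> + repeat_mset q k) = (\<Oplus>l\<in>L. u c'' l [^] q \<otimes> l)"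
            by (rule trans[OF trans[OF fun_cong[OF c''(2)] S[OF m(2) z(2) True]] ue[OF m(2), symmetric]])
          ultimately have "u c' = u c''" using L(3)[OF coeff_closed[OF Pc]] by blast
          then have "u c' l = u c'' l" by simp
          then show ?thesis using z by (simp add: u_def)
        qed
      qed
    qed
    ultimately have "\<exists>!c. c \<in> B \<rightarrow>\<^sub>E carrier A \<and> P = (\<Oplus>\<^bsub>A\<^esub>b\<in>B. c b [^]\<^bsub>A\<^esub> q \<otimes>\<^bsub>A\<^esub> b)"
      by (intro ex1I[of _ c]) blast+
    then show "\<exists>!c. c \<in> B \<rightarrow>\<^sub>E carrier A \<and> P = (\<Oplus>\<^bsub>A\<^esub>b\<in>B. c b \<odot>\<^bsub>M\<^esub> b)"
      by (simp add: frobenius_pushforward_def)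
  qed
  then show ?thesis
    unfolding has_free_summand_of_rank_def using Fsub Nsub sum int cardB by blast
qed

lemma max_free_rank_eq:
  assumes D: "dimension D (pth_powers p R) (carrier R)"
  shows "max_free_rank A M = D ^ e * card small"
proof -
  from basis_over_pth_powers[OF prime_p char_p dimension_pth_powers[OF prime_p char_p D]]
  obtain L where h: "L \<subseteq> carrier R \<and> finite L \<and> card L = D ^ e
    \<and> (\<forall>x\<in>carrier R. \<exists>!c. c \<in> L \<rightarrow>\<^sub>E carrier R \<and> x = (\<Oplus>b\<in>L. c b [^] q \<otimes> b))" ..
  have L: "L \<subseteq> carrier R" "finite L" "card L = D ^ e" using h by simp_all
  have L4: "\<exists>!c. c \<in> L \<rightarrow>\<^sub>E carrier R \<and> x = (\<Oplus>b\<in>L. c b [^] q \<otimes> b)" if "x \<in> carrier R" for x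
    using h that by simp
  have up: "r \<le> D ^ e * card small" if "has_free_summand_of_rank A M r" for r
    using free_rank_upper[OF L(2,1) ex1_implies_ex[OF L4] that] L(3) by simp
  have lo: "has_free_summand_of_rank A M (D ^ e * card small)"
    using free_rank_lower[OF L(2,1) L4] L(3) by simp
  have "finite {r. has_free_summand_of_rank A M r}"
    by (rule finite_subset[of _ "{..D ^ e * card small}"]) (use up in auto)
  then show ?thesis unfolding max_free_rank_def using up lo by (intro Max_eqI) auto
qed

end

section \<open>The toric model of the hypersurface\<close>

text \<open>The monomials of \<open>S[[u,v]]/(f + uv)\<close> are encoded by their values on the facets of the cone they
  generate: \<open>(False, j)\<close> and \<open>(True, j)\<close> record the order of vanishing along \<open>x\<^sub>j = v = 0\<close> and along
  \<open>x\<^sub>j = u = 0\<close>. The integer \<open>t\<close> is the exponent of \<open>u\<close>, with \<open>v\<close> counted negatively.\<close>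
definition facet_monoid :: "nat \<Rightarrow> (nat \<Rightarrow> nat) \<Rightarrow> (bool \<times> nat) multiset set"
  where "facet_monoid n d = {m. set_mset m \<subseteq> UNIV \<times> {1..n} \<and>
    (\<exists>t::int. \<forall>j\<in>{1..n}. int (count m (True, j)) = int (count m (False, j)) + t * int (d j))}"

definition exponent_mset :: "nat \<Rightarrow> (nat \<Rightarrow> nat) \<Rightarrow> nat multiset"
  where "exponent_mset n d = (\<Sum>j\<in>{1..n}. replicate_mset (d j) j)"

lemma count_exponent_mset: "count (exponent_mset n d) j = (if j \<in> {1..n} then d j else 0)"
  by (simp add: exponent_mset_def count_sum)

lemma set_exponent_mset: "set_mset (exponent_mset n d) \<subseteq> {1..n}"
  using count_exponent_mset[of n d] by (metis count_eq_zero_iff subsetI)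

lemma count_image_Pair: "count (image_mset (Pair b) \<mu>) (c, j) = (if b = c then count \<mu> j else 0)"
proof (induction \<mu>)
  case (add x \<mu>)
  then show ?case by (cases "b = c") auto
qed simp

lemma uv_cases: "UNIV = {U, V}"
  using uv_var.exhaust by blast

lemma uv_mset_eqI: "count \<nu> U = count \<nu>' U \<Longrightarrow> count \<nu> V = count \<nu>' V \<Longrightarrow> \<nu> = \<nu>'"
  using uv_var.exhaust by (metis multiset_eqI)

lemma size_uv: "size \<nu> = count \<nu> U + count \<nu> V"
proof (induction \<nu>)
  case (add x \<nu>)
  then show ?case by (cases x) auto
qed simp

text \<open>Each variable of \<open>S\<close> has value 1 on both facets of its index;
  \<open>u\<close> has the values \<open>d j\<close> on the \<open>True\<close> side and
  \<open>v\<close> has them on the \<open>False\<close> side. Thus \<open>uv\<close> and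
  \<open>f\<close> have the same image, as the equation requires up to sign.\<close>

definition facet_map :: "nat \<Rightarrow> (nat \<Rightarrow> nat) \<Rightarrow> uv_var multiset \<times> nat multiset \<Rightarrow> (bool \<times> nat) multiset"
  where "facet_map n d x =
    image_mset (Pair False) (snd x) + image_mset (Pair True) (snd x)
    + repeat_mset (count (fst x) U) (image_mset (Pair True) (exponent_mset n d))
    + repeat_mset (count (fst x) V) (image_mset (Pair False) (exponent_mset n d))"

lemma facet_map_add:
  "facet_map n d (\<nu> + \<nu>', \<mu> + \<mu>') = facet_map n d (\<nu>, \<mu>) + facet_map n d (\<nu>', \<mu>')"
  by (simp add: facet_map_def multiset_eq_iff algebra_simps)

lemma count_facet_map:
  "count (facet_map n d (\<nu>, \<mu>)) (True, j) = count \<mu> j + count \<nu> U * count (exponent_mset n d) j"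
  "count (facet_map n d (\<nu>, \<mu>)) (False, j) = count \<mu> j + count \<nu> V * count (exponent_mset n d) j"
  by (simp_all add: facet_map_def count_image_Pair)

locale hypersurface = field K for K (structure) +
  fixes n :: nat and d :: "nat \<Rightarrow> nat"
  assumes n_pos: "n \<ge> 1" and d_pos: "\<And>j. j \<in> {1..n} \<Longrightarrow> d j > 0"
begin

definition QS :: "nat multiset set"
  where "QS = {\<mu>. set_mset \<mu> \<subseteq> {1..n}}"

lemma mem_QS [simp]: "\<mu> \<in> QS \<longleftrightarrow> set_mset \<mu> \<subseteq> {1..n}"
  by (simp add: QS_def)

abbreviation "S \<equiv> series_ring K QS"
abbreviation "T \<equiv> series_ring S (UNIV :: uv_var multiset set)"
abbreviation "E \<equiv> exponent_mset n d"
abbreviation "\<theta> \<equiv> facet_map n d"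
abbreviation "UV \<equiv> {#U, V#}"

lemma facet_map_mem:
  assumes "\<mu> \<in> QS"
  shows "\<theta> (\<nu>, \<mu>) \<in> facet_monoid n d"
proof -
  have "set_mset (\<theta> (\<nu>, \<mu>)) \<subseteq> UNIV \<times> {1..n}"
  proof
    fix x assume x: "x \<in># \<theta> (\<nu>, \<mu>)"
    obtain b j where bj: "x = (b, j)" by (cases x)
    have "count (\<theta> (\<nu>, \<mu>)) (b, j) \<noteq> 0" using x bj by simp
    then have "count \<mu> j \<noteq> 0 \<or> count E j \<noteq> 0" by (cases b) (auto simp: count_facet_map)
    then have "j \<in> {1..n}" using assms by (auto simp: count_exponent_mset split: if_splits)
    then show "x \<in> UNIV \<times> {1..n}" using bj by simp
  qed
  moreover have "\<forall>j\<in>{1..n}. int (count (\<theta> (\<nu>, \<mu>)) (True, j))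
      = int (count (\<theta> (\<nu>, \<mu>)) (False, j)) + (int (count \<nu> U) - int (count \<nu> V)) * int (d j)"
    by (simp add: count_facet_map count_exponent_mset algebra_simps)
  ultimately show ?thesis unfolding facet_monoid_def by blast
qed

text \<open>Every variable has a nonzero image because \<open>E\<close> is not empty. Bounding the
  source by the image makes all fibres finite.\<close>

lemma size_facet_map: "size \<nu> + size \<mu> \<le> size (\<theta> (\<nu>, \<mu>))"
proof -
  have "count E 1 > 0" using n_pos d_pos[of 1] by (simp add: count_exponent_mset)
  then have "E \<noteq> {#}" by auto
  then have E: "size E \<ge> 1" by (simp add: Suc_leI nonempty_has_size)
  define r where "r = (count \<nu> U + count \<nu> V) * size E"
  have "size (\<theta> (\<nu>, \<mu>)) = 2 * size \<mu> + r"
    by (simp add: facet_map_def r_def algebra_simps)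
  moreover have "count \<nu> U + count \<nu> V \<le> r"
    using mult_le_mono2[OF E, of "count \<nu> U + count \<nu> V"] by (simp only: r_def mult_1_right)
  ultimately show ?thesis unfolding size_uv by linarith
qed

definition fib :: "(bool \<times> nat) multiset \<Rightarrow> (uv_var multiset \<times> nat multiset) set"
  where "fib m = {x. snd x \<in> QS \<and> \<theta> x = m}"

lemma finite_fib: "finite (fib m)"
proof (rule finite_subset)
  show "fib m \<subseteq> {\<nu>. set_mset \<nu> \<subseteq> {U, V} \<and> size \<nu> < Suc (size m)} \<times> {\<mu>. set_mset \<mu> \<subseteq> {1..n} \<and> size \<mu> < Suc (size m)}"
  proof
    fix x assume x: "x \<in> fib m"
    obtain \<nu> \<mu> where e: "x = (\<nu>, \<mu>)" by (cases x)
    then show "x \<in> {\<nu>. set_mset \<nu> \<subseteq> {U, V} \<and> size \<nu> < Suc (size m)} \<times> {\<mu>. set_mset \<mu> \<subseteq> {1..n} \<and> size \<mu> < Suc (size m)}"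
      using x size_facet_map[of \<nu> \<mu>] by (auto simp: fib_def uv_cases[symmetric])
  qed
  show "finite ({\<nu>. set_mset \<nu> \<subseteq> {U, V} \<and> size \<nu> < Suc (size m)} \<times> {\<mu>. set_mset \<mu> \<subseteq> {1..n} \<and> size \<mu> < Suc (size m)})"
    by (intro finite_cartesian_product finite_supported_size_less) auto
qed

text \<open>Members of one fibre differ by trading powers of \<open>f\<close> for powers of
  \<open>uv\<close>. Comparing the two facets of index 1 shows that the difference of the exponents
  of \<open>u\<close> and \<open>v\<close> is constant on a fibre, and a member not divisible by
  \<open>uv\<close> has the least exponents.\<close>

lemma fib_structure:
  assumes \<nu>: "\<not> UV \<subseteq># \<nu>" and e: "\<theta> (\<nu>', \<mu>') = \<theta> (\<nu>, \<mu>)"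
  shows "\<exists>s. \<nu>' = \<nu> + repeat_mset s UV \<and> \<mu> = \<mu>' + repeat_mset s E"
proof -
  have c1: "count \<mu>' j + count \<nu>' U * count E j = count \<mu> j + count \<nu> U * count E j" for j
    using arg_cong[OF e, of "\<lambda>m. count m (True, j)"] by (simp add: count_facet_map)
  have c2: "count \<mu>' j + count \<nu>' V * count E j = count \<mu> j + count \<nu> V * count E j" for j
    using arg_cong[OF e, of "\<lambda>m. count m (False, j)"] by (simp add: count_facet_map)
  have E1: "count E 1 > 0" using n_pos d_pos[of 1] by (simp add: count_exponent_mset)
  have "count \<nu>' U * count E 1 + count \<nu> V * count E 1 = count \<nu>' V * count E 1 + count \<nu> U * count E 1"
    using c1[of 1] c2[of 1] by linarith
  then have "(count \<nu>' U + count \<nu> V) * count E 1 = (count \<nu>' V + count \<nu> U) * count E 1"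
    by (simp add: algebra_simps)
  then have eq: "count \<nu>' U + count \<nu> V = count \<nu>' V + count \<nu> U"
    using E1 by (metis mult_cancel2 less_numeral_extra(3))
  have "count \<nu> U = 0 \<or> count \<nu> V = 0"
  proof (rule ccontr)
    assume a: "\<not> (count \<nu> U = 0 \<or> count \<nu> V = 0)"
    have "UV \<subseteq># \<nu>"
    proof (rule mset_subset_eqI)
      fix x show "count UV x \<le> count \<nu> x"
        using a by (cases x) (auto simp: Suc_le_eq)
    qed
    then show False using \<nu> by simp
  qed
  then obtain s where s: "count \<nu>' U = count \<nu> U + s" "count \<nu>' V = count \<nu> V + s"
    using eq by (metis add.commute add.right_neutral add_0)
  have "\<nu>' = \<nu> + repeat_mset s UV" using s by (intro uv_mset_eqI) simp_all
  moreover have "\<mu> = \<mu>' + repeat_mset s E"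
  proof (rule multiset_eqI)
    fix j show "count \<mu> j = count (\<mu>' + repeat_mset s E) j"
      using c1[of j] s by (simp add: algebra_simps)
  qed
  ultimately show ?thesis by blast
qed

sublocale SS: monoid_series K QS
  by unfold_locales auto

sublocale TT: monoid_series S "UNIV :: uv_var multiset set"
  by (intro monoid_series.intro SS.cring_A monoid_series_axioms.intro) auto

text \<open>The integers \<open>t\<close> add and subtract together with the monomials: the monoid
  consists of the nonnegative points of a lattice, and such a monoid is full.\<close>

lemma facet_monoid_affine: "affine_series K (facet_monoid n d) (UNIV \<times> {1..n})"
proof
  show "{#} \<in> facet_monoid n d" by (auto simp: facet_monoid_def)
  fix k l assume k: "k \<in> facet_monoid n d"
  then obtain t :: int where t: "set_mset k \<subseteq> UNIV \<times> {1..n}"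
    "\<And>j. j \<in> {1..n} \<Longrightarrow> int (count k (True, j)) = int (count k (False, j)) + t * int (d j)"
    unfolding facet_monoid_def by blast
  show "set_mset k \<subseteq> UNIV \<times> {1..n}" by fact
  assume l: "l \<in> facet_monoid n d"
  then obtain s :: int where s: "set_mset l \<subseteq> UNIV \<times> {1..n}"
    "\<And>j. j \<in> {1..n} \<Longrightarrow> int (count l (True, j)) = int (count l (False, j)) + s * int (d j)"
    unfolding facet_monoid_def by blast
  have "\<forall>j\<in>{1..n}. int (count (k + l) (True, j)) = int (count (k + l) (False, j)) + (t + s) * int (d j)"
    using t(2) s(2) by (simp add: algebra_simps)
  moreover have "set_mset (k + l) \<subseteq> UNIV \<times> {1..n}" using t(1) s(1) by simp
  ultimately show "k + l \<in> facet_monoid n d" unfolding facet_monoid_def by blast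
  assume kl: "k \<subseteq># l"
  have c: "int (count (l - k) x) = int (count l x) - int (count k x)" for x
    using mset_subset_eq_count[OF kl, of x] by simp
  have "\<forall>j\<in>{1..n}. int (count (l - k) (True, j)) = int (count (l - k) (False, j)) + (s - t) * int (d j)"
    unfolding c using t(2) s(2) by (simp add: algebra_simps)
  moreover have "set_mset (l - k) \<subseteq> UNIV \<times> {1..n}" using s(1) by (meson in_diffD subset_eq)
  ultimately show "l - k \<in> facet_monoid n d" unfolding facet_monoid_def by blast
qed auto

sublocale AA: affine_series K "facet_monoid n d" "UNIV \<times> {1..n}"
  by (rule facet_monoid_affine)

abbreviation "B \<equiv> series_ring K (facet_monoid n d)"

section \<open>The substitution of monomials by their facet values\<close>

lemma E_QS: "E \<in> QS"
  using set_exponent_mset by auto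

text \<open>The equation says \<open>f = - uv\<close>, while \<open>f\<close> and \<open>uv\<close>
  have equal facet values. Sending \<open>v\<close> to minus its monomial makes the two images
  cancel.\<close>

definition sgn_uv :: "uv_var multiset \<Rightarrow> 'a"
  where "sgn_uv \<nu> = (\<ominus> \<one>) [^] (count \<nu> V)"

lemma sgn_uv_closed [simp]: "sgn_uv \<nu> \<in> carrier K"
  by (simp add: sgn_uv_def)

lemma sgn_uv_add: "sgn_uv (\<nu> + \<nu>') = sgn_uv \<nu> \<otimes> sgn_uv \<nu>'"
  by (simp add: sgn_uv_def nat_pow_mult)

lemma minus_one_pow_square: "(\<ominus> \<one>) [^] (k::nat) \<otimes> (\<ominus> \<one>) [^] k = \<one>"
proof -
  have "(\<ominus> \<one>) [^] k \<otimes> (\<ominus> \<one>) [^] k = (\<ominus> \<one> \<otimes> \<ominus> \<one>) [^] k" by (rule nat_pow_distrib[symmetric]) auto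
  then show ?thesis by (simp add: l_minus r_minus)
qed

lemma sgn_uv_square: "sgn_uv \<nu> \<otimes> sgn_uv \<nu> = \<one>"
  by (simp add: sgn_uv_def minus_one_pow_square)

text \<open>The signed map on monomials, extended to series by summing over fibres; finiteness of
  the fibres makes every coefficient a finite sum.\<close>

definition \<Phi> :: "(uv_var multiset \<Rightarrow> nat multiset \<Rightarrow> 'a) \<Rightarrow> (bool \<times> nat) multiset \<Rightarrow> 'a"
  where "\<Phi> G m = (\<Oplus>x\<in>fib m. sgn_uv (fst x) \<otimes> G (fst x) (snd x))"

lemma T_coeff: "G \<in> carrier T \<Longrightarrow> G \<nu> \<mu> \<in> carrier K"
  using SS.coeff_closed[OF TT.coeff_closed] .

lemma T_carrier: "G \<in> carrier T \<longleftrightarrow> (\<forall>\<nu> \<mu>. G \<nu> \<mu> \<in> carrier K) \<and> (\<forall>\<nu> \<mu>. \<mu> \<notin> QS \<longrightarrow> G \<nu> \<mu> = \<zero>)"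
  unfolding TT.carrier_A SS.carrier_A by blast

lemma T_outside: "G \<in> carrier T \<Longrightarrow> \<mu> \<notin> QS \<Longrightarrow> G \<nu> \<mu> = \<zero>"
  unfolding T_carrier by blast

lemma T_add: "(G \<oplus>\<^bsub>T\<^esub> H) \<nu> \<mu> = G \<nu> \<mu> \<oplus> H \<nu> \<mu>"
  unfolding TT.coeff_add SS.coeff_add ..

lemma T_mult:
  assumes G: "G \<in> carrier T" and H: "H \<in> carrier T"
  shows "(G \<otimes>\<^bsub>T\<^esub> H) \<nu> \<mu> = (\<Oplus>z\<in>splits \<nu> \<times> splits \<mu>. G (fst (fst z)) (fst (snd z)) \<otimes> H (snd (fst z)) (snd (snd z)))"
proof -
  note Gc = TT.coeff_closed[OF G] and Hc = TT.coeff_closed[OF H]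
  have "(G \<otimes>\<^bsub>T\<^esub> H) \<nu> = (\<Oplus>\<^bsub>S\<^esub>z\<in>splits \<nu>. case z of (a, b) \<Rightarrow> G a \<otimes>\<^bsub>S\<^esub> H b)"
    by (rule TT.coeff_mult[OF G H])
  then have "(G \<otimes>\<^bsub>T\<^esub> H) \<nu> \<mu> = (\<Oplus>z\<in>splits \<nu>. (case z of (a, b) \<Rightarrow> G a \<otimes>\<^bsub>S\<^esub> H b) \<mu>)"
    using SS.coeff_finsum[of "splits \<nu>" "\<lambda>z. case z of (a, b) \<Rightarrow> G a \<otimes>\<^bsub>S\<^esub> H b" \<mu>] SS.mult_closed_A[OF Gc Hc]
    by (simp add: split_def)
  also have "\<dots> = (\<Oplus>x\<in>splits \<nu>. \<Oplus>y\<in>splits \<mu>. G (fst x) (fst y) \<otimes> H (snd x) (snd y))"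
  proof (rule finsum_cong'[OF refl])
    show "(\<lambda>x. \<Oplus>y\<in>splits \<mu>. G (fst x) (fst y) \<otimes> H (snd x) (snd y)) \<in> splits \<nu> \<rightarrow> carrier K"
      using T_coeff[OF G] T_coeff[OF H] by (intro Pi_I finsum_closed) auto
    show "(case x of (a, b) \<Rightarrow> G a \<otimes>\<^bsub>S\<^esub> H b) \<mu> = (\<Oplus>y\<in>splits \<mu>. G (fst x) (fst y) \<otimes> H (snd x) (snd y))" for x
      using SS.coeff_mult[OF Gc Hc, of "fst x" "snd x" \<mu>] by (simp add: split_def)
  qed
  also have "\<dots> = (\<Oplus>z\<in>splits \<nu> \<times> splits \<mu>. case z of (x, y) \<Rightarrow> G (fst x) (fst y) \<otimes> H (snd x) (snd y))"
    using T_coeff[OF G] T_coeff[OF H] by (intro finsum_Sigma) auto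
  finally show ?thesis by (simp add: split_def)
qed

lemma Phi_closed: "G \<in> carrier T \<Longrightarrow> \<Phi> G \<in> carrier B"
  unfolding AA.carrier_A
proof (intro conjI allI impI)
  assume G: "G \<in> carrier T"
  fix m
  show "\<Phi> G m \<in> carrier K" unfolding \<Phi>_def using T_coeff[OF G] by (intro finsum_closed) auto
  assume "m \<notin> facet_monoid n d"
  then have "fib m = {}" using facet_map_mem by (auto simp: fib_def)
  then show "\<Phi> G m = \<zero>" by (simp add: \<Phi>_def)
qed

lemma Phi_add:
  assumes "G \<in> carrier T" "H \<in> carrier T"
  shows "\<Phi> (G \<oplus>\<^bsub>T\<^esub> H) = \<Phi> G \<oplus>\<^bsub>B\<^esub> \<Phi> H"
proof
  fix m
  have "\<Phi> (G \<oplus>\<^bsub>T\<^esub> H) m = (\<Oplus>x\<in>fib m. sgn_uv (fst x) \<otimes> G (fst x) (snd x) \<oplus> sgn_uv (fst x) \<otimes> H (fst x) (snd x))"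
    unfolding \<Phi>_def T_add using T_coeff[OF assms(1)] T_coeff[OF assms(2)]
    by (intro finsum_cong') (auto simp: r_distr)
  also have "\<dots> = \<Phi> G m \<oplus> \<Phi> H m"
    unfolding \<Phi>_def using T_coeff[OF assms(1)] T_coeff[OF assms(2)] by (intro finsum_addf) auto
  finally show "\<Phi> (G \<oplus>\<^bsub>T\<^esub> H) m = (\<Phi> G \<oplus>\<^bsub>B\<^esub> \<Phi> H) m" unfolding AA.coeff_add .
qed

text \<open>A change of the order of summation: because the facet map is additive, a splitting of
  \<open>m\<close> with a point in each of the two fibres amounts to a point in the fibre of
  \<open>m\<close> with a splitting of that point.\<close>

lemma Phi_mult:
  assumes G: "G \<in> carrier T" and H: "H \<in> carrier T"
  shows "\<Phi> (G \<otimes>\<^bsub>T\<^esub> H) = \<Phi> G \<otimes>\<^bsub>B\<^esub> \<Phi> H"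
proof
  fix m
  note [simp] = T_coeff[OF G] T_coeff[OF H]
  define tm where "tm = (\<lambda>w. (sgn_uv (fst (fst w)) \<otimes> G (fst (fst w)) (snd (fst w)))
    \<otimes> (sgn_uv (fst (snd w)) \<otimes> H (fst (snd w)) (snd (snd w))))"
  have tc: "tm w \<in> carrier K" for w by (simp add: tm_def)
  define W where "W = (SIGMA z:splits m. fib (fst z) \<times> fib (snd z))"
  define W' where "W' = (SIGMA x:fib m. splits (fst x) \<times> splits (snd x))"
  have fW: "finite W" unfolding W_def using finite_fib by (intro finite_SigmaI) auto
  have "(\<Phi> G \<otimes>\<^bsub>B\<^esub> \<Phi> H) m = (\<Oplus>z\<in>splits m. \<Phi> G (fst z) \<otimes> \<Phi> H (snd z))"
    using AA.coeff_mult[OF Phi_closed[OF G] Phi_closed[OF H], of m] by (simp add: split_def)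
  also have "\<dots> = (\<Oplus>z\<in>splits m. \<Oplus>w\<in>fib (fst z) \<times> fib (snd z). tm w)"
  proof (rule finsum_cong'[OF refl])
    show "(\<lambda>z. \<Oplus>w\<in>fib (fst z) \<times> fib (snd z). tm w) \<in> splits m \<rightarrow> carrier K"
      using tc by (intro Pi_I finsum_closed) auto
    fix z
    have "\<Phi> G (fst z) \<otimes> \<Phi> H (snd z) = (\<Oplus>x\<in>fib (fst z). sgn_uv (fst x) \<otimes> G (fst x) (snd x) \<otimes> \<Phi> H (snd z))"
      unfolding \<Phi>_def[of G] using finite_fib AA.coeff_closed[OF Phi_closed[OF H]] by (intro finsum_ldistr) auto
    also have "\<dots> = (\<Oplus>x\<in>fib (fst z). \<Oplus>y\<in>fib (snd z). tm (x, y))"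
    proof (rule finsum_cong'[OF refl])
      show "(\<lambda>x. \<Oplus>y\<in>fib (snd z). tm (x, y)) \<in> fib (fst z) \<rightarrow> carrier K"
        using tc by (intro Pi_I finsum_closed) auto
      show "sgn_uv (fst x) \<otimes> G (fst x) (snd x) \<otimes> \<Phi> H (snd z) = (\<Oplus>y\<in>fib (snd z). tm (x, y))" for x
        unfolding \<Phi>_def[of H] tm_def fst_conv snd_conv using finite_fib by (intro finsum_rdistr) auto
    qed
    also have "\<dots> = (\<Oplus>w\<in>fib (fst z) \<times> fib (snd z). case w of (x, y) \<Rightarrow> tm (x, y))"
      using finite_fib tc by (intro finsum_Sigma) auto
    finally show "\<Phi> G (fst z) \<otimes> \<Phi> H (snd z) = (\<Oplus>w\<in>fib (fst z) \<times> fib (snd z). tm w)"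
      by (simp add: split_def)
  qed
  also have "\<dots> = (\<Oplus>zw\<in>W. case zw of (z, w) \<Rightarrow> tm w)"
    unfolding W_def using finite_fib tc by (intro finsum_Sigma) auto
  also have "\<dots> = (\<Oplus>xy\<in>W'. case xy of (x, y) \<Rightarrow> tm ((fst (fst y), fst (snd y)), (snd (fst y), snd (snd y))))"
  proof (rule finsum_bij_witness[where
      h = "\<lambda>(z, w). ((fst (fst w) + fst (snd w), snd (fst w) + snd (snd w)), ((fst (fst w), fst (snd w)), (snd (fst w), snd (snd w))))"
      and h' = "\<lambda>(x, y). ((\<theta> (fst (fst y), fst (snd y)), \<theta> (snd (fst y), snd (snd y))), ((fst (fst y), fst (snd y)), (snd (fst y), snd (snd y))))"])
    fix a assume "a \<in> W"
    then obtain \<nu>1 \<mu>1 \<nu>2 \<mu>2 where a: "a = ((\<theta> (\<nu>1, \<mu>1), \<theta> (\<nu>2, \<mu>2)), ((\<nu>1, \<mu>1), (\<nu>2, \<mu>2)))"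
      "\<theta> (\<nu>1, \<mu>1) + \<theta> (\<nu>2, \<mu>2) = m" "\<mu>1 \<in> QS" "\<mu>2 \<in> QS"
      by (auto simp: W_def fib_def)
    show "(\<lambda>(z, w). ((fst (fst w) + fst (snd w), snd (fst w) + snd (snd w)), ((fst (fst w), fst (snd w)), (snd (fst w), snd (snd w))))) a \<in> W'"
      using a by (simp add: W'_def fib_def facet_map_add)
    show "(\<lambda>(x, y). ((\<theta> (fst (fst y), fst (snd y)), \<theta> (snd (fst y), snd (snd y))), ((fst (fst y), fst (snd y)), (snd (fst y), snd (snd y)))))
      ((\<lambda>(z, w). ((fst (fst w) + fst (snd w), snd (fst w) + snd (snd w)), ((fst (fst w), fst (snd w)), (snd (fst w), snd (snd w))))) a) = a"
      using a(1) by simp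
    show "(case a of (z, w) \<Rightarrow> tm w) = (case (\<lambda>(z, w). ((fst (fst w) + fst (snd w), snd (fst w) + snd (snd w)), ((fst (fst w), fst (snd w)), (snd (fst w), snd (snd w))))) a of
        (x, y) \<Rightarrow> tm ((fst (fst y), fst (snd y)), (snd (fst y), snd (snd y))))"
      using a(1) by simp
  next
    fix b assume "b \<in> W'"
    then obtain \<nu>1 \<mu>1 \<nu>2 \<mu>2 where b: "b = ((\<nu>1 + \<nu>2, \<mu>1 + \<mu>2), ((\<nu>1, \<nu>2), (\<mu>1, \<mu>2)))"
      "\<theta> (\<nu>1 + \<nu>2, \<mu>1 + \<mu>2) = m" "\<mu>1 + \<mu>2 \<in> QS"
      by (auto simp: W'_def fib_def)
    show "(\<lambda>(x, y). ((\<theta> (fst (fst y), fst (snd y)), \<theta> (snd (fst y), snd (snd y))), ((fst (fst y), fst (snd y)), (snd (fst y), snd (snd y))))) b \<in> W"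
      using b by (simp add: W_def fib_def facet_map_add)
    show "(\<lambda>(z, w). ((fst (fst w) + fst (snd w), snd (fst w) + snd (snd w)), ((fst (fst w), fst (snd w)), (snd (fst w), snd (snd w)))))
      ((\<lambda>(x, y). ((\<theta> (fst (fst y), fst (snd y)), \<theta> (snd (fst y), snd (snd y))), ((fst (fst y), fst (snd y)), (snd (fst y), snd (snd y))))) b) = b"
      using b(1) by simp
    show "(case b of (x, y) \<Rightarrow> tm ((fst (fst y), fst (snd y)), (snd (fst y), snd (snd y)))) \<in> carrier K"
      using tc by (simp add: split_def)
  qed
  also have "\<dots> = (\<Oplus>x\<in>fib m. \<Oplus>y\<in>splits (fst x) \<times> splits (snd x). tm ((fst (fst y), fst (snd y)), (snd (fst y), snd (snd y))))"
    unfolding W'_def using finite_fib tc by (intro finsum_Sigma[symmetric]) auto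
  also have "\<dots> = \<Phi> (G \<otimes>\<^bsub>T\<^esub> H) m"
    unfolding \<Phi>_def
  proof (rule finsum_cong'[OF refl])
    show "(\<lambda>x. sgn_uv (fst x) \<otimes> (G \<otimes>\<^bsub>T\<^esub> H) (fst x) (snd x)) \<in> fib m \<rightarrow> carrier K"
      using T_coeff[OF TT.mult_closed_A[OF G H]] by auto
    fix x
    have "sgn_uv (fst x) \<otimes> (G \<otimes>\<^bsub>T\<^esub> H) (fst x) (snd x)
      = (\<Oplus>y\<in>splits (fst x) \<times> splits (snd x). sgn_uv (fst x) \<otimes> (G (fst (fst y)) (fst (snd y)) \<otimes> H (snd (fst y)) (snd (snd y))))"
      unfolding T_mult[OF G H] by (intro finsum_rdistr) auto
    also have "\<dots> = (\<Oplus>y\<in>splits (fst x) \<times> splits (snd x). tm ((fst (fst y), fst (snd y)), (snd (fst y), snd (snd y))))"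
    proof (rule finsum_cong'[OF refl])
      fix y assume "y \<in> splits (fst x) \<times> splits (snd x)"
      then have "fst x = fst (fst y) + snd (fst y)" by (cases y) auto
      then have "sgn_uv (fst x) = sgn_uv (fst (fst y)) \<otimes> sgn_uv (snd (fst y))" by (simp only: sgn_uv_add)
      then show "sgn_uv (fst x) \<otimes> (G (fst (fst y)) (fst (snd y)) \<otimes> H (snd (fst y)) (snd (snd y)))
        = tm ((fst (fst y), fst (snd y)), (snd (fst y), snd (snd y)))"
        by (simp add: tm_def m_ac)
    qed (use tc in auto)
    finally show "(\<Oplus>y\<in>splits (fst x) \<times> splits (snd x). tm ((fst (fst y), fst (snd y)), (snd (fst y), snd (snd y))))
      = sgn_uv (fst x) \<otimes> (G \<otimes>\<^bsub>T\<^esub> H) (fst x) (snd x)" ..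
  qed
  finally show "\<Phi> (G \<otimes>\<^bsub>T\<^esub> H) m = (\<Phi> G \<otimes>\<^bsub>B\<^esub> \<Phi> H) m" ..
qed

end

section \<open>Surjectivity and kernel of the substitution\<close>

context hypersurface
begin

definition delta :: "'a \<Rightarrow> uv_var multiset \<Rightarrow> nat multiset \<Rightarrow> uv_var multiset \<Rightarrow> nat multiset \<Rightarrow> 'a"
  where "delta c \<nu> \<mu> = mono_series S (mono_series K c \<mu>) \<nu>"

lemma delta_coeff: "delta c \<nu> \<mu> \<nu>' \<mu>' = (if \<nu>' = \<nu> \<and> \<mu>' = \<mu> then c else \<zero>)"
  by (auto simp: delta_def mono_series_def SS.coeff_zero)

lemma delta_closed: "c \<in> carrier K \<Longrightarrow> \<mu> \<in> QS \<Longrightarrow> delta c \<nu> \<mu> \<in> carrier T"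
  unfolding delta_def by (intro TT.mono_series_closed SS.mono_series_closed) auto

lemma delta_mult:
  assumes c: "c \<in> carrier K" and \<mu>: "\<mu> \<in> QS" and H: "H \<in> carrier T"
  shows "(delta c \<nu> \<mu> \<otimes>\<^bsub>T\<^esub> H) \<nu>' \<mu>' = (if \<nu> \<subseteq># \<nu>' \<and> \<mu> \<subseteq># \<mu>' then c \<otimes> H (\<nu>' - \<nu>) (\<mu>' - \<mu>) else \<zero>)"
proof -
  have m: "mono_series K c \<mu> \<in> carrier S" using c \<mu> by (intro SS.mono_series_closed) auto
  have "(delta c \<nu> \<mu> \<otimes>\<^bsub>T\<^esub> H) \<nu>' = (if \<nu> \<subseteq># \<nu>' then mono_series K c \<mu> \<otimes>\<^bsub>S\<^esub> H (\<nu>' - \<nu>) else \<zero>\<^bsub>S\<^esub>)"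
    unfolding delta_def by (rule TT.coeff_mono_mult[OF m UNIV_I H])
  then show ?thesis
    using SS.coeff_mono_mult[OF c \<mu> TT.coeff_closed[OF H]] by (simp add: SS.coeff_zero)
qed

lemma Phi_delta:
  assumes c: "c \<in> carrier K" and \<mu>: "\<mu> \<in> QS"
  shows "\<Phi> (delta c \<nu> \<mu>) = mono_series K (sgn_uv \<nu> \<otimes> c) (\<theta> (\<nu>, \<mu>))"
proof
  fix m
  show "\<Phi> (delta c \<nu> \<mu>) m = mono_series K (sgn_uv \<nu> \<otimes> c) (\<theta> (\<nu>, \<mu>)) m"
  proof (cases "m = \<theta> (\<nu>, \<mu>)")
    case True
    have "\<Phi> (delta c \<nu> \<mu>) m = sgn_uv (fst (\<nu>, \<mu>)) \<otimes> delta c \<nu> \<mu> (fst (\<nu>, \<mu>)) (snd (\<nu>, \<mu>))"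
      unfolding \<Phi>_def
    proof (rule finsum_only[OF finite_fib])
      show "(\<nu>, \<mu>) \<in> fib m" using True \<mu> by (simp add: fib_def)
      show "sgn_uv (fst (\<nu>, \<mu>)) \<otimes> delta c \<nu> \<mu> (fst (\<nu>, \<mu>)) (snd (\<nu>, \<mu>)) \<in> carrier K"
        using c by (simp add: delta_coeff)
      show "sgn_uv (fst b) \<otimes> delta c \<nu> \<mu> (fst b) (snd b) = \<zero>" if "b \<noteq> (\<nu>, \<mu>)" for b
      proof -
        have "\<not> (fst b = \<nu> \<and> snd b = \<mu>)" using that by (cases b) simp
        then show ?thesis by (simp only: delta_coeff if_False) simp
      qed
    qed
    then show ?thesis using True by (simp add: delta_coeff mono_series_def)
  next
    case False
    have "\<Phi> (delta c \<nu> \<mu>) m = \<zero>"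
      unfolding \<Phi>_def
    proof (rule finsum_all_zero)
      fix x assume x: "x \<in> fib m"
      have "\<not> (fst x = \<nu> \<and> snd x = \<mu>)" using x False by (cases x) (auto simp: fib_def)
      then show "sgn_uv (fst x) \<otimes> delta c \<nu> \<mu> (fst x) (snd x) = \<zero>" by (simp only: delta_coeff if_False) simp
    qed
    then show ?thesis using False by (simp add: mono_series_def)
  qed
qed

lemma empty_QS: "{#} \<in> QS" by simp

lemma one_T: "\<one>\<^bsub>T\<^esub> = delta \<one> {#} {#}"
  unfolding delta_def TT.one_eq SS.one_eq ..

lemma facet_map_empty: "\<theta> ({#}, {#}) = {#}"
  by (simp add: facet_map_def)

lemma sgn_uv_empty: "sgn_uv {#} = \<one>"
  by (simp add: sgn_uv_def)

lemma Phi_hom: "\<Phi> \<in> ring_hom T B"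
proof (rule ring_hom_memI)
  show "\<Phi> \<one>\<^bsub>T\<^esub> = \<one>\<^bsub>B\<^esub>"
    unfolding one_T Phi_delta[OF one_closed empty_QS] facet_map_empty sgn_uv_empty AA.one_eq by simp
qed (simp_all add: Phi_closed Phi_add Phi_mult)

lemma Phi_ring_hom_ring: "ring_hom_ring T B \<Phi>"
  by (rule ring_hom_ringI2[OF TT.A.ring_axioms AA.A.ring_axioms Phi_hom])

text \<open>Each fibre over \<open>facet_monoid n d\<close> contains exactly one monomial not
  divisible by \<open>uv\<close>. Placing the coefficient there, with its sign, gives a
  preimage.\<close>

lemma Phi_surj: "\<Phi> ` carrier T = carrier B"
proof
  show "\<Phi> ` carrier T \<subseteq> carrier B" using Phi_closed by blast
  show "carrier B \<subseteq> \<Phi> ` carrier T"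
  proof
    fix P assume P: "P \<in> carrier B"
    define G where "G = (\<lambda>\<nu> \<mu>. if \<not> UV \<subseteq># \<nu> \<and> \<mu> \<in> QS then sgn_uv \<nu> \<otimes> P (\<theta> (\<nu>, \<mu>)) else \<zero>)"
    have Pc: "\<And>m. P m \<in> carrier K" using AA.coeff_closed[OF P] .
    have G: "G \<in> carrier T" unfolding T_carrier using Pc by (simp add: G_def)
    have "\<Phi> G m = P m" for m
    proof (cases "m \<in> facet_monoid n d")
      case False
      then show ?thesis using AA.coeff_outside[OF P] AA.coeff_outside[OF Phi_closed[OF G]] by simp
    next
      case True
      then obtain t :: int where t: "set_mset m \<subseteq> UNIV \<times> {1..n}"
        "\<And>j. j \<in> {1..n} \<Longrightarrow> int (count m (True, j)) = int (count m (False, j)) + t * int (d j)"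
        unfolding facet_monoid_def by blast
      have ex: "\<exists>\<nu> \<mu>. \<not> UV \<subseteq># \<nu> \<and> \<mu> \<in> QS \<and> \<theta> (\<nu>, \<mu>) = m"
      proof -
        \<comment> \<open>The representative contains a power of \<open>u\<close> or of
          \<open>v\<close> according to the sign of \<open>t\<close>, and \<open>\<mu>\<close> takes
          the smaller of the two facet values at each \<open>j\<close>, selected by
          \<open>b\<close>.\<close>
        define b where "b = (t < 0)"
        define \<nu> where "\<nu> = replicate_mset (nat \<bar>t\<bar>) (if t < 0 then V else U)"
        define \<mu> where "\<mu> = (\<Sum>j\<in>{1..n}. replicate_mset (count m (b, j)) j)"
        have c\<mu>: "count \<mu> j = (if j \<in> {1..n} then count m (b, j) else 0)" for j
          by (simp add: \<mu>_def count_sum)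
        have \<mu>: "\<mu> \<in> QS"
          unfolding mem_QS
        proof
          fix j assume "j \<in># \<mu>"
          then have "count \<mu> j \<noteq> 0" by simp
          then show "j \<in> {1..n}" unfolding c\<mu> by presburger
        qed
        have \<nu>: "\<not> UV \<subseteq># \<nu>"
        proof
          assume "UV \<subseteq># \<nu>"
          then have "U \<in># \<nu>" "V \<in># \<nu>"
            by (rule mset_subset_eqD, simp)+
          then show False by (auto simp: \<nu>_def split: if_splits)
        qed
        have "count (\<theta> (\<nu>, \<mu>)) (c, j) = count m (c, j)" for c j
        proof (cases "j \<in> {1..n}")
          case False
          then have "(c, j) \<notin># m" using t(1) by auto
          then have "count m (c, j) = 0" by (simp add: not_in_iff)
          moreover have "count \<mu> j = 0" "count E j = 0" using False by (simp_all only: c\<mu> count_exponent_mset if_False)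
          ultimately show ?thesis by (cases c) (simp_all add: count_facet_map)
        next
          case True
          have E: "count E j = d j" using True by (simp add: count_exponent_mset)
          have c\<nu>: "count \<nu> U = nat t" "count \<nu> V = nat (- t)" by (auto simp: \<nu>_def)
          have "int (count (\<theta> (\<nu>, \<mu>)) (c, j)) = int (count m (c, j))"
            using t(2)[OF True] True
            by (cases c; cases "t < 0") (auto simp: count_facet_map E c\<nu> c\<mu> b_def algebra_simps)
          then show ?thesis by simp
        qed
        then have "\<theta> (\<nu>, \<mu>) = m" by (intro multiset_eqI) (metis surj_pair)
        then show ?thesis using \<mu> \<nu> by blast
      qed
      then obtain \<nu> \<mu> where nm: "\<not> UV \<subseteq># \<nu>" "\<mu> \<in> QS" "\<theta> (\<nu>, \<mu>) = m" by blast
      have "\<Phi> G m = sgn_uv (fst (\<nu>, \<mu>)) \<otimes> G (fst (\<nu>, \<mu>)) (snd (\<nu>, \<mu>))"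
        unfolding \<Phi>_def
      proof (rule finsum_only[OF finite_fib])
        show "(\<nu>, \<mu>) \<in> fib m" using nm by (simp add: fib_def)
        show "sgn_uv (fst (\<nu>, \<mu>)) \<otimes> G (fst (\<nu>, \<mu>)) (snd (\<nu>, \<mu>)) \<in> carrier K" using T_coeff[OF G] by simp
        fix x assume x: "x \<in> fib m" "x \<noteq> (\<nu>, \<mu>)"
        obtain \<nu>' \<mu>' where xe: "x = (\<nu>', \<mu>')" by (cases x)
        have "\<theta> (\<nu>', \<mu>') = \<theta> (\<nu>, \<mu>)" using x(1) xe nm(3) by (simp add: fib_def)
        then obtain s where s: "\<nu>' = \<nu> + repeat_mset s UV" "\<mu> = \<mu>' + repeat_mset s E"
          using fib_structure[OF nm(1)] by blast
        have "s \<noteq> 0" using s xe x(2) by (intro notI) simp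
        then obtain s' where "s = Suc s'" using not0_implies_Suc by blast
        then have "UV \<subseteq># \<nu>'" using s(1) by simp
        then show "sgn_uv (fst x) \<otimes> G (fst x) (snd x) = \<zero>" using xe by (simp add: G_def)
      qed
      also have "\<dots> = sgn_uv \<nu> \<otimes> (sgn_uv \<nu> \<otimes> P m)" using nm by (simp add: G_def)
      also have "\<dots> = P m" using sgn_uv_square[of \<nu>] Pc[of m] by (simp add: m_assoc[symmetric])
      finally show ?thesis .
    qed
    then have "\<Phi> G = P" by (simp add: fun_eq_iff)
    then show "P \<in> \<Phi> ` carrier T" using G by blast
  qed
qed

definition equation :: "uv_var multiset \<Rightarrow> nat multiset \<Rightarrow> 'a"
  where "equation = delta \<one> {#} E \<oplus>\<^bsub>T\<^esub> delta \<one> UV {#}"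

lemma equation_closed: "equation \<in> carrier T"
  unfolding equation_def using delta_closed[OF one_closed E_QS] delta_closed[OF one_closed empty_QS]
  by (rule TT.A.a_closed)

lemma Phi_equation: "\<Phi> equation = \<zero>\<^bsub>B\<^esub>"
proof -
  have th: "\<theta> ({#}, E) = \<theta> (UV, {#})" by (simp add: facet_map_def)
  have s: "sgn_uv UV = \<ominus> \<one>" by (simp add: sgn_uv_def)
  have "\<Phi> equation = \<Phi> (delta \<one> {#} E) \<oplus>\<^bsub>B\<^esub> \<Phi> (delta \<one> UV {#})"
    unfolding equation_def
    by (rule Phi_add[OF delta_closed[OF one_closed E_QS] delta_closed[OF one_closed empty_QS]])
  also have "\<dots> = mono_series K \<one> (\<theta> (UV, {#})) \<oplus>\<^bsub>B\<^esub> mono_series K (\<ominus> \<one>) (\<theta> (UV, {#}))"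
    unfolding Phi_delta[OF one_closed E_QS] Phi_delta[OF one_closed empty_QS] th s sgn_uv_empty by simp
  also have "\<dots> = \<zero>\<^bsub>B\<^esub>"
    by (rule ext) (simp add: AA.coeff_add AA.coeff_zero mono_series_def r_neg)
  finally show ?thesis .
qed

text \<open>Formally \<open>tail N G\<close> is the partial sum over \<open>s \<le> N\<close> of \<open>(- f) ^ s\<close> times the coefficient of
  \<open>(uv) ^ s\<close>. It stabilises at every monomial because \<open>f\<close> is not a unit.\<close>
definition tail :: "nat \<Rightarrow> (uv_var multiset \<Rightarrow> nat multiset \<Rightarrow> 'a) \<Rightarrow> uv_var multiset \<Rightarrow> nat multiset \<Rightarrow> 'a"
  where "tail N G \<nu> \<mu> = (\<Oplus>s\<in>{..N}. if repeat_mset s E \<subseteq># \<mu>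
    then (\<ominus> \<one>) [^] s \<otimes> G (\<nu> + repeat_mset s UV) (\<mu> - repeat_mset s E) else \<zero>)"

lemma size_E: "size E \<ge> 1"
proof -
  have "count E 1 > 0" using n_pos d_pos[of 1] by (simp add: count_exponent_mset)
  then have "E \<noteq> {#}" by auto
  then show ?thesis by (simp add: Suc_leI nonempty_has_size)
qed

lemma repeat_E_size: "repeat_mset s E \<subseteq># \<mu> \<Longrightarrow> s \<le> size \<mu>"
proof -
  assume "repeat_mset s E \<subseteq># \<mu>"
  then have "s * size E \<le> size \<mu>" using size_mset_mono[of "repeat_mset s E" \<mu>] by simp
  moreover have "s \<le> s * size E" using mult_le_mono2[OF size_E, of s] by (simp only: mult_1_right)
  ultimately show ?thesis by (rule order_trans[rotated])
qed

lemma tail_term_closed: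
  assumes G: "G \<in> carrier T"
  shows "(if repeat_mset s E \<subseteq># \<mu> then (\<ominus> \<one>) [^] s \<otimes> G (\<nu> + repeat_mset s UV) (\<mu> - repeat_mset s E) else \<zero>) \<in> carrier K"
  using T_coeff[OF G] by simp

lemma tail_stable:
  assumes G: "G \<in> carrier T" and N: "size \<mu> \<le> N"
  shows "tail N G \<nu> \<mu> = tail (size \<mu>) G \<nu> \<mu>"
  unfolding tail_def
proof (rule add.finprod_mono_neutral_cong_right)
  fix s assume "s \<in> {..N} - {..size \<mu>}"
  then have "\<not> repeat_mset s E \<subseteq># \<mu>" using repeat_E_size[of s \<mu>] by auto
  then show "(if repeat_mset s E \<subseteq># \<mu> then (\<ominus> \<one>) [^] s \<otimes> G (\<nu> + repeat_mset s UV) (\<mu> - repeat_mset s E) else \<zero>) = \<zero>"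
    by simp
qed (use N tail_term_closed[OF G] in auto)

text \<open>The term \<open>s = 0\<close> is split off and the others are shifted. With the tails at
  monomials divisible by \<open>uv\<close> as coefficients of a quotient, this recursion is division
  by \<open>f + uv\<close>, one coefficient at a time; \<open>tail_stable\<close> makes the choice
  of the cut \<open>N\<close> immaterial.\<close>

lemma tail_step:
  assumes G: "G \<in> carrier T" and N: "size \<mu> \<le> N"
  shows "tail N G \<nu> \<mu> = G \<nu> \<mu> \<ominus> (if E \<subseteq># \<mu> then tail N G (\<nu> + UV) (\<mu> - E) else \<zero>)"
proof -
  define h where "h = (\<lambda>s. if repeat_mset s E \<subseteq># \<mu> then (\<ominus> \<one>) [^] (s::nat) \<otimes> G (\<nu> + repeat_mset s UV) (\<mu> - repeat_mset s E) else \<zero>)"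
  define g where "g = (\<lambda>s. if repeat_mset s E \<subseteq># \<mu> - E then (\<ominus> \<one>) [^] (s::nat) \<otimes> G (\<nu> + UV + repeat_mset s UV) (\<mu> - E - repeat_mset s E) else \<zero>)"
  have hc: "h s \<in> carrier K" "g s \<in> carrier K" for s using T_coeff[OF G] by (simp_all add: h_def g_def)
  have hS: "h (Suc s) = \<ominus> (if E \<subseteq># \<mu> then g s else \<zero>)" for s
  proof (cases "E \<subseteq># \<mu>")
    case False
    then have "\<not> repeat_mset (Suc s) E \<subseteq># \<mu>" using subset_mset.order_trans[of E "repeat_mset (Suc s) E" \<mu>] by auto
    then show ?thesis using False by (simp add: h_def)
  next
    case True
    have 1: "repeat_mset (Suc s) E \<subseteq># \<mu> \<longleftrightarrow> repeat_mset s E \<subseteq># \<mu> - E"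
      using True subset_mset.le_diff_conv2[OF True, of "repeat_mset s E"] by (simp add: add.commute)
    have 2: "\<nu> + UV + repeat_mset s UV = \<nu> + repeat_mset (Suc s) UV" by simp
    have 3: "\<mu> - E - repeat_mset s E = \<mu> - repeat_mset (Suc s) E" by simp
    show ?thesis using True T_coeff[OF G] unfolding h_def g_def 1 2 3
      by (simp add: l_minus m_ac)
  qed
  have "tail N G \<nu> \<mu> = tail (Suc N) G \<nu> \<mu>"
    using tail_stable[OF G, of \<mu> N \<nu>] tail_stable[OF G, of \<mu> "Suc N" \<nu>] N by simp
  also have "\<dots> = (\<Oplus>s\<in>{..Suc N}. h s)" by (simp add: tail_def h_def)
  also have "\<dots> = (\<Oplus>s\<in>{..N}. h (Suc s)) \<oplus> h 0" using hc by (intro finsum_Suc2) auto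
  also have "h 0 = G \<nu> \<mu>" using T_coeff[OF G] by (simp add: h_def)
  also have "(\<Oplus>s\<in>{..N}. h (Suc s)) = \<ominus> (if E \<subseteq># \<mu> then (\<Oplus>s\<in>{..N}. g s) else \<zero>)"
  proof (cases "E \<subseteq># \<mu>")
    case True
    have "(\<Oplus>s\<in>{..N}. h (Suc s)) = (\<Oplus>s\<in>{..N}. \<ominus> \<one> \<otimes> g s)"
      using hc True by (intro finsum_cong') (auto simp: hS l_minus)
    also have "\<dots> = \<ominus> \<one> \<otimes> (\<Oplus>s\<in>{..N}. g s)"
      using hc by (intro finsum_rdistr[symmetric]) auto
    finally show ?thesis using True hc by (simp add: l_minus Pi_def)
  next
    case False
    then show ?thesis by (simp add: hS finsum_all_zero)
  qed
  also have "(\<Oplus>s\<in>{..N}. g s) = tail N G (\<nu> + UV) (\<mu> - E)" by (simp only: tail_def g_def)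
  finally show ?thesis
    using T_coeff[OF G] hc by (simp add: a_minus_def a_comm tail_def g_def[symmetric] Pi_def)
qed

text \<open>For \<open>\<nu>\<close> not divisible by \<open>uv\<close>, the fibre through
  \<open>(\<nu>, \<mu>)\<close> is the index set of the tail, and the signs match those of
  \<open>\<Phi>\<close>. So the tail is a coefficient of \<open>\<Phi> G\<close> up to sign; it is
  the remainder in the division by \<open>equation\<close>.\<close>

lemma tail_zero:
  assumes G: "G \<in> carrier T" and ker: "\<Phi> G = \<zero>\<^bsub>B\<^esub>" and \<nu>: "\<not> UV \<subseteq># \<nu>" and \<mu>: "\<mu> \<in> QS"
  shows "tail (size \<mu>) G \<nu> \<mu> = \<zero>"
proof -
  define Y where "Y = {s. s \<le> size \<mu> \<and> repeat_mset s E \<subseteq># \<mu>}"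
  have fY: "finite Y" by (simp add: Y_def)
  define pt where "pt = (\<lambda>s. (\<nu> + repeat_mset s UV, \<mu> - repeat_mset s E))"
  have fibY: "fib (\<theta> (\<nu>, \<mu>)) = pt ` Y"
  proof
    show "fib (\<theta> (\<nu>, \<mu>)) \<subseteq> pt ` Y"
    proof
      fix x assume x: "x \<in> fib (\<theta> (\<nu>, \<mu>))"
      obtain \<nu>' \<mu>' where xe: "x = (\<nu>', \<mu>')" by (cases x)
      then obtain s where s: "\<nu>' = \<nu> + repeat_mset s UV" "\<mu> = \<mu>' + repeat_mset s E"
        using fib_structure[OF \<nu>, of \<nu>' \<mu>' \<mu>] x by (auto simp: fib_def)
      then have "repeat_mset s E \<subseteq># \<mu>" by simp
      then have "s \<in> Y" using repeat_E_size by (simp add: Y_def)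
      moreover have "x = pt s" using xe s by (simp add: pt_def)
      ultimately show "x \<in> pt ` Y" by blast
    qed
    show "pt ` Y \<subseteq> fib (\<theta> (\<nu>, \<mu>))"
    proof
      fix x assume "x \<in> pt ` Y"
      then obtain s where s: "s \<in> Y" "x = pt s" by blast
      define \<mu>' where "\<mu>' = \<mu> - repeat_mset s E"
      have e: "\<mu> = \<mu>' + repeat_mset s E" using s(1) by (simp add: Y_def \<mu>'_def)
      have "\<theta> (\<nu> + repeat_mset s UV, \<mu>') = \<theta> (\<nu>, \<mu>' + repeat_mset s E)"
      proof (rule multiset_eqI)
        fix bj :: "bool \<times> nat"
        obtain b j where "bj = (b, j)" by (cases bj)
        then show "count (\<theta> (\<nu> + repeat_mset s UV, \<mu>')) bj = count (\<theta> (\<nu>, \<mu>' + repeat_mset s E)) bj"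
          by (cases b) (simp_all add: count_facet_map algebra_simps)
      qed
      moreover have "\<mu>' \<in> QS" using \<mu> e by auto
      ultimately show "x \<in> fib (\<theta> (\<nu>, \<mu>))" using s(2) e by (simp add: fib_def pt_def \<mu>'_def[symmetric])
    qed
  qed
  have inj: "inj_on pt Y"
  proof (rule inj_onI)
    fix s s' assume "pt s = pt s'"
    then have "count (\<nu> + repeat_mset s UV) U = count (\<nu> + repeat_mset s' UV) U" by (simp add: pt_def)
    then show "s = s'" by simp
  qed
  have sg: "sgn_uv (\<nu> + repeat_mset s UV) = sgn_uv \<nu> \<otimes> (\<ominus> \<one>) [^] s" for s
    by (simp add: sgn_uv_def nat_pow_mult)
  have "\<zero> = \<Phi> G (\<theta> (\<nu>, \<mu>))" unfolding ker AA.coeff_zero ..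
  also have "\<dots> = (\<Oplus>s\<in>Y. sgn_uv (fst (pt s)) \<otimes> G (fst (pt s)) (snd (pt s)))"
    unfolding \<Phi>_def fibY using inj T_coeff[OF G] by (intro finsum_reindex) auto
  also have "\<dots> = (\<Oplus>s\<in>Y. sgn_uv \<nu> \<otimes> ((\<ominus> \<one>) [^] s \<otimes> G (\<nu> + repeat_mset s UV) (\<mu> - repeat_mset s E)))"
  proof (rule finsum_cong'[OF refl])
    show "(\<lambda>s. sgn_uv \<nu> \<otimes> ((\<ominus> \<one>) [^] s \<otimes> G (\<nu> + repeat_mset s UV) (\<mu> - repeat_mset s E))) \<in> Y \<rightarrow> carrier K"
      using T_coeff[OF G] by auto
    show "sgn_uv (fst (pt s)) \<otimes> G (fst (pt s)) (snd (pt s))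
      = sgn_uv \<nu> \<otimes> ((\<ominus> \<one>) [^] s \<otimes> G (\<nu> + repeat_mset s UV) (\<mu> - repeat_mset s E))" for s
      unfolding pt_def fst_conv snd_conv sg using T_coeff[OF G] by (intro m_assoc) auto
  qed
  also have "\<dots> = sgn_uv \<nu> \<otimes> (\<Oplus>s\<in>Y. (\<ominus> \<one>) [^] s \<otimes> G (\<nu> + repeat_mset s UV) (\<mu> - repeat_mset s E))"
    using T_coeff[OF G] fY by (intro finsum_rdistr[symmetric]) auto
  also have "(\<Oplus>s\<in>Y. (\<ominus> \<one>) [^] s \<otimes> G (\<nu> + repeat_mset s UV) (\<mu> - repeat_mset s E)) = tail (size \<mu>) G \<nu> \<mu>"
    unfolding tail_def
    by (rule add.finprod_mono_neutral_cong_left) (use T_coeff[OF G] in \<open>auto simp: Y_def\<close>)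
  finally have z: "sgn_uv \<nu> \<otimes> tail (size \<mu>) G \<nu> \<mu> = \<zero>" by simp
  have tc: "tail (size \<mu>) G \<nu> \<mu> \<in> carrier K"
    unfolding tail_def using tail_term_closed[OF G] by (intro finsum_closed) blast
  have "sgn_uv \<nu> \<otimes> (sgn_uv \<nu> \<otimes> tail (size \<mu>) G \<nu> \<mu>) = tail (size \<mu>) G \<nu> \<mu>"
    using sgn_uv_square[of \<nu>] tc by (simp add: m_assoc[symmetric])
  then show ?thesis using z by simp
qed

text \<open>Division by \<open>f + uv\<close> with \<open>uv\<close> as leading term: the quotient
  \<open>H\<close> collects the tails at monomials divisible by \<open>uv\<close>, and the
  remainder, which lives on the other monomials, vanishes by \<open>tail_zero\<close>.\<close>

lemma Phi_kernel: "a_kernel T B \<Phi> = PIdl\<^bsub>T\<^esub> equation"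
proof
  show "PIdl\<^bsub>T\<^esub> equation \<subseteq> a_kernel T B \<Phi>"
  proof
    fix G assume "G \<in> PIdl\<^bsub>T\<^esub> equation"
    then obtain H where H: "H \<in> carrier T" "G = H \<otimes>\<^bsub>T\<^esub> equation" by (auto simp: cgenideal_def)
    have "\<Phi> G = \<Phi> H \<otimes>\<^bsub>B\<^esub> \<zero>\<^bsub>B\<^esub>" unfolding H(2) Phi_mult[OF H(1) equation_closed] Phi_equation ..
    then have "\<Phi> G = \<zero>\<^bsub>B\<^esub>" using AA.A.r_null[OF Phi_closed[OF H(1)]] by simp
    then show "G \<in> a_kernel T B \<Phi>"
      unfolding a_kernel_def' H(2) using TT.A.m_closed[OF H(1) equation_closed] by blast
  qed
  show "a_kernel T B \<Phi> \<subseteq> PIdl\<^bsub>T\<^esub> equation"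
  proof
    fix G assume "G \<in> a_kernel T B \<Phi>"
    then have G: "G \<in> carrier T" and ker: "\<Phi> G = \<zero>\<^bsub>B\<^esub>" unfolding a_kernel_def' by blast+
    \<comment> \<open>The shift by \<open>UV\<close> removes the factor \<open>uv\<close> that the
      quotient loses against \<open>G\<close>.\<close>
    define H where "H = (\<lambda>\<nu> \<mu>. tail (size \<mu>) G (\<nu> + UV) \<mu>)"
    have H: "H \<in> carrier T"
      unfolding T_carrier
    proof (intro conjI allI impI)
      show "H \<nu> \<mu> \<in> carrier K" for \<nu> \<mu>
        unfolding H_def tail_def using tail_term_closed[OF G] by (intro finsum_closed) blast
      show "H \<nu> \<mu> = \<zero>" if \<mu>: "\<mu> \<notin> QS" for \<nu> \<mu>
        unfolding H_def tail_def
      proof (rule finsum_all_zero)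
        fix s
        have "G (\<nu> + UV + repeat_mset s UV) (\<mu> - repeat_mset s E) = \<zero>" if sub: "repeat_mset s E \<subseteq># \<mu>"
        proof (rule T_outside[OF G])
          show "\<mu> - repeat_mset s E \<notin> QS"
          proof
            assume "\<mu> - repeat_mset s E \<in> QS"
            moreover have "repeat_mset s E \<in> QS" using SS.add_Q E_QS by (induction s) auto
            ultimately have "(\<mu> - repeat_mset s E) + repeat_mset s E \<in> QS" by (rule SS.add_Q)
            then show False using \<mu> sub by simp
          qed
        qed
        then show "(if repeat_mset s E \<subseteq># \<mu> then (\<ominus> \<one>) [^] s \<otimes> G (\<nu> + UV + repeat_mset s UV) (\<mu> - repeat_mset s E) else \<zero>) = \<zero>"
          by simp
      qed
    qed
    have "G = H \<otimes>\<^bsub>T\<^esub> equation"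
    proof (intro ext)
      fix \<nu> \<mu>
      have dc: "delta \<one> {#} E \<in> carrier T" "delta \<one> UV {#} \<in> carrier T"
        using delta_closed[OF one_closed E_QS] delta_closed[OF one_closed empty_QS] by blast+
      have "H \<otimes>\<^bsub>T\<^esub> equation = delta \<one> {#} E \<otimes>\<^bsub>T\<^esub> H \<oplus>\<^bsub>T\<^esub> delta \<one> UV {#} \<otimes>\<^bsub>T\<^esub> H"
        unfolding TT.A.m_comm[OF H equation_closed] unfolding equation_def
        by (rule TT.A.l_distr[OF dc H])
      then have e: "(H \<otimes>\<^bsub>T\<^esub> equation) \<nu> \<mu>
          = (if E \<subseteq># \<mu> then H \<nu> (\<mu> - E) else \<zero>) \<oplus> (if UV \<subseteq># \<nu> then H (\<nu> - UV) \<mu> else \<zero>)"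
        using T_coeff[OF H]
        by (simp add: T_add delta_mult[OF one_closed E_QS H] delta_mult[OF one_closed empty_QS H])
      have st: "tail (size \<mu>) G \<nu> \<mu> = G \<nu> \<mu> \<ominus> (if E \<subseteq># \<mu> then H \<nu> (\<mu> - E) else \<zero>)"
      proof (cases "E \<subseteq># \<mu>")
        case False
        then show ?thesis using tail_step[OF G order_refl, of \<mu> \<nu>] by simp
      next
        case True
        have "size (\<mu> - E) \<le> size \<mu>" by (simp add: size_mset_mono)
        then have "tail (size \<mu>) G (\<nu> + UV) (\<mu> - E) = H \<nu> (\<mu> - E)"
          unfolding H_def by (rule tail_stable[OF G])
        then show ?thesis using True tail_step[OF G order_refl, of \<mu> \<nu>] by simp
      qed
      have alg: "a = b \<oplus> (a \<ominus> b)" if "a \<in> carrier K" "b \<in> carrier K" for a b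
        using that a_lcomm[of b a "\<ominus> b"] by (simp add: a_minus_def r_neg)
      have main: "G \<nu> \<mu> = (if E \<subseteq># \<mu> then H \<nu> (\<mu> - E) else \<zero>) \<oplus> tail (size \<mu>) G \<nu> \<mu>"
        unfolding st using T_coeff[OF G] T_coeff[OF H] by (intro alg) auto
      show "G \<nu> \<mu> = (H \<otimes>\<^bsub>T\<^esub> equation) \<nu> \<mu>"
      proof (cases "UV \<subseteq># \<nu>")
        case True
        have "tail (size \<mu>) G \<nu> \<mu> = H (\<nu> - UV) \<mu>"
          unfolding H_def subset_mset.diff_add[OF True] ..
        then show ?thesis using main e True by simp
      next
        case uv: False
        show ?thesis
        proof (cases "\<mu> \<in> QS")
          case True
          then show ?thesis using main e uv tail_zero[OF G ker uv] by simp
        next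
          case False
          then show ?thesis using T_outside[OF G] T_outside[OF TT.A.m_closed[OF H equation_closed]] by simp
        qed
      qed
    qed
    then show "G \<in> PIdl\<^bsub>T\<^esub> equation" using H by (auto simp: cgenideal_def)
  qed
qed

section \<open>Identification of the hypersurface ring with the model\<close>

lemma monomial_of_eq: "monomial_of K n d = mono_series K \<one> E"
proof -
  have S: "power_series_ring K {1..n} = S"
    unfolding QS_def by (rule power_series_ring_eq[OF ring_axioms])
  have var: "indexed_var j = mono_series K \<one> {#j#}" for j :: nat
    by (rule ext) (auto simp: indexed_var_def indexed_pmult_def indexed_const_def mono_series_def
        dest: multi_member_split)
  have p: "mono_series K \<one> {#j#} [^]\<^bsub>S\<^esub> d j = mono_series K \<one> (replicate_mset (d j) j)" if "j \<in> {1..n}" for j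
    using SS.mono_pow[of \<one> "{#j#}" "d j"] that by simp
  have "(\<Otimes>\<^bsub>S\<^esub>j\<in>J. mono_series K \<one> {#j#} [^]\<^bsub>S\<^esub> d j) = mono_series K \<one> (\<Sum>j\<in>J. replicate_mset (d j) j)
      \<and> (\<Sum>j\<in>J. replicate_mset (d j) j) \<in> QS" if "finite J" "J \<subseteq> {1..n}" for J
    using that
  proof (induction J rule: finite_induct)
    case empty
    then show ?case by (simp add: SS.one_eq)
  next
    case (insert j J)
    have c: "\<And>i. i \<in> insert j J \<Longrightarrow> mono_series K \<one> {#i#} [^]\<^bsub>S\<^esub> d i \<in> carrier S"
      using insert.prems by (intro SS.A.nat_pow_closed SS.mono_series_closed) auto
    have q: "replicate_mset (d j) j \<in> QS" using insert.prems by (auto split: if_splits)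
    have "(\<Otimes>\<^bsub>S\<^esub>j\<in>insert j J. mono_series K \<one> {#j#} [^]\<^bsub>S\<^esub> d j)
      = mono_series K \<one> {#j#} [^]\<^bsub>S\<^esub> d j \<otimes>\<^bsub>S\<^esub> (\<Otimes>\<^bsub>S\<^esub>j\<in>J. mono_series K \<one> {#j#} [^]\<^bsub>S\<^esub> d j)"
      using insert.hyps c by (intro SS.A.finprod_insert) auto
    also have "\<dots> = mono_series K \<one> (replicate_mset (d j) j) \<otimes>\<^bsub>S\<^esub> mono_series K \<one> (\<Sum>j\<in>J. replicate_mset (d j) j)"
      using insert p by simp
    also have "\<dots> = mono_series K (\<one> \<otimes> \<one>) (replicate_mset (d j) j + (\<Sum>j\<in>J. replicate_mset (d j) j))"
      using insert q by (intro SS.mono_mult_mono) auto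
    finally show ?case using insert q SS.add_Q by auto
  qed
  from this[of "{1..n}"] show ?thesis
    unfolding monomial_of_def S var exponent_mset_def by simp
qed

lemma R_star_eq: "R_star K n d = T Quot (PIdl\<^bsub>T\<^esub> equation)"
proof -
  have S: "power_series_ring K {1..n} = S"
    unfolding QS_def by (rule power_series_ring_eq[OF ring_axioms])
  have T: "power_series_ring S {U, V} = T"
    using power_series_ring_eq[OF SS.A.ring_axioms, of "{U, V}"] by (simp add: uv_cases[symmetric])
  have var: "ring.indexed_var S x = mono_series S \<one>\<^bsub>S\<^esub> {#x#}" for x :: uv_var
    by (rule ext) (auto simp: SS.A.indexed_var_def SS.A.indexed_pmult_def SS.A.indexed_const_def mono_series_def
        dest: multi_member_split)
  have c: "ring.indexed_const S (mono_series K \<one> E) = delta \<one> {#} E"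
    by (rule ext) (simp add: SS.A.indexed_const_def delta_def mono_series_def)
  have "mono_series S \<one>\<^bsub>S\<^esub> {#U#} \<otimes>\<^bsub>T\<^esub> mono_series S \<one>\<^bsub>S\<^esub> {#V#} = mono_series S (\<one>\<^bsub>S\<^esub> \<otimes>\<^bsub>S\<^esub> \<one>\<^bsub>S\<^esub>) ({#U#} + {#V#})"
    by (rule TT.mono_mult_mono) auto
  then have uv: "mono_series S \<one>\<^bsub>S\<^esub> {#U#} \<otimes>\<^bsub>T\<^esub> mono_series S \<one>\<^bsub>S\<^esub> {#V#} = delta \<one> UV {#}"
    by (simp add: delta_def SS.one_eq[symmetric] add_mset_commute)
  show ?thesis
    unfolding R_star_def Let_def S T monomial_of_eq c var uv equation_def ..
qed

lemma R_star_iso: "(\<lambda>Y. the_elem (\<Phi> ` Y)) \<in> ring_iso (R_star K n d) B"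
  unfolding R_star_eq Phi_kernel[symmetric]
  by (rule ring_hom_ring.FactRing_iso_set[OF Phi_ring_hom_ring Phi_surj])

lemma R_star_cring: "cring (R_star K n d)"
  unfolding R_star_eq
  by (rule ideal.quotient_is_cring[OF TT.A.cgenideal_ideal[OF equation_closed] TT.A.is_cring])

end

section \<open>Invariance under ring isomorphisms\<close>

text \<open>The isomorphism acts on vectors and on scalars at the same time. Coefficients for the
  image basis are pulled back by the inverse \<open>k\<close>, which reduces existence and
  uniqueness over \<open>C'\<close> to those over \<open>C\<close>.\<close>

lemma free_summand_iso:
  assumes C: "cring C" and C': "cring C'" and h: "h \<in> ring_iso C C'"
    and free: "has_free_summand_of_rank C (frobenius_pushforward p e C) r"
  shows "has_free_summand_of_rank C' (frobenius_pushforward p e C') r"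
proof -
  interpret C: cring C by fact
  interpret C': cring C' by fact
  have hom: "h \<in> ring_hom C C'" and bij: "bij_betw h (carrier C) (carrier C')"
    using h by (simp_all add: ring_iso_def)
  interpret h: ring_hom_cring C C' h
    by (intro ring_hom_cring.intro ring_hom_cring_axioms.intro C C' hom)
  define k where "k = inv_into (carrier C) h"
  have khom: "k \<in> ring_iso C' C" unfolding k_def by (rule ring_iso_set_sym[OF C.ring_axioms h])
  have hk: "\<And>y. y \<in> carrier C' \<Longrightarrow> h (k y) = y" and kh: "\<And>x. x \<in> carrier C \<Longrightarrow> k (h x) = x"
    using bij by (simp_all add: k_def bij_betw_inv_into_right bij_betw_inv_into_left)
  have kc: "\<And>y. y \<in> carrier C' \<Longrightarrow> k y \<in> carrier C" using khom ring_iso_memE(1) by metis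
  have hc: "\<And>x. x \<in> carrier C \<Longrightarrow> h x \<in> carrier C'" by (rule h.hom_closed)
  from free obtain F N B where FN: "submodule F C (frobenius_pushforward p e C)"
    "submodule N C (frobenius_pushforward p e C)"
    "F <+>\<^bsub>frobenius_pushforward p e C\<^esub> N = carrier (frobenius_pushforward p e C)"
    "F \<inter> N = {\<zero>\<^bsub>frobenius_pushforward p e C\<^esub>}"
    and B: "module_basis C (frobenius_pushforward p e C) F B" "card B = r"
    unfolding has_free_summand_of_rank_def by auto
  note F = FN(1)[unfolded C.submodule_pushforward] and N = FN(2)[unfolded C.submodule_pushforward]
  have FNc: "\<And>x. x \<in> F \<Longrightarrow> x \<in> carrier C" "\<And>x. x \<in> N \<Longrightarrow> x \<in> carrier C" using F N by blast+
  have hpow: "h (x [^]\<^bsub>C\<^esub> (s::nat)) = h x [^]\<^bsub>C'\<^esub> s" if "x \<in> carrier C" for x s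
    using that by (induction s) (simp_all add: h.hom_mult)
  have img: "submodule (h ` G) C' (frobenius_pushforward p e C')"
    if G: "submodule G C (frobenius_pushforward p e C)" for G
  proof -
    note G' = G[unfolded C.submodule_pushforward]
    have Gc: "\<And>x. x \<in> G \<Longrightarrow> x \<in> carrier C" using G' by blast
    show ?thesis
      unfolding C'.submodule_pushforward
    proof (intro conjI ballI)
      show "h ` G \<subseteq> carrier C'" using Gc hc by blast
      show "\<zero>\<^bsub>C'\<^esub> \<in> h ` G" using G' h.hom_zero by (metis imageI)
    next
      fix x y assume "x \<in> h ` G" "y \<in> h ` G"
      then obtain a b where ab: "a \<in> G" "b \<in> G" "x = h a" "y = h b" by blast
      have "h (a \<oplus>\<^bsub>C\<^esub> b) \<in> h ` G" using ab G' by blast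
      then show "x \<oplus>\<^bsub>C'\<^esub> y \<in> h ` G" using ab Gc by (simp add: h.hom_add)
    next
      fix x assume "x \<in> h ` G"
      then obtain a where a: "a \<in> G" "x = h a" by blast
      have "h (\<ominus>\<^bsub>C\<^esub> a) \<in> h ` G" using a G' by blast
      then show "\<ominus>\<^bsub>C'\<^esub> x \<in> h ` G" using a Gc by (simp add: h.hom_a_inv)
      fix s assume s: "s \<in> carrier C'"
      have "h (k s [^]\<^bsub>C\<^esub> (p ^ e) \<otimes>\<^bsub>C\<^esub> a) \<in> h ` G" using a G' kc[OF s] by blast
      then show "s [^]\<^bsub>C'\<^esub> (p ^ e) \<otimes>\<^bsub>C'\<^esub> x \<in> h ` G"
        using a Gc kc[OF s] by (simp add: h.hom_mult hpow hk[OF s])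
    qed
  qed
  define S where "S = (\<lambda>c. \<Oplus>\<^bsub>C\<^esub>b\<in>B. c b [^]\<^bsub>C\<^esub> (p ^ e) \<otimes>\<^bsub>C\<^esub> b)"
  define S' where "S' = (\<lambda>c. \<Oplus>\<^bsub>C'\<^esub>b\<in>h ` B. c b [^]\<^bsub>C'\<^esub> (p ^ e) \<otimes>\<^bsub>C'\<^esub> b)"
  have basis: "finite B" "B \<subseteq> F" "\<And>x. x \<in> F \<Longrightarrow> \<exists>!c. c \<in> B \<rightarrow>\<^sub>E carrier C \<and> x = S c"
    using B(1) unfolding module_basis_def S_def finsum_pushforward
    by (simp_all add: frobenius_pushforward_def)
  have Bc: "\<And>b. b \<in> B \<Longrightarrow> b \<in> carrier C" using basis(2) FNc by blast
  have injB: "inj_on h B" using bij Bc by (meson bij_betw_def inj_on_subset subsetI)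
  have SS: "S' c = h (S (\<lambda>b\<in>B. k (c (h b))))" if c: "\<And>b. b \<in> h ` B \<Longrightarrow> c b \<in> carrier C'" for c
  proof -
    have "S' c = (\<Oplus>\<^bsub>C'\<^esub>b\<in>B. c (h b) [^]\<^bsub>C'\<^esub> (p ^ e) \<otimes>\<^bsub>C'\<^esub> h b)"
      unfolding S'_def using c Bc hc injB by (intro C'.finsum_reindex) auto
    also have "\<dots> = (\<Oplus>\<^bsub>C'\<^esub>b\<in>B. h (k (c (h b)) [^]\<^bsub>C\<^esub> (p ^ e) \<otimes>\<^bsub>C\<^esub> b))"
      using c Bc hc kc by (intro C'.finsum_cong') (auto simp: h.hom_mult hpow hk)
    also have "\<dots> = h (\<Oplus>\<^bsub>C\<^esub>b\<in>B. k (c (h b)) [^]\<^bsub>C\<^esub> (p ^ e) \<otimes>\<^bsub>C\<^esub> b)"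
      using c Bc kc by (subst h.hom_finsum) (auto simp: Pi_def comp_def)
    also have "(\<Oplus>\<^bsub>C\<^esub>b\<in>B. k (c (h b)) [^]\<^bsub>C\<^esub> (p ^ e) \<otimes>\<^bsub>C\<^esub> b) = S (\<lambda>b\<in>B. k (c (h b)))"
      unfolding S_def using c Bc kc by (intro C.finsum_cong') auto
    finally show ?thesis .
  qed
  have Sc: "S c \<in> carrier C" if "\<And>b. b \<in> B \<Longrightarrow> c b \<in> carrier C" for c
    unfolding S_def using that Bc by (intro C.finsum_closed) auto
  have "module_basis C' (frobenius_pushforward p e C') (h ` F) (h ` B)"
    unfolding module_basis_def finsum_pushforward
  proof (intro conjI ballI)
    show "finite (h ` B)" "h ` B \<subseteq> h ` F" using basis by auto
    fix y assume "y \<in> h ` F"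
    then obtain x where x: "x \<in> F" "y = h x" by blast
    have ex: "\<exists>c. c \<in> h ` B \<rightarrow>\<^sub>E carrier C' \<and> y = S' c"
    proof -
      obtain c where c: "c \<in> B \<rightarrow>\<^sub>E carrier C" "x = S c" using basis(3)[OF x(1)] by blast
      have cc: "\<And>b. b \<in> B \<Longrightarrow> c b \<in> carrier C" using c(1) by auto
      define c' where "c' = (\<lambda>b\<in>h ` B. h (c (k b)))"
      have c'v: "c' (h b) = h (c b)" if "b \<in> B" for b using that kh[OF Bc[OF that]] by (simp add: c'_def)
      have c'c: "\<And>b. b \<in> h ` B \<Longrightarrow> c' b \<in> carrier C'" using c'v cc hc by auto
      have "(\<lambda>b\<in>B. k (c' (h b))) = c"
        using c(1) by (intro PiE_ext[OF _ c(1)]) (auto simp: c'v kh cc)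
      then have "S' c' = y" using SS[OF c'c] c(2) x(2) by simp
      moreover have "c' \<in> h ` B \<rightarrow>\<^sub>E carrier C'" using c'c by (auto simp: c'_def)
      ultimately show ?thesis by blast
    qed
    have uniq: "c1 = c2" if c1: "c1 \<in> h ` B \<rightarrow>\<^sub>E carrier C'" "y = S' c1"
      and c2: "c2 \<in> h ` B \<rightarrow>\<^sub>E carrier C'" "y = S' c2" for c1 c2
    proof -
      have m: "\<And>b. b \<in> h ` B \<Longrightarrow> c1 b \<in> carrier C'" "\<And>b. b \<in> h ` B \<Longrightarrow> c2 b \<in> carrier C'"
        using c1(1) c2(1) by auto
      have r: "(\<lambda>b\<in>B. k (c1 (h b))) \<in> B \<rightarrow>\<^sub>E carrier C" "(\<lambda>b\<in>B. k (c2 (h b))) \<in> B \<rightarrow>\<^sub>E carrier C"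
        using m kc by auto
      have eqx: "x = S (\<lambda>b\<in>B. k (c1 (h b)))" "x = S (\<lambda>b\<in>B. k (c2 (h b)))"
      proof -
        have s: "S (\<lambda>b\<in>B. k (c1 (h b))) \<in> carrier C" "S (\<lambda>b\<in>B. k (c2 (h b))) \<in> carrier C"
          using m kc by (auto intro!: Sc)
        have "k (h x) = k (h (S (\<lambda>b\<in>B. k (c1 (h b)))))" using c1(2) SS[OF m(1)] x(2) by simp
        then show "x = S (\<lambda>b\<in>B. k (c1 (h b)))" using kh FNc(1)[OF x(1)] s(1) by simp
        have "k (h x) = k (h (S (\<lambda>b\<in>B. k (c2 (h b)))))" using c2(2) SS[OF m(2)] x(2) by simp
        then show "x = S (\<lambda>b\<in>B. k (c2 (h b)))" using kh FNc(1)[OF x(1)] s(2) by simp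
      qed
      have eq: "(\<lambda>b\<in>B. k (c1 (h b))) = (\<lambda>b\<in>B. k (c2 (h b)))"
        using basis(3)[OF x(1)] r eqx by blast
      show ?thesis
      proof (rule PiE_ext[OF c1(1) c2(1)])
        fix b' assume "b' \<in> h ` B"
        then obtain b where b: "b \<in> B" "b' = h b" by blast
        have "k (c1 (h b)) = k (c2 (h b))" using fun_cong[OF eq, of b] b(1) by simp
        then have "h (k (c1 (h b))) = h (k (c2 (h b)))" by simp
        then show "c1 b' = c2 b'" using hk m b by simp
      qed
    qed
    have "\<exists>!c. c \<in> h ` B \<rightarrow>\<^sub>E carrier C' \<and> y = S' c"
      using ex uniq by blast
    then show "\<exists>!c. c \<in> h ` B \<rightarrow>\<^sub>E carrier C' \<and>
        y = (\<Oplus>\<^bsub>C'\<^esub>b\<in>h ` B. c b \<odot>\<^bsub>frobenius_pushforward p e C'\<^esub> b)"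
      by (simp add: S'_def frobenius_pushforward_def)
  qed
  moreover have "card (h ` B) = r" using card_image[OF injB] B(2) by simp
  moreover have "h ` F <+>\<^bsub>frobenius_pushforward p e C'\<^esub> h ` N = carrier (frobenius_pushforward p e C')"
  proof -
    have s1: "F <+>\<^bsub>frobenius_pushforward p e C\<^esub> N = {x. \<exists>f\<in>F. \<exists>n\<in>N. x = f \<oplus>\<^bsub>C\<^esub> n}"
      by (auto simp: set_add_def set_mult_def frobenius_pushforward_def)
    have s2: "h ` F <+>\<^bsub>frobenius_pushforward p e C'\<^esub> h ` N = {x. \<exists>f\<in>F. \<exists>n\<in>N. x = h f \<oplus>\<^bsub>C'\<^esub> h n}"
      by (auto simp: set_add_def set_mult_def frobenius_pushforward_def)
    have e: "carrier C = {x. \<exists>f\<in>F. \<exists>n\<in>N. x = f \<oplus>\<^bsub>C\<^esub> n}"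
      using FN(3) unfolding s1 by (simp add: frobenius_pushforward_def)
    have "carrier C' = h ` carrier C" using bij by (simp add: bij_betw_def)
    also have "\<dots> = {x. \<exists>f\<in>F. \<exists>n\<in>N. x = h f \<oplus>\<^bsub>C'\<^esub> h n}"
    proof
      show "h ` carrier C \<subseteq> {x. \<exists>f\<in>F. \<exists>n\<in>N. x = h f \<oplus>\<^bsub>C'\<^esub> h n}"
      proof
        fix y assume "y \<in> h ` carrier C"
        then obtain f n where "f \<in> F" "n \<in> N" "y = h (f \<oplus>\<^bsub>C\<^esub> n)" unfolding e by blast
        then show "y \<in> {x. \<exists>f\<in>F. \<exists>n\<in>N. x = h f \<oplus>\<^bsub>C'\<^esub> h n}" using FNc h.hom_add by blast
      qed
      show "{x. \<exists>f\<in>F. \<exists>n\<in>N. x = h f \<oplus>\<^bsub>C'\<^esub> h n} \<subseteq> h ` carrier C"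
      proof
        fix y assume "y \<in> {x. \<exists>f\<in>F. \<exists>n\<in>N. x = h f \<oplus>\<^bsub>C'\<^esub> h n}"
        then obtain f n where fn: "f \<in> F" "n \<in> N" "y = h f \<oplus>\<^bsub>C'\<^esub> h n" by blast
        then have "y = h (f \<oplus>\<^bsub>C\<^esub> n)" using FNc by (simp add: h.hom_add)
        moreover have "f \<oplus>\<^bsub>C\<^esub> n \<in> carrier C" using fn FNc by simp
        ultimately show "y \<in> h ` carrier C" by (rule image_eqI)
      qed
    qed
    finally show ?thesis unfolding s2 by (simp add: frobenius_pushforward_def)
  qed
  moreover have "h ` F \<inter> h ` N = {\<zero>\<^bsub>frobenius_pushforward p e C'\<^esub>}"
  proof -
    have "inj_on h (F \<union> N)" using bij FNc by (meson Un_iff bij_betw_def inj_on_subset subsetI)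
    then have "h ` F \<inter> h ` N = h ` (F \<inter> N)" by (intro inj_on_image_Int[symmetric, of h "F \<union> N"]) auto
    also have "\<dots> = {\<zero>\<^bsub>C'\<^esub>}" unfolding FN(4) using h.hom_zero by (simp add: frobenius_pushforward_def)
    finally show ?thesis by (simp add: frobenius_pushforward_def)
  qed
  ultimately show ?thesis
    unfolding has_free_summand_of_rank_def using img[OF FN(1)] img[OF FN(2)] by blast
qed

lemma max_free_rank_iso:
  assumes "cring C" "cring C'" "h \<in> ring_iso C C'"
  shows "max_free_rank C (frobenius_pushforward p e C) = max_free_rank C' (frobenius_pushforward p e C')"
proof -
  have k: "inv_into (carrier C) h \<in> ring_iso C' C"
    by (rule ring_iso_set_sym[OF cring.axioms(1)[OF assms(1)] assms(3)])
  show ?thesis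
    unfolding max_free_rank_def using free_summand_iso[OF assms] free_summand_iso[OF assms(2,1) k] by metis
qed

text \<open>Preimages of primes are prime, and surjectivity keeps the inclusions strict.\<close>

lemma prime_chain_iso:
  assumes C: "cring C" and C': "cring C'" and h: "h \<in> ring_iso C' C"
    and P: "\<And>i. i \<le> l \<Longrightarrow> primeideal (P i) C" "\<And>i. i < l \<Longrightarrow> P i \<subset> P (Suc i)"
  shows "\<exists>P :: nat \<Rightarrow> 'a set. (\<forall>i\<le>l. primeideal (P i) C') \<and> (\<forall>i<l. P i \<subset> P (Suc i))"
proof -
  interpret C: cring C by fact
  interpret C': cring C' by fact
  have hom: "h \<in> ring_hom C' C" and bij: "bij_betw h (carrier C') (carrier C)"
    using h by (simp_all add: ring_iso_def)
  interpret h: ring_hom_ring C' C h by (rule ring_hom_ringI2[OF C'.ring_axioms C.ring_axioms hom])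
  define P' where "P' = (\<lambda>i. {x \<in> carrier C'. h x \<in> P i})"
  have surj: "\<exists>x\<in>carrier C'. h x = y" if "y \<in> carrier C" for y
  proof -
    have "y \<in> h ` carrier C'" using that bij_betw_imp_surj_on[OF bij] by simp
    then show ?thesis by (rule imageE) (rule bexI, simp_all)
  qed
  have "primeideal (P' i) C'" if i: "i \<le> l" for i
  proof -
    interpret Pi: primeideal "P i" C by (rule P(1)[OF i])
    show ?thesis
    proof (rule primeidealI)
      show "ideal (P' i) C'" unfolding P'_def by (rule h.ideal_vimage[OF Pi.is_ideal])
      show "cring C'" by fact
      show "carrier C' \<noteq> P' i"
      proof
        assume "carrier C' = P' i"
        then have "carrier C \<subseteq> P i" using surj unfolding P'_def by blast
        then show False using Pi.I_notcarr Pi.Icarr by blast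
      qed
      fix a b assume ab: "a \<in> carrier C'" "b \<in> carrier C'" "a \<otimes>\<^bsub>C'\<^esub> b \<in> P' i"
      then have "h a \<otimes>\<^bsub>C\<^esub> h b \<in> P i" using ring_hom_mult[OF hom ab(1,2)] by (simp add: P'_def)
      then have "h a \<in> P i \<or> h b \<in> P i" using Pi.I_prime ring_hom_closed[OF hom] ab by blast
      then show "a \<in> P' i \<or> b \<in> P' i" using ab by (simp add: P'_def)
    qed
  qed
  moreover have "P' i \<subset> P' (Suc i)" if i: "i < l" for i
  proof -
    have "primeideal (P (Suc i)) C" using P(1) i by simp
    then have "ideal (P (Suc i)) C" by (rule primeideal.axioms(1))
    obtain y where y: "y \<in> P (Suc i)" "y \<notin> P i" using P(2)[OF i] by blast
    have "y \<in> carrier C" using ideal.Icarr[OF \<open>ideal (P (Suc i)) C\<close> y(1)] .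
    then obtain x where "x \<in> carrier C'" "h x = y" using surj by blast
    then have "x \<in> P' (Suc i)" "x \<notin> P' i" using y by (auto simp: P'_def)
    moreover have "P' i \<subseteq> P' (Suc i)" using P(2)[OF i] by (auto simp: P'_def)
    ultimately show ?thesis by blast
  qed
  ultimately show ?thesis by blast
qed

lemma krull_dim_iso:
  assumes C: "cring C" and C': "cring C'" and h: "h \<in> ring_iso C C'"
  shows "krull_dim C = krull_dim C'"
proof -
  have k: "inv_into (carrier C) h \<in> ring_iso C' C"
    by (rule ring_iso_set_sym[OF cring.axioms(1)[OF C] h])
  have "(\<exists>P. (\<forall>i\<le>l. primeideal (P i) C) \<and> (\<forall>i<l. P i \<subset> P (Suc i)))
      \<longleftrightarrow> (\<exists>P. (\<forall>i\<le>l. primeideal (P i) C') \<and> (\<forall>i<l. P i \<subset> P (Suc i)))" for l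
  proof
    assume "\<exists>P. (\<forall>i\<le>l. primeideal (P i) C) \<and> (\<forall>i<l. P i \<subset> P (Suc i))"
    then obtain P where P: "(\<forall>i\<le>l. primeideal (P i) C) \<and> (\<forall>i<l. P i \<subset> P (Suc i))" ..
    show "\<exists>P. (\<forall>i\<le>l. primeideal (P i) C') \<and> (\<forall>i<l. P i \<subset> P (Suc i))"
      by (rule prime_chain_iso[OF C C' k, of l P]) (use P in simp_all)
  next
    assume "\<exists>P. (\<forall>i\<le>l. primeideal (P i) C') \<and> (\<forall>i<l. P i \<subset> P (Suc i))"
    then obtain P where P: "(\<forall>i\<le>l. primeideal (P i) C') \<and> (\<forall>i<l. P i \<subset> P (Suc i))" ..
    show "\<exists>P. (\<forall>i\<le>l. primeideal (P i) C) \<and> (\<forall>i<l. P i \<subset> P (Suc i))"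
      by (rule prime_chain_iso[OF C' C h, of l P]) (use P in simp_all)
  qed
  then show ?thesis unfolding krull_dim_def by simp
qed

section \<open>Invariants of the toric model\<close>

context affine_series
begin

text \<open>The quotient is the ring of series on the face \<open>F\<close>. It is a domain: the
  least monomials of two nonzero series on \<open>F\<close> add up to a monomial of \<open>F\<close>
  at which no other pair contributes, since both parts of a sum in \<open>F\<close> lie in
  \<open>F\<close>.\<close>

lemma face_prime:
  assumes F: "F \<subseteq> Q" "{#} \<in> F" "\<And>k l. k \<in> Q \<Longrightarrow> l \<in> Q \<Longrightarrow> k + l \<in> F \<longleftrightarrow> k \<in> F \<and> l \<in> F"
  shows "primeideal {P \<in> carrier A. \<forall>m\<in>F. P m = \<zero>} A" (is "primeideal ?P A")
proof (rule primeidealI)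
  have mult: "(P \<otimes>\<^bsub>A\<^esub> P') m = \<zero>" if P: "P \<in> carrier A" and P': "P' \<in> carrier A" and z: "\<forall>m\<in>F. P' m = \<zero>" and m: "m \<in> F" for P P' m
    unfolding coeff_mult[OF P P']
  proof (rule finsum_all_zero)
    fix x assume "x \<in> splits m"
    then obtain k l where x: "x = (k, l)" "k + l = m" by (cases x) auto
    show "(case x of (k, l) \<Rightarrow> P k \<otimes> P' l) = \<zero>"
    proof (cases "k \<in> Q \<and> l \<in> Q")
      case True
      then have "l \<in> F" using F(3) m x(2) by blast
      then show ?thesis using z x(1) coeff_closed[OF P] by simp
    next
      case False
      then have "P k = \<zero> \<or> P' l = \<zero>" using coeff_outside P P' by blast
      then show ?thesis using x(1) coeff_closed[OF P] coeff_closed[OF P'] by auto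
    qed
  qed
  show "ideal ?P A"
  proof (rule idealI)
    show "ring A" by (rule A.ring_axioms)
    show "subgroup ?P (add_monoid A)"
    proof (rule A.add.subgroupI)
      show "?P \<subseteq> carrier A" by blast
      show "?P \<noteq> {}" using A.zero_closed coeff_zero by blast
      show "\<ominus>\<^bsub>A\<^esub> a \<in> ?P" if "a \<in> ?P" for a using that by (auto simp: coeff_a_inv)
      show "a \<oplus>\<^bsub>A\<^esub> b \<in> ?P" if "a \<in> ?P" "b \<in> ?P" for a b using that by (auto simp: coeff_add)
    qed
    fix a x assume a: "a \<in> ?P" and x: "x \<in> carrier A"
    then show xa: "x \<otimes>\<^bsub>A\<^esub> a \<in> ?P" using mult by auto
    have "a \<otimes>\<^bsub>A\<^esub> x = x \<otimes>\<^bsub>A\<^esub> a" using a x by (intro A.m_comm) auto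
    then show "a \<otimes>\<^bsub>A\<^esub> x \<in> ?P" using xa by (simp only:)
  qed
  show "cring A" by (rule cring_A)
  show "carrier A \<noteq> ?P"
  proof
    assume "carrier A = ?P"
    then have "\<one>\<^bsub>A\<^esub> \<in> ?P" using A.one_closed by blast
    then have "\<one>\<^bsub>A\<^esub> {#} = \<zero>" using F(2) by blast
    then show False by (simp add: coeff_one)
  qed
  fix a b assume a: "a \<in> carrier A" and b: "b \<in> carrier A" and ab: "a \<otimes>\<^bsub>A\<^esub> b \<in> ?P"
  show "a \<in> ?P \<or> b \<in> ?P"
  proof (rule ccontr)
    assume n: "\<not> (a \<in> ?P \<or> b \<in> ?P)"
    have least: "\<exists>m\<in>F. c m \<noteq> \<zero> \<and> (\<forall>m'\<in>F. c m' \<noteq> \<zero> \<longrightarrow> m = m' \<or> mono_less m m')"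
      if c: "c \<in> carrier A" "c \<notin> ?P" for c
    proof -
      have "{m \<in> F. c m \<noteq> \<zero>} \<noteq> {}" using c by blast
      moreover have "set_mset m \<subseteq> I" if "m \<in> {m \<in> F. c m \<noteq> \<zero>}" for m using that F(1) Q_supported by blast
      ultimately have "\<exists>m\<in>{m \<in> F. c m \<noteq> \<zero>}. \<forall>m'\<in>{m \<in> F. c m \<noteq> \<zero>}. m' = m \<or> mono_less m m'"
        by (rule mono_least[OF finite_I])
      then obtain m where m: "m \<in> {m \<in> F. c m \<noteq> \<zero>}"
        "\<forall>m'\<in>{m \<in> F. c m \<noteq> \<zero>}. m' = m \<or> mono_less m m'" ..
      show ?thesis
      proof (intro bexI[of _ m] conjI ballI impI)
        show "m = m' \<or> mono_less m m'" if "m' \<in> F" "c m' \<noteq> \<zero>" for m'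
          using bspec[OF m(2), of m'] that by auto
      qed (use m(1) in simp_all)
    qed
    have np: "a \<notin> ?P" "b \<notin> ?P" using n by simp_all
    from least[OF a np(1)] obtain k
      where k': "k \<in> F" "a k \<noteq> \<zero> \<and> (\<forall>m'\<in>F. a m' \<noteq> \<zero> \<longrightarrow> k = m' \<or> mono_less k m')" ..
    have k: "k \<in> F" "a k \<noteq> \<zero>" "\<And>m. m \<in> F \<Longrightarrow> a m \<noteq> \<zero> \<Longrightarrow> k = m \<or> mono_less k m"
      using k' by simp_all
    from least[OF b np(2)] obtain l
      where l': "l \<in> F" "b l \<noteq> \<zero> \<and> (\<forall>m'\<in>F. b m' \<noteq> \<zero> \<longrightarrow> l = m' \<or> mono_less l m')" ..
    have l: "l \<in> F" "b l \<noteq> \<zero>" "\<And>m. m \<in> F \<Longrightarrow> b m \<noteq> \<zero> \<Longrightarrow> l = m \<or> mono_less l m"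
      using l' by simp_all
    have kl: "k + l \<in> F" using F(1,3) k(1) l(1) by blast
    have ac: "\<And>m. a m \<in> carrier R" and bc: "\<And>m. b m \<in> carrier R" using coeff_closed a b by blast+
    have "(a \<otimes>\<^bsub>A\<^esub> b) (k + l) = (case (k, l) of (x, y) \<Rightarrow> a x \<otimes> b y)"
      unfolding coeff_mult[OF a b]
    proof (rule finsum_only)
      show "finite (splits (k + l))" "(k, l) \<in> splits (k + l)" by simp_all
      show "(case (k, l) of (x, y) \<Rightarrow> a x \<otimes> b y) \<in> carrier R" using ac bc by simp
      fix z assume z: "z \<in> splits (k + l)" "z \<noteq> (k, l)"
      obtain x y where xy: "z = (x, y)" by (cases z)
      have s: "x + y = k + l" using z(1) xy by simp
      show "(case z of (x, y) \<Rightarrow> a x \<otimes> b y) = \<zero>"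
      proof (rule ccontr)
        assume "(case z of (x, y) \<Rightarrow> a x \<otimes> b y) \<noteq> \<zero>"
        then have nz: "a x \<noteq> \<zero>" "b y \<noteq> \<zero>" using xy ac bc by auto
        then have "x \<in> Q" "y \<in> Q" using support_Q a b by blast+
        then have "x \<in> F" "y \<in> F" using F(3) s kl by metis+
        then have "k = x \<or> mono_less k x" "l = y \<or> mono_less l y" using k(3) l(3) nz by blast+
        then have "k = x \<and> l = y" using s by (intro mono_less_add_both) auto
        then show False using z(2) xy by simp
      qed
    qed
    moreover have "(a \<otimes>\<^bsub>A\<^esub> b) (k + l) = \<zero>" using ab kl by blast
    ultimately show False using integral[of "a k" "b l"] k(2) l(2) ac bc by auto
  qed
qed

end

section \<open>Asymptotics of the free rank\<close>

text \<open>At \<open>x = t / q\<close> with \<open>t \<ge> 0\<close> this is the number of small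
  monomials with exponent \<open>t\<close> of \<open>u\<close>, divided by \<open>q ^ n\<close>;
  truncation at zero corresponds to an empty range of exponents.\<close>

definition trunc_prod :: "nat \<Rightarrow> (nat \<Rightarrow> nat) \<Rightarrow> real \<Rightarrow> real"
  where "trunc_prod n d x = (\<Prod>j\<in>{1..n}. max 0 (1 - x * real (d j)))"

text \<open>Choosing the first summand exactly at the indices in \<open>J\<close>, and sorting the
  subsets \<open>J\<close> by cardinality, produces the sums that define \<open>W\<close>.\<close>

lemma prod_expansion:
  fixes r :: real
  shows "(\<Prod>j\<in>{1..n}. (real (max_exponent n d) - real (d j)) + real (d j) * r) = (\<Sum>s\<in>{0..n}. W n d s * r ^ (n - s))"
proof -
  let ?c = "\<lambda>j. real (max_exponent n d) - real (d j)"
  let ?f = "\<lambda>J. (\<Prod>j\<in>J. ?c j) * (\<Prod>j\<in>{1..n} - J. real (d j) * r)"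
  have "(\<Prod>j\<in>{1..n}. ?c j + real (d j) * r) = (\<Sum>J\<in>Pow {1..n}. ?f J)"
    by (rule prod_add) simp
  also have "\<dots> = (\<Sum>s\<in>{0..n}. \<Sum>J\<in>{J \<in> Pow {1..n}. card J = s}. ?f J)"
  proof (rule sum.group[symmetric])
    show "card ` Pow {1..n} \<subseteq> {0..n}"
    proof
      fix c assume "c \<in> card ` Pow {1..n}"
      then obtain J where "J \<subseteq> {1..n}" "c = card J" by blast
      then show "c \<in> {0..n}" using card_mono[of "{1..n}" J] by simp
    qed
  qed simp_all
  also have "\<dots> = (\<Sum>s\<in>{0..n}. W n d s * r ^ (n - s))"
  proof (rule sum.cong[OF refl])
    fix s
    have "?f J = ((\<Prod>j\<in>J. ?c j) * (\<Prod>j\<in>{1..n} - J. real (d j))) * r ^ (n - s)"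
      if "J \<in> {J \<in> Pow {1..n}. card J = s}" for J
    proof -
      have "card ({1..n} - J) = n - s" using that by (subst card_Diff_subset) (auto intro: finite_subset)
      then show ?thesis by (simp add: prod.distrib)
    qed
    then have "(\<Sum>J\<in>{J \<in> Pow {1..n}. card J = s}. ?f J)
      = (\<Sum>J\<in>{J \<in> Pow {1..n}. card J = s}. ((\<Prod>j\<in>J. ?c j) * (\<Prod>j\<in>{1..n} - J. real (d j))) * r ^ (n - s))"
      by (rule sum.cong[OF refl])
    also have "{J \<in> Pow {1..n}. card J = s} = {J. J \<subseteq> {1..n} \<and> card J = s}" by auto
    finally show "(\<Sum>J\<in>{J \<in> Pow {1..n}. card J = s}. ?f J) = W n d s * r ^ (n - s)"
      unfolding W_def sum_distrib_right by simp
  qed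
  finally show ?thesis .
qed

lemma sum_symmetric_interval:
  fixes G :: "nat \<Rightarrow> nat"
  shows "(\<Sum>t\<in>{- int N..int N}. G (nat \<bar>t\<bar>)) = G 0 + 2 * (\<Sum>t\<in>{1..N}. G t)"
proof (induction N)
  case (Suc N)
  have "{- int (Suc N)..int (Suc N)} = insert (- int (Suc N)) (insert (int (Suc N)) {- int N..int N})"
    by auto
  moreover have "nat (1 + int N) = Suc N" by simp
  ultimately show ?case using Suc.IH by (simp add: algebra_simps)
qed simp

section \<open>The volume as an integral and its Riemann sums\<close>

context
  fixes n :: nat and d :: "nat \<Rightarrow> nat" and D :: real
  assumes n: "n \<ge> 1" and dpos: "\<And>j. j \<in> {1..n} \<Longrightarrow> d j > 0"
  defines "D \<equiv> real (max_exponent n d)"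
begin

lemma max_exponent_ge: "j \<in> {1..n} \<Longrightarrow> real (d j) \<le> D"
  unfolding D_def max_exponent_def by (intro of_nat_mono Max_ge) auto

lemma D_ge_1: "D \<ge> 1"
proof -
  have "real (d 1) \<ge> 1" using dpos[of 1] n by simp
  then show ?thesis using max_exponent_ge[of 1] n by simp
qed

lemma max_exponent_attained: "\<exists>j\<in>{1..n}. D = real (d j)"
proof -
  have "Max (d ` {1..n}) \<in> d ` {1..n}" using n by (intro Max_in) auto
  then show ?thesis unfolding D_def max_exponent_def by auto
qed

text \<open>Some \<open>d j\<close> equals the maximum and contributes a zero factor. This is why
  the sum over \<open>s\<close> ends at \<open>n - 1\<close>.\<close>

lemma W_top: "W n d n = 0"
proof -
  obtain j where j: "j \<in> {1..n}" "D = real (d j)" using max_exponent_attained by blast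
  have "J = {1..n}" if "J \<subseteq> {1..n}" "card J = n" for J
    using card_subset_eq[of "{1..n}" J] that by simp
  then have "{J. J \<subseteq> {1..n} \<and> card J = n} = {{1..n}}" by auto
  then have "W n d n = (\<Prod>j\<in>{1..n}. D - real (d j))" by (simp add: W_def D_def)
  also have "\<dots> = 0" using j by (intro prod_zero) auto
  finally show ?thesis .
qed

lemma W_nonneg: "W n d s \<ge> 0"
  unfolding W_def D_def[symmetric] using max_exponent_ge
  by (intro sum_nonneg mult_nonneg_nonneg prod_nonneg) auto

lemma W_0_pos: "W n d 0 > 0"
proof -
  have "{J. J \<subseteq> {1..n} \<and> card J = 0} = {{}}" by (auto dest: finite_subset)
  then have "W n d 0 = (\<Prod>j\<in>{1..n}. real (d j))" by (simp add: W_def)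
  also have "\<dots> > 0" using dpos by (intro prod_pos) auto
  finally show ?thesis .
qed

text \<open>An antiderivative of the product of all \<open>1 - x * d j\<close>, normalised to vanish
  at \<open>1 / D\<close>, the first positive zero of the product.\<close>

definition primitive :: "real \<Rightarrow> real"
  where "primitive x = - (\<Sum>s\<in>{0..n - 1}. W n d s * (1 - D * x) ^ (n - s + 1) / real (n - s + 1)) / D ^ (n + 1)"

text \<open>The integral of that product from 0 to \<open>1 / D\<close>, that is, minus the value of
  \<open>primitive\<close> at 0. Twice this number is the asserted signature.\<close>

definition volume :: real
  where "volume = (\<Sum>s\<in>{0..n - 1}. W n d s / real (n - s + 1)) / D ^ (n + 1)"

lemma primitive_end: "primitive (1 / D) = 0"
  using D_ge_1 by (simp add: primitive_def)

lemma primitive_0: "primitive 0 = - volume"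
  by (simp add: primitive_def volume_def)

lemma volume_pos: "volume > 0"
proof -
  have "0 < W n d 0 / real (n - 0 + 1)" using W_0_pos by simp
  also have "\<dots> \<le> (\<Sum>s\<in>{0..n - 1}. W n d s / real (n - s + 1))"
    using W_nonneg by (intro member_le_sum) auto
  finally show ?thesis using D_ge_1 by (simp add: volume_def)
qed

text \<open>The polynomial in \<open>r = 1 - D * x\<close> from \<open>prod_expansion\<close> is
  matched term by term. The chain rule factor \<open>- D\<close> accounts for the sign in
  \<open>primitive\<close> and for the extra power of \<open>D\<close> in its denominator.\<close>

lemma primitive_deriv: "(primitive has_real_derivative (\<Prod>j\<in>{1..n}. 1 - x * real (d j))) (at x)"
proof -
  define r where "r = 1 - D * x"
  have D0: "D \<noteq> 0" using D_ge_1 by simp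
  have "(\<Prod>j\<in>{1..n}. 1 - x * real (d j)) = (\<Prod>j\<in>{1..n}. ((D - real (d j)) + real (d j) * r) / D)"
    using D0 by (intro prod.cong) (auto simp: r_def field_simps)
  also have "\<dots> = (\<Sum>s\<in>{0..n}. W n d s * r ^ (n - s)) / D ^ n"
    using prod_expansion[of n d r] by (simp add: prod_dividef D_def)
  also have "(\<Sum>s\<in>{0..n}. W n d s * r ^ (n - s)) = (\<Sum>s\<in>{0..n - 1}. W n d s * r ^ (n - s))"
  proof (rule sum.mono_neutral_right)
    show "\<forall>i\<in>{0..n} - {0..n - 1}. W n d i * r ^ (n - i) = 0"
    proof
      fix i assume "i \<in> {0..n} - {0..n - 1}"
      then have "i = n" by auto
      then show "W n d i * r ^ (n - i) = 0" using W_top by simp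
    qed
  qed auto
  finally have e: "(\<Prod>j\<in>{1..n}. 1 - x * real (d j)) = (\<Sum>s\<in>{0..n - 1}. W n d s * r ^ (n - s)) / D ^ n" .
  have "(primitive has_real_derivative
      - (\<Sum>s\<in>{0..n - 1}. W n d s * (real (n - s + 1) * (1 - D * x) ^ (n - s) * (- D)) / real (n - s + 1)) / D ^ (n + 1)) (at x)"
    unfolding primitive_def
    by (rule DERIV_cdivide DERIV_minus DERIV_sum derivative_eq_intros refl | simp)+
  also have "- (\<Sum>s\<in>{0..n - 1}. W n d s * (real (n - s + 1) * (1 - D * x) ^ (n - s) * (- D)) / real (n - s + 1)) / D ^ (n + 1)
      = (\<Sum>s\<in>{0..n - 1}. W n d s * r ^ (n - s)) / D ^ n"
  proof -
    have "(\<Sum>s\<in>{0..n - 1}. W n d s * (real (n - s + 1) * (1 - D * x) ^ (n - s) * (- D)) / real (n - s + 1))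
      = (\<Sum>s\<in>{0..n - 1}. (- D) * (W n d s * r ^ (n - s)))"
      by (intro sum.cong) (simp_all add: r_def)
    also have "\<dots> = (- D) * (\<Sum>s\<in>{0..n - 1}. W n d s * r ^ (n - s))" by (simp add: sum_distrib_left)
    finally show ?thesis using D0 by simp
  qed
  finally show ?thesis by (simp only: e)
qed

lemma trunc_prod_eq: "0 \<le> x \<Longrightarrow> x \<le> 1 / D \<Longrightarrow> trunc_prod n d x = (\<Prod>j\<in>{1..n}. 1 - x * real (d j))"
proof -
  assume x: "0 \<le> x" "x \<le> 1 / D"
  have "x * real (d j) \<le> 1" if "j \<in> {1..n}" for j
  proof -
    have "x * real (d j) \<le> 1 / D * D" using x max_exponent_ge[OF that] by (intro mult_mono) auto
    then show ?thesis using D_ge_1 by simp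
  qed
  then show ?thesis unfolding trunc_prod_def by (intro prod.cong) auto
qed

lemma trunc_prod_zero: "1 / D \<le> x \<Longrightarrow> trunc_prod n d x = 0"
proof -
  assume x: "1 / D \<le> x"
  obtain j where j: "j \<in> {1..n}" "D = real (d j)" using max_exponent_attained by blast
  have "1 \<le> x * D" using x D_ge_1 by (simp add: field_simps)
  then show ?thesis unfolding trunc_prod_def using j by (intro prod_zero bexI[of _ j]) auto
qed

lemma trunc_prod_nonneg: "0 \<le> trunc_prod n d x"
  unfolding trunc_prod_def by (intro prod_nonneg) auto

lemma trunc_prod_mono: "x \<le> y \<Longrightarrow> trunc_prod n d y \<le> trunc_prod n d x"
proof -
  assume xy: "x \<le> y"
  show ?thesis unfolding trunc_prod_def
  proof (rule prod_mono)
    fix j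
    have "x * real (d j) \<le> y * real (d j)" using xy by (intro mult_right_mono) auto
    then show "0 \<le> max 0 (1 - y * real (d j)) \<and> max 0 (1 - y * real (d j)) \<le> max 0 (1 - x * real (d j))"
      by (simp add: max_def)
  qed
qed

text \<open>The mean value theorem expresses the increment through a value of the product in
  between, and monotonicity bounds it by the values at the two ends.\<close>

lemma primitive_diff:
  assumes "0 \<le> x" "x \<le> y" "y \<le> 1 / D"
  shows "(y - x) * trunc_prod n d y \<le> primitive y - primitive x \<and> primitive y - primitive x \<le> (y - x) * trunc_prod n d x"
proof (cases "x = y")
  case False
  then have "x < y" using assms by simp
  then obtain z where z: "x < z" "z < y" "primitive y - primitive x = (y - x) * (\<Prod>j\<in>{1..n}. 1 - z * real (d j))"
    using MVT2[of x y primitive "\<lambda>z. \<Prod>j\<in>{1..n}. 1 - z * real (d j)"] primitive_deriv by blast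
  have "primitive y - primitive x = (y - x) * trunc_prod n d z"
    using z trunc_prod_eq[of z] assms by simp
  then show ?thesis
    using trunc_prod_mono[of x z] trunc_prod_mono[of z y] z assms by (auto intro: mult_left_mono)
qed simp

text \<open>Beyond \<open>1 / D\<close> the truncated product is zero. Freezing the antiderivative
  there gives increment bounds on the whole half-line, so the Riemann sum can run up to
  \<open>q\<close> although \<open>1 / D\<close> need not be one of its nodes.\<close>

definition cut_primitive :: "real \<Rightarrow> real"
  where "cut_primitive x = primitive (min x (1 / D))"

lemma cut_primitive_diff:
  assumes "0 \<le> x" "x \<le> y"
  shows "(y - x) * trunc_prod n d y \<le> cut_primitive y - cut_primitive x
    \<and> cut_primitive y - cut_primitive x \<le> (y - x) * trunc_prod n d x"
proof -
  consider "y \<le> 1 / D" | "x \<le> 1 / D" "1 / D < y" | "1 / D < x" using assms by linarith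
  then show ?thesis
  proof cases
    case 1
    then show ?thesis using primitive_diff[OF assms 1] assms by (simp add: cut_primitive_def min_absorb1)
  next
    case 2
    have "0 \<le> (1 / D - x) * trunc_prod n d (1 / D)" using 2 trunc_prod_nonneg by simp
    moreover have "(1 / D - x) * trunc_prod n d x \<le> (y - x) * trunc_prod n d x"
      using 2 trunc_prod_nonneg by (intro mult_right_mono) auto
    ultimately show ?thesis
      using primitive_diff[OF assms(1) 2(1) order_refl] 2 trunc_prod_zero[of y]
      by (simp add: cut_primitive_def)
  next
    case 3
    then show ?thesis using assms trunc_prod_zero[of x] trunc_prod_zero[of y]
      by (simp add: cut_primitive_def)
  qed
qed

text \<open>For a decreasing function the sum over right end points lies below the integral and the
  sum over left end points above it. They differ by \<open>(g 0 - g q) / q\<close>, which is at most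
  \<open>1 / q\<close>.\<close>

lemma riemann_sum:
  assumes q: "q > 0"
  shows "(\<Sum>t\<in>{1..q}. trunc_prod n d (real t / real q)) / real q \<le> volume
    \<and> volume \<le> (\<Sum>t\<in>{1..q}. trunc_prod n d (real t / real q)) / real q + 1 / real q"
proof -
  define g where "g = (\<lambda>t :: nat. trunc_prod n d (real t / real q))"
  define c where "c = (\<lambda>t :: nat. cut_primitive (real t / real q))"
  have step: "g (Suc t) / real q \<le> c (Suc t) - c t \<and> c (Suc t) - c t \<le> g t / real q" for t
  proof -
    have "real (Suc t) / real q - real t / real q = 1 / real q" by (simp add: diff_divide_distrib[symmetric])
    then show ?thesis
      using cut_primitive_diff[of "real t / real q" "real (Suc t) / real q"]
      by (simp add: g_def c_def divide_right_mono)
  qed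
  have up: "(\<Sum>t\<in>{1..N}. g t) / real q \<le> c N - c 0" for N
  proof (induction N)
    case (Suc N)
    then show ?case using step[of N] by (simp add: add_divide_distrib)
  qed simp
  have lo: "c N - c 0 \<le> (g 0 + (\<Sum>t\<in>{1..N}. g t) - g N) / real q" for N
  proof (induction N)
    case (Suc N)
    then show ?case using step[of N] by (simp add: add_divide_distrib diff_divide_distrib)
  qed simp
  have c0: "c 0 = - volume" using D_ge_1 primitive_0 by (simp add: c_def cut_primitive_def)
  \<comment> \<open>The bound \<open>D \<ge> 1\<close> puts \<open>1 / D\<close> at or before the
    last node \<open>q / q\<close>.\<close>
  have cq: "c q = 0" using q D_ge_1 primitive_end by (simp add: c_def cut_primitive_def min_absorb2)
  have g0: "g 0 = 1" by (simp add: g_def trunc_prod_def)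
  have gq: "g q \<ge> 0" using trunc_prod_nonneg by (simp add: g_def)
  have "(g 0 + (\<Sum>t\<in>{1..q}. g t) - g q) / real q \<le> ((\<Sum>t\<in>{1..q}. g t) + 1) / real q"
    using g0 gq by (intro divide_right_mono) auto
  then have "volume \<le> (\<Sum>t\<in>{1..q}. g t) / real q + 1 / real q"
    using lo[of q] c0 cq by (simp add: add_divide_distrib)
  then show ?thesis using up[of q] c0 cq by (simp add: g_def)
qed

text \<open>Subtraction of natural numbers truncates at zero exactly as \<open>max 0\<close>
  does.\<close>

lemma prod_trunc:
  assumes q: "q > 0"
  shows "real (\<Prod>j\<in>{1..n}. q - t * d j) = real q ^ n * trunc_prod n d (real t / real q)"
proof -
  have "real (q - t * d j) = real q * max 0 (1 - real t / real q * real (d j))" for j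
  proof (cases "t * d j \<le> q")
    case True
    then have "real t * real (d j) \<le> real q" by (metis of_nat_le_iff of_nat_mult)
    then show ?thesis using q True by (simp add: of_nat_diff field_simps max_def)
  next
    case False
    then have "real q \<le> real t * real (d j)" by (metis nat_le_linear of_nat_le_iff of_nat_mult)
    then show ?thesis using q False by (simp add: field_simps max_def)
  qed
  then have "real (\<Prod>j\<in>{1..n}. q - t * d j) = (\<Prod>j\<in>{1..n}. real q * max 0 (1 - real t / real q * real (d j)))"
    by simp
  then show ?thesis by (simp add: prod.distrib trunc_prod_def)
qed

lemma count_asymptotics:
  assumes p: "p \<ge> 2"
  shows "(\<lambda>e. real (\<Sum>t\<in>{- int (p ^ e)..int (p ^ e)}. \<Prod>j\<in>{1..n}. p ^ e - nat \<bar>t\<bar> * d j) / real (p ^ e) ^ (n + 1))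
    \<longlonglongrightarrow> 2 * volume"
proof -
  define s where "s = (\<lambda>e. real (\<Sum>t\<in>{- int (p ^ e)..int (p ^ e)}. \<Prod>j\<in>{1..n}. p ^ e - nat \<bar>t\<bar> * d j) / real (p ^ e) ^ (n + 1))"
  \<comment> \<open>The term \<open>t = 0\<close> occurs once and contributes \<open>1 / q\<close>;
    the others occur in pairs. The Riemann sum errs by at most \<open>1 / q\<close> and only
    downwards, so the total stays within \<open>1 / q\<close> of \<open>2 * volume\<close> on either
    side.\<close>
  have s: "2 * volume - 1 / real (p ^ e) \<le> s e \<and> s e \<le> 2 * volume + 1 / real (p ^ e)" for e
  proof -
    define q where "q = p ^ e"
    have q: "q > 0" using p by (simp add: q_def)
    have "(\<Sum>t\<in>{- int q..int q}. \<Prod>j\<in>{1..n}. q - nat \<bar>t\<bar> * d j)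
      = (\<Prod>j\<in>{1..n}. q - 0 * d j) + 2 * (\<Sum>t\<in>{1..q}. \<Prod>j\<in>{1..n}. q - t * d j)"
      by (rule sum_symmetric_interval)
    then have "real (\<Sum>t\<in>{- int q..int q}. \<Prod>j\<in>{1..n}. q - nat \<bar>t\<bar> * d j)
      = real (\<Prod>j\<in>{1..n}. q - 0 * d j) + 2 * (\<Sum>t\<in>{1..q}. real (\<Prod>j\<in>{1..n}. q - t * d j))"
      by simp
    also have "\<dots> = real q ^ n * trunc_prod n d (real 0 / real q) + 2 * (\<Sum>t\<in>{1..q}. real q ^ n * trunc_prod n d (real t / real q))"
      unfolding prod_trunc[OF q] ..
    also have "\<dots> = real q ^ n * (1 + 2 * (\<Sum>t\<in>{1..q}. trunc_prod n d (real t / real q)))"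
      by (simp add: trunc_prod_def sum_distrib_left algebra_simps)
    finally have expand: "real (\<Sum>t\<in>{- int q..int q}. \<Prod>j\<in>{1..n}. q - nat \<bar>t\<bar> * d j)
      = real q ^ n * (1 + 2 * (\<Sum>t\<in>{1..q}. trunc_prod n d (real t / real q)))" .
    have "s e = (1 + 2 * (\<Sum>t\<in>{1..q}. trunc_prod n d (real t / real q))) / real q"
    proof -
      have "s e = real (\<Sum>t\<in>{- int q..int q}. \<Prod>j\<in>{1..n}. q - nat \<bar>t\<bar> * d j) / real q ^ (n + 1)"
        by (simp only: s_def q_def)
      also have "\<dots> = real q ^ n * (1 + 2 * (\<Sum>t\<in>{1..q}. trunc_prod n d (real t / real q))) / real q ^ (n + 1)"
        by (simp only: expand)
      also have "\<dots> = (1 + 2 * (\<Sum>t\<in>{1..q}. trunc_prod n d (real t / real q))) / real q"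
        using q by simp
      finally show ?thesis .
    qed
    also have "\<dots> = 1 / real q + 2 * ((\<Sum>t\<in>{1..q}. trunc_prod n d (real t / real q)) / real q)"
      by (simp add: add_divide_distrib)
    finally show ?thesis using riemann_sum[OF q] unfolding q_def[symmetric] by linarith
  qed
  have "(\<lambda>e. 1 / real (p ^ e)) \<longlonglongrightarrow> 0"
  proof -
    have "(\<lambda>e. (1 / real p) ^ e) \<longlonglongrightarrow> 0" using p by (intro LIMSEQ_power_zero) simp
    then show ?thesis by (simp add: power_divide)
  qed
  then have "(\<lambda>e. 2 * volume - 1 / real (p ^ e)) \<longlonglongrightarrow> 2 * volume - 0"
    "(\<lambda>e. 2 * volume + 1 / real (p ^ e)) \<longlonglongrightarrow> 2 * volume + 0"
    by (intro tendsto_intros; assumption)+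
  then have "s \<longlonglongrightarrow> 2 * volume"
    using s by (intro tendsto_sandwich[of "\<lambda>e. 2 * volume - 1 / real (p ^ e)" s sequentially "\<lambda>e. 2 * volume + 1 / real (p ^ e)"])
      (auto intro!: always_eventually)
  then show ?thesis by (simp add: s_def)
qed

end

section \<open>Faces, dimension and lattice points of the facet monoid\<close>

context hypersurface
begin

abbreviation "Q \<equiv> facet_monoid n d"

definition mset_of :: "(bool \<times> nat \<Rightarrow> nat) \<Rightarrow> (bool \<times> nat) multiset"
  where "mset_of f = (\<Sum>x\<in>UNIV \<times> {1..n}. replicate_mset (f x) x)"

lemma count_mset_of: "count (mset_of f) x = (if snd x \<in> {1..n} then f x else 0)"
proof -
  have "count (mset_of f) x = (\<Sum>y\<in>UNIV \<times> {1..n}. if y = x then f y else 0)"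
    unfolding mset_of_def count_sum by (intro sum.cong) auto
  also have "\<dots> = (if x \<in> UNIV \<times> {1..n} then f x else 0)" by (rule sum.delta) simp
  finally show ?thesis by (cases x) simp
qed

lemma mset_of_mem:
  assumes "\<And>j. j \<in> {1..n} \<Longrightarrow> int (f (True, j)) = int (f (False, j)) + t * int (d j)"
  shows "mset_of f \<in> Q"
proof -
  have "set_mset (mset_of f) \<subseteq> UNIV \<times> {1..n}"
  proof
    fix x assume "x \<in># mset_of f"
    then have "count (mset_of f) x \<noteq> 0" by simp
    then have "snd x \<in> {1..n}" unfolding count_mset_of by presburger
    then show "x \<in> UNIV \<times> {1..n}" by (cases x) simp
  qed
  moreover have "\<forall>j\<in>{1..n}. int (count (mset_of f) (True, j)) = int (count (mset_of f) (False, j)) + t * int (d j)"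
    using assms by (simp add: count_mset_of)
  ultimately show ?thesis unfolding facet_monoid_def by blast
qed

lemma Q_facets:
  assumes i: "i \<in> UNIV \<times> {1..n}"
  shows "\<exists>g\<in>Q. \<exists>h\<in>Q. count g i = 0 \<and> count h i = 1 \<and> (\<forall>x. x \<noteq> i \<longrightarrow> count h x \<le> count g x)"
proof -
  obtain b j where ij: "i = (b, j)" "j \<in> {1..n}" using i by auto
  \<comment> \<open>\<open>h\<close> is the variable with index \<open>j\<close>. \<open>g\<close>
    is the product of the other variables of \<open>S\<close> with \<open>v\<close> if
    \<open>b\<close> holds and with \<open>u\<close> otherwise: it has value 0 at \<open>i\<close>
    and value \<open>d j\<close>, which is at least 1, on the other facet of index
    \<open>j\<close>.\<close>
  define h where "h = mset_of (\<lambda>x. if snd x = j then 1 else 0)"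
  define g where "g = mset_of (\<lambda>x. (if snd x = j then 0 else 1) + (if fst x = b then 0 else d (snd x)))"
  have "h \<in> Q" unfolding h_def by (rule mset_of_mem[of _ 0]) simp
  moreover have "g \<in> Q" unfolding g_def by (rule mset_of_mem[of _ "if b then - 1 else 1"]) simp
  moreover have "count g i = 0" "count h i = 1" using ij by (simp_all add: g_def h_def count_mset_of)
  moreover have "count h x \<le> count g x" if x: "x \<noteq> i" for x
  proof (cases "snd x = j")
    case True
    then have "fst x \<noteq> b" using x ij(1) by (cases x) auto
    then show ?thesis using True ij(2) d_pos[OF ij(2)] by (simp add: g_def h_def count_mset_of Suc_le_eq)
  next
    case False
    then show ?thesis by (simp add: h_def count_mset_of)
  qed
  ultimately show ?thesis by blast
qed

text \<open>The choice is unambiguous on \<open>Q\<close>, since \<open>n \<ge> 1\<close> and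
  \<open>d 1 > 0\<close>; this is \<open>u_exponent_eqI\<close>.\<close>

definition u_exponent :: "(bool \<times> nat) multiset \<Rightarrow> int"
  where "u_exponent m = (SOME t. \<forall>j\<in>{1..n}. int (count m (True, j)) = int (count m (False, j)) + t * int (d j))"

lemma u_exponent:
  assumes "m \<in> Q" "j \<in> {1..n}"
  shows "int (count m (True, j)) = int (count m (False, j)) + u_exponent m * int (d j)"
proof -
  have "\<exists>t. \<forall>j\<in>{1..n}. int (count m (True, j)) = int (count m (False, j)) + t * int (d j)"
    using assms(1) unfolding facet_monoid_def by blast
  from someI_ex[OF this] show ?thesis using assms(2) unfolding u_exponent_def by blast
qed

lemma u_exponent_eqI:
  assumes "m \<in> Q" "int (count m (True, 1)) = int (count m (False, 1)) + t * int (d 1)"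
  shows "u_exponent m = t"
proof -
  have one: "1 \<in> {1..n}" using n_pos by simp
  have "u_exponent m * int (d 1) = t * int (d 1)" using u_exponent[OF assms(1) one] assms(2) by linarith
  then show ?thesis using d_pos[OF one] by (simp only: mult_cancel_right of_nat_eq_0_iff) simp
qed

text \<open>The exponent of \<open>u\<close> and the \<open>n\<close> values on the
  \<open>False\<close> side are lattice coordinates of rank \<open>n + 1\<close>, the form suited to
  counting.\<close>

definition coords :: "(bool \<times> nat) multiset \<Rightarrow> int \<times> (nat \<Rightarrow> nat)"
  where "coords m = (u_exponent m, \<lambda>j\<in>{1..n}. count m (False, j))"

lemma coords_inj: "inj_on coords Q"
proof (rule inj_onI)
  fix m m' assume m: "m \<in> Q" "m' \<in> Q" "coords m = coords m'"
  have t: "u_exponent m = u_exponent m'" using m(3) by (simp add: coords_def)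
  have f: "count m (False, j) = count m' (False, j)" if "j \<in> {1..n}" for j
  proof -
    have "snd (coords m) j = snd (coords m') j" using m(3) by simp
    then show ?thesis using that by (simp add: coords_def)
  qed
  show "m = m'"
  proof (rule multiset_eqI)
    fix x :: "bool \<times> nat"
    obtain b j where x: "x = (b, j)" by (cases x)
    show "count m x = count m' x"
    proof (cases "j \<in> {1..n}")
      case True
      then have "int (count m (True, j)) = int (count m' (True, j))"
        using u_exponent[OF m(1) True] u_exponent[OF m(2) True] t f[OF True] by simp
      then show ?thesis using f[OF True] x by (cases b) auto
    next
      case False
      then have "x \<notin># m" "x \<notin># m'" using m(1,2) x by (auto simp: facet_monoid_def)
      then show ?thesis by (simp add: not_in_iff)
    qed
  qed
qed

lemma u_exponent_bound:
  assumes m: "m \<in> Q" and j: "j \<in> {1..n}" and c: "count m (True, j) < N" "count m (False, j) < N"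
  shows "\<bar>u_exponent m\<bar> < int N"
proof -
  have "u_exponent m * int (d j) = int (count m (True, j)) - int (count m (False, j))"
    using u_exponent[OF m j] by simp
  then have "\<bar>u_exponent m\<bar> * int (d j) < int N" using c by (simp add: abs_mult[symmetric])
  moreover have "\<bar>u_exponent m\<bar> * 1 \<le> \<bar>u_exponent m\<bar> * int (d j)"
    using d_pos[OF j] by (intro mult_left_mono) auto
  ultimately show ?thesis by linarith
qed

text \<open>All facet values are below \<open>N\<close>, so the exponent of \<open>u\<close> has
  absolute value below \<open>N\<close> as well. There remain \<open>n + 1\<close> coordinates with
  a linear range each, which gives the exponent in the dimension bound.\<close>

lemma card_Q_less: "card {m \<in> Q. size m < N} \<le> 2 * N ^ (n + 1)"
proof -
  have n1: "1 \<in> {1..n}" using n_pos by simp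
  have "card {m \<in> Q. size m < N} \<le> card ({- int N<..<int N} \<times> ({1..n} \<rightarrow>\<^sub>E {..<N}))"
  proof (rule card_inj_on_le)
    show "inj_on coords {m \<in> Q. size m < N}" by (rule inj_on_subset[OF coords_inj]) auto
    show "finite ({- int N<..<int N} \<times> ({1..n} \<rightarrow>\<^sub>E {..<N}))" by (intro finite_cartesian_product finite_PiE) auto
    show "coords ` {m \<in> Q. size m < N} \<subseteq> {- int N<..<int N} \<times> ({1..n} \<rightarrow>\<^sub>E {..<N})"
    proof
      fix y assume "y \<in> coords ` {m \<in> Q. size m < N}"
      then obtain m where m: "m \<in> Q" "size m < N" "y = coords m" by blast
      have c: "count m x < N" for x using count_le_size[of m x] m(2) by linarith
      have "\<bar>u_exponent m\<bar> < int N" by (rule u_exponent_bound[OF m(1) n1 c c])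
      then show "y \<in> {- int N<..<int N} \<times> ({1..n} \<rightarrow>\<^sub>E {..<N})"
        using m(3) c by (auto simp: coords_def)
    qed
  qed
  also have "\<dots> = card {- int N<..<int N} * N ^ n" by (simp add: card_cartesian_product card_PiE)
  also have "\<dots> \<le> (2 * N) * N ^ n" by (intro mult_right_mono) auto
  finally show ?thesis by simp
qed

text \<open>A chain of faces of the cone. It starts with the whole monoid at \<open>k = 0\<close>,
  reaches the powers of \<open>u\<close> at \<open>k = n\<close> and ends with the vertex; the
  primes of series vanishing on them go from the zero ideal to the maximal ideal in
  \<open>n + 1\<close> strict steps.\<close>

definition face :: "nat \<Rightarrow> (bool \<times> nat) multiset set"
  where "face k = (if k \<le> n then {m \<in> Q. \<forall>j\<in>{1..k}. count m (False, j) = 0} else {{#}})"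

lemma face_prime_ideal: "primeideal {P \<in> carrier B. \<forall>m\<in>face k. P m = \<zero>} B"
proof (rule AA.face_prime)
  show "face k \<subseteq> Q" "{#} \<in> face k" using AA.empty_Q by (auto simp: face_def)
  fix l m assume "l \<in> Q" "m \<in> Q"
  then show "l + m \<in> face k \<longleftrightarrow> l \<in> face k \<and> m \<in> face k"
    using AA.add_Q by (auto simp: face_def)
qed

lemma face_strict:
  assumes k: "k \<le> n"
  shows "\<exists>m. m \<in> face k \<and> m \<notin> face (Suc k)"
proof (cases "k < n")
  case True
  \<comment> \<open>The variable with index \<open>Suc k\<close> separates the two faces.\<close>
  define m where "m = mset_of (\<lambda>x. if snd x = Suc k then 1 else 0)"
  have "m \<in> Q" unfolding m_def by (rule mset_of_mem[of _ 0]) simp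
  then have "m \<in> face k" using k by (simp add: face_def m_def count_mset_of)
  moreover have "count m (False, Suc k) = 1" using True by (simp add: m_def count_mset_of)
  then have "m \<notin> face (Suc k)" using True by (auto simp: face_def intro!: bexI[of _ "Suc k"] count_inI)
  ultimately show ?thesis by blast
next
  case False
  \<comment> \<open>At \<open>k = n\<close> the step down to the vertex is witnessed by the monomial
    \<open>u\<close>.\<close>
  define m where "m = mset_of (\<lambda>x. if fst x then d (snd x) else 0)"
  have "m \<in> Q" unfolding m_def by (rule mset_of_mem[of _ 1]) simp
  then have "m \<in> face k" using k by (simp add: face_def m_def count_mset_of)
  moreover have "count m (True, 1) > 0" using n_pos d_pos[of 1] by (simp add: m_def count_mset_of)
  then have "m \<noteq> {#}" by auto
  then have "m \<notin> face (Suc k)" using False by (simp add: face_def)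
  ultimately show ?thesis by blast
qed

lemma face_antimono: "face (Suc k) \<subseteq> face k"
  using AA.empty_Q by (auto simp: face_def)

lemma krull_dim_B: "krull_dim B = n + 1"
proof -
  define Ls where "Ls = {l. \<exists>P :: nat \<Rightarrow> ((bool \<times> nat) multiset \<Rightarrow> 'a) set.
    (\<forall>i\<le>l. primeideal (P i) B) \<and> (\<forall>i<l. P i \<subset> P (Suc i))}"
  have up: "l \<le> n + 1" if "l \<in> Ls" for l
  proof -
    from that obtain P where P: "(\<forall>i\<le>l. primeideal (P i) B) \<and> (\<forall>i<l. P i \<subset> P (Suc i))"
      unfolding Ls_def by blast
    show ?thesis
      by (rule AA.prime_chain_length[of l P 2]) (use P card_Q_less in simp_all)
  qed
  have "n + 1 \<in> Ls"
  proof -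
    define P where "P = (\<lambda>k. {P \<in> carrier B. \<forall>m\<in>face k. P m = \<zero>})"
    have "P k \<subset> P (Suc k)" if k: "k < n + 1" for k
    proof -
      obtain m where m: "m \<in> face k" "m \<notin> face (Suc k)" using face_strict[of k] k by auto
      have "m \<in> Q" using m(1) AA.empty_Q by (auto simp: face_def split: if_splits)
      then have "mono_series K \<one> m \<in> carrier B" by (intro AA.mono_series_closed) auto
      moreover have "mono_series K \<one> m m' = \<zero>" if "m' \<in> face (Suc k)" for m'
        using m(2) that by (auto simp: mono_series_def)
      moreover have "mono_series K \<one> m m \<noteq> \<zero>" by (simp add: mono_series_def)
      ultimately have "mono_series K \<one> m \<in> P (Suc k)" "mono_series K \<one> m \<notin> P k"
        using m(1) by (auto simp: P_def)
      moreover have "P k \<subseteq> P (Suc k)" using face_antimono[of k] by (auto simp: P_def)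
      ultimately show ?thesis by blast
    qed
    moreover have "primeideal (P k) B" for k unfolding P_def by (rule face_prime_ideal)
    ultimately show ?thesis unfolding Ls_def by blast
  qed
  moreover have "finite Ls" by (rule finite_subset[of _ "{..n + 1}"]) (use up in auto)
  ultimately have "Max Ls = n + 1" using up by (intro Max_eqI) auto
  then show ?thesis by (simp add: krull_dim_def Ls_def)
qed

lemma krull_dim_R_star: "krull_dim (R_star K n d) = n + 1"
  using krull_dim_iso[OF R_star_cring AA.cring_A R_star_iso] krull_dim_B by simp

lemma card_interval_shift: "card {a. a < q \<and> 0 \<le> int a + s \<and> int a + s < int q} = q - nat \<bar>s\<bar>"
proof (cases "s \<ge> 0")
  case True
  then have "{a. a < q \<and> 0 \<le> int a + s \<and> int a + s < int q} = {..<q - nat s}" by auto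
  then show ?thesis using True by simp
next
  case False
  then have "{a. a < q \<and> 0 \<le> int a + s \<and> int a + s < int q} = {nat (- s)..<q}" by auto
  then show ?thesis using False by simp
qed

text \<open>For a fixed exponent \<open>t\<close> of \<open>u\<close> the conditions at different
  indices \<open>j\<close> are independent: the value at \<open>(False, j)\<close> must lie below
  \<open>q\<close> and stay in range after the shift by \<open>t * d j\<close>. Each slice is a box,
  whence the product. The end points \<open>t = q\<close> and \<open>t = - q\<close> of the
  summation contribute zero.\<close>

lemma card_small:
  fixes q :: nat
  shows "card {m \<in> Q. \<forall>i\<in>UNIV \<times> {1..n}. count m i < q}
    = (\<Sum>t\<in>{- int q..int q}. \<Prod>j\<in>{1..n}. q - nat \<bar>t\<bar> * d j)"
proof -
  define I where "I = (\<lambda>t j. {a. a < q \<and> 0 \<le> int a + t * int (d j) \<and> int a + t * int (d j) < int q})"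
  define Z where "Z = (SIGMA t:{- int q..int q}. PiE {1..n} (I t))"
  have n1: "1 \<in> {1..n}" using n_pos by simp
  have "coords ` {m \<in> Q. \<forall>i\<in>UNIV \<times> {1..n}. count m i < q} = Z"
  proof
    show "coords ` {m \<in> Q. \<forall>i\<in>UNIV \<times> {1..n}. count m i < q} \<subseteq> Z"
    proof
      fix y assume "y \<in> coords ` {m \<in> Q. \<forall>i\<in>UNIV \<times> {1..n}. count m i < q}"
      then obtain m where m: "m \<in> Q" "\<forall>i\<in>UNIV \<times> {1..n}. count m i < q" "y = coords m" by blast
      have "\<bar>u_exponent m\<bar> < int q" by (rule u_exponent_bound[OF m(1) n1]) (use m(2) n1 in auto)
      moreover have "count m (False, j) \<in> I (u_exponent m) j" if j: "j \<in> {1..n}" for j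
      proof -
        have "count m (False, j) < q" "count m (True, j) < q" using m(2) j by auto
        then show ?thesis using u_exponent[OF m(1) j] by (simp add: I_def)
      qed
      ultimately show "y \<in> Z" using m(3) by (auto simp: Z_def coords_def)
    qed
    show "Z \<subseteq> coords ` {m \<in> Q. \<forall>i\<in>UNIV \<times> {1..n}. count m i < q}"
    proof
      fix y assume y: "y \<in> Z"
      obtain t f where tf: "y = (t, f)" by (cases y)
      have f: "f \<in> PiE {1..n} (I t)" using y tf by (simp add: Z_def)
      define m where "m = mset_of (\<lambda>x. if fst x then nat (int (f (snd x)) + t * int (d (snd x))) else f (snd x))"
      have fI: "f j < q" "0 \<le> int (f j) + t * int (d j)" "int (f j) + t * int (d j) < int q" if "j \<in> {1..n}" for j
        using PiE_mem[OF f that] by (simp_all add: I_def)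
      have mQ: "m \<in> Q" unfolding m_def by (rule mset_of_mem[of _ t]) (simp add: fI(2))
      have c: "count m (False, j) = f j" "int (count m (True, j)) = int (f j) + t * int (d j)" if "j \<in> {1..n}" for j
        using that fI(2)[OF that] by (simp_all add: m_def count_mset_of)
      have "count m i < q" if i0: "i \<in> UNIV \<times> {1..n}" for i
      proof -
        obtain b j where i: "i = (b, j)" "j \<in> {1..n}" using i0 by (cases i) simp
        then show ?thesis using c[OF i(2)] fI[OF i(2)] by (cases b) auto
      qed
      moreover have "coords m = y"
      proof -
        have "u_exponent m = t" using c[OF n1] by (intro u_exponent_eqI[OF mQ]) simp
        moreover have "(\<lambda>j\<in>{1..n}. count m (False, j)) = f"
          using f c(1) by (intro PiE_ext[OF _ f]) (auto dest: PiE_mem[OF f])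
        ultimately show ?thesis using tf by (simp add: coords_def)
      qed
      ultimately show "y \<in> coords ` {m \<in> Q. \<forall>i\<in>UNIV \<times> {1..n}. count m i < q}" using mQ by blast
    qed
  qed
  then have "card {m \<in> Q. \<forall>i\<in>UNIV \<times> {1..n}. count m i < q} = card Z"
    by (simp only: card_image[OF inj_on_subset[OF coords_inj Collect_restrict], symmetric])
  also have "\<dots> = (\<Sum>t\<in>{- int q..int q}. card (PiE {1..n} (I t)))"
  proof -
    have "finite (I t j)" for t j by (rule finite_subset[of _ "{..<q}"]) (simp_all add: I_def Collect_mono_iff lessThan_def)
    then have "finite (PiE {1..n} (I t))" for t by (intro finite_PiE) simp_all
    then show ?thesis unfolding Z_def by (intro card_SigmaI) simp_all
  qed
  also have "\<dots> = (\<Sum>t\<in>{- int q..int q}. \<Prod>j\<in>{1..n}. card (I t j))" by (simp add: card_PiE)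
  also have "\<dots> = (\<Sum>t\<in>{- int q..int q}. \<Prod>j\<in>{1..n}. q - nat \<bar>t\<bar> * d j)"
  proof (intro sum.cong prod.cong refl)
    fix t :: int and j
    have "nat \<bar>t * int (d j)\<bar> = nat \<bar>t\<bar> * d j" by (simp add: abs_mult nat_mult_distrib)
    then show "card (I t j) = q - nat \<bar>t\<bar> * d j" unfolding I_def card_interval_shift by simp
  qed
  finally show ?thesis .
qed

text \<open>The residue map is the isomorphism onto the model followed by the constant coefficient.
  Inverses found in the model by \<open>unit_if_const_coeff\<close> are pulled back to the quotient
  ring.\<close>

lemma alpha_R_star:
  assumes p: "Factorial_Ring.prime p" "[p] \<cdot> \<one> = \<zero>" and D: "dimension D (pth_powers p K) (carrier K)"
  shows "alpha p (R_star K n d) = log (real p) (real D)"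
proof -
  define h where "h = (\<lambda>Y. the_elem (\<Phi> ` Y))"
  define eps where "eps = (\<lambda>P :: (bool \<times> nat) multiset \<Rightarrow> 'a. P {#})"
  have h: "h \<in> ring_iso (R_star K n d) B" unfolding h_def by (rule R_star_iso)
  have hom: "h \<in> ring_hom (R_star K n d) B" and bij: "bij_betw h (carrier (R_star K n d)) (carrier B)"
    using h by (simp_all add: ring_iso_def)
  have eps: "eps \<in> ring_hom B K" unfolding eps_def by (rule AA.const_coeff_hom)
  interpret Rs: cring "R_star K n d" by (rule R_star_cring)
  show ?thesis
  proof (rule alpha_eq[of "R_star K n d" K "eps \<circ> h"])
    show "cring (R_star K n d)" by (rule R_star_cring)
    show "field K" by (rule field_axioms)
    show "eps \<circ> h \<in> ring_hom (R_star K n d) K" by (rule ring_hom_trans[OF hom eps])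
    show "(eps \<circ> h) ` carrier (R_star K n d) = carrier K"
    proof -
      have "eps ` carrier B = carrier K"
      proof
        show "eps ` carrier B \<subseteq> carrier K" using ring_hom_closed[OF eps] by blast
        show "carrier K \<subseteq> eps ` carrier B"
        proof
          fix c assume c: "c \<in> carrier K"
          have "eps (mono_series K c {#}) = c" by (simp add: eps_def mono_series_def)
          moreover have "mono_series K c {#} \<in> carrier B" by (rule AA.mono_series_closed[OF c AA.empty_Q])
          ultimately show "c \<in> eps ` carrier B" by (metis imageI)
        qed
      qed
      then show ?thesis using bij_betw_imp_surj_on[OF bij] by (simp only: image_comp[symmetric])
    qed
    fix x assume x: "x \<in> carrier (R_star K n d)" "(eps \<circ> h) x \<noteq> \<zero>"
    have hx: "h x \<in> carrier B" by (rule ring_hom_closed[OF hom x(1)])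
    have "h x \<in> Units B" using x(2) by (intro AA.unit_if_const_coeff[OF hx]) (simp add: eps_def)
    then have iv: "inv\<^bsub>B\<^esub> (h x) \<in> carrier B" "h x \<otimes>\<^bsub>B\<^esub> inv\<^bsub>B\<^esub> (h x) = \<one>\<^bsub>B\<^esub>"
      using AA.A.Units_inv_closed AA.A.Units_r_inv by blast+
    then have "inv\<^bsub>B\<^esub> (h x) \<in> h ` carrier (R_star K n d)" using bij_betw_imp_surj_on[OF bij] by simp
    then obtain y where y: "inv\<^bsub>B\<^esub> (h x) = h y" "y \<in> carrier (R_star K n d)" by (rule imageE)
    have "h (x \<otimes>\<^bsub>R_star K n d\<^esub> y) = h \<one>\<^bsub>R_star K n d\<^esub>"
      using ring_hom_mult[OF hom x(1) y(2)] ring_hom_one[OF hom] iv(2) y(1) by simp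
    then have "x \<otimes>\<^bsub>R_star K n d\<^esub> y = \<one>\<^bsub>R_star K n d\<^esub>"
      using bij_betw_imp_inj_on[OF bij] Rs.m_closed[OF x(1) y(2)] Rs.one_closed by (meson inj_onD)
    then show "x \<in> Units (R_star K n d)"
      using x(1) y(2) Rs.m_comm[OF x(1) y(2)] unfolding Units_def by auto
  qed (fact p D)+
qed

text \<open>In the denominator \<open>p\<close> raised to \<open>e * alpha\<close> equals
  \<open>D ^ e\<close> and cancels the factor that \<open>max_free_rank_eq\<close> takes from the
  basis of \<open>K\<close> over its powers. What remains is the number of small monomials over
  \<open>q ^ (n + 1)\<close>.\<close>

lemma F_signature_seq_R_star:
  assumes p: "Factorial_Ring.prime p" "[p] \<cdot> \<one> = \<zero>" and D: "dimension D (pth_powers p K) (carrier K)"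
  shows "F_signature_seq p (R_star K n d) e
    = real (\<Sum>t\<in>{- int (p ^ e)..int (p ^ e)}. \<Prod>j\<in>{1..n}. p ^ e - nat \<bar>t\<bar> * d j) / real (p ^ e) ^ (n + 1)"
proof -
  interpret F: frobenius_series K Q "UNIV \<times> {1..n}" p e
    by unfold_locales (use p Q_facets in auto)
  have p2: "p \<ge> 2" using p(1) prime_ge_2_nat by blast
  \<comment> \<open>Positivity of \<open>D\<close> is what turns \<open>p powr log p D\<close> into
    \<open>D\<close>; dimension zero would make \<open>K\<close> the zero ring.\<close>
  have D0: "D > 0"
  proof (rule ccontr)
    assume "\<not> D > 0"
    then have "dimension 0 (pth_powers p K) (carrier K)" using D by simp
    moreover have "subfield (pth_powers p K) K" using pth_powers_subfield[OF p, of 1] by simp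
    ultimately have "carrier K = {\<zero>}" using dimension_zero by blast
    then show False using one_closed one_not_zero by blast
  qed
  have "max_free_rank (R_star K n d) (frobenius_pushforward p e (R_star K n d))
    = max_free_rank B (frobenius_pushforward p e B)"
    by (rule max_free_rank_iso[OF R_star_cring AA.cring_A R_star_iso])
  also have "\<dots> = D ^ e * card F.small" by (rule F.max_free_rank_eq[OF D])
  also have "card F.small = (\<Sum>t\<in>{- int (p ^ e)..int (p ^ e)}. \<Prod>j\<in>{1..n}. p ^ e - nat \<bar>t\<bar> * d j)"
    unfolding F.small_def by (rule card_small)
  finally have rank: "max_free_rank (R_star K n d) (frobenius_pushforward p e (R_star K n d))
    = D ^ e * (\<Sum>t\<in>{- int (p ^ e)..int (p ^ e)}. \<Prod>j\<in>{1..n}. p ^ e - nat \<bar>t\<bar> * d j)" .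
  have "real p powr (real e * (real (n + 1) + log (real p) (real D)))
      = real p powr (real (e * (n + 1))) * (real p powr (log (real p) (real D))) powr real e"
    by (simp add: powr_powr powr_add[symmetric] algebra_simps)
  also have "real p powr (log (real p) (real D)) = real D" using p2 D0 by simp
  also have "real D powr real e = real (D ^ e)" using D0 by (simp add: powr_realpow)
  also have "real p powr (real (e * (n + 1))) = real (p ^ e) ^ (n + 1)"
    using p2 by (simp only: powr_realpow power_mult of_nat_power)
  finally have "real p powr (real e * (real (n + 1) + log (real p) (real D))) = real (p ^ e) ^ (n + 1) * real (D ^ e)" .
  then show ?thesis
    unfolding F_signature_seq_def krull_dim_R_star alpha_R_star[OF p D] rank
    using D0 by simp
qed

end

theorem proposition7p4:
  fixes K :: "('a, 'm) ring_scheme" and p n :: nat and d :: "nat \<Rightarrow> nat"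
  assumes "field K"
    and "Factorial_Ring.prime p" and "ring_char K = p"
    and "ring.finite_dimension K (pth_powers p K) (carrier K)"
    and "n \<ge> 1"
    and "\<And>j. j \<in> {1..n} \<Longrightarrow> d j > 0"
  shows "convergent (F_signature_seq p (R_star K n d)) \<and>
    F_signature p (R_star K n d) =
      2 / real (max_exponent n d) ^ (n + 1) * (\<Sum>s = 0..n - 1. W n d s / real (n - s + 1)) \<and>
    F_signature p (R_star K n d) > 0"
proof -
  interpret K: field K by fact
  interpret H: hypersurface K n d
    by (rule hypersurface.intro[OF assms(1)], unfold_locales) (use assms(5,6) in auto)
  have char: "[p] \<cdot>\<^bsub>K\<^esub> \<one>\<^bsub>K\<^esub> = \<zero>\<^bsub>K\<^esub>" by (rule char_eq_zero[OF assms(1,3)])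
  obtain D where D: "K.dimension D (pth_powers p K) (carrier K)"
    using assms(4) unfolding K.finite_dimension_def by blast
  have p2: "p \<ge> 2" using assms(2) prime_ge_2_nat by blast
  have "F_signature_seq p (R_star K n d) = (\<lambda>e. real (\<Sum>t\<in>{- int (p ^ e)..int (p ^ e)}.
      \<Prod>j\<in>{1..n}. p ^ e - nat \<bar>t\<bar> * d j) / real (p ^ e) ^ (n + 1))"
    by (rule ext) (rule H.F_signature_seq_R_star[OF assms(2) char D])
  then have lim: "F_signature_seq p (R_star K n d) \<longlonglongrightarrow> 2 * volume n d"
    using count_asymptotics[OF assms(5,6) p2] by simp
  then have "F_signature p (R_star K n d) = 2 * volume n d"
    unfolding F_signature_def by (rule limI)
  moreover have "2 * volume n d
      = 2 / real (max_exponent n d) ^ (n + 1) * (\<Sum>s = 0..n - 1. W n d s / real (n - s + 1))"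
    by (simp only: volume_def[OF assms(5,6)] times_divide_eq_left times_divide_eq_right)
  moreover have "volume n d > 0" by (rule volume_pos[OF assms(5,6)])
  ultimately show ?thesis using lim by (auto simp: convergent_def)
qed

end
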